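(* Let $H\in(0,1)$ and $\kappa>0$, and let $u=\{u_t(x);(t,x)\in\mathbb R_+\times\mathbb R\}$ be the stochastic convolution $$u_t(x)=\int_0^t\int_{\mathbb R}p_{t-s}(x-y)\,W(ds,dy),\qquad p_t(x)=\frac{1}{\sqrt{2\pi\kappa t}}e^{-\frac{x^2}{2\kappa t}},$$ i.e. the mild solution with zero initial condition of $\frac{\partial u}{\partial t}=\frac{\kappa}{2}\frac{\partial^2u}{\partial x^2}+\dot W$. Then: (a) For every $x\in\mathbb R$ there exists a fractional Brownian motion $\{X_t\}_{t\ge0}$ with Hurst parameter $H/2$ such that $$u_t(x)-C_{1,H,\kappa}X_t,\qquad t\ge0,$$ defines a mean-zero Gaussian process with a version that is continuous on $\mathbb R_+$ and infinitely differentiable on $(0,\infty)$, where $$C_{1,H,\kappa}=\left(\frac{2^{1-H}\Gamma(2H)}{\kappa^{1-H}\Gamma(H)}\right)^{1/2}.$$ (b) For every $t>0$ there exists a (two-sided) fractional Brownian motion $\{B(x)\}_{x\in\mathbb R}$ with Hurst parameter $H$ such that $$u_t(x)-\kappa^{-1/2}B(x),\qquad x\in\mathbb R,$$ defines a Gaussian random field with a version that is continuous on $\mathbb R$ and infinitely differentiable on $\mathbb R$.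
   Context: $W$ is a centered Gaussian process on $\mathbb R_+\times\mathbb R$ with covariance $\mathbb E[W(s,x)W(t,y)]=\frac12(|x|^{2H}+|y|^{2H}-|x-y|^{2H})(s\wedge t)$, i.e. a Brownian motion in time and a fractional Brownian motion with Hurst parameter $H$ in space; $\dot W=\partial^2W/\partial t\partial x$. Equivalently, $W$ is represented as a zero-mean Gaussian family $\{W(\phi)\}$ indexed by smooth compactly supported $\phi$ on $(0,\infty)\times\mathbb R$ with $\mathbb E[W(\phi)W(\psi)]=c_{1,H}\int_{\mathbb R_+\times\mathbb R}\mathcal F\phi(s,\xi)\overline{\mathcal F\psi(s,\xi)}|\xi|^{1-2H}\,ds\,d\xi$, where $\mathcal F$ is the Fourier transform in space, $\mathcal F u(\xi)=\int e^{-i\xi x}u(x)dx$, and $c_{1,H}=\frac{1}{2\pi}\Gamma(2H+1)\sin(H\pi)$; the stochastic integral above is the Wiener integral extending this isometry. A fractional Brownian motion with Hurst parameter $\alpha\in(0,1)$ is a mean-zero Gaussian process $X$ with $X_0=0$ and $\mathbb E|X_t-X_s|^2=|t-s|^{2\alpha}$. *)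

theory Defs
  imports "HOL-Probability.Probability"
begin

text \<open>A real random variable is Gaussian (possibly degenerate) iff its characteristic
  function is that of a normal law N(mu, sigma^2), sigma allowed to be 0.\<close>
definition gaussian_rv :: "'a measure \<Rightarrow> ('a \<Rightarrow> real) \<Rightarrow> bool" where
  "gaussian_rv M X \<longleftrightarrow> X \<in> borel_measurable M \<and>
     (\<exists>\<mu> \<sigma>::real. \<forall>\<theta>::real. char (distr M borel X) \<theta> =
        exp (\<i> * complex_of_real (\<mu> * \<theta>) - complex_of_real (\<sigma>\<^sup>2 * \<theta>\<^sup>2 / 2)))"

definition gaussian_family :: "'a measure \<Rightarrow> 'i set \<Rightarrow> ('i \<Rightarrow> 'a \<Rightarrow> real) \<Rightarrow> bool" where
  "gaussian_family M I Z \<longleftrightarrow>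
     (\<forall>J c. J \<subseteq> I \<longrightarrow> finite J \<longrightarrow> gaussian_rv M (\<lambda>\<omega>. \<Sum>i\<in>J. c i * Z i \<omega>))"

definition centered_family :: "'a measure \<Rightarrow> 'i set \<Rightarrow> ('i \<Rightarrow> 'a \<Rightarrow> real) \<Rightarrow> bool" where
  "centered_family M I Z \<longleftrightarrow> (\<forall>i\<in>I. integral\<^sup>L M (Z i) = 0)"

text \<open>Fractional Brownian motion with Hurst parameter alpha, indexed by a set I
  containing 0 (I = [0,oo) for one-sided, I = UNIV for two-sided).\<close>
definition is_fBm :: "'a measure \<Rightarrow> real \<Rightarrow> real set \<Rightarrow> (real \<Rightarrow> 'a \<Rightarrow> real) \<Rightarrow> bool" where
  "is_fBm M \<alpha> I X \<longleftrightarrow> gaussian_family M I X \<and> centered_family M I X \<and>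
     (\<forall>\<omega>\<in>space M. X 0 \<omega> = 0) \<and>
     (\<forall>s\<in>I. \<forall>t\<in>I. integral\<^sup>L M (\<lambda>\<omega>. (X t \<omega> - X s \<omega>)\<^sup>2) = \<bar>t - s\<bar> powr (2 * \<alpha>))"

definition smooth_on_real :: "real set \<Rightarrow> (real \<Rightarrow> real) \<Rightarrow> bool" where
  "smooth_on_real S f \<longleftrightarrow> (\<forall>k. \<forall>x\<in>S. ((deriv ^^ k) f) differentiable (at x))"

definition partial_t :: "(real \<Rightarrow> real \<Rightarrow> real) \<Rightarrow> real \<Rightarrow> real \<Rightarrow> real" where
  "partial_t g = (\<lambda>s y. deriv (\<lambda>r. g r y) s)"

definition partial_x :: "(real \<Rightarrow> real \<Rightarrow> real) \<Rightarrow> real \<Rightarrow> real \<Rightarrow> real" where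
  "partial_x g = (\<lambda>s y. deriv (\<lambda>z. g s z) y)"

definition iter_partial :: "bool list \<Rightarrow> (real \<Rightarrow> real \<Rightarrow> real) \<Rightarrow> real \<Rightarrow> real \<Rightarrow> real" where
  "iter_partial ds g = foldr (\<lambda>b h. if b then partial_t h else partial_x h) ds g"

definition smooth2 :: "(real \<Rightarrow> real \<Rightarrow> real) \<Rightarrow> bool" where
  "smooth2 g \<longleftrightarrow> (\<forall>ds. continuous_on UNIV (\<lambda>(s, y). iter_partial ds g s y) \<and>
     (\<forall>s y. (\<lambda>r. iter_partial ds g r y) differentiable (at s) \<and>
            (\<lambda>z. iter_partial ds g s z) differentiable (at y)))"

definition test_function :: "(real \<Rightarrow> real \<Rightarrow> real) \<Rightarrow> bool" where
  "test_function g \<longleftrightarrow> smooth2 g \<and>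
     (\<exists>K. compact K \<and> K \<subseteq> {0<..} \<times> UNIV \<and> (\<forall>s y. (s, y) \<notin> K \<longrightarrow> g s y = 0))"

definition fourier :: "(real \<Rightarrow> real) \<Rightarrow> real \<Rightarrow> complex" where
  "fourier f \<xi> = integral\<^sup>L lborel (\<lambda>x. cis (- \<xi> * x) * complex_of_real (f x))"

definition c1H :: "real \<Rightarrow> real" where
  "c1H H = 1 / (2 * pi) * Gamma (2 * H + 1) * sin (H * pi)"

text \<open>Inner product of the noise (time white, space fractional with Hurst H).\<close>
definition noise_inner :: "real \<Rightarrow> (real \<Rightarrow> real \<Rightarrow> real) \<Rightarrow> (real \<Rightarrow> real \<Rightarrow> real) \<Rightarrow> complex" where
  "noise_inner H \<phi> \<psi> = complex_of_real (c1H H) *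
     (LINT s:{0<..}|lborel. (LINT \<xi>|lborel.
        fourier (\<phi> s) \<xi> * cnj (fourier (\<psi> s) \<xi>) * complex_of_real (\<bar>\<xi>\<bar> powr (1 - 2 * H))))"

definition noise_norm2 :: "real \<Rightarrow> (real \<Rightarrow> real \<Rightarrow> real) \<Rightarrow> ennreal" where
  "noise_norm2 H g = ennreal (c1H H) *
     (\<integral>\<^sup>+ s. indicator {0<..} s * (\<integral>\<^sup>+ \<xi>. ennreal ((cmod (fourier (g s) \<xi>))\<^sup>2 * \<bar>\<xi>\<bar> powr (1 - 2 * H)) \<partial>lborel) \<partial>lborel)"

definition is_noise :: "'a measure \<Rightarrow> real \<Rightarrow> ((real \<Rightarrow> real \<Rightarrow> real) \<Rightarrow> 'a \<Rightarrow> real) \<Rightarrow> bool" where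
  "is_noise M H W \<longleftrightarrow> gaussian_family M {\<phi>. test_function \<phi>} W \<and>
     centered_family M {\<phi>. test_function \<phi>} W \<and>
     (\<forall>\<phi> \<psi>. test_function \<phi> \<longrightarrow> test_function \<psi> \<longrightarrow>
        complex_of_real (integral\<^sup>L M (\<lambda>\<omega>. W \<phi> \<omega> * W \<psi> \<omega>)) = noise_inner H \<phi> \<psi>)"

definition heat_kernel :: "real \<Rightarrow> real \<Rightarrow> real \<Rightarrow> real" where
  "heat_kernel \<kappa> t x = 1 / sqrt (2 * pi * \<kappa> * t) * exp (- x\<^sup>2 / (2 * \<kappa> * t))"

definition conv_kernel :: "real \<Rightarrow> real \<Rightarrow> real \<Rightarrow> real \<Rightarrow> real \<Rightarrow> real" where
  "conv_kernel \<kappa> t x = (\<lambda>s y. if 0 < s \<and> s < t then heat_kernel \<kappa> (t - s) (x - y) else 0)"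

text \<open>u_t(x) is the Wiener integral of conv_kernel: the L^2 limit of W(phi_n) for any
  sequence of test functions phi_n converging to the kernel in the noise norm.\<close>
definition is_stoch_conv :: "'a measure \<Rightarrow> real \<Rightarrow> real \<Rightarrow> ((real \<Rightarrow> real \<Rightarrow> real) \<Rightarrow> 'a \<Rightarrow> real)
     \<Rightarrow> (real \<Rightarrow> real \<Rightarrow> 'a \<Rightarrow> real) \<Rightarrow> bool" where
  "is_stoch_conv M H \<kappa> W u \<longleftrightarrow> (\<forall>t\<ge>0. \<forall>x.
     u t x \<in> borel_measurable M \<and> integrable M (\<lambda>\<omega>. (u t x \<omega>)\<^sup>2) \<and>
     (\<forall>\<phi>::nat \<Rightarrow> real \<Rightarrow> real \<Rightarrow> real. (\<forall>n. test_function (\<phi> n)) \<longrightarrow>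
        (\<lambda>n. noise_norm2 H (\<lambda>s y. \<phi> n s y - conv_kernel \<kappa> t x s y)) \<longlonglongrightarrow> 0 \<longrightarrow>
        (\<lambda>n. integral\<^sup>L M (\<lambda>\<omega>. (W (\<phi> n) \<omega> - u t x \<omega>)\<^sup>2)) \<longlonglongrightarrow> 0))"

definition has_smooth_version ::
  "'a measure \<Rightarrow> real set \<Rightarrow> real set \<Rightarrow> (real \<Rightarrow> 'a \<Rightarrow> real) \<Rightarrow> bool" where
  "has_smooth_version M I S Y \<longleftrightarrow> (\<exists>Z. (\<forall>t\<in>I. Z t \<in> borel_measurable M \<and> (AE \<omega> in M. Z t \<omega> = Y t \<omega>)) \<and>
     (\<forall>\<omega>\<in>space M. continuous_on I (\<lambda>t. Z t \<omega>) \<and> smooth_on_real S (\<lambda>t. Z t \<omega>)))"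

definition C1 :: "real \<Rightarrow> real \<Rightarrow> real" where
  "C1 H \<kappa> = sqrt (2 powr (1 - H) * Gamma (2 * H) / (\<kappa> powr (1 - H) * Gamma H))"

end

theory Submission
  imports Defs
begin

text \<open>
  By the spectral isometry, the increments of $u$ satisfy
  $E|u_t(x) - u_s(x)|^2 = C^2 (|t-s|^H - r(s,t))$ with $C = C_{1,H,\kappa}$ and
  $r(s,t) = (t+s)^H - ((2t)^H + (2s)^H)/2$, and
  $E|u_t(x) - u_t(y)|^2 = 2 c_{1,H} \kappa^{-1} \int (1 - \cos((x-y)\xi)) |\xi|^{-1-2H} (1 - e^{-\kappa t \xi^2})\, d\xi$.
  It therefore suffices to add to $u$ an independent Gaussian process $S$ with smooth paths whose increments
  carry the missing part of the variance, and to put $u + S$, normalised at the origin, for the multiple of fractional Brownian motion.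
  The randomness for $S$ has to come from $W$ itself: in (a) one uses test functions that are odd about $x$, in (b) test functions
  supported after time $t$; both are orthogonal to $u$, and countably many of them with disjoint time supports give
  an orthonormal Gaussian sequence. From it, $S$ is built by explicit series. In time, $S$ is a primitive
  of a process with covariance $(r+r')^{H-2}$, which the Cayley transform diagonalises. In space, $S$ is a power series
  in $x$ whose coefficients have the moments of $|\xi|^{1-2H} e^{-\kappa t \xi^2}$ as covariance matrix; its triangular factor
  is explicit by Vandermonde's identity.
\<close>

text \<open>The statement fixes the probability space, so an independent process cannot be adjoined
  by enlarging it; hence the probes inside W. Adding S works because of a sign: what the increments
  of u lack compared with fractional Brownian motion is itself an increment variance. In time, 2
  r(s,t) / (H (1-H)) is the integral of (a+b)^(H-2) over the square [s,t]^2, whence the factor C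
  sqrt(H (1-H) / 2) in front of the primitive. Its derivative has variance (2a)^(H-2), which blows
  up at 0 while the mean absolute value stays integrable; this gives continuity on the closed
  half-line and smoothness on the open one. In space the missing weight exp(-kappa t xi^2) decays so
  fast that the random power series is entire. Explicit series settle two things at once: every path
  is smooth after setting it to 0 on a null event, and every value is a mean square limit of
  combinations of W, so joint Gaussianity with u is automatic.\<close>

section \<open>Smooth functions of one and two real variables\<close>

text \<open>Membership in a class closed under differentiation on $S$ replaces the computation of all iterated derivatives.\<close>
lemma smooth_on_real_coinduct:
  assumes "open S" and "f \<in> C"
    and step: "\<And>g. g \<in> C \<Longrightarrow> \<exists>g'\<in>C. \<forall>x\<in>S. (g has_real_derivative g' x) (at x)"
  shows "smooth_on_real S f"
proof -
  have *: "\<exists>g\<in>C. \<forall>x\<in>S. (deriv ^^ k) f x = g x" for k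
  proof (induction k)
    case 0
    then show ?case using assms(2) by auto
  next
    case (Suc k)
    then obtain g where g: "g \<in> C" "\<And>x. x \<in> S \<Longrightarrow> (deriv ^^ k) f x = g x" by blast
    obtain g' where g': "g' \<in> C" "\<And>x. x \<in> S \<Longrightarrow> (g has_real_derivative g' x) (at x)"
      using step[OF g(1)] by blast
    have "deriv ((deriv ^^ k) f) x = g' x" if "x \<in> S" for x
      by (rule DERIV_imp_deriv, rule has_field_derivative_transform_within_open[OF g'(2)[OF that] \<open>open S\<close> that])
         (simp add: g(2))
    then show ?case using g'(1) by auto
  qed
  have "((deriv ^^ k) f) differentiable (at x)" if "x \<in> S" for k x
  proof -
    obtain g where g: "g \<in> C" "\<And>x. x \<in> S \<Longrightarrow> (deriv ^^ k) f x = g x" using * by blast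
    obtain g' where g': "\<And>x. x \<in> S \<Longrightarrow> (g has_real_derivative g' x) (at x)"
      using step[OF g(1)] by blast
    have "((deriv ^^ k) f has_real_derivative g' x) (at x)"
      by (rule has_field_derivative_transform_within_open[OF g'[OF that] \<open>open S\<close> that]) (simp add: g(2))
    then show ?thesis using real_differentiable_def by blast
  qed
  then show ?thesis by (simp add: smooth_on_real_def)
qed

lemma smooth_on_real_deriv:
  assumes "smooth_on_real S f"
  shows "smooth_on_real S (deriv f)" and "\<And>x. x \<in> S \<Longrightarrow> (f has_real_derivative deriv f x) (at x)"
proof -
  have "((deriv ^^ k) (deriv f)) differentiable (at x)" if "x \<in> S" for k x
    using assms that unfolding smooth_on_real_def
    by (metis comp_apply funpow_Suc_right)
  then show "smooth_on_real S (deriv f)" by (simp add: smooth_on_real_def)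
  fix x assume "x \<in> S"
  then have "((deriv ^^ 0) f) differentiable (at x)" using assms unfolding smooth_on_real_def by blast
  then show "(f has_real_derivative deriv f x) (at x)"
    by (simp add: DERIV_deriv_iff_real_differentiable)
qed

lemma smooth_on_real_affine:
  assumes "smooth_on_real UNIV f"
  shows "smooth_on_real UNIV (\<lambda>x. f (a * x + c))"
\<comment> \<open>The constant k collects the powers of a produced by the chain rule.\<close>
proof (rule smooth_on_real_coinduct[where C = "{\<lambda>x. k * h (a * x + c) | k h. smooth_on_real UNIV h}"])
  show "(\<lambda>x. f (a * x + c)) \<in> {\<lambda>x. k * h (a * x + c) | k h. smooth_on_real UNIV h}"
    using assms by (auto intro!: exI[of _ 1] exI[of _ f])
next
  fix g assume "g \<in> {\<lambda>x. k * h (a * x + c) | k h. smooth_on_real UNIV h}"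
  then obtain k h where g: "g = (\<lambda>x. k * h (a * x + c))" and h: "smooth_on_real UNIV h" by blast
  note [derivative_intros] = DERIV_chain2[OF smooth_on_real_deriv(2)[OF h UNIV_I]]
  have "(g has_real_derivative ((k * a) * deriv h (a * x + c))) (at x)" for x
    unfolding g by (auto intro!: derivative_eq_intros)
  then show "\<exists>g'\<in>{\<lambda>x. k * h (a * x + c) | k h. smooth_on_real UNIV h}. \<forall>x\<in>UNIV. (g has_real_derivative g' x) (at x)"
    using smooth_on_real_deriv(1)[OF h] by (intro bexI[of _ "\<lambda>x. (k * a) * deriv h (a * x + c)"]) auto
qed auto

text \<open>\<open>iter_partial\<close> runs over all words in the two partial derivatives. If both
  lead from C into C, every word applied to g stays in C, so symmetry of mixed derivatives never
  enters.\<close>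

lemma smooth2_coinduct:
  assumes "g \<in> C"
    and cont: "\<And>g. g \<in> C \<Longrightarrow> continuous_on UNIV (\<lambda>(s, y). g s y)"
    and dt: "\<And>g. g \<in> C \<Longrightarrow> \<exists>g'\<in>C. \<forall>s y. ((\<lambda>r. g r y) has_real_derivative g' s y) (at s)"
    and dx: "\<And>g. g \<in> C \<Longrightarrow> \<exists>g'\<in>C. \<forall>s y. ((\<lambda>z. g s z) has_real_derivative g' s y) (at y)"
  shows "smooth2 g"
proof -
  have pt: "partial_t h \<in> C" if "h \<in> C" for h
  proof -
    obtain h' where "h' \<in> C" "\<And>s y. ((\<lambda>r. h r y) has_real_derivative h' s y) (at s)" using dt[OF \<open>h \<in> C\<close>] by blast
    moreover then have "partial_t h = h'" by (auto simp: partial_t_def fun_eq_iff intro!: DERIV_imp_deriv)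
    ultimately show ?thesis by simp
  qed
  have px: "partial_x h \<in> C" if "h \<in> C" for h
  proof -
    obtain h' where "h' \<in> C" "\<And>s y. ((\<lambda>z. h s z) has_real_derivative h' s y) (at y)" using dx[OF \<open>h \<in> C\<close>] by blast
    moreover then have "partial_x h = h'" by (auto simp: partial_x_def fun_eq_iff intro!: DERIV_imp_deriv)
    ultimately show ?thesis by simp
  qed
  have *: "iter_partial ds g \<in> C" for ds
    by (induction ds) (auto simp: iter_partial_def assms(1) pt px)
  show ?thesis unfolding smooth2_def
    using cont[OF *] dt[OF *] dx[OF *] unfolding real_differentiable_def by blast
qed

lemma smooth2D:
  assumes "smooth2 g"
  shows "continuous_on UNIV (\<lambda>(s, y). g s y)"
    and "((\<lambda>r. g r y) has_real_derivative partial_t g s y) (at s)"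
    and "((\<lambda>z. g s z) has_real_derivative partial_x g s y) (at y)"
    and "smooth2 (partial_t g)" and "smooth2 (partial_x g)"
proof -
  note a = assms[unfolded smooth2_def, rule_format]
  show "continuous_on UNIV (\<lambda>(s, y). g s y)" using a[of "[]"] by (simp add: iter_partial_def)
  show "((\<lambda>r. g r y) has_real_derivative partial_t g s y) (at s)"
    using a[of "[]"] by (simp add: iter_partial_def partial_t_def DERIV_deriv_iff_real_differentiable)
  show "((\<lambda>z. g s z) has_real_derivative partial_x g s y) (at y)"
    using a[of "[]"] by (simp add: iter_partial_def partial_x_def DERIV_deriv_iff_real_differentiable)
  \<comment> \<open>\<open>foldr\<close> applies the last letter of the word first, so one more
    inner derivative is a letter appended at the end.\<close>
  have "iter_partial ds (partial_t g) = iter_partial (ds @ [True]) g" 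
       "iter_partial ds (partial_x g) = iter_partial (ds @ [False]) g" for ds
    by (simp_all add: iter_partial_def)
  then show "smooth2 (partial_t g)" "smooth2 (partial_x g)"
    using assms unfolding smooth2_def by presburger+
qed

lemma smooth2_time:
  assumes "smooth_on_real UNIV f" shows "smooth2 (\<lambda>s y. f s)"
proof (rule smooth2_coinduct[where C = "{\<lambda>s y. f s | f. smooth_on_real UNIV f}"])
  have zero: "smooth_on_real UNIV (\<lambda>_. 0)"
    by (rule smooth_on_real_coinduct[where C = "{\<lambda>_. 0}"]) auto
  fix g assume "g \<in> {\<lambda>s (y::real). f s | f. smooth_on_real UNIV f}"
  then obtain f where g: "g = (\<lambda>s y. f s)" and f: "smooth_on_real UNIV f" by blast
  have c: "continuous_on UNIV f" using smooth_on_real_deriv(2)[OF f]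
    by (meson DERIV_isCont UNIV_I continuous_at_imp_continuous_on)
  show "continuous_on UNIV (\<lambda>(s, y). g s y)"
    unfolding g case_prod_beta by (intro continuous_on_compose2[OF c] continuous_intros) auto
  show "\<exists>g'\<in>{\<lambda>s (y::real). f s | f. smooth_on_real UNIV f}. \<forall>s y. ((\<lambda>r. g r y) has_real_derivative g' s y) (at s)"
    using smooth_on_real_deriv[OF f] by (intro bexI[of _ "\<lambda>s y. deriv f s"]) (auto simp: g)
  show "\<exists>g'\<in>{\<lambda>s (y::real). f s | f. smooth_on_real UNIV f}. \<forall>s y. ((\<lambda>z. g s z) has_real_derivative g' s y) (at y)"
    using zero by (intro bexI[of _ "\<lambda>s y. 0"]) (auto simp: g)
qed (use assms in auto)

lemma smooth2_space:
  assumes "smooth_on_real UNIV f" shows "smooth2 (\<lambda>s y. f y)"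
proof (rule smooth2_coinduct[where C = "{\<lambda>s y. f y | f. smooth_on_real UNIV f}"])
  have zero: "smooth_on_real UNIV (\<lambda>_. 0)"
    by (rule smooth_on_real_coinduct[where C = "{\<lambda>_. 0}"]) auto
  fix g assume "g \<in> {\<lambda>(s::real) y. f y | f. smooth_on_real UNIV f}"
  then obtain f where g: "g = (\<lambda>s y. f y)" and f: "smooth_on_real UNIV f" by blast
  have c: "continuous_on UNIV f" using smooth_on_real_deriv(2)[OF f]
    by (meson DERIV_isCont UNIV_I continuous_at_imp_continuous_on)
  show "continuous_on UNIV (\<lambda>(s, y). g s y)"
    unfolding g case_prod_beta by (intro continuous_on_compose2[OF c] continuous_intros) auto
  show "\<exists>g'\<in>{\<lambda>(s::real) y. f y | f. smooth_on_real UNIV f}. \<forall>s y. ((\<lambda>z. g s z) has_real_derivative g' s y) (at y)"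
    using smooth_on_real_deriv[OF f] by (intro bexI[of _ "\<lambda>s y. deriv f y"]) (auto simp: g)
  show "\<exists>g'\<in>{\<lambda>(s::real) y. f y | f. smooth_on_real UNIV f}. \<forall>s y. ((\<lambda>r. g r y) has_real_derivative g' s y) (at s)"
    using zero by (intro bexI[of _ "\<lambda>s y. 0"]) (auto simp: g)
qed (use assms in auto)

text \<open>The Leibniz rule turns a product into a sum of two products. Sums of products of smooth
  functions are closed under both derivatives and hence a class for
  \<open>smooth2_coinduct\<close>.\<close>

inductive_set sum_of_products :: "(real \<Rightarrow> real \<Rightarrow> real) set" where
  prod: "smooth2 f \<Longrightarrow> smooth2 g \<Longrightarrow> (\<lambda>s y. f s y * g s y) \<in> sum_of_products"
| sum: "f \<in> sum_of_products \<Longrightarrow> g \<in> sum_of_products \<Longrightarrow> (\<lambda>s y. f s y + g s y) \<in> sum_of_products"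

lemma smooth2_sum_of_products:
  assumes "h \<in> sum_of_products" shows "smooth2 h"
proof (rule smooth2_coinduct[OF assms])
  fix g assume "g \<in> sum_of_products"
  then have "continuous_on UNIV (\<lambda>(s, y). g s y) \<and>
    (\<exists>g'\<in>sum_of_products. \<forall>s y. ((\<lambda>r. g r y) has_real_derivative g' s y) (at s)) \<and>
    (\<exists>g'\<in>sum_of_products. \<forall>s y. ((\<lambda>z. g s z) has_real_derivative g' s y) (at y))"
  proof induction
    case (prod f g)
    have "\<forall>s y. ((\<lambda>r. f r y * g r y) has_real_derivative partial_t f s y * g s y + f s y * partial_t g s y) (at s)"
      by (auto intro!: derivative_eq_intros smooth2D(2)[OF prod(1)] smooth2D(2)[OF prod(2)])
    moreover have "\<forall>s y. ((\<lambda>z. f s z * g s z) has_real_derivative partial_x f s y * g s y + f s y * partial_x g s y) (at y)"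
      by (auto intro!: derivative_eq_intros smooth2D(3)[OF prod(1)] smooth2D(3)[OF prod(2)])
    moreover have "(\<lambda>s y. partial_t f s y * g s y + f s y * partial_t g s y) \<in> sum_of_products"
        "(\<lambda>s y. partial_x f s y * g s y + f s y * partial_x g s y) \<in> sum_of_products"
      by (intro sum_of_products.intros smooth2D(4,5) prod)+
    moreover have "continuous_on UNIV (\<lambda>(s, y). f s y * g s y)"
      using continuous_on_mult[OF smooth2D(1)[OF prod(1)] smooth2D(1)[OF prod(2)]] by (simp add: case_prod_beta)
    ultimately show ?case by (intro conjI bexI)
  next
    case (sum f g)
    from sum.IH obtain f1 f2 g1 g2 where *: "f1 \<in> sum_of_products" "f2 \<in> sum_of_products" "g1 \<in> sum_of_products" "g2 \<in> sum_of_products"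
       and d[derivative_intros]: "\<And>s y. ((\<lambda>r. f r y) has_real_derivative f1 s y) (at s)" "\<And>s y. ((\<lambda>z. f s z) has_real_derivative f2 s y) (at y)"
       "\<And>s y. ((\<lambda>r. g r y) has_real_derivative g1 s y) (at s)" "\<And>s y. ((\<lambda>z. g s z) has_real_derivative g2 s y) (at y)"
       and c: "continuous_on UNIV (\<lambda>(s, y). f s y)" "continuous_on UNIV (\<lambda>(s, y). g s y)"
      by blast
    have "\<forall>s y. ((\<lambda>r. f r y + g r y) has_real_derivative f1 s y + g1 s y) (at s)"
      "\<forall>s y. ((\<lambda>z. f s z + g s z) has_real_derivative f2 s y + g2 s y) (at y)"
      by (auto intro!: DERIV_add d)
    moreover have "(\<lambda>s y. f1 s y + g1 s y) \<in> sum_of_products" "(\<lambda>s y. f2 s y + g2 s y) \<in> sum_of_products"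
      by (intro sum_of_products.intros *)+
    moreover have "continuous_on UNIV (\<lambda>(s, y). f s y + g s y)"
      using continuous_on_add[OF c] by (simp add: case_prod_beta)
    ultimately show ?case by (intro conjI bexI)
  qed
  then show "continuous_on UNIV (\<lambda>(s, y). g s y)"
    "\<exists>g'\<in>sum_of_products. \<forall>s y. ((\<lambda>r. g r y) has_real_derivative g' s y) (at s)"
    "\<exists>g'\<in>sum_of_products. \<forall>s y. ((\<lambda>z. g s z) has_real_derivative g' s y) (at y)" by blast+
qed

lemma smooth2_mult: "smooth2 f \<Longrightarrow> smooth2 g \<Longrightarrow> smooth2 (\<lambda>s y. f s y * g s y)"
  by (rule smooth2_sum_of_products, rule sum_of_products.prod)

lemma smooth_on_real_const: "open S \<Longrightarrow> smooth_on_real S (\<lambda>_. c)"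
  by (rule smooth_on_real_coinduct[where C = "range (\<lambda>c _. c)"]) (auto intro!: derivative_eq_intros)

lemma smooth2_const: "smooth2 (\<lambda>s y. c)"
  by (intro smooth2_time smooth_on_real_const) simp

lemma smooth2_add: "smooth2 f \<Longrightarrow> smooth2 g \<Longrightarrow> smooth2 (\<lambda>s y. f s y + g s y)"
  using smooth2_sum_of_products[OF sum_of_products.sum[OF sum_of_products.prod[OF _ smooth2_const[of 1]] sum_of_products.prod[OF _ smooth2_const[of 1]]]]
  by simp

lemma smooth2_exp:
  assumes "smooth2 g" shows "smooth2 (\<lambda>s y. exp (g s y))"
\<comment> \<open>The factor h absorbs the inner derivative, so the class is stable.\<close>
proof (rule smooth2_coinduct[where C = "{\<lambda>s y. h s y * exp (g s y) | h. smooth2 h}"])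
  show "(\<lambda>s y. exp (g s y)) \<in> {\<lambda>s y. h s y * exp (g s y) | h. smooth2 h}"
    using smooth2_const[of 1] by (auto intro!: exI[of _ "\<lambda>s y. 1"])
next
  fix f assume "f \<in> {\<lambda>s y. h s y * exp (g s y) | h. smooth2 h}"
  then obtain h where f: "f = (\<lambda>s y. h s y * exp (g s y))" and h: "smooth2 h" by blast
  show "continuous_on UNIV (\<lambda>(s, y). f s y)"
    using continuous_on_mult[OF smooth2D(1)[OF h] continuous_on_exp[OF smooth2D(1)[OF assms]]] 
    by (simp add: f case_prod_beta)
  have "((\<lambda>r. f r y) has_real_derivative (partial_t h s y + h s y * partial_t g s y) * exp (g s y)) (at s)" for s y
    unfolding f by (auto intro!: derivative_eq_intros smooth2D(2)[OF h] smooth2D(2)[OF assms] simp: algebra_simps)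
  then show "\<exists>g'\<in>{\<lambda>s y. h s y * exp (g s y) | h. smooth2 h}. \<forall>s y. ((\<lambda>r. f r y) has_real_derivative g' s y) (at s)"
    using smooth2_add[OF smooth2D(4)[OF h] smooth2_mult[OF h smooth2D(4)[OF assms]]]
    by (intro bexI[of _ "\<lambda>s y. (partial_t h s y + h s y * partial_t g s y) * exp (g s y)"]) auto
  have "((\<lambda>z. f s z) has_real_derivative (partial_x h s y + h s y * partial_x g s y) * exp (g s y)) (at y)" for s y
    unfolding f by (auto intro!: derivative_eq_intros smooth2D(3)[OF h] smooth2D(3)[OF assms] simp: algebra_simps)
  then show "\<exists>g'\<in>{\<lambda>s y. h s y * exp (g s y) | h. smooth2 h}. \<forall>s y. ((\<lambda>z. f s z) has_real_derivative g' s y) (at y)"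
    using smooth2_add[OF smooth2D(5)[OF h] smooth2_mult[OF h smooth2D(5)[OF assms]]]
    by (intro bexI[of _ "\<lambda>s y. (partial_x h s y + h s y * partial_x g s y) * exp (g s y)"]) auto
qed

lemma smooth_on_real_poly: "smooth_on_real UNIV (poly p)"
  by (rule smooth_on_real_coinduct[where C = "range poly"]) (auto intro: poly_DERIV)

text \<open>Each derivative lowers the exponent by one and leaves a polynomial in front, so the
  exponent varies inside the class. The application is to the quadratic under the root in
  \<open>gauss_rate\<close>.\<close>

lemma smooth_on_real_poly_powr:
  fixes q :: "real poly"
  assumes "\<And>x. poly q x > 0"
  shows "smooth_on_real UNIV (\<lambda>x. poly q x powr b)"
proof (rule smooth_on_real_coinduct[where C = "{\<lambda>x. poly p x * poly q x powr b | p b. True}"])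
  show "(\<lambda>x. poly q x powr b) \<in> {\<lambda>x. poly p x * poly q x powr b | p b. True}"
    by (auto intro!: exI[of _ "[:1:]"] exI[of _ b])
next
  fix g assume "g \<in> {\<lambda>x. poly p x * poly q x powr b | p b. True}"
  then obtain p b where g: "g = (\<lambda>x. poly p x * poly q x powr b)" by blast
  let ?r = "pderiv p * q + smult b (p * pderiv q)"
  have "(g has_real_derivative poly ?r x * poly q x powr (b - 1)) (at x)" for x
  proof -
    have "poly q x powr b = poly q x powr (b - 1) * poly q x"
      using assms[of x] by (simp add: powr_diff)
    then show ?thesis unfolding g 
      by (auto intro!: derivative_eq_intros poly_DERIV simp: assms algebra_simps)
  qed
  then show "\<exists>g'\<in>{\<lambda>x. poly p x * poly q x powr b | p b. True}. \<forall>x\<in>UNIV. (g has_real_derivative g' x) (at x)"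
    by (intro bexI[of _ "\<lambda>x. poly ?r x * poly q x powr (b - 1)"]) blast+
qed simp

section \<open>The flat function exp(-1/x) and its smoothness\<close>

definition flat_exp :: "real \<Rightarrow> real" where
  "flat_exp x = (if x > 0 then exp (- (1 / x)) else 0)"

lemma poly_times_exp_minus_tendsto: "((\<lambda>x::real. poly p x * exp (- x)) \<longlongrightarrow> 0) at_top"
proof -
  have "((\<lambda>x::real. \<Sum>i\<le>degree p. coeff p i * (x ^ i / exp x)) \<longlongrightarrow> (\<Sum>i\<le>degree p. coeff p i * 0)) at_top"
    by (intro tendsto_intros tendsto_power_div_exp_0)
  moreover have "(\<Sum>i\<le>degree p. coeff p i * (x ^ i / exp x)) = poly p x * exp (- x)" for x
    by (simp add: poly_altdef sum_distrib_right exp_minus divide_inverse mult.assoc)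
  ultimately show ?thesis by simp
qed

lemma smooth_on_real_flat_exp: "smooth_on_real UNIV flat_exp"
proof (rule smooth_on_real_coinduct[where C = "{\<lambda>x. if x > 0 then poly p (1 / x) * exp (- (1 / x)) else 0 | p. True}"])
  show "flat_exp \<in> {\<lambda>x. if x > 0 then poly p (1 / x) * exp (- (1 / x)) else 0 | p. True}"
    by (auto simp: flat_exp_def fun_eq_iff intro!: exI[of _ "[:1:]"])
next
  fix g :: "real \<Rightarrow> real" assume "g \<in> {\<lambda>x. if x > 0 then poly p (1 / x) * exp (- (1 / x)) else 0 | p. True}"
  then obtain p where g: "g = (\<lambda>x. if x > 0 then poly p (1 / x) * exp (- (1 / x)) else 0)" by blast
  \<comment> \<open>The derivative of p(1/x) exp(-1/x) is x^(-2) (p - p')(1/x) exp(-1/x); the factor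
    x^(-2) is the square of the argument 1/x.\<close>
  let ?q = "[:0, 0, 1:] * (p - pderiv p)"
  let ?g' = "\<lambda>x. if x > 0 then poly ?q (1 / x) * exp (- (1 / x)) else (0::real)"
  have "(g has_real_derivative ?g' x) (at x)" for x
  proof -
    consider "x > 0" | "x < 0" | "x = 0" by linarith
    then show ?thesis
    proof cases
      case 1
      have "((\<lambda>x. poly p (1 / x) * exp (- (1 / x))) has_real_derivative poly ?q (1 / x) * exp (- (1 / x))) (at x)"
        using 1 by (auto intro!: derivative_eq_intros DERIV_chain2[OF poly_DERIV] simp: algebra_simps power2_eq_square divide_simps)
      then have "(g has_real_derivative poly ?q (1 / x) * exp (- (1 / x))) (at x)"
        by (rule has_field_derivative_transform_within_open[where S = "{0<..}"]) (use 1 in \<open>auto simp: g\<close>)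
      then show ?thesis using 1 by simp
    next
      case 2
      have "((\<lambda>x. 0) has_real_derivative 0) (at x)" by simp
      then have "(g has_real_derivative 0) (at x)"
        by (rule has_field_derivative_transform_within_open[where S = "{..<0}"]) (use 2 in \<open>auto simp: g\<close>)
      then show ?thesis using 2 by simp
    next
      case 3
      \<comment> \<open>Dividing p(1/h) by h is multiplication by the argument, that is
        \<open>pCons 0 p\<close> at 1/h; the exponential beats it.\<close>
      have "((\<lambda>x. poly (pCons 0 p) (inverse x) * exp (- inverse x)) \<longlongrightarrow> 0) (at_right (0::real))"
        by (rule filterlim_compose[OF poly_times_exp_minus_tendsto filterlim_inverse_at_top_right])
      then have r: "((\<lambda>h. g h / h) \<longlongrightarrow> 0) (at_right 0)"
        by (rule Lim_transform_eventually) 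
           (auto simp: g eventually_at_right_less divide_simps intro!: eventually_at_rightI[of 0 1])
      have l: "((\<lambda>h. g h / h) \<longlongrightarrow> 0) (at_left 0)"
        by (rule Lim_transform_eventually[OF tendsto_const]) (auto simp: g eventually_at_left_real intro!: eventually_at_leftI[of "-1" 0])
      have "((\<lambda>h. g h / h) \<longlongrightarrow> 0) (at 0)" using l r by (rule filterlim_split_at_real)
      then show ?thesis unfolding DERIV_def 3 by (simp add: g)
    qed
  qed
  then show "\<exists>g'\<in>{\<lambda>x. if x > 0 then poly p (1 / x) * exp (- (1 / x)) else 0 | p. True}. \<forall>x\<in>UNIV. (g has_real_derivative g' x) (at x)"
    by (intro bexI[of _ ?g']) blast+
qed simp

section \<open>Gaussian spaces and mean square limits\<close>

definition sq_int :: "'a measure \<Rightarrow> ('a \<Rightarrow> real) \<Rightarrow> bool" where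
  "sq_int M Y \<longleftrightarrow> Y \<in> borel_measurable M \<and> integrable M (\<lambda>\<omega>. (Y \<omega>)\<^sup>2)"

abbreviation msq :: "'a measure \<Rightarrow> ('a \<Rightarrow> real) \<Rightarrow> real" where
  "msq M Y \<equiv> integral\<^sup>L M (\<lambda>\<omega>. (Y \<omega>)\<^sup>2)"

lemma sq_intD[dest]: "sq_int M Y \<Longrightarrow> Y \<in> borel_measurable M" "sq_int M Y \<Longrightarrow> integrable M (\<lambda>\<omega>. (Y \<omega>)\<^sup>2)"
  by (auto simp: sq_int_def)

lemma tendsto_zero_norm_bound:
  fixes f :: "nat \<Rightarrow> 'b::real_normed_vector"
  assumes "g \<longlonglongrightarrow> 0" "\<And>n. norm (f n) \<le> g n"
  shows "f \<longlonglongrightarrow> 0"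
  using assms(2) by (intro Lim_null_comparison[OF _ assms(1)] always_eventually allI)

lemma tendsto_zero_bound:
  fixes f g :: "nat \<Rightarrow> real"
  assumes "g \<longlonglongrightarrow> c" "c = 0" "\<And>n. 0 \<le> f n" "\<And>n. f n \<le> g n"
  shows "f \<longlonglongrightarrow> 0"
  by (rule tendsto_sandwich[where f = "\<lambda>_. 0" and h = g]) (use assms in \<open>auto intro!: always_eventually\<close>)

lemma sq_int_mult:
  assumes "sq_int M X" "sq_int M Y" shows "integrable M (\<lambda>\<omega>. X \<omega> * Y \<omega>)"
proof (rule Bochner_Integration.integrable_bound)
  show "integrable M (\<lambda>\<omega>. (X \<omega>)\<^sup>2 + (Y \<omega>)\<^sup>2)" using assms by auto
  show "(\<lambda>\<omega>. X \<omega> * Y \<omega>) \<in> borel_measurable M" using assms[THEN sq_intD(1)] by (rule borel_measurable_times)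
  have "\<bar>x * y\<bar> \<le> x\<^sup>2 + y\<^sup>2" for x y :: real
  proof -
    have "2 * (\<bar>x\<bar> * \<bar>y\<bar>) \<le> x\<^sup>2 + y\<^sup>2" using sum_squares_bound[of "\<bar>x\<bar>" "\<bar>y\<bar>"] by simp
    moreover have "0 \<le> \<bar>x\<bar> * \<bar>y\<bar>" by simp
    ultimately show ?thesis unfolding abs_mult by linarith
  qed
  then show "AE \<omega> in M. norm (X \<omega> * Y \<omega>) \<le> norm ((X \<omega>)\<^sup>2 + (Y \<omega>)\<^sup>2)" by simp
qed

lemma sq_int_lin:
  assumes "sq_int M X" "sq_int M Y" shows "sq_int M (\<lambda>\<omega>. a * X \<omega> + b * Y \<omega>)"
proof -
  have "integrable M (\<lambda>\<omega>. a\<^sup>2 * (X \<omega>)\<^sup>2 + b\<^sup>2 * (Y \<omega>)\<^sup>2 + 2 * a * b * (X \<omega> * Y \<omega>))"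
    using assms sq_int_mult[OF assms] by (intro Bochner_Integration.integrable_add integrable_mult_right) auto
  then have "integrable M (\<lambda>\<omega>. (a * X \<omega> + b * Y \<omega>)\<^sup>2)" 
    by (rule back_subst[of "integrable M"]) (auto simp: power2_eq_square algebra_simps)
  then show ?thesis using assms by (auto simp: sq_int_def)
qed

lemma sq_int_diff: "sq_int M X \<Longrightarrow> sq_int M Y \<Longrightarrow> sq_int M (\<lambda>\<omega>. X \<omega> - Y \<omega>)"
  using sq_int_lin[of M X Y 1 "-1"] by simp

lemma msq_lin:
  assumes "sq_int M X" "sq_int M Y"
  shows "msq M (\<lambda>\<omega>. a * X \<omega> + b * Y \<omega>) = a\<^sup>2 * msq M X + b\<^sup>2 * msq M Y + 2 * a * b * integral\<^sup>L M (\<lambda>\<omega>. X \<omega> * Y \<omega>)"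
proof -
  have "msq M (\<lambda>\<omega>. a * X \<omega> + b * Y \<omega>) = integral\<^sup>L M (\<lambda>\<omega>. a\<^sup>2 * (X \<omega>)\<^sup>2 + b\<^sup>2 * (Y \<omega>)\<^sup>2 + 2 * a * b * (X \<omega> * Y \<omega>))"
    by (simp add: power2_eq_square algebra_simps)
  also have "\<dots> = a\<^sup>2 * msq M X + b\<^sup>2 * msq M Y + 2 * a * b * integral\<^sup>L M (\<lambda>\<omega>. X \<omega> * Y \<omega>)"
    using sq_intD(2)[OF assms(1)] sq_intD(2)[OF assms(2)] sq_int_mult[OF assms] by simp
  finally show ?thesis .
qed

lemma inner_sq_le:
  assumes "sq_int M X" "sq_int M Y"
  shows "\<bar>integral\<^sup>L M (\<lambda>\<omega>. X \<omega> * Y \<omega>)\<bar> \<le> sqrt (msq M X) * sqrt (msq M Y)"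
proof -
  let ?A = "msq M X" and ?B = "msq M Y" and ?C = "integral\<^sup>L M (\<lambda>\<omega>. X \<omega> * Y \<omega>)"
  have AB: "0 \<le> ?A" "0 \<le> ?B" by auto
  have pos: "0 \<le> a\<^sup>2 * ?A + b\<^sup>2 * ?B + 2 * a * b * ?C" for a b
    unfolding msq_lin[OF assms, symmetric] by simp
  have "?C\<^sup>2 \<le> ?A * ?B"
  proof (cases "?B = 0")
    case True
    have "?C = 0"
    proof (rule ccontr)
      assume "?C \<noteq> 0"
      \<comment> \<open>With \<open>msq M Y\<close> = 0 the form is A + 2 a b C, where A =
        \<open>msq M X\<close>; this choice of b makes it - A - 2 < 0.\<close>
      then show False using pos[of 1 "- (?A + 1) / ?C"] True AB by simp
    qed
    then show ?thesis using AB by simp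
  next
    case False
    with AB have "?B > 0" by linarith
    have "0 \<le> ?B * ?B * ?A - ?B * ?C * ?C"
      using pos[of ?B "- ?C"] by (simp add: power2_eq_square algebra_simps)
    then have "0 \<le> ?B * (?A * ?B - ?C\<^sup>2)" by (simp add: power2_eq_square algebra_simps)
    then show ?thesis using \<open>?B > 0\<close> by (simp add: zero_le_mult_iff)
  qed
  then have "sqrt (?C\<^sup>2) \<le> sqrt (?A * ?B)" by (rule real_sqrt_le_mono)
  then show ?thesis by (simp add: real_sqrt_mult)
qed

lemma sqrt_msq_triangle:
  assumes "sq_int M X" "sq_int M Y"
  shows "\<bar>sqrt (msq M X) - sqrt (msq M Y)\<bar> \<le> sqrt (msq M (\<lambda>\<omega>. X \<omega> - Y \<omega>))"
proof -
  have "msq M (\<lambda>\<omega>. X \<omega> - Y \<omega>) = msq M X + msq M Y - 2 * integral\<^sup>L M (\<lambda>\<omega>. X \<omega> * Y \<omega>)"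
    using msq_lin[OF assms, of 1 "-1"] by simp
  moreover have "integral\<^sup>L M (\<lambda>\<omega>. X \<omega> * Y \<omega>) \<le> sqrt (msq M X) * sqrt (msq M Y)" 
    using inner_sq_le[OF assms] by linarith
  ultimately have "(sqrt (msq M X) - sqrt (msq M Y))\<^sup>2 \<le> msq M (\<lambda>\<omega>. X \<omega> - Y \<omega>)"
    by (simp add: power2_diff)
  then have "sqrt ((sqrt (msq M X) - sqrt (msq M Y))\<^sup>2) \<le> sqrt (msq M (\<lambda>\<omega>. X \<omega> - Y \<omega>))"
    by (rule real_sqrt_le_mono)
  then show ?thesis by simp
qed

lemma msq_tendsto:
  assumes "\<And>n. sq_int M (Z n)" "sq_int M Y" "(\<lambda>n. msq M (\<lambda>\<omega>. Z n \<omega> - Y \<omega>)) \<longlonglongrightarrow> 0"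
  shows "(\<lambda>n. msq M (Z n)) \<longlonglongrightarrow> msq M Y"
proof -
  have "(\<lambda>n. sqrt (msq M (\<lambda>\<omega>. Z n \<omega> - Y \<omega>))) \<longlonglongrightarrow> 0" using tendsto_real_sqrt[OF assms(3)] by simp
  then have "(\<lambda>n. sqrt (msq M (Z n)) - sqrt (msq M Y)) \<longlonglongrightarrow> 0"
    by (rule tendsto_zero_norm_bound) (simp add: sqrt_msq_triangle assms)
  then have "(\<lambda>n. sqrt (msq M (Z n))) \<longlonglongrightarrow> sqrt (msq M Y)" using LIM_zero_iff by blast
  then have "(\<lambda>n. (sqrt (msq M (Z n)))\<^sup>2) \<longlonglongrightarrow> (sqrt (msq M Y))\<^sup>2" by (rule tendsto_power)
  then show ?thesis by simp
qed

lemma inner_tendsto: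
  assumes "\<And>n. sq_int M (Z n)" "sq_int M Y" "(\<lambda>n. msq M (\<lambda>\<omega>. Z n \<omega> - Y \<omega>)) \<longlonglongrightarrow> 0" "sq_int M X"
  shows "(\<lambda>n. integral\<^sup>L M (\<lambda>\<omega>. X \<omega> * Z n \<omega>)) \<longlonglongrightarrow> integral\<^sup>L M (\<lambda>\<omega>. X \<omega> * Y \<omega>)"
proof -
  have d: "integral\<^sup>L M (\<lambda>\<omega>. X \<omega> * Z n \<omega>) - integral\<^sup>L M (\<lambda>\<omega>. X \<omega> * Y \<omega>) = integral\<^sup>L M (\<lambda>\<omega>. X \<omega> * (Z n \<omega> - Y \<omega>))" for n
    by (subst Bochner_Integration.integral_diff[symmetric]) (auto intro!: sq_int_mult assms simp: algebra_simps)
  have "(\<lambda>n. sqrt (msq M X) * sqrt (msq M (\<lambda>\<omega>. Z n \<omega> - Y \<omega>))) \<longlonglongrightarrow> sqrt (msq M X) * sqrt 0"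
    by (intro tendsto_intros assms)
  then have l: "(\<lambda>n. sqrt (msq M X) * sqrt (msq M (\<lambda>\<omega>. Z n \<omega> - Y \<omega>))) \<longlonglongrightarrow> 0" by simp
  have "\<forall>n. norm (integral\<^sup>L M (\<lambda>\<omega>. X \<omega> * (Z n \<omega> - Y \<omega>))) \<le> sqrt (msq M X) * sqrt (msq M (\<lambda>\<omega>. Z n \<omega> - Y \<omega>))"
    unfolding real_norm_def by (intro allI inner_sq_le sq_int_diff assms)
  then have "(\<lambda>n. integral\<^sup>L M (\<lambda>\<omega>. X \<omega> * Z n \<omega>) - integral\<^sup>L M (\<lambda>\<omega>. X \<omega> * Y \<omega>)) \<longlonglongrightarrow> 0"
    unfolding d by (rule Lim_null_comparison[OF always_eventually l])
  then show ?thesis using LIM_zero_iff by blast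
qed

section \<open>Centered Gaussian variables and their mean square limits\<close>

lemma (in prob_space) sq_int_integrable:
  assumes "sq_int M X" shows "integrable M X"
proof -
  have "sq_int M (\<lambda>_. 1)" by (simp add: sq_int_def)
  from sq_int_mult[OF assms this] show ?thesis by simp
qed

lemma (in prob_space) expectation_abs_le:
  assumes "sq_int M X" shows "expectation (\<lambda>\<omega>. \<bar>X \<omega>\<bar>) \<le> sqrt (msq M X)"
proof -
  have 1: "sq_int M (\<lambda>_. 1)" by (simp add: sq_int_def)
  note [measurable] = sq_intD(1)[OF assms]
  have "sq_int M (\<lambda>\<omega>. \<bar>X \<omega>\<bar>)" unfolding sq_int_def using sq_intD(2)[OF assms] by simp
  from inner_sq_le[OF this 1] show ?thesis by (simp add: prob_space)
qed

text \<open>The variance parameter of the characteristic function is tied to the second moment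
  \<open>msq M Y\<close>, so that mean square convergence determines the limit law;
  \<open>gaussian_rv\<close> alone only asserts that some parameter exists.\<close>

definition centered_gaussian :: "'a measure \<Rightarrow> ('a \<Rightarrow> real) \<Rightarrow> bool" where
  "centered_gaussian M Y \<longleftrightarrow> sq_int M Y \<and> integral\<^sup>L M Y = 0 \<and>
     (\<forall>\<theta>. char (distr M borel Y) \<theta> = exp (complex_of_real (- msq M Y * \<theta>\<^sup>2 / 2)))"

lemma centered_gaussian_imp_gaussian_rv:
  assumes "centered_gaussian M Y" shows "gaussian_rv M Y"
  unfolding gaussian_rv_def
proof (rule conjI, goal_cases)
  case 1
  show "Y \<in> borel_measurable M" using assms by (auto simp: centered_gaussian_def sq_int_def)
next
  case 2
  have "(sqrt (msq M Y))\<^sup>2 = msq M Y" by simp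
  then have "char (distr M borel Y) \<theta> = exp (\<i> * complex_of_real (0 * \<theta>) - complex_of_real ((sqrt (msq M Y))\<^sup>2 * \<theta>\<^sup>2 / 2))" for \<theta>
    using assms unfolding centered_gaussian_def by simp
  then show ?case by blast
qed

lemma (in prob_space) char_affine:
  assumes "X \<in> borel_measurable M"
  shows "char (distr M borel (\<lambda>\<omega>. a * X \<omega> + b)) \<theta> = iexp (\<theta> * b) * char (distr M borel X) (\<theta> * a)"
proof -
  have "char (distr M borel (\<lambda>\<omega>. a * X \<omega> + b)) \<theta> = (CLINT \<omega>|M. iexp (\<theta> * b) * iexp (\<theta> * a * X \<omega>))"
    unfolding char_def using assms
    by (subst integral_distr) (auto simp: algebra_simps exp_add[symmetric] intro!: Bochner_Integration.integral_cong)
  also have "\<dots> = iexp (\<theta> * b) * (CLINT \<omega>|M. iexp (\<theta> * a * X \<omega>))" by simp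
  also have "(CLINT \<omega>|M. iexp (\<theta> * a * X \<omega>)) = char (distr M borel X) (\<theta> * a)"
    unfolding char_def using assms by (subst integral_distr) auto
  finally show ?thesis .
qed

text \<open>Only the characteristic function is known, and integrability has to be recovered from
  it. By Levy's uniqueness theorem the law is a point mass or, after standardising, the standard
  normal one, whose moments are known.\<close>

lemma (in prob_space) gaussian_rv_imp_centered_gaussian:
  assumes "gaussian_rv M X" "expectation X = 0"
  shows "centered_gaussian M X"
proof -
  obtain \<mu> \<sigma> where [measurable]: "X \<in> borel_measurable M" and
    c: "\<And>\<theta>. char (distr M borel X) \<theta> = exp (\<i> * complex_of_real (\<mu> * \<theta>) - complex_of_real (\<sigma>\<^sup>2 * \<theta>\<^sup>2 / 2))"
    using assms(1) unfolding gaussian_rv_def by blast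
  have "sq_int M X \<and> expectation X = \<mu> \<and> (\<mu> = 0 \<longrightarrow> msq M X = \<sigma>\<^sup>2)"
  proof (cases "\<sigma> = 0")
    case True
    interpret R: prob_space "return borel \<mu>" by (rule prob_space_return) simp
    have di: "distr M borel X = return borel \<mu>"
    proof (rule Levy_uniqueness)
      show "real_distribution (distr M borel X)" by (simp add: real_distribution_distr)
      show "real_distribution (return borel \<mu>)" by (simp add: real_distribution_def real_distribution_axioms_def prob_space_return)
      show "char (distr M borel X) = char (return borel \<mu>)"
        by (simp add: fun_eq_iff c True) (simp add: char_def integral_return mult.commute)
    qed
    have "AE x in distr M borel X. x = \<mu>" unfolding di by (subst AE_return) auto
    then have ae: "AE \<omega> in M. X \<omega> = \<mu>" by (subst (asm) AE_distr_iff) auto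
    have 1: "integrable M (\<lambda>\<omega>. (X \<omega>)\<^sup>2) \<longleftrightarrow> integrable M (\<lambda>\<omega>. \<mu>\<^sup>2)"
      by (rule integrable_cong_AE) (use ae in auto)
    have 2: "expectation X = expectation (\<lambda>_. \<mu>)" by (rule integral_cong_AE) (use ae in auto)
    have 3: "msq M X = expectation (\<lambda>_. \<mu>\<^sup>2)" by (rule integral_cong_AE) (use ae in auto)
    show ?thesis using 1 2 3 True by (simp add: sq_int_def prob_space)
  next
    case False
    define Y where "Y = (\<lambda>\<omega>. (1 / \<sigma>) * X \<omega> + (- \<mu> / \<sigma>))"
    have [measurable]: "Y \<in> borel_measurable M" by (simp add: Y_def)
    have d: "distr M borel Y = std_normal_distribution"
    proof (rule Levy_uniqueness)
      show "real_distribution (distr M borel Y)" by (simp add: real_distribution_distr)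
      show "real_distribution std_normal_distribution" by (rule real_dist_normal_dist)
      show "char (distr M borel Y) = char std_normal_distribution"
      proof
        fix \<theta>
        have e: "\<i> * complex_of_real (\<theta> * (- \<mu> / \<sigma>)) + (\<i> * complex_of_real (\<mu> * (\<theta> * (1 / \<sigma>))) - complex_of_real (\<sigma>\<^sup>2 * (\<theta> * (1 / \<sigma>))\<^sup>2 / 2))
          = complex_of_real (- \<theta>\<^sup>2 / 2)" using False by (simp add: field_simps)
        show "char (distr M borel Y) \<theta> = char std_normal_distribution \<theta>"
          unfolding Y_def char_affine[OF \<open>X \<in> borel_measurable M\<close>] c char_std_normal_distribution 
          unfolding exp_add[symmetric] e by (simp only: exp_of_real)
      qed
    qed
    have i: "integrable M (\<lambda>\<omega>. (Y \<omega>)^k)" for k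
      using integrable_std_normal_distribution_moment[of k] unfolding d[symmetric]
      by (subst (asm) integrable_distr_eq) auto
    have e: "expectation (\<lambda>\<omega>. (Y \<omega>)^k) = integral\<^sup>L std_normal_distribution (\<lambda>x. x^k)" for k
      unfolding d[symmetric] by (subst integral_distr) auto
    have e1: "expectation Y = 0" using e[of 1] integral_std_normal_distribution_moment_odd[of 1] by simp
    have e2: "msq M Y = 1" using e[of 2] std_normal_distribution_even_moments(1)[of 1] by simp
    have X: "X = (\<lambda>\<omega>. \<sigma> * Y \<omega> + \<mu> * 1)" using False by (auto simp: Y_def fun_eq_iff field_simps)
    have s: "sq_int M Y" using i[of 2] by (simp add: sq_int_def)
    have s1: "sq_int M (\<lambda>_. 1)" by (simp add: sq_int_def)
    have "sq_int M X" unfolding X by (rule sq_int_lin[OF s s1])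
    moreover have "expectation X = \<mu>" using i[of 1] e1 by (subst X) (simp add: prob_space)
    moreover have "msq M X = \<sigma>\<^sup>2" if "\<mu> = 0" unfolding X using msq_lin[OF s s1, of \<sigma> \<mu>] e2 that by simp
    ultimately show ?thesis by blast
  qed
  with assms(2) c show ?thesis by (simp add: centered_gaussian_def)
qed

text \<open>The bounds |exp(ia) - exp(ib)| <= |a - b| and E|Y| <= sqrt(E Y^2) carry mean square
  convergence over to the characteristic functions, while \<open>msq_tendsto\<close> moves the
  variance on the other side of the identity.\<close>

lemma (in prob_space) centered_gaussian_limit:
  assumes Z: "\<And>n. centered_gaussian M (Z n)" and Y: "sq_int M Y"
    and lim: "(\<lambda>n. msq M (\<lambda>\<omega>. Z n \<omega> - Y \<omega>)) \<longlonglongrightarrow> 0"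
  shows "centered_gaussian M Y"
proof -
  have sq: "sq_int M (Z n)" for n using Z by (simp add: centered_gaussian_def)
  note [measurable] = sq_intD(1)[OF sq] sq_intD(1)[OF Y]
  have sd: "sq_int M (\<lambda>\<omega>. Z n \<omega> - Y \<omega>)" for n by (intro sq_int_diff sq Y)
  have lim': "(\<lambda>n. sqrt (msq M (\<lambda>\<omega>. Z n \<omega> - Y \<omega>))) \<longlonglongrightarrow> 0" using tendsto_real_sqrt[OF lim] by simp
  have "\<bar>expectation (Z n) - expectation Y\<bar> \<le> sqrt (msq M (\<lambda>\<omega>. Z n \<omega> - Y \<omega>))" for n
  proof -
    have "\<bar>expectation (Z n) - expectation Y\<bar> = \<bar>expectation (\<lambda>\<omega>. Z n \<omega> - Y \<omega>)\<bar>"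
      using sq_int_integrable[OF sq] sq_int_integrable[OF Y] by simp
    also have "\<dots> \<le> expectation (\<lambda>\<omega>. \<bar>Z n \<omega> - Y \<omega>\<bar>)" by (rule integral_abs_bound)
    finally show ?thesis using expectation_abs_le[OF sd, of n] by linarith
  qed
  then have "(\<lambda>n. expectation (Z n) - expectation Y) \<longlonglongrightarrow> 0"
    unfolding real_norm_def[symmetric] by (rule tendsto_zero_norm_bound[OF lim'])
  then have E0: "expectation Y = 0" using Z by (simp add: centered_gaussian_def LIMSEQ_const_iff)
  have "char (distr M borel Y) \<theta> = exp (complex_of_real (- msq M Y * \<theta>\<^sup>2 / 2))" for \<theta>
  proof -
    have "cmod (char (distr M borel (Z n)) \<theta> - char (distr M borel Y) \<theta>) \<le> \<bar>\<theta>\<bar> * sqrt (msq M (\<lambda>\<omega>. Z n \<omega> - Y \<omega>))" for n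
    proof -
      have ii: "integrable M (\<lambda>\<omega>. iexp (\<theta> * U \<omega>))" if [measurable]: "U \<in> borel_measurable M" for U
        by (rule integrable_const_bound[where B = 1]) (auto simp del: of_real_mult)
      have di: "char (distr M borel U) \<theta> = (CLINT \<omega>|M. iexp (\<theta> * U \<omega>))" if [measurable]: "U \<in> borel_measurable M" for U
        unfolding char_def by (subst integral_distr) auto
      have "char (distr M borel (Z n)) \<theta> - char (distr M borel Y) \<theta> = (CLINT \<omega>|M. iexp (\<theta> * Z n \<omega>) - iexp (\<theta> * Y \<omega>))"
        by (subst Bochner_Integration.integral_diff) (simp_all only: ii di sq_intD(1)[OF sq] sq_intD(1)[OF Y])
      also have "cmod \<dots> \<le> expectation (\<lambda>\<omega>. cmod (iexp (\<theta> * Z n \<omega>) - iexp (\<theta> * Y \<omega>)))"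
        by (rule integral_norm_bound)
      also have "\<dots> \<le> expectation (\<lambda>\<omega>. \<bar>\<theta>\<bar> * \<bar>Z n \<omega> - Y \<omega>\<bar>)"
      proof (rule integral_mono)
        show "integrable M (\<lambda>\<omega>. cmod (iexp (\<theta> * Z n \<omega>) - iexp (\<theta> * Y \<omega>)))" by (intro integrable_norm Bochner_Integration.integrable_diff ii) auto
        show "integrable M (\<lambda>\<omega>. \<bar>\<theta>\<bar> * \<bar>Z n \<omega> - Y \<omega>\<bar>)" using sq_int_integrable[OF sd] by auto
        fix \<omega>
        have "iexp (\<theta> * Y \<omega>) * iexp (\<theta> * (Z n \<omega> - Y \<omega>)) = iexp (\<theta> * Z n \<omega>)"
          unfolding exp_add[symmetric] by (simp add: algebra_simps)
        then have "iexp (\<theta> * Z n \<omega>) - iexp (\<theta> * Y \<omega>) = iexp (\<theta> * Y \<omega>) * (iexp (\<theta> * (Z n \<omega> - Y \<omega>)) - 1)"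
          unfolding right_diff_distrib by (simp only: mult_1_right)
        then have "cmod (iexp (\<theta> * Z n \<omega>) - iexp (\<theta> * Y \<omega>)) = cmod (iexp (\<theta> * (Z n \<omega> - Y \<omega>)) - 1)"
          by (simp only: norm_mult norm_exp_i_times)
        also have "\<dots> \<le> \<bar>\<theta> * (Z n \<omega> - Y \<omega>)\<bar>" using iexp_approx1[of "\<theta> * (Z n \<omega> - Y \<omega>)" 0] by simp
        finally show "cmod (iexp (\<theta> * Z n \<omega>) - iexp (\<theta> * Y \<omega>)) \<le> \<bar>\<theta>\<bar> * \<bar>Z n \<omega> - Y \<omega>\<bar>" by (simp add: abs_mult)
      qed
      also have "\<dots> = \<bar>\<theta>\<bar> * expectation (\<lambda>\<omega>. \<bar>Z n \<omega> - Y \<omega>\<bar>)" by simp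
      also have "\<dots> \<le> \<bar>\<theta>\<bar> * sqrt (msq M (\<lambda>\<omega>. Z n \<omega> - Y \<omega>))" by (intro mult_left_mono expectation_abs_le sd) auto
      finally show ?thesis .
    qed
    then have "(\<lambda>n. char (distr M borel (Z n)) \<theta> - char (distr M borel Y) \<theta>) \<longlonglongrightarrow> 0"
      by (rule tendsto_zero_norm_bound[OF tendsto_mult_right_zero[OF lim']])
    then have 1: "(\<lambda>n. char (distr M borel (Z n)) \<theta>) \<longlonglongrightarrow> char (distr M borel Y) \<theta>" using LIM_zero_iff by blast
    have "(\<lambda>n. exp (complex_of_real (- msq M (Z n) * \<theta>\<^sup>2 / 2))) \<longlonglongrightarrow> exp (complex_of_real (- msq M Y * \<theta>\<^sup>2 / 2))"
      by (intro tendsto_intros msq_tendsto[OF sq Y lim]) auto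
    moreover have "char (distr M borel (Z n)) \<theta> = exp (complex_of_real (- msq M (Z n) * \<theta>\<^sup>2 / 2))" for n
      using Z by (simp add: centered_gaussian_def)
    ultimately show ?thesis using 1 LIMSEQ_unique by auto
  qed
  with E0 Y show ?thesis by (simp add: centered_gaussian_def)
qed

section \<open>Gaussian spaces, their spans and mean square closures\<close>

definition gaussian_space :: "'a measure \<Rightarrow> ('a \<Rightarrow> real) set \<Rightarrow> bool" where
  "gaussian_space M L \<longleftrightarrow> L \<noteq> {} \<and> (\<forall>Y\<in>L. centered_gaussian M Y) \<and>
     (\<forall>X\<in>L. \<forall>Y\<in>L. \<forall>a b. (\<lambda>\<omega>. a * X \<omega> + b * Y \<omega>) \<in> L)"

lemma gaussian_spaceD:
  assumes "gaussian_space M L"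
  shows "Y \<in> L \<Longrightarrow> centered_gaussian M Y" "Y \<in> L \<Longrightarrow> sq_int M Y"
    "X \<in> L \<Longrightarrow> Y \<in> L \<Longrightarrow> (\<lambda>\<omega>. a * X \<omega> + b * Y \<omega>) \<in> L" "(\<lambda>_. 0) \<in> L"
    "X \<in> L \<Longrightarrow> Y \<in> L \<Longrightarrow> (\<lambda>\<omega>. X \<omega> + Y \<omega>) \<in> L"
    "X \<in> L \<Longrightarrow> Y \<in> L \<Longrightarrow> (\<lambda>\<omega>. X \<omega> - Y \<omega>) \<in> L"
    "X \<in> L \<Longrightarrow> (\<lambda>\<omega>. a * X \<omega>) \<in> L"
proof -
  have lin: "(\<lambda>\<omega>. a * X \<omega> + b * Y \<omega>) \<in> L" if "X \<in> L" "Y \<in> L" for a b X Y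
    using assms that unfolding gaussian_space_def by blast
  then show "X \<in> L \<Longrightarrow> Y \<in> L \<Longrightarrow> (\<lambda>\<omega>. a * X \<omega> + b * Y \<omega>) \<in> L" .
  show "Y \<in> L \<Longrightarrow> centered_gaussian M Y" "Y \<in> L \<Longrightarrow> sq_int M Y"
    using assms unfolding gaussian_space_def centered_gaussian_def by blast+
  show "(\<lambda>_. 0) \<in> L" using assms lin[of _ _ 0 0] unfolding gaussian_space_def by auto
  show "X \<in> L \<Longrightarrow> Y \<in> L \<Longrightarrow> (\<lambda>\<omega>. X \<omega> + Y \<omega>) \<in> L" using lin[of X Y 1 1] by simp
  show "X \<in> L \<Longrightarrow> Y \<in> L \<Longrightarrow> (\<lambda>\<omega>. X \<omega> - Y \<omega>) \<in> L" using lin[of X Y 1 "-1"] by simp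
  show "X \<in> L \<Longrightarrow> (\<lambda>\<omega>. a * X \<omega>) \<in> L" using lin[of X X a 0] by simp
qed

lemma gaussian_space_sum:
  assumes "gaussian_space M L" "\<And>i. i \<in> J \<Longrightarrow> Z i \<in> L" "finite J"
  shows "(\<lambda>\<omega>. \<Sum>i\<in>J. c i * Z i \<omega>) \<in> L"
  using assms(3,2)
proof (induction rule: finite_induct)
  case empty
  then show ?case using gaussian_spaceD(4)[OF assms(1)] by simp
next
  case (insert x F)
  then have "(\<lambda>\<omega>. c x * Z x \<omega> + 1 * (\<Sum>i\<in>F. c i * Z i \<omega>)) \<in> L"
    by (intro gaussian_spaceD(3)[OF assms(1)]) auto
  then show ?case using insert by simp
qed

lemma gaussian_space_family:
  assumes "gaussian_space M L" "\<And>i. i \<in> I \<Longrightarrow> Z i \<in> L"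
  shows "gaussian_family M I Z" "centered_family M I Z"
proof -
  show "gaussian_family M I Z" unfolding gaussian_family_def
  proof (intro allI impI)
    fix J c assume "J \<subseteq> I" "finite J"
    then have "(\<lambda>\<omega>. \<Sum>i\<in>J. c i * Z i \<omega>) \<in> L" using assms by (intro gaussian_space_sum[OF assms(1)]) auto
    then show "gaussian_rv M (\<lambda>\<omega>. \<Sum>i\<in>J. c i * Z i \<omega>)"
      using gaussian_spaceD(1)[OF assms(1)] centered_gaussian_imp_gaussian_rv by blast
  qed
  show "centered_family M I Z" unfolding centered_family_def
    using assms gaussian_spaceD(1)[OF assms(1)] by (auto simp: centered_gaussian_def)
qed

text \<open>Members are functions, not classes modulo null sets. Every square integrable version of
  a limit belongs to the closure, in particular one whose paths have been repaired on a null
  set.\<close>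

definition L2_closure :: "'a measure \<Rightarrow> ('a \<Rightarrow> real) set \<Rightarrow> ('a \<Rightarrow> real) set" where
  "L2_closure M L = {Y. sq_int M Y \<and> (\<exists>Z. (\<forall>n::nat. Z n \<in> L) \<and> (\<lambda>n. msq M (\<lambda>\<omega>. Z n \<omega> - Y \<omega>)) \<longlonglongrightarrow> 0)}"

lemma L2_closureI:
  "sq_int M Y \<Longrightarrow> (\<And>n::nat. Z n \<in> L) \<Longrightarrow> (\<lambda>n. msq M (\<lambda>\<omega>. Z n \<omega> - Y \<omega>)) \<longlonglongrightarrow> 0 \<Longrightarrow> Y \<in> L2_closure M L"
  unfolding L2_closure_def by blast

lemma msq_add_le:
  assumes "sq_int M X" "sq_int M Y"
  shows "msq M (\<lambda>\<omega>. X \<omega> + Y \<omega>) \<le> 2 * msq M X + 2 * msq M Y"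
proof -
  have "msq M (\<lambda>\<omega>. X \<omega> + Y \<omega>) \<le> integral\<^sup>L M (\<lambda>\<omega>. 2 * (X \<omega>)\<^sup>2 + 2 * (Y \<omega>)\<^sup>2)"
  proof (rule integral_mono)
    show "integrable M (\<lambda>\<omega>. (X \<omega> + Y \<omega>)\<^sup>2)" using sq_int_lin[OF assms, of 1 1] by (auto simp: sq_int_def)
    show "integrable M (\<lambda>\<omega>. 2 * (X \<omega>)\<^sup>2 + 2 * (Y \<omega>)\<^sup>2)" using assms by (auto simp: sq_int_def)
    show "(X \<omega> + Y \<omega>)\<^sup>2 \<le> 2 * (X \<omega>)\<^sup>2 + 2 * (Y \<omega>)\<^sup>2" for \<omega>
      using zero_le_power2[of "X \<omega> - Y \<omega>"] by (simp add: power2_eq_square algebra_simps)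
  qed
  also have "\<dots> = 2 * msq M X + 2 * msq M Y" using assms by (auto simp: sq_int_def)
  finally show ?thesis .
qed

lemma (in prob_space) gaussian_space_L2_closure:
  assumes L: "gaussian_space M L" shows "gaussian_space M (L2_closure M L)"
  unfolding gaussian_space_def
proof (intro conjI ballI allI)
  have "(\<lambda>_. 0) \<in> L2_closure M L"
    using gaussian_spaceD(4)[OF L] by (auto simp: L2_closure_def sq_int_def intro!: exI[of _ "\<lambda>_ _. 0"])
  then show "L2_closure M L \<noteq> {}" by blast
next
  fix Y assume "Y \<in> L2_closure M L"
  then show "centered_gaussian M Y"
    using centered_gaussian_limit gaussian_spaceD(1)[OF L] unfolding L2_closure_def by blast
next
  fix X Y a b assume "X \<in> L2_closure M L" "Y \<in> L2_closure M L"
  then obtain U V where UV: "\<And>n::nat. U n \<in> L" "(\<lambda>n. msq M (\<lambda>\<omega>. U n \<omega> - X \<omega>)) \<longlonglongrightarrow> 0"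
     "\<And>n::nat. V n \<in> L" "(\<lambda>n. msq M (\<lambda>\<omega>. V n \<omega> - Y \<omega>)) \<longlonglongrightarrow> 0" and XY: "sq_int M X" "sq_int M Y"
    unfolding L2_closure_def by blast
  note s = sq_int_diff[OF gaussian_spaceD(2)[OF L UV(1)] XY(1)] sq_int_diff[OF gaussian_spaceD(2)[OF L UV(3)] XY(2)]
  have s': "sq_int M (\<lambda>\<omega>. a * (U n \<omega> - X \<omega>))" "sq_int M (\<lambda>\<omega>. b * (V n \<omega> - Y \<omega>))" for n
    using sq_int_lin[OF s(1) s(1), of a n 0 n] sq_int_lin[OF s(2) s(2), of b n 0 n] by simp_all
  have "msq M (\<lambda>\<omega>. (a * U n \<omega> + b * V n \<omega>) - (a * X \<omega> + b * Y \<omega>)) \<le> 2 * (a\<^sup>2 * msq M (\<lambda>\<omega>. U n \<omega> - X \<omega>)) + 2 * (b\<^sup>2 * msq M (\<lambda>\<omega>. V n \<omega> - Y \<omega>))" for n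
  proof -
    have e: "(a * U n \<omega> + b * V n \<omega>) - (a * X \<omega> + b * Y \<omega>) = a * (U n \<omega> - X \<omega>) + b * (V n \<omega> - Y \<omega>)" for \<omega>
      by (simp add: algebra_simps)
    show ?thesis unfolding e using msq_add_le[OF s'(1)[of n] s'(2)[of n]] by (simp only: power_mult_distrib integral_mult_right_zero)
  qed
  note le = this
  have l: "(\<lambda>n. 2 * (a\<^sup>2 * msq M (\<lambda>\<omega>. U n \<omega> - X \<omega>)) + 2 * (b\<^sup>2 * msq M (\<lambda>\<omega>. V n \<omega> - Y \<omega>))) \<longlonglongrightarrow> 2 * (a\<^sup>2 * 0) + 2 * (b\<^sup>2 * 0)"
    by (intro tendsto_intros UV)
  have "(\<lambda>n. msq M (\<lambda>\<omega>. (a * U n \<omega> + b * V n \<omega>) - (a * X \<omega> + b * Y \<omega>))) \<longlonglongrightarrow> 0"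
    by (rule tendsto_zero_bound[OF l _ _ le]) simp_all
  then show "(\<lambda>\<omega>. a * X \<omega> + b * Y \<omega>) \<in> L2_closure M L"
    by (rule L2_closureI[OF sq_int_lin[OF XY] gaussian_spaceD(3)[OF L UV(1) UV(3)]])
qed

text \<open>Diagonal choice: some V n in L lies within 1/(n+1) of Z n in squared distance.
  \<open>msq_add_le\<close> serves as the triangle inequality for squared distances, at the cost of
  a factor 2.\<close>

lemma (in prob_space) L2_closure_limit:
  assumes L: "gaussian_space M L" and Z: "\<And>n::nat. Z n \<in> L2_closure M L" and Y: "sq_int M Y"
    and lim: "(\<lambda>n. msq M (\<lambda>\<omega>. Z n \<omega> - Y \<omega>)) \<longlonglongrightarrow> 0"
  shows "Y \<in> L2_closure M L"
proof -
  have "\<exists>V\<in>L. msq M (\<lambda>\<omega>. V \<omega> - Z n \<omega>) < inverse (Suc n)" for n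
  proof -
    obtain V where V: "\<And>n::nat. V n \<in> L" "(\<lambda>k. msq M (\<lambda>\<omega>. V k \<omega> - Z n \<omega>)) \<longlonglongrightarrow> 0"
      using Z[of n] unfolding L2_closure_def by blast
    from order_tendstoD(2)[OF V(2), of "inverse (Suc n)"] obtain k where "msq M (\<lambda>\<omega>. V k \<omega> - Z n \<omega>) < inverse (Suc n)"
      by (auto dest: eventually_happens)
    then show ?thesis using V(1) by blast
  qed
  then obtain V where V: "\<And>n. V n \<in> L" "\<And>n. msq M (\<lambda>\<omega>. V n \<omega> - Z n \<omega>) < inverse (Suc n)" by metis
  have sZ: "sq_int M (Z n)" for n using Z by (auto simp: L2_closure_def)
  have e: "V n \<omega> - Z n \<omega> + (Z n \<omega> - Y \<omega>) = V n \<omega> - Y \<omega>" for n \<omega> by simp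
  have "msq M (\<lambda>\<omega>. V n \<omega> - Y \<omega>) \<le> 2 * inverse (Suc n) + 2 * msq M (\<lambda>\<omega>. Z n \<omega> - Y \<omega>)" for n
    using msq_add_le[OF sq_int_diff[OF gaussian_spaceD(2)[OF L V(1)] sZ] sq_int_diff[OF sZ Y], of n n n] V(2)[of n]
    unfolding e by linarith
  note le = this
  have l: "(\<lambda>n. 2 * inverse (Suc n) + 2 * msq M (\<lambda>\<omega>. Z n \<omega> - Y \<omega>)) \<longlonglongrightarrow> 2 * 0 + 2 * 0"
    by (intro tendsto_intros lim LIMSEQ_inverse_real_of_nat)
  have "(\<lambda>n. msq M (\<lambda>\<omega>. V n \<omega> - Y \<omega>)) \<longlonglongrightarrow> 0"
    by (rule tendsto_zero_bound[OF l _ _ le]) simp_all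
  then show ?thesis by (rule L2_closureI[OF Y V(1)])
qed

text \<open>Fatou's lemma in the second index turns the Cauchy estimate into one against the
  pointwise limit. This identifies the mean square limit with a version that is defined path by
  path.\<close>

lemma L2_AE_limit:
  assumes Z: "\<And>n::nat. sq_int M (Z n)" and [measurable]: "Y \<in> borel_measurable M"
    and ae: "AE \<omega> in M. (\<lambda>n. Z n \<omega>) \<longlonglongrightarrow> Y \<omega>"
    and d: "\<And>n m. msq M (\<lambda>\<omega>. Z n \<omega> - Z m \<omega>) \<le> d n + d m" "d \<longlonglongrightarrow> (0::real)" "\<And>n. d n \<ge> 0"
  shows "sq_int M Y" "(\<lambda>n. msq M (\<lambda>\<omega>. Z n \<omega> - Y \<omega>)) \<longlonglongrightarrow> 0"
proof -
  note [measurable] = sq_intD(1)[OF Z]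
  have le: "(\<integral>\<^sup>+\<omega>. ennreal ((Z n \<omega> - Y \<omega>)\<^sup>2) \<partial>M) \<le> ennreal (d n)" for n
  proof -
    have "(\<integral>\<^sup>+\<omega>. ennreal ((Z n \<omega> - Y \<omega>)\<^sup>2) \<partial>M) = (\<integral>\<^sup>+\<omega>. liminf (\<lambda>m. ennreal ((Z n \<omega> - Z m \<omega>)\<^sup>2)) \<partial>M)"
    proof (rule nn_integral_cong_AE, use ae in eventually_elim)
      fix \<omega> assume "(\<lambda>n. Z n \<omega>) \<longlonglongrightarrow> Y \<omega>"
      then have "(\<lambda>m. ennreal ((Z n \<omega> - Z m \<omega>)\<^sup>2)) \<longlonglongrightarrow> ennreal ((Z n \<omega> - Y \<omega>)\<^sup>2)"
        by (intro tendsto_intros)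
      then show "ennreal ((Z n \<omega> - Y \<omega>)\<^sup>2) = liminf (\<lambda>m. ennreal ((Z n \<omega> - Z m \<omega>)\<^sup>2))"
        by (intro lim_imp_Liminf[symmetric]) simp_all
    qed
    also have "\<dots> \<le> liminf (\<lambda>m. \<integral>\<^sup>+\<omega>. ennreal ((Z n \<omega> - Z m \<omega>)\<^sup>2) \<partial>M)"
      by (rule nn_integral_liminf) simp
    also have "\<dots> \<le> liminf (\<lambda>m. ennreal (d n + d m))"
    proof (rule Liminf_mono, rule always_eventually, rule allI)
      fix m
      have "(\<integral>\<^sup>+\<omega>. ennreal ((Z n \<omega> - Z m \<omega>)\<^sup>2) \<partial>M) = ennreal (msq M (\<lambda>\<omega>. Z n \<omega> - Z m \<omega>))"
        using sq_int_diff[OF Z Z] by (intro nn_integral_eq_integral) (auto simp: sq_int_def)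
      then show "(\<integral>\<^sup>+\<omega>. ennreal ((Z n \<omega> - Z m \<omega>)\<^sup>2) \<partial>M) \<le> ennreal (d n + d m)"
        using d(1) by (simp add: ennreal_leI)
    qed
    also have "\<dots> = ennreal (d n)"
    proof (rule lim_imp_Liminf)
      have "(\<lambda>m. ennreal (d n + d m)) \<longlonglongrightarrow> ennreal (d n + 0)" by (intro tendsto_intros d)
      then show "(\<lambda>m. ennreal (d n + d m)) \<longlonglongrightarrow> ennreal (d n)" by simp
    qed simp
    finally show ?thesis .
  qed
  have i: "integrable M (\<lambda>\<omega>. (Z n \<omega> - Y \<omega>)\<^sup>2)" for n
    by (rule integrableI_bounded) (use le[of n] in \<open>auto simp: less_top[symmetric] top_unique\<close>)
  then have s: "sq_int M (\<lambda>\<omega>. Z n \<omega> - Y \<omega>)" for n by (simp add: sq_int_def)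
  from sq_int_diff[OF Z s, of 0 0] show "sq_int M Y" by simp
  have "msq M (\<lambda>\<omega>. Z n \<omega> - Y \<omega>) \<le> d n" for n
    using le[of n] d(3)[of n] by (subst (asm) nn_integral_eq_integral[OF i]) (auto simp: ennreal_le_iff)
  then show "(\<lambda>n. msq M (\<lambda>\<omega>. Z n \<omega> - Y \<omega>)) \<longlonglongrightarrow> 0"
    by (intro tendsto_zero_norm_bound[OF d(2)]) simp
qed

lemma (in prob_space) gaussian_space_span:
  assumes "gaussian_family M I W" "centered_family M I W"
  shows "gaussian_space M {\<lambda>\<omega>. \<Sum>i\<in>J. c i * W i \<omega> | J c. finite J \<and> J \<subseteq> I}" (is "gaussian_space M ?L")
  unfolding gaussian_space_def
proof (intro conjI ballI allI)
  show "?L \<noteq> {}" by auto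
next
  have cg: "centered_gaussian M (W i)" if "i \<in> I" for i
  proof (rule gaussian_rv_imp_centered_gaussian)
    show "gaussian_rv M (W i)" using assms(1)[unfolded gaussian_family_def, rule_format, of "{i}" "\<lambda>_. 1"] that by simp
    show "expectation (W i) = 0" using assms(2) that by (simp add: centered_family_def)
  qed
  fix Y assume "Y \<in> ?L"
  then obtain J c where Y: "Y = (\<lambda>\<omega>. \<Sum>i\<in>J. c i * W i \<omega>)" "finite J" "J \<subseteq> I" by blast
  show "centered_gaussian M Y"
  proof (rule gaussian_rv_imp_centered_gaussian)
    show "gaussian_rv M Y" using assms(1) Y unfolding gaussian_family_def by blast
    have "integrable M (W i)" if "i \<in> J" for i using cg[of i] that Y sq_int_integrable by (auto simp: centered_gaussian_def)
    then have "expectation Y = (\<Sum>i\<in>J. c i * expectation (W i))" unfolding Y by (subst Bochner_Integration.integral_sum) auto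
    also have "\<dots> = 0" using assms(2) Y by (intro sum.neutral) (auto simp: centered_family_def)
    finally show "expectation Y = 0" .
  qed
next
  fix X Y a b assume "X \<in> ?L" "Y \<in> ?L"
  then obtain J c J' c' where X: "X = (\<lambda>\<omega>. \<Sum>i\<in>J. c i * W i \<omega>)" "finite J" "J \<subseteq> I"
    and Y: "Y = (\<lambda>\<omega>. \<Sum>i\<in>J'. c' i * W i \<omega>)" "finite J'" "J' \<subseteq> I" by blast
  \<comment> \<open>Both coefficient families are extended by 0 to the union of the index
    sets.\<close>
  let ?e = "\<lambda>i. a * (if i \<in> J then c i else 0) + b * (if i \<in> J' then c' i else 0)"
  have "a * X \<omega> + b * Y \<omega> = (\<Sum>i\<in>J\<union>J'. ?e i * W i \<omega>)" for \<omega>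
  proof -
    have "X \<omega> = (\<Sum>i\<in>J\<union>J'. (if i \<in> J then c i else 0) * W i \<omega>)"
      unfolding X(1) using X(2,3) Y(2,3) by (intro sum.mono_neutral_cong_left) auto
    moreover have "Y \<omega> = (\<Sum>i\<in>J\<union>J'. (if i \<in> J' then c' i else 0) * W i \<omega>)"
      unfolding Y(1) using X(2,3) Y(2,3) by (intro sum.mono_neutral_cong_left) auto
    ultimately show ?thesis by (simp only: distrib_right sum.distrib sum_distrib_left mult.assoc)
  qed
  then have "(\<lambda>\<omega>. a * X \<omega> + b * Y \<omega>) = (\<lambda>\<omega>. \<Sum>i\<in>J\<union>J'. ?e i * W i \<omega>)" by (rule ext)
  moreover have "finite (J \<union> J')" "J \<union> J' \<subseteq> I" using X(2,3) Y(2,3) by simp_all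
  ultimately have "\<exists>K c. (\<lambda>\<omega>. a * X \<omega> + b * Y \<omega>) = (\<lambda>\<omega>. \<Sum>i\<in>K. c i * W i \<omega>) \<and> finite K \<and> K \<subseteq> I"
    by (intro exI conjI)
  then show "(\<lambda>\<omega>. a * X \<omega> + b * Y \<omega>) \<in> ?L" by (simp only: mem_Collect_eq)
qed

section \<open>Integrals expressed by the Gamma function\<close>

lemma nn_integral_even:
  fixes f :: "real \<Rightarrow> ennreal"
  assumes [measurable]: "f \<in> borel_measurable borel" and even: "\<And>x. f (- x) = f x"
  shows "(\<integral>\<^sup>+x. f x \<partial>lborel) = 2 * (\<integral>\<^sup>+x. f x * indicator {0<..} x \<partial>lborel)"
proof -
  have "(\<integral>\<^sup>+x. f x \<partial>lborel) = (\<integral>\<^sup>+x. (f x * indicator {0<..} x + f x * indicator {..<0} x) \<partial>lborel)"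
    by (intro nn_integral_cong_AE) (use AE_lborel_singleton[of 0] in \<open>auto split: split_indicator elim!: eventually_mono\<close>)
  also have "\<dots> = (\<integral>\<^sup>+x. f x * indicator {0<..} x \<partial>lborel) + (\<integral>\<^sup>+x. f x * indicator {..<0} x \<partial>lborel)"
    by (intro nn_integral_add) auto
  also have "(\<integral>\<^sup>+x. f x * indicator {..<0} x \<partial>lborel) = (\<integral>\<^sup>+x. f x * indicator {0<..} x \<partial>lborel)"
    by (subst nn_integral_real_affine[where c = "-1" and t = 0])
       (auto simp: even one_ennreal_def[symmetric] intro!: nn_integral_cong split: split_indicator)
  finally show ?thesis by (simp add: mult_2)
qed

lemma nn_integral_Gamma:
  assumes "p > 0"
  shows "(\<integral>\<^sup>+r. ennreal (r powr (p - 1) * exp (- r)) * indicator {0<..} r \<partial>lborel) = ennreal (Gamma p)"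
proof -
  have "(\<integral>\<^sup>+r. ennreal (r powr (p - 1) * exp (- r)) * indicator {0<..} r \<partial>lborel)
     = (\<integral>\<^sup>+r. ennreal (indicator {0..} r * r powr (p - 1) / exp r) \<partial>lborel)"
    by (intro nn_integral_cong) (auto simp: exp_minus field_simps split: split_indicator)
  then show ?thesis using Gamma_conv_nn_integral_real[OF assms] by simp
qed

lemma nn_integral_Gamma_scale:
  assumes "p > 0" "b > 0"
  shows "(\<integral>\<^sup>+r. ennreal (r powr (p - 1) * exp (- (b * r))) * indicator {0<..} r \<partial>lborel) = ennreal (Gamma p * b powr (- p))"
proof -
  have "ennreal (b powr p) * (\<integral>\<^sup>+r. ennreal (r powr (p - 1) * exp (- (b * r))) * indicator {0<..} r \<partial>lborel) = ennreal (Gamma p)"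
  proof -
    have "ennreal (Gamma p) = ennreal \<bar>b\<bar> * (\<integral>\<^sup>+r. ennreal ((0 + b * r) powr (p - 1) * exp (- (0 + b * r))) * indicator {0<..} (0 + b * r) \<partial>lborel)"
      unfolding nn_integral_Gamma[OF assms(1), symmetric]
      using assms(2) by (intro nn_integral_real_affine) auto
    also have "\<dots> = (\<integral>\<^sup>+r. ennreal \<bar>b\<bar> * (ennreal ((0 + b * r) powr (p - 1) * exp (- (0 + b * r))) * indicator {0<..} (0 + b * r)) \<partial>lborel)"
      by (intro nn_integral_cmult[symmetric]) auto
    also have "\<dots> = (\<integral>\<^sup>+r. ennreal (b powr p) * (ennreal (r powr (p - 1) * exp (- (b * r))) * indicator {0<..} r) \<partial>lborel)"
    proof (intro nn_integral_cong)
      fix r :: real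
      have "b * ((b * r) powr (p - 1)) = b powr p * r powr (p - 1)" if "r > 0"
        using assms(2) that by (simp add: powr_mult powr_diff)
      then show "ennreal \<bar>b\<bar> * (ennreal ((0 + b * r) powr (p - 1) * exp (- (0 + b * r))) * indicator {0<..} (0 + b * r))
        = ennreal (b powr p) * (ennreal (r powr (p - 1) * exp (- (b * r))) * indicator {0<..} r)"
        using assms(2) by (auto simp: ennreal_mult[symmetric] mult.assoc[symmetric] zero_less_mult_iff split: split_indicator)
    qed
    also have "\<dots> = ennreal (b powr p) * (\<integral>\<^sup>+r. ennreal (r powr (p - 1) * exp (- (b * r))) * indicator {0<..} r \<partial>lborel)"
      by (intro nn_integral_cmult) auto
    finally show ?thesis by simp
  qed
  then have "ennreal (b powr (-p)) * (ennreal (b powr p) * (\<integral>\<^sup>+r. ennreal (r powr (p - 1) * exp (- (b * r))) * indicator {0<..} r \<partial>lborel)) 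
     = ennreal (b powr (-p)) * ennreal (Gamma p)" by simp
  then show ?thesis using assms
    by (simp add: mult.assoc[symmetric] ennreal_mult[symmetric] powr_add[symmetric] mult.commute Gamma_real_nonneg)
qed

text \<open>Substitute r = x^2 in the Gamma integral. The substitution rule is applied on [0, n],
  and monotone convergence removes the truncation.\<close>

lemma nn_integral_power_gauss:
  fixes p v :: real
  assumes "p > 0" "v > 0"
  shows "(\<integral>\<^sup>+x. ennreal (\<bar>x\<bar> powr (2 * p - 1) * exp (- (v * x\<^sup>2))) \<partial>lborel) = ennreal (Gamma p * v powr (- p))"
proof -
  let ?f = "\<lambda>r::real. r powr (p - 1) * exp (- (v * r))"
  let ?g = "\<lambda>x::real. ?f (x\<^sup>2) * (2 * x)"
  \<comment> \<open>The condition h 0 = 0 reconciles the closed intervals with the open half-line;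
    both uses satisfy it, since 0 \<open>powr\<close> anything is 0.\<close>
  have m: "(\<lambda>n. \<integral>\<^sup>+r. ennreal (h r * indicator {0..(c::nat\<Rightarrow>real) n} r) \<partial>lborel) \<longlonglongrightarrow> (\<integral>\<^sup>+r. ennreal (h r * indicator {0<..} r) \<partial>lborel)"
    if [measurable]: "h \<in> borel_measurable borel" and h: "\<And>r. r \<ge> 0 \<Longrightarrow> h r \<ge> 0" "h 0 = 0" and c: "incseq c" "filterlim c at_top sequentially" for h c
  proof (rule nn_integral_LIMSEQ)
    show "incseq (\<lambda>n r. ennreal (h r * indicator {0..c n} r))"
      using c(1) h by (auto simp: incseq_def le_fun_def split: split_indicator intro!: ennreal_leI) (meson order_trans)
    fix r :: real
    have "eventually (\<lambda>n. c n \<ge> r) sequentially" using c(2) by (simp add: filterlim_at_top)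
    then have "eventually (\<lambda>n. ennreal (h r * indicator {0<..} r) = ennreal (h r * indicator {0..c n} r)) sequentially"
      by eventually_elim (use h in \<open>auto split: split_indicator simp: less_le\<close>)
    then show "(\<lambda>n. ennreal (h r * indicator {0..c n} r)) \<longlonglongrightarrow> ennreal (h r * indicator {0<..} r)"
      by (rule Lim_transform_eventually[OF tendsto_const])
  qed simp
  have 1: "(\<lambda>n. \<integral>\<^sup>+r. ennreal (?f r * indicator {0..(real n)\<^sup>2} r) \<partial>lborel) \<longlonglongrightarrow> (\<integral>\<^sup>+r. ennreal (?f r * indicator {0<..} r) \<partial>lborel)"
    by (rule m) (auto simp: incseq_def power_mono intro!: filterlim_pow_at_top filterlim_real_sequentially)
  have 2: "(\<lambda>n. \<integral>\<^sup>+r. ennreal (?g r * indicator {0..real n} r) \<partial>lborel) \<longlonglongrightarrow> (\<integral>\<^sup>+r. ennreal (?g r * indicator {0<..} r) \<partial>lborel)"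
    by (rule m) (auto simp: incseq_def filterlim_real_sequentially)
  have "(\<integral>\<^sup>+r. ennreal (?f r * indicator {0..(real n)\<^sup>2} r) \<partial>lborel) = (\<integral>\<^sup>+r. ennreal (?g r * indicator {0..real n} r) \<partial>lborel)" for n
  proof -
    have d: "((\<lambda>x. x\<^sup>2) has_real_derivative 2 * x) (at x)" for x :: real
      by (auto intro!: derivative_eq_intros)
    show ?thesis
      using nn_integral_substitution[of "\<lambda>x. x\<^sup>2" 0 "real n" ?f "\<lambda>x. 2 * x", OF _ d]
      by (simp add: set_borel_measurable_def continuous_intros)
  qed
  with 1 2 have e: "(\<integral>\<^sup>+r. ennreal (?f r * indicator {0<..} r) \<partial>lborel) = (\<integral>\<^sup>+r. ennreal (?g r * indicator {0<..} r) \<partial>lborel)"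
    using LIMSEQ_unique by auto
  have "(\<integral>\<^sup>+x. ennreal (\<bar>x\<bar> powr (2 * p - 1) * exp (- (v * x\<^sup>2))) \<partial>lborel)
      = 2 * (\<integral>\<^sup>+x. ennreal (\<bar>x\<bar> powr (2 * p - 1) * exp (- (v * x\<^sup>2))) * indicator {0<..} x \<partial>lborel)"
    by (rule nn_integral_even) auto
  also have "\<dots> = (\<integral>\<^sup>+x. 2 * (ennreal (\<bar>x\<bar> powr (2 * p - 1) * exp (- (v * x\<^sup>2))) * indicator {0<..} x) \<partial>lborel)"
    by (rule nn_integral_cmult[symmetric]) auto
  also have "\<dots> = (\<integral>\<^sup>+r. ennreal (?g r * indicator {0<..} r) \<partial>lborel)"
  proof (rule nn_integral_cong)
    fix x :: real
    have "x powr (2 * p - 1) = (x\<^sup>2) powr (p - 1) * x" if "x > 0"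
    proof -
      have "(x\<^sup>2) powr (p - 1) = (x powr 2) powr (p - 1)" using that by simp
      also have "\<dots> = x powr (2 * (p - 1))" by (rule powr_powr)
      finally have "(x\<^sup>2) powr (p - 1) * x = x powr (2 * (p - 1)) * x powr 1" using that by simp
      also have "\<dots> = x powr (2 * p - 1)" unfolding powr_add[symmetric] by (simp add: algebra_simps)
      finally show ?thesis by simp
    qed
    then show "2 * (ennreal (\<bar>x\<bar> powr (2 * p - 1) * exp (- (v * x\<^sup>2))) * indicator {0<..} x) = ennreal (?g x * indicator {0<..} x)"
      by (auto split: split_indicator simp: ennreal_mult[symmetric] mult_ac simp flip: ennreal_numeral)
  qed
  also have "\<dots> = ennreal (Gamma p * v powr (- p))"
    unfolding e[symmetric] nn_integral_Gamma_scale[OF assms, symmetric]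
    by (intro nn_integral_cong) (auto split: split_indicator)
  finally show ?thesis .
qed

lemma has_bochner_integral_power_gauss:
  fixes p v :: real
  assumes "p > 0" "v > 0"
  shows "has_bochner_integral lborel (\<lambda>x. \<bar>x\<bar> powr (2 * p - 1) * exp (- (v * x\<^sup>2))) (Gamma p * v powr (- p))"
  by (rule has_bochner_integral_nn_integral) (use assms nn_integral_power_gauss[OF assms] in \<open>auto simp: Gamma_real_nonneg\<close>)

text \<open>For a = c the integrand is singular at the endpoint s = c. After the reflection s -> c -
  s the integral is a difference of two integrals starting at 0, which are known with the
  singularity included.\<close>

lemma has_bochner_integral_powr_shift:
  fixes H a c :: real
  assumes "0 < H" "0 \<le> a" "a \<le> c"
  shows "has_bochner_integral lborel (\<lambda>s. indicator {0<..<a} s * (c - s) powr (H - 1)) ((c powr H - (c - a) powr H) / H)"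
proof -
  have 1: "((\<lambda>x. x powr (H - 1)) has_integral (c powr H / H - (c - a) powr H / H)) {c - a..c}"
  proof -
    have *: "((\<lambda>x. x powr (H - 1)) has_integral (b powr H / H)) {0..b}" if "b \<ge> 0" for b
      using has_integral_powr_from_0[of "H - 1" b] assms that by simp
    obtain I where I: "((\<lambda>x. x powr (H - 1)) has_integral I) {c - a..c}"
      using integrable_subinterval_real[of "\<lambda>x. x powr (H - 1)" 0 c "c - a" c] *[of c] assms by (auto simp: integrable_on_def)
    have "((\<lambda>x. x powr (H - 1)) has_integral ((c - a) powr H / H + I)) {0..c}"
      by (rule has_integral_combine[OF _ _ *[of "c - a"] I]) (use assms in auto)
    with *[of c] assms have "(c - a) powr H / H + I = c powr H / H" using has_integral_unique by auto
    then have "I = c powr H / H - (c - a) powr H / H" by linarith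
    with I show ?thesis by simp
  qed
  have nn: "(\<integral>\<^sup>+x. ennreal (x powr (H - 1)) * indicator {c - a..c} x \<partial>lborel) = ennreal (c powr H / H - (c - a) powr H / H)"
    by (rule nn_integral_has_integral_lebesgue'[OF _ 1]) auto
  have "(\<integral>\<^sup>+s. ennreal (indicator {0<..<a} s * (c - s) powr (H - 1)) \<partial>lborel) = (\<integral>\<^sup>+s. ennreal ((c - s) powr (H - 1)) * indicator {c - a..c} (c - s) \<partial>lborel)"
    by (rule nn_integral_cong_AE)
       (use AE_lborel_singleton[of 0] AE_lborel_singleton[of a] in \<open>eventually_elim, auto split: split_indicator\<close>)
  also have "\<dots> = (\<integral>\<^sup>+x. ennreal (x powr (H - 1)) * indicator {c - a..c} x \<partial>lborel)"
    by (subst (2) nn_integral_real_affine[where c = "-1" and t = c]) (auto simp: one_ennreal_def[symmetric])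
  finally show ?thesis unfolding nn using assms
    by (intro has_bochner_integral_nn_integral) (auto simp: diff_divide_distrib intro!: divide_right_mono powr_mono2)
qed

lemma Gamma_reflection_real:
  assumes "0 < H" "H < (1::real)"
  shows "Gamma H * Gamma (1 - H) = pi / sin (pi * H)"
proof -
  have "complex_of_real (Gamma H * Gamma (1 - H)) = complex_of_real (pi / sin (pi * H))"
    using Gamma_reflection_complex[of "complex_of_real H"] 
    by (simp add: Gamma_complex_of_real[symmetric] sin_of_real[symmetric])
  then show ?thesis unfolding of_real_eq_iff .
qed

section \<open>The integral of (1 - cos x) |x|^(-1-2H)\<close>

lemma nn_integral_one_minus_cos_exp:
  assumes "v > 0"
  shows "(\<integral>\<^sup>+x. ennreal ((1 - cos x) * exp (- (v * x))) * indicator {0<..} x \<partial>lborel) = ennreal (1 / (v * (1 + v\<^sup>2)))"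
proof -
  \<comment> \<open>Antiderivative of exp(-vx) minus that of cos x exp(-vx); its boundary value
    gives 1/v - v/(1+v^2).\<close>
  let ?F = "\<lambda>x. - exp (- (v * x)) / v - exp (- (v * x)) * (sin x - v * cos x) / (1 + v\<^sup>2)"
  have nz: "1 + v\<^sup>2 \<noteq> 0" by (metis add_nonneg_eq_0_iff zero_le_one zero_le_power2 zero_neq_one)
  have "(\<integral>\<^sup>+x. ennreal ((1 - cos x) * exp (- (v * x))) * indicator {0..} x \<partial>lborel) = ennreal (0 - ?F 0)"
  proof (rule nn_integral_FTC_atLeast)
    fix x :: real
    have "(?F has_real_derivative exp (- (v * x)) - (- v * exp (- (v * x)) * (sin x - v * cos x) + exp (- (v * x)) * (cos x + v * sin x)) / (1 + v\<^sup>2)) (at x)"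
      using assms nz by (auto intro!: derivative_eq_intros)
    also have "exp (- (v * x)) - (- v * exp (- (v * x)) * (sin x - v * cos x) + exp (- (v * x)) * (cos x + v * sin x)) / (1 + v\<^sup>2) = (1 - cos x) * exp (- (v * x))"
      using nz by (simp add: field_simps power2_eq_square)
    finally show "(?F has_real_derivative (1 - cos x) * exp (- (v * x))) (at x)" .
    show "0 \<le> (1 - cos x) * exp (- (v * x))" by (simp add: cos_le_one)
  next
    have e: "((\<lambda>x. exp (- (v * x))) \<longlongrightarrow> 0) at_top"
      using assms by (intro filterlim_compose[OF exp_at_bot] filterlim_compose[OF filterlim_uminus_at_bot_at_top] filterlim_tendsto_pos_mult_at_top[OF tendsto_const] filterlim_ident) auto
    have "((\<lambda>x. exp (- (v * x)) * (sin x - v * cos x)) \<longlongrightarrow> 0) at_top"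
    proof (rule Lim_null_comparison[where g = "\<lambda>x. exp (- (v * x)) * (1 + v)"])
      show "((\<lambda>x. exp (- (v * x)) * (1 + v)) \<longlongrightarrow> 0) at_top" using tendsto_mult_left_zero[OF e] .
      have "\<bar>sin x - v * cos x\<bar> \<le> 1 + v" for x
      proof -
        have "\<bar>v * cos x\<bar> \<le> v * 1" unfolding abs_mult using assms by (intro mult_mono) auto
        then show ?thesis using abs_sin_le_one[of x] by linarith
      qed
      then show "\<forall>\<^sub>F x in at_top. norm (exp (- (v * x)) * (sin x - v * cos x)) \<le> exp (- (v * x)) * (1 + v)"
        by (intro always_eventually) (auto simp: abs_mult)
    qed
    from tendsto_diff[OF tendsto_divide[OF tendsto_minus[OF e] tendsto_const[of v]] tendsto_divide[OF this tendsto_const[of "1 + v\<^sup>2"]]] assms nz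
    show "(?F \<longlongrightarrow> 0) at_top" by simp
  qed auto
  also have "0 - ?F 0 = 1 / (v * (1 + v\<^sup>2))" using assms nz by (simp add: field_simps power2_eq_square)
  also have "(\<integral>\<^sup>+x. ennreal ((1 - cos x) * exp (- (v * x))) * indicator {0..} x \<partial>lborel)
     = (\<integral>\<^sup>+x. ennreal ((1 - cos x) * exp (- (v * x))) * indicator {0<..} x \<partial>lborel)"
    by (intro nn_integral_cong) (auto split: split_indicator simp: less_le)
  finally show ?thesis .
qed

text \<open>Writing x^(-1-2H) as a Gamma integral over v leaves the Laplace transform of 1 - cos,
  hence the integral of v^(2H-1) / (1+v^2). Writing 1/(1+v^2) as an exponential integral over z
  splits that one into Gamma(H) Gamma(1-H) / 2, and the reflection formula ends the
  computation.\<close>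

lemma nn_integral_one_minus_cos:
  assumes H: "0 < H" "H < (1::real)"
  shows "(\<integral>\<^sup>+x. ennreal ((1 - cos x) * \<bar>x\<bar> powr (- 1 - 2 * H)) \<partial>lborel) = ennreal (pi / (Gamma (2 * H + 1) * sin (H * pi)))"
proof -
  let ?J = "\<integral>\<^sup>+x. ennreal ((1 - cos x) * x powr (- 1 - 2 * H)) * indicator {0<..} x \<partial>lborel"
  have G: "Gamma (2 * H + 1) > 0" using H by (simp add: Gamma_real_pos)
  have s: "sin (H * pi) > 0" using H by (intro sin_gt_zero) auto
  let ?I = "\<lambda>x::real. indicator {0<..} x :: ennreal"
  have "ennreal (Gamma (2 * H + 1)) * ?J = (\<integral>\<^sup>+x. ennreal (Gamma (2 * H + 1)) * (ennreal ((1 - cos x) * x powr (- 1 - 2 * H)) * ?I x) \<partial>lborel)"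
    by (rule nn_integral_cmult[symmetric]) auto
  also have "\<dots> = (\<integral>\<^sup>+x. \<integral>\<^sup>+v. ennreal (v powr (2 * H)) * ?I v * (ennreal ((1 - cos x) * exp (- (v * x))) * ?I x) \<partial>lborel \<partial>lborel)"
  proof (rule nn_integral_cong)
    fix x :: real
    show "ennreal (Gamma (2 * H + 1)) * (ennreal ((1 - cos x) * x powr (- 1 - 2 * H)) * ?I x)
      = (\<integral>\<^sup>+v. ennreal (v powr (2 * H)) * ?I v * (ennreal ((1 - cos x) * exp (- (v * x))) * ?I x) \<partial>lborel)"
    proof (cases "x > 0")
      case True
      have "(\<integral>\<^sup>+v. ennreal (v powr (2 * H)) * ?I v * (ennreal ((1 - cos x) * exp (- (v * x))) * ?I x) \<partial>lborel)
        = (\<integral>\<^sup>+v. ennreal (1 - cos x) * (ennreal (v powr ((2 * H + 1) - 1) * exp (- (x * v))) * ?I v) \<partial>lborel)"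
        using True by (intro nn_integral_cong) (auto split: split_indicator simp: ennreal_mult cos_le_one mult_ac)
      also have "\<dots> = ennreal (1 - cos x) * ennreal (Gamma (2 * H + 1) * x powr (- (2 * H + 1)))"
        using H True nn_integral_Gamma_scale[of "2 * H + 1" x] by (subst nn_integral_cmult) (auto intro!: arg_cong2[where f = "(*)"])
      also have "- (2 * H + 1) = - 1 - 2 * H" by simp
      finally show ?thesis using True G 
        by (simp add: ennreal_mult[symmetric] cos_le_one mult_ac)
    qed simp
  qed
  also have "\<dots> = (\<integral>\<^sup>+v. \<integral>\<^sup>+x. ennreal (v powr (2 * H)) * ?I v * (ennreal ((1 - cos x) * exp (- (v * x))) * ?I x) \<partial>lborel \<partial>lborel)"
    by (rule lborel_pair.Fubini') simp
  also have "\<dots> = (\<integral>\<^sup>+v. ennreal (v powr (2 * H - 1)) * ?I v * ennreal (1 / (1 + v\<^sup>2)) \<partial>lborel)"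
  proof (rule nn_integral_cong)
    fix v :: real
    show "(\<integral>\<^sup>+x. ennreal (v powr (2 * H)) * ?I v * (ennreal ((1 - cos x) * exp (- (v * x))) * ?I x) \<partial>lborel) = ennreal (v powr (2 * H - 1)) * ?I v * ennreal (1 / (1 + v\<^sup>2))"
    proof (cases "v > 0")
      case True
      have "v powr (2 * H) * (1 / (v * (1 + v\<^sup>2))) = v powr (2 * H - 1) * (1 / (1 + v\<^sup>2))"
        using True by (simp add: powr_diff)
      with True show ?thesis
        by (subst nn_integral_cmult) (auto simp: nn_integral_one_minus_cos_exp ennreal_mult[symmetric])
    qed simp
  qed
  also have "\<dots> = (\<integral>\<^sup>+v. \<integral>\<^sup>+z. ennreal (v powr (2 * H - 1)) * ?I v * (ennreal (exp (- ((1 + v\<^sup>2) * z))) * ?I z) \<partial>lborel \<partial>lborel)"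
  proof (rule nn_integral_cong)
    fix v :: real
    have "1 + v\<^sup>2 > 0" by (simp add: add_pos_nonneg)
    have e: "(\<integral>\<^sup>+z. ennreal (z powr 0 * exp (- ((1 + v\<^sup>2) * z))) * ?I z \<partial>lborel) = (\<integral>\<^sup>+z. ennreal (exp (- ((1 + v\<^sup>2) * z))) * ?I z \<partial>lborel)"
      by (intro nn_integral_cong) (auto split: split_indicator)
    have "(\<integral>\<^sup>+z. ennreal (z powr 0 * exp (- ((1 + v\<^sup>2) * z))) * ?I z \<partial>lborel) = ennreal (1 / (1 + v\<^sup>2))"
      using nn_integral_Gamma_scale[of 1 "1 + v\<^sup>2"] \<open>1 + v\<^sup>2 > 0\<close> by (simp only: diff_self powr_minus_divide zero_less_one powr_one Gamma_1 mult_1 less_imp_le)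
    note this[unfolded e]
    then show "ennreal (v powr (2 * H - 1)) * ?I v * ennreal (1 / (1 + v\<^sup>2)) = (\<integral>\<^sup>+z. ennreal (v powr (2 * H - 1)) * ?I v * (ennreal (exp (- ((1 + v\<^sup>2) * z))) * ?I z) \<partial>lborel)"
      by (subst nn_integral_cmult) auto
  qed
  also have "\<dots> = (\<integral>\<^sup>+z. \<integral>\<^sup>+v. ennreal (v powr (2 * H - 1)) * ?I v * (ennreal (exp (- ((1 + v\<^sup>2) * z))) * ?I z) \<partial>lborel \<partial>lborel)"
    by (rule lborel_pair.Fubini') simp
  finally have "2 * (ennreal (Gamma (2 * H + 1)) * ?J) = (\<integral>\<^sup>+z. 2 * (\<integral>\<^sup>+v. ennreal (v powr (2 * H - 1)) * ?I v * (ennreal (exp (- ((1 + v\<^sup>2) * z))) * ?I z) \<partial>lborel) \<partial>lborel)"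
    by (subst nn_integral_cmult) auto
  also have "\<dots> = (\<integral>\<^sup>+z. ennreal (Gamma H) * (ennreal (z powr ((1 - H) - 1) * exp (- z)) * ?I z) \<partial>lborel)"
  proof (rule nn_integral_cong)
    fix z :: real
    show "2 * (\<integral>\<^sup>+v. ennreal (v powr (2 * H - 1)) * ?I v * (ennreal (exp (- ((1 + v\<^sup>2) * z))) * ?I z) \<partial>lborel) = ennreal (Gamma H) * (ennreal (z powr ((1 - H) - 1) * exp (- z)) * ?I z)"
    proof (cases "z > 0")
      case True
      have "(\<integral>\<^sup>+v. ennreal (v powr (2 * H - 1)) * ?I v * (ennreal (exp (- ((1 + v\<^sup>2) * z))) * ?I z) \<partial>lborel)
        = (\<integral>\<^sup>+v. ennreal (exp (- z)) * (ennreal (\<bar>v\<bar> powr (2 * H - 1) * exp (- (z * v\<^sup>2))) * ?I v) \<partial>lborel)"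
        using True by (intro nn_integral_cong) (auto split: split_indicator simp: ennreal_mult[symmetric] exp_add[symmetric] algebra_simps)
      also have "\<dots> = ennreal (exp (- z)) * (\<integral>\<^sup>+v. (ennreal (\<bar>v\<bar> powr (2 * H - 1) * exp (- (z * v\<^sup>2))) * ?I v) \<partial>lborel)"
        by (rule nn_integral_cmult) auto
      \<comment> \<open>The factor 2 turns the half-line into the whole line, where
        \<open>nn_integral_power_gauss\<close> applies.\<close>
      also have "2 * \<dots> = ennreal (exp (- z)) * (\<integral>\<^sup>+v. ennreal (\<bar>v\<bar> powr (2 * H - 1) * exp (- (z * v\<^sup>2))) \<partial>lborel)"
        by (subst nn_integral_even[of "\<lambda>v. ennreal (\<bar>v\<bar> powr (2 * H - 1) * exp (- (z * v\<^sup>2)))"]) (auto simp: mult_ac)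
      also have "\<dots> = ennreal (exp (- z)) * ennreal (Gamma H * z powr (- H))"
        using nn_integral_power_gauss[OF H(1) True] by simp
      finally show ?thesis using True H by (simp add: ennreal_mult[symmetric] Gamma_real_nonneg mult_ac)
    qed simp
  qed
  also have "\<dots> = ennreal (Gamma H) * ennreal (Gamma (1 - H))"
    using H nn_integral_Gamma[of "1 - H"] by (subst nn_integral_cmult) auto
  also have "\<dots> = ennreal (pi / sin (H * pi))"
    using H Gamma_reflection_real[OF H] by (simp add: ennreal_mult[symmetric] Gamma_real_nonneg mult.commute)
  finally have *: "ennreal (Gamma (2 * H + 1)) * (2 * ?J) = ennreal (pi / sin (H * pi))" by (simp add: mult_ac)
  have "(\<integral>\<^sup>+x. ennreal ((1 - cos x) * \<bar>x\<bar> powr (- 1 - 2 * H)) \<partial>lborel) = 2 * (\<integral>\<^sup>+x. ennreal ((1 - cos x) * \<bar>x\<bar> powr (- 1 - 2 * H)) * ?I x \<partial>lborel)"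
    by (rule nn_integral_even) auto
  also have "\<dots> = 2 * ?J" by (rule arg_cong2[where f = "(*)", OF refl], rule nn_integral_cong) (simp add: indicator_def)
  also have "2 * ?J = ennreal (1 / Gamma (2 * H + 1)) * (ennreal (Gamma (2 * H + 1)) * (2 * ?J))"
    using G by (simp add: mult.assoc[symmetric] ennreal_mult[symmetric])
  also have "\<dots> = ennreal (pi / (Gamma (2 * H + 1) * sin (H * pi)))"
    unfolding * using G s by (simp add: ennreal_mult[symmetric])
  finally show ?thesis .
qed

lemma nn_integral_one_minus_cos_scale:
  assumes H: "0 < H" "H < (1::real)"
  shows "(\<integral>\<^sup>+x. ennreal ((1 - cos (h * x)) * \<bar>x\<bar> powr (- 1 - 2 * H)) \<partial>lborel) = ennreal (\<bar>h\<bar> powr (2 * H) * pi / (Gamma (2 * H + 1) * sin (H * pi)))"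
proof (cases "h = 0")
  case False
  let ?A = "\<integral>\<^sup>+x. ennreal ((1 - cos (h * x)) * \<bar>x\<bar> powr (- 1 - 2 * H)) \<partial>lborel"
  have "ennreal (pi / (Gamma (2 * H + 1) * sin (H * pi))) = ennreal \<bar>h\<bar> * (\<integral>\<^sup>+x. ennreal ((1 - cos (0 + h * x)) * \<bar>0 + h * x\<bar> powr (- 1 - 2 * H)) \<partial>lborel)"
    unfolding nn_integral_one_minus_cos[OF H, symmetric] using False by (intro nn_integral_real_affine) auto
  also have "\<dots> = (\<integral>\<^sup>+x. ennreal \<bar>h\<bar> * ennreal ((1 - cos (0 + h * x)) * \<bar>0 + h * x\<bar> powr (- 1 - 2 * H)) \<partial>lborel)"
    by (rule nn_integral_cmult[symmetric]) auto
  also have "\<dots> = (\<integral>\<^sup>+x. ennreal (\<bar>h\<bar> powr (- 2 * H)) * ennreal ((1 - cos (h * x)) * \<bar>x\<bar> powr (- 1 - 2 * H)) \<partial>lborel)"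
  proof (rule nn_integral_cong)
    fix x :: real
    have e: "\<bar>h\<bar> * (\<bar>h\<bar> powr (- 1 - 2 * H)) = \<bar>h\<bar> powr (- 2 * H)"
      using False powr_add[of "\<bar>h\<bar>" 1 "- 1 - 2 * H"] by simp
    have "\<bar>h\<bar> * ((1 - cos (0 + h * x)) * \<bar>0 + h * x\<bar> powr (- 1 - 2 * H)) = (\<bar>h\<bar> * \<bar>h\<bar> powr (- 1 - 2 * H)) * ((1 - cos (h * x)) * \<bar>x\<bar> powr (- 1 - 2 * H))"
      by (simp add: abs_mult powr_mult mult_ac)
    then show "ennreal \<bar>h\<bar> * ennreal ((1 - cos (0 + h * x)) * \<bar>0 + h * x\<bar> powr (- 1 - 2 * H)) = ennreal (\<bar>h\<bar> powr (- 2 * H)) * ennreal ((1 - cos (h * x)) * \<bar>x\<bar> powr (- 1 - 2 * H))"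
      unfolding e by (simp add: ennreal_mult[symmetric] cos_le_one)
  qed
  also have "\<dots> = ennreal (\<bar>h\<bar> powr (- 2 * H)) * ?A"
    by (rule nn_integral_cmult) auto
  finally have "ennreal (\<bar>h\<bar> powr (2 * H)) * ennreal (pi / (Gamma (2 * H + 1) * sin (H * pi))) = ennreal (\<bar>h\<bar> powr (2 * H)) * (ennreal (\<bar>h\<bar> powr (- 2 * H)) * ?A)" by simp
  also have "\<dots> = ?A" using False by (simp add: mult.assoc[symmetric] ennreal_mult[symmetric] powr_add[symmetric])
  finally show ?thesis by (simp add: ennreal_mult'[symmetric])
qed simp

lemma flat_exp_nonneg [simp]: "0 \<le> flat_exp x" by (simp add: flat_exp_def)
lemma flat_exp_eq_0 [simp]: "x \<le> 0 \<Longrightarrow> flat_exp x = 0" by (simp add: flat_exp_def)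
section \<open>Test functions and the spectral side of the noise\<close>

lemma flat_exp_pos: "0 < x \<Longrightarrow> 0 < flat_exp x" by (simp add: flat_exp_def)

lemma isCont_smooth: "smooth_on_real UNIV f \<Longrightarrow> isCont f x"
  using smooth_on_real_deriv(2)[of UNIV f x] DERIV_isCont by blast

text \<open>The factor exp 2 undoes the square of \<open>flat_exp 1\<close>, so the bump is 1 at the
  origin and rescaled copies of it tend to 1 pointwise.\<close>

definition cutoff :: "real \<Rightarrow> real" where
  "cutoff y = exp 2 * (flat_exp (1 + y) * flat_exp (1 - y))"

lemma cutoff_nonneg [simp]: "0 \<le> cutoff y" by (simp add: cutoff_def)

lemma cutoff_le_1: "cutoff y \<le> 1"
proof (cases "-1 < y \<and> y < 1")
  case True
  then have "0 < (1 + y) * (1 - y)" by simp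
  moreover have "(1 + y) * (1 - y) \<le> 1" by (simp add: algebra_simps)
  \<comment> \<open>The exponents of the two flat factors add up to this quantity, which has to
    outweigh the normalising exponent 2.\<close>
  ultimately have "2 \<le> 2 / ((1 + y) * (1 - y))" by (simp only: le_divide_eq) simp
  also have "\<dots> = 1 / (1 + y) + 1 / (1 - y)" using True by (simp add: divide_simps)
  finally have "2 \<le> 1 / (1 + y) + 1 / (1 - y)" .
  then show ?thesis using True by (simp add: cutoff_def flat_exp_def exp_add[symmetric])
qed (auto simp: cutoff_def flat_exp_def)

lemma cutoff_0 [simp]: "cutoff 0 = 1" by (simp add: cutoff_def flat_exp_def exp_add[symmetric])
lemma cutoff_minus [simp]: "cutoff (- y) = cutoff y" by (simp add: cutoff_def)
lemma cutoff_eq_0: "1 \<le> \<bar>y\<bar> \<Longrightarrow> cutoff y = 0" by (cases "0 \<le> y") (auto simp: cutoff_def)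

lemma smooth2_cutoff: "smooth2 (\<lambda>s y. cutoff (a * y + b))"
proof -
  have e: "(\<lambda>s y. cutoff (a * y + b)) = (\<lambda>(s::real) y. exp 2 * (flat_exp (a * y + (b + 1)) * flat_exp ((- a) * y + (1 - b))))"
    by (simp add: cutoff_def fun_eq_iff algebra_simps)
  show ?thesis unfolding e
    by (intro smooth2_mult smooth2_const smooth2_space smooth_on_real_affine smooth_on_real_flat_exp)
qed

lemma DERIV_cutoff: "(cutoff has_real_derivative deriv cutoff y) (at y)"
  and continuous_on_deriv_cutoff: "continuous_on UNIV (deriv cutoff)"
proof -
  have s: "smooth2 (\<lambda>s y. cutoff y)" using smooth2_cutoff[of 1 0] by simp
  have e: "partial_x (\<lambda>s y. cutoff y) 0 y = deriv cutoff y" for y by (simp add: partial_x_def)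
  show "(cutoff has_real_derivative deriv cutoff y) (at y)" using smooth2D(3)[OF s, of 0 y] by (simp add: e)
  have "continuous_on UNIV (\<lambda>y. (\<lambda>(s, y). partial_x (\<lambda>s y. cutoff y) s y) (0::real, y))"
    by (rule continuous_on_compose2[OF smooth2D(1)[OF smooth2D(5)[OF s]]]) (auto intro!: continuous_intros)
  then show "continuous_on UNIV (deriv cutoff)" by (simp add: partial_x_def)
qed

lemma deriv_cutoff_bounded: "\<exists>B\<ge>0. \<forall>y. \<bar>deriv cutoff y\<bar> \<le> B"
proof -
  have "compact (deriv cutoff ` {-1..1})"
    by (intro compact_continuous_image continuous_on_subset[OF continuous_on_deriv_cutoff]) auto
  then have "bounded (deriv cutoff ` {-1..1})" by (rule compact_imp_bounded)
  then obtain B where "\<forall>z\<in>deriv cutoff ` {-1..1}. norm z \<le> B" unfolding bounded_iff by blast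
  then have B: "\<And>y. y \<in> {-1..1} \<Longrightarrow> \<bar>deriv cutoff y\<bar> \<le> B" by simp
  have "deriv cutoff y = 0" if "y \<notin> {-1..1}" for y
  proof (rule DERIV_imp_deriv)
    have "((\<lambda>_. 0) has_real_derivative 0) (at y)" by simp
    then show "(cutoff has_real_derivative 0) (at y)"
      by (rule has_field_derivative_transform_within_open[where S = "- {-1..1}"]) (use that in \<open>auto simp: cutoff_eq_0\<close>)
  qed
  then have "\<bar>deriv cutoff y\<bar> \<le> B" for y using B[of y] B[of 0] by (cases "y \<in> {-1..1}") auto
  moreover have "0 \<le> B" using B[of 0] by simp
  ultimately show ?thesis by blast
qed

lemma test_functionI:
  assumes "smooth2 g" "0 < a" "\<And>s y. g s y \<noteq> 0 \<Longrightarrow> a \<le> s \<and> s \<le> b \<and> c \<le> y \<and> y \<le> d"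
  shows "test_function g"
  unfolding test_function_def
proof (intro conjI exI[of _ "{a..b} \<times> {c..d}"])
  show "\<forall>s y. (s, y) \<notin> {a..b} \<times> {c..d} \<longrightarrow> g s y = 0" using assms(3) by fastforce
qed (use assms in \<open>auto intro!: compact_Times\<close>)

text \<open>Collects what the Fourier estimate needs: bounds on g and its space derivative that are
  uniform in time, and a bounded support at positive times.\<close>

lemma test_functionE:
  assumes "test_function g"
  obtains T A C where "0 < T" "0 < A" "0 \<le> C" "\<And>s y. g s y \<noteq> 0 \<Longrightarrow> 0 < s \<and> s < T \<and> - A < y \<and> y < A"
    "\<And>s y. \<bar>g s y\<bar> \<le> C" "\<And>s y. \<bar>partial_x g s y\<bar> \<le> C"
proof -
  from assms obtain K where s: "smooth2 g" and K: "compact K" "K \<subseteq> {0<..} \<times> UNIV" "\<And>s y. (s, y) \<notin> K \<Longrightarrow> g s y = 0"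
    unfolding test_function_def by blast
  from compact_imp_bounded[OF K(1)] obtain B where B: "\<And>p. p \<in> K \<Longrightarrow> norm p \<le> B" unfolding bounded_iff by blast
  \<comment> \<open>K may be empty and B negative, hence the absolute value; adding 1 makes the
    inequalities strict.\<close>
  define T where "T = \<bar>B\<bar> + 1"
  have in_T: "0 < s \<and> s < T \<and> - T < y \<and> y < T" if "(s, y) \<in> K" for s y
  proof -
    have "\<bar>s\<bar> \<le> B" "\<bar>y\<bar> \<le> B" using B[OF that] norm_fst_le[of s y] norm_snd_le[of y s] by auto
    then show ?thesis using K(2) that by (auto simp: T_def)
  qed
  have bdd: "\<exists>C\<ge>0. \<forall>s y. (s, y) \<in> K \<longrightarrow> \<bar>h s y\<bar> \<le> C" if "smooth2 h" for h
  proof -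
    have "compact ((\<lambda>(s, y). h s y) ` K)"
      by (intro compact_continuous_image continuous_on_subset[OF smooth2D(1)[OF that]] K) auto
    from compact_imp_bounded[OF this] obtain C where "\<And>z. z \<in> (\<lambda>(s, y). h s y) ` K \<Longrightarrow> norm z \<le> C" unfolding bounded_iff by blast
    then have "\<bar>h s y\<bar> \<le> \<bar>C\<bar>" if "(s, y) \<in> K" for s y using that by fastforce
    then show ?thesis by (intro exI[of _ "\<bar>C\<bar>"]) auto
  qed
  obtain C1 where C1: "C1 \<ge> 0" "\<And>s y. (s, y) \<in> K \<Longrightarrow> \<bar>g s y\<bar> \<le> C1" using bdd[OF s] by blast
  obtain C2 where C2: "C2 \<ge> 0" "\<And>s y. (s, y) \<in> K \<Longrightarrow> \<bar>partial_x g s y\<bar> \<le> C2" using bdd[OF smooth2D(5)[OF s]] by blast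
  have out: "partial_x g s y = 0" if "(s, y) \<notin> K" for s y
  proof -
    have "open (- K)" using K(1) by (simp add: compact_imp_closed open_Compl)
    then have o: "open ((\<lambda>z. (s, z)) -` (- K))"
      by (rule open_vimage) (intro continuous_intros)
    have "((\<lambda>z. g s z) has_real_derivative 0) (at y)"
      by (rule has_field_derivative_transform_within_open[OF DERIV_const o]) (use that K(3) in simp_all)
    then show ?thesis unfolding partial_x_def by (rule DERIV_imp_deriv)
  qed
  show ?thesis
  proof (rule that[of T T "max C1 C2"])
    show "0 < T" "0 < T" "0 \<le> max C1 C2" using C1(1) by (auto simp: T_def)
    show "0 < s \<and> s < T \<and> - T < y \<and> y < T" if "g s y \<noteq> 0" for s y using that K(3) in_T by blast
    show "\<bar>g s y\<bar> \<le> max C1 C2" for s y using C1 K(3)[of s y] 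
      by (cases "(s, y) \<in> K") (simp_all add: le_max_iff_disj)
    show "\<bar>partial_x g s y\<bar> \<le> max C1 C2" for s y using C1(1) C2 out[of s y]
      by (cases "(s, y) \<in> K") (simp_all add: le_max_iff_disj)
  qed
qed

section \<open>Fourier transforms of integrable, compactly supported and Gaussian functions\<close>

lemma norm_cis_mult [simp]: "norm (cis a * complex_of_real r) = \<bar>r\<bar>" by (simp add: norm_mult)

lemma fourier_norm_le: "cmod (fourier f \<xi>) \<le> (\<integral>x. \<bar>f x\<bar> \<partial>lborel)"
  unfolding fourier_def using integral_norm_bound[of lborel "\<lambda>x. cis (- \<xi> * x) * complex_of_real (f x)"] by simp

lemma integrable_fourier:
  assumes "integrable lborel f"
  shows "integrable lborel (\<lambda>x. cis (- \<xi> * x) * complex_of_real (f x))"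
proof (rule Bochner_Integration.integrable_bound[OF assms])
  have "(\<lambda>x. cis (- \<xi> * x)) \<in> borel_measurable borel"
    by (intro borel_measurable_continuous_onI continuous_intros)
  then show "(\<lambda>x. cis (- \<xi> * x) * complex_of_real (f x)) \<in> borel_measurable lborel" using assms by auto
qed simp

lemma fourier_diff:
  assumes "integrable lborel f" "integrable lborel g"
  shows "fourier (\<lambda>x. f x - g x) \<xi> = fourier f \<xi> - fourier g \<xi>"
  unfolding fourier_def using integrable_fourier[OF assms(1), of \<xi>] integrable_fourier[OF assms(2), of \<xi>]
  by (subst Bochner_Integration.integral_diff[symmetric]) (auto simp: algebra_simps)

lemma fourier_cmult: "fourier (\<lambda>x. c * f x) \<xi> = complex_of_real c * fourier f \<xi>"
  unfolding fourier_def by (subst integral_mult_right_zero[symmetric]) (simp add: algebra_simps)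

text \<open>Integration by parts: the fundamental theorem for the product of the character and f has
  vanishing boundary terms at A and -A, so the transform of f' is i xi times that of f.\<close>

lemma fourier_derivative_bound:
  assumes d: "\<And>x. (f has_real_derivative f' x) (at x)" and c: "continuous_on UNIV f'"
    and z: "\<And>x. f x \<noteq> 0 \<Longrightarrow> - A < x \<and> x < A" "0 < A"
  shows "\<bar>\<xi>\<bar> * cmod (fourier f \<xi>) \<le> (\<integral>x. \<bar>f' x\<bar> \<partial>lborel)"
proof -
  let ?h = "\<lambda>x. cis (- \<xi> * x) * complex_of_real (f x)"
  let ?h' = "\<lambda>x. cis (- \<xi> * x) * complex_of_real (f' x) - \<i> * \<xi> * (cis (- \<xi> * x) * complex_of_real (f x))"
  have f0: "f x = 0" if "x \<notin> {-A<..<A}" for x using z(1)[of x] that by fastforce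
  have f'0: "f' x = 0" if "x \<notin> {-A..A}" for x
  proof -
    have "((\<lambda>_. 0) has_real_derivative 0) (at x)" by simp
    then have "(f has_real_derivative 0) (at x)"
      by (rule has_field_derivative_transform_within_open[where S = "- {-A..A}"]) (use that f0 in auto)
    then show ?thesis using d DERIV_unique by blast
  qed
  have cf: "continuous_on UNIV f" using d by (meson DERIV_isCont continuous_at_imp_continuous_on)
  have ch': "continuous_on {-A..A} ?h'"
    by (intro continuous_intros continuous_on_subset[OF c] continuous_on_subset[OF cf]) auto
  have "has_bochner_integral lborel (\<lambda>x. indicator {-A..A} x *\<^sub>R ?h' x) (?h A - ?h (-A))"
  proof (rule has_bochner_integral_FTC_Icc[OF _ _ ch'])
    fix x
    have "((\<lambda>x. iexp x) \<circ> (\<lambda>x. - \<xi> * x) has_vector_derivative (- \<xi>) *\<^sub>R (\<i> * iexp (- \<xi> * x))) (at x within {-A..A})"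
      by (rule vector_diff_chain_within[OF _ has_vector_derivative_iexp])
         (auto intro!: derivative_eq_intros has_vector_derivative_at_within simp: has_real_derivative_iff_has_vector_derivative[symmetric])
    then have 1: "((\<lambda>x. cis (- \<xi> * x)) has_vector_derivative (- \<xi>) *\<^sub>R (\<i> * cis (- \<xi> * x))) (at x within {-A..A})"
      unfolding cis_conv_exp by (simp only: o_def)
    have 2: "((\<lambda>x. complex_of_real (f x)) has_vector_derivative complex_of_real (f' x)) (at x within {-A..A})"
      using d[of x] by (intro has_vector_derivative_of_real has_vector_derivative_at_within) (simp add: has_real_derivative_iff_has_vector_derivative)
    show "(?h has_vector_derivative ?h' x) (at x within {-A..A})"
      using has_vector_derivative_mult[OF 1 2] by (rule has_vector_derivative_eq_rhs) (simp add: scaleR_conv_of_real)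
  qed (use z in auto)
  moreover have "(\<lambda>x. indicator {-A..A} x *\<^sub>R ?h' x) = ?h'"
    using f0 f'0 by (auto simp: fun_eq_iff split: split_indicator)
  moreover have "?h A = 0" "?h (- A) = 0" using f0[of A] f0[of "-A"] by auto
  ultimately have I: "has_bochner_integral lborel ?h' 0" by simp
  have int: "integrable lborel g" if "continuous_on UNIV g" "\<And>x. x \<notin> {-A..A} \<Longrightarrow> g x = 0" for g :: "real \<Rightarrow> real"
  proof -
    have "integrable lborel (\<lambda>x. indicator {-A..A} x *\<^sub>R g x)"
      using borel_integrable_atLeastAtMost'[OF continuous_on_subset[OF that(1)]] by (simp add: set_integrable_def)
    moreover have "(\<lambda>x. indicator {-A..A} x *\<^sub>R g x) = g" using that(2) by (auto simp: fun_eq_iff split: split_indicator)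
    ultimately show ?thesis by simp
  qed
  have if1: "integrable lborel f" using f0 by (intro int cf) auto
  have if2: "integrable lborel f'" by (intro int c f'0)
  have "(\<integral>x. ?h' x \<partial>lborel) = fourier f' \<xi> - \<i> * \<xi> * fourier f \<xi>"
    unfolding fourier_def using integrable_fourier[OF if1, of \<xi>] integrable_fourier[OF if2, of \<xi>]
    by (subst Bochner_Integration.integral_diff) (auto simp: mult.assoc)
  then have "fourier f' \<xi> = \<i> * \<xi> * fourier f \<xi>" using I by (simp add: has_bochner_integral_integral_eq)
  then have "\<bar>\<xi>\<bar> * cmod (fourier f \<xi>) = cmod (fourier f' \<xi>)" by (simp add: norm_mult)
  also have "\<dots> \<le> (\<integral>x. \<bar>f' x\<bar> \<partial>lborel)" by (rule fourier_norm_le)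
  finally show ?thesis .
qed

text \<open>The substitution y = x + z / sqrt(2a) reduces this to the characteristic function of the
  standard normal law.\<close>

lemma fourier_gauss:
  assumes "a > 0"
  shows "fourier (\<lambda>y. sqrt (a / pi) * exp (- (a * (y - x)\<^sup>2))) \<xi> = cis (- \<xi> * x) * complex_of_real (exp (- \<xi>\<^sup>2 / (4 * a)))"
proof -
  let ?c = "1 / sqrt (2 * a)"
  have c: "?c > 0" using assms by simp
  have "fourier (\<lambda>y. sqrt (a / pi) * exp (- (a * (y - x)\<^sup>2))) \<xi>
     = \<bar>?c\<bar> *\<^sub>R (\<integral>z. cis (- \<xi> * (x + ?c * z)) * complex_of_real (sqrt (a / pi) * exp (- (a * (x + ?c * z - x)\<^sup>2))) \<partial>lborel)"
    unfolding fourier_def by (rule lborel_integral_real_affine) (use c in simp)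
  also have "(\<integral>z. cis (- \<xi> * (x + ?c * z)) * complex_of_real (sqrt (a / pi) * exp (- (a * (x + ?c * z - x)\<^sup>2))) \<partial>lborel)
    = (\<integral>z. (cis (- \<xi> * x) * complex_of_real (sqrt (2 * a))) * (std_normal_density z *\<^sub>R iexp ((- \<xi> * ?c) * z)) \<partial>lborel)"
  proof (rule Bochner_Integration.integral_cong[OF refl])
    fix z :: real
    have 1: "cis (- \<xi> * (x + ?c * z)) = cis (- \<xi> * x) * iexp ((- \<xi> * ?c) * z)"
      unfolding cis_conv_exp[symmetric] cis_mult by (simp add: algebra_simps)
    have 2: "a * (x + ?c * z - x)\<^sup>2 = z\<^sup>2 / 2" using assms by (simp add: power_mult_distrib power_divide field_simps)
    have 3: "sqrt (a / pi) = sqrt (2 * a) * (1 / sqrt (2 * pi))" using assms by (simp add: real_sqrt_divide real_sqrt_mult)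
    show "cis (- \<xi> * (x + ?c * z)) * complex_of_real (sqrt (a / pi) * exp (- (a * (x + ?c * z - x)\<^sup>2)))
      = (cis (- \<xi> * x) * complex_of_real (sqrt (2 * a))) * (std_normal_density z *\<^sub>R iexp ((- \<xi> * ?c) * z))"
      unfolding 1 2 3 std_normal_density_def by (simp add: scaleR_conv_of_real mult_ac)
  qed
  also have "\<dots> = (cis (- \<xi> * x) * complex_of_real (sqrt (2 * a))) * char std_normal_distribution (- \<xi> * ?c)"
    unfolding integral_mult_right_zero char_def by (subst integral_density) auto
  also have "char std_normal_distribution (- \<xi> * ?c) = complex_of_real (exp (- \<xi>\<^sup>2 / (4 * a)))"
    unfolding char_std_normal_distribution using assms by (simp add: power_mult_distrib power_divide field_simps)
  finally show ?thesis using assms by (simp add: scaleR_conv_of_real real_sqrt_divide)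
qed

lemma c1H_pos: "0 < H \<Longrightarrow> H < 1 \<Longrightarrow> 0 < c1H H"
  unfolding c1H_def by (intro mult_pos_pos divide_pos_pos Gamma_real_pos sin_gt_zero) auto

section \<open>The spectral measure of the noise on time and frequency\<close>

definition fhat :: "(real \<Rightarrow> real \<Rightarrow> real) \<Rightarrow> real \<times> real \<Rightarrow> complex" where
  "fhat g p = fourier (g (fst p)) (snd p)"

definition noise_weight :: "real \<Rightarrow> real \<times> real \<Rightarrow> real" where
  "noise_weight H p = c1H H * (indicator {0<..} (fst p) * \<bar>snd p\<bar> powr (1 - 2 * H))"

text \<open>A single measure on time and frequency makes the covariance of the noise a plain L2
  inner product of the functions \<open>fhat\<close>, so Fubini and dominated convergence act on
  both variables at once.\<close>

definition noise_measure :: "real \<Rightarrow> (real \<times> real) measure" where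
  "noise_measure H = density (lborel \<Otimes>\<^sub>M lborel) (\<lambda>p. ennreal (noise_weight H p))"

lemma noise_weight_measurable [measurable]: "noise_weight H \<in> borel_measurable (borel \<Otimes>\<^sub>M borel)"
  unfolding noise_weight_def by measurable

lemma noise_weight_nonneg: "0 < H \<Longrightarrow> H < 1 \<Longrightarrow> 0 \<le> noise_weight H p"
  using c1H_pos[of H] by (simp add: noise_weight_def)

lemma sets_noise_measure [measurable_cong, simp]: "sets (noise_measure H) = sets (borel \<Otimes>\<^sub>M borel)"
  unfolding noise_measure_def sets_density by (rule sets_pair_measure_cong) simp_all

lemma fhat_measurable [measurable]:
  assumes [measurable]: "(\<lambda>p. g (fst p) (snd p)) \<in> borel_measurable (borel \<Otimes>\<^sub>M borel)"
  shows "fhat g \<in> borel_measurable (borel \<Otimes>\<^sub>M borel)"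
proof -
  have [measurable]: "cis \<in> borel_measurable borel" by (intro borel_measurable_continuous_onI continuous_intros)
  have [measurable]: "(\<lambda>q. g (fst (fst q)) (snd q)) \<in> borel_measurable ((borel \<Otimes>\<^sub>M borel) \<Otimes>\<^sub>M borel)"
    using measurable_compose[of "\<lambda>q. (fst (fst q), snd q)" "(borel \<Otimes>\<^sub>M borel) \<Otimes>\<^sub>M borel" "borel \<Otimes>\<^sub>M borel", OF _ assms] by simp
  have "(\<lambda>p. \<integral>x. cis (- snd p * x) * complex_of_real (g (fst p) x) \<partial>lborel) \<in> borel_measurable (borel \<Otimes>\<^sub>M borel)"
    by (rule lborel.borel_measurable_lebesgue_integral) (simp add: case_prod_beta)
  then show ?thesis unfolding fhat_def[abs_def] fourier_def .
qed

lemma nn_integral_noise_measure: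
  assumes [measurable]: "f \<in> borel_measurable (borel \<Otimes>\<^sub>M borel)"
  shows "(\<integral>\<^sup>+p. f p \<partial>noise_measure H) = (\<integral>\<^sup>+s. \<integral>\<^sup>+\<xi>. ennreal (noise_weight H (s, \<xi>)) * f (s, \<xi>) \<partial>lborel \<partial>lborel)"
proof -
  have "(\<integral>\<^sup>+p. f p \<partial>noise_measure H) = (\<integral>\<^sup>+p. ennreal (noise_weight H p) * f p \<partial>(lborel \<Otimes>\<^sub>M lborel))"
    unfolding noise_measure_def by (rule nn_integral_density) simp_all
  also have "\<dots> = (\<integral>\<^sup>+s. \<integral>\<^sup>+\<xi>. ennreal (noise_weight H (s, \<xi>)) * f (s, \<xi>) \<partial>lborel \<partial>lborel)"
    by (rule lborel.nn_integral_fst[symmetric]) simp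
  finally show ?thesis .
qed

lemma noise_norm2_eq:
  assumes H: "0 < H" "H < 1" and [measurable]: "(\<lambda>p. g (fst p) (snd p)) \<in> borel_measurable (borel \<Otimes>\<^sub>M borel)"
  shows "noise_norm2 H g = (\<integral>\<^sup>+p. ennreal ((cmod (fhat g p))\<^sup>2) \<partial>noise_measure H)"
proof -
  have m [measurable]: "fhat g \<in> borel_measurable (borel \<Otimes>\<^sub>M borel)" by measurable
  have m2 [measurable]: "(\<lambda>\<xi>. fourier (g s) \<xi>) \<in> borel_measurable borel" for s
    using measurable_compose[OF _ m, of "\<lambda>\<xi>. (s, \<xi>)" borel] by (simp add: fhat_def)
  have m3 [measurable]: "(\<lambda>p. fourier (g (fst p)) (snd p)) \<in> borel_measurable (borel \<Otimes>\<^sub>M borel)"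
    using m unfolding fhat_def[abs_def] .
  have "(\<integral>\<^sup>+p. ennreal ((cmod (fhat g p))\<^sup>2) \<partial>noise_measure H)
     = (\<integral>\<^sup>+s. \<integral>\<^sup>+\<xi>. ennreal (noise_weight H (s, \<xi>)) * ennreal ((cmod (fhat g (s, \<xi>)))\<^sup>2) \<partial>lborel \<partial>lborel)"
    by (rule nn_integral_noise_measure) simp
  also have "\<dots> = (\<integral>\<^sup>+s. \<integral>\<^sup>+\<xi>. ennreal (c1H H) * (indicator {0<..} s * ennreal ((cmod (fourier (g s) \<xi>))\<^sup>2 * \<bar>\<xi>\<bar> powr (1 - 2 * H))) \<partial>lborel \<partial>lborel)"
    using c1H_pos[OF H]
    by (intro nn_integral_cong) (auto simp: noise_weight_def fhat_def ennreal_mult[symmetric] mult_ac split: split_indicator)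
  also have "\<dots> = (\<integral>\<^sup>+s. ennreal (c1H H) * (indicator {0<..} s * (\<integral>\<^sup>+\<xi>. ennreal ((cmod (fourier (g s) \<xi>))\<^sup>2 * \<bar>\<xi>\<bar> powr (1 - 2 * H)) \<partial>lborel)) \<partial>lborel)"
    by (intro nn_integral_cong) (simp add: nn_integral_cmult)
  also have "\<dots> = noise_norm2 H g" unfolding noise_norm2_def
  proof (rule nn_integral_cmult)
    have [measurable]: "(\<lambda>s. \<integral>\<^sup>+\<xi>. ennreal ((cmod (fourier (g s) \<xi>))\<^sup>2 * \<bar>\<xi>\<bar> powr (1 - 2 * H)) \<partial>lborel) \<in> borel_measurable borel"
      by (rule lborel.borel_measurable_nn_integral) (simp add: case_prod_beta)
    show "(\<lambda>s. indicator {0<..} s * (\<integral>\<^sup>+\<xi>. ennreal ((cmod (fourier (g s) \<xi>))\<^sup>2 * \<bar>\<xi>\<bar> powr (1 - 2 * H)) \<partial>lborel)) \<in> borel_measurable lborel"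
      by simp
  qed
  finally show ?thesis by simp
qed

text \<open>The Fourier transform of a test function in space is dominated by a multiple of this function, whose square is integrable against $|\xi|^{1-2H}$ for every $H \in (0,1)$.\<close>
definition freq_bound :: "real \<Rightarrow> real" where
  "freq_bound \<xi> = (if \<bar>\<xi>\<bar> \<le> 1 then 1 else 1 / \<bar>\<xi>\<bar>)"

lemma freq_bound_measurable [measurable]: "freq_bound \<in> borel_measurable borel"
  unfolding freq_bound_def by measurable

lemma freq_boundI:
  assumes "a \<le> C" "\<bar>\<xi>\<bar> * a \<le> C" "0 \<le> a" shows "a \<le> C * freq_bound \<xi>"
proof (cases "\<bar>\<xi>\<bar> \<le> 1")
  case False
  then have "0 < \<bar>\<xi>\<bar>" by linarith
  then show ?thesis using assms False by (simp add: freq_bound_def field_simps)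
qed (use assms in \<open>simp add: freq_bound_def\<close>)

text \<open>Near 0 the weight is integrable because 1 - 2H > -1, and at infinity the squared bound
  1/xi^2 leaves the exponent -1 - 2H < -1. The time interval contributes its finite length.\<close>

lemma nn_integral_freq_bound:
  assumes H: "0 < H" "H < 1"
  shows "(\<integral>\<^sup>+p. ennreal (indicator {0<..<T} (fst p) * (freq_bound (snd p))\<^sup>2) \<partial>noise_measure H) < \<infinity>"
proof -
  have 1: "(\<integral>\<^sup>+\<xi>. ennreal (\<xi> powr (1 - 2 * H)) * indicator {0..1} \<xi> \<partial>lborel) = ennreal (1 powr (1 - 2 * H + 1) / (1 - 2 * H + 1))"
    by (rule nn_integral_has_integral_lebesgue'[OF _ has_integral_powr_from_0]) (use H in auto)
  have 2: "(\<integral>\<^sup>+\<xi>. ennreal (\<xi> powr (- 1 - 2 * H)) * indicator {1..} \<xi> \<partial>lborel) = ennreal (- (1 powr (- 1 - 2 * H + 1)) / (- 1 - 2 * H + 1))"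
    by (rule nn_integral_has_integral_lebesgue'[OF _ has_integral_powr_to_inf]) (use H in auto)
  let ?J = "\<integral>\<^sup>+\<xi>. ennreal (\<bar>\<xi>\<bar> powr (1 - 2 * H) * (freq_bound \<xi>)\<^sup>2) \<partial>lborel"
  have "?J = 2 * (\<integral>\<^sup>+\<xi>. ennreal (\<bar>\<xi>\<bar> powr (1 - 2 * H) * (freq_bound \<xi>)\<^sup>2) * indicator {0<..} \<xi> \<partial>lborel)"
    by (rule nn_integral_even) (auto simp: freq_bound_def)
  also have "\<dots> \<le> 2 * (\<integral>\<^sup>+\<xi>. (ennreal (\<xi> powr (1 - 2 * H)) * indicator {0..1} \<xi> + ennreal (\<xi> powr (- 1 - 2 * H)) * indicator {1..} \<xi>) \<partial>lborel)"
  proof (intro mult_left_mono nn_integral_mono)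
    fix \<xi> :: real
    have "\<xi> powr (1 - 2 * H) * (1 / \<xi>)\<^sup>2 = \<xi> powr (- 1 - 2 * H)" if "\<xi> > 0"
    proof -
      have "(1 / \<xi>)\<^sup>2 = \<xi> powr (-2)" using that by (simp add: powr_minus divide_inverse power_inverse)
      then show ?thesis by (simp add: powr_add[symmetric])
    qed
    then show "ennreal (\<bar>\<xi>\<bar> powr (1 - 2 * H) * (freq_bound \<xi>)\<^sup>2) * indicator {0<..} \<xi> \<le> ennreal (\<xi> powr (1 - 2 * H)) * indicator {0..1} \<xi> + ennreal (\<xi> powr (- 1 - 2 * H)) * indicator {1..} \<xi>"
      by (auto simp: freq_bound_def split: split_indicator)
  qed simp
  also have "\<dots> < \<infinity>" by (subst nn_integral_add) (auto simp: 1 2 ennreal_mult_less_top)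
  finally have J: "?J < \<infinity>" .
  have "(\<integral>\<^sup>+p. ennreal (indicator {0<..<T} (fst p) * (freq_bound (snd p))\<^sup>2) \<partial>noise_measure H)
     = (\<integral>\<^sup>+s. \<integral>\<^sup>+\<xi>. ennreal (noise_weight H (s, \<xi>)) * ennreal (indicator {0<..<T} (fst (s, \<xi>)) * (freq_bound (snd (s, \<xi>)))\<^sup>2) \<partial>lborel \<partial>lborel)"
    by (rule nn_integral_noise_measure) simp
  also have "\<dots> = (\<integral>\<^sup>+s. \<integral>\<^sup>+\<xi>. ennreal (c1H H * indicator {0<..<T} s) * ennreal (\<bar>\<xi>\<bar> powr (1 - 2 * H) * (freq_bound \<xi>)\<^sup>2) \<partial>lborel \<partial>lborel)"
    using c1H_pos[OF H]
    by (intro nn_integral_cong) (auto simp: noise_weight_def ennreal_mult[symmetric] mult_ac split: split_indicator)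
  also have "\<dots> = (\<integral>\<^sup>+s. ennreal (c1H H * indicator {0<..<T} s) * ?J \<partial>lborel)"
    by (intro nn_integral_cong nn_integral_cmult) simp
  also have "\<dots> = (\<integral>\<^sup>+s. ennreal (c1H H * indicator {0<..<T} s) \<partial>lborel) * ?J"
    by (rule nn_integral_multc) simp
  also have "(\<integral>\<^sup>+s. ennreal (c1H H * indicator {0<..<T} s) \<partial>lborel) = (\<integral>\<^sup>+s. ennreal (c1H H) * indicator {0<..<T} s \<partial>lborel)"
    by (intro nn_integral_cong) (auto split: split_indicator)
  also have "\<dots> = ennreal (c1H H) * emeasure lborel {0<..<T}" by (rule nn_integral_cmult_indicator) simp
  finally have e: "(\<integral>\<^sup>+p. ennreal (indicator {0<..<T} (fst p) * (freq_bound (snd p))\<^sup>2) \<partial>noise_measure H) = ennreal (c1H H) * emeasure lborel {0<..<T} * ?J" .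
  have "ennreal (c1H H) * emeasure lborel {0<..<T} < \<infinity>" by (cases "0 \<le> T") (auto simp: ennreal_mult_less_top)
  then show ?thesis using J unfolding e by (simp only: ennreal_mult_less_top infinity_ennreal_def simp_thms)
qed

lemma test_function_measurable:
  assumes "test_function g"
  shows "(\<lambda>p. g (fst p) (snd p)) \<in> borel_measurable (borel \<Otimes>\<^sub>M borel)"
proof -
  have "smooth2 g" using assms by (simp add: test_function_def)
  then have "continuous_on UNIV (\<lambda>(s, y). g s y)" by (rule smooth2D(1))
  then have "(\<lambda>(s, y). g s y) \<in> borel_measurable borel" by (rule borel_measurable_continuous_onI)
  moreover have "(\<lambda>(s, y). g s y) = (\<lambda>p. g (fst p) (snd p))" by (simp add: fun_eq_iff)
  ultimately show ?thesis by (simp add: borel_prod)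
qed

lemma test_function_integrable:
  assumes "test_function g" shows "integrable lborel (g s)"
proof -
  obtain T A C where b: "0 < A" "\<And>s y. g s y \<noteq> 0 \<Longrightarrow> 0 < s \<and> s < T \<and> - A < y \<and> y < A" 
    by (rule test_functionE[OF assms]) blast
  have s: "smooth2 g" using assms by (simp add: test_function_def)
  have c: "continuous_on UNIV (g s)" using smooth2D(3)[OF s] by (meson DERIV_isCont continuous_at_imp_continuous_on)
  have "integrable lborel (\<lambda>x. indicator {-A..A} x *\<^sub>R g s x)"
    using borel_integrable_atLeastAtMost'[OF continuous_on_subset[OF c]] by (simp add: set_integrable_def)
  moreover have "(\<lambda>x. indicator {-A..A} x *\<^sub>R g s x) = g s"
    using b(2)[of s] by (fastforce simp: fun_eq_iff split: split_indicator)
  ultimately show ?thesis by simp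
qed

lemma test_function_fhat_bound:
  assumes "test_function g"
  shows "\<exists>T C. \<forall>p. cmod (fhat g p) \<le> C * (indicator {0<..<T} (fst p) * freq_bound (snd p))"
proof -
  obtain T A C where b: "0 < T" "0 < A" "0 \<le> C" "\<And>s y. g s y \<noteq> 0 \<Longrightarrow> 0 < s \<and> s < T \<and> - A < y \<and> y < A"
    "\<And>s y. \<bar>g s y\<bar> \<le> C" "\<And>s y. \<bar>partial_x g s y\<bar> \<le> C"
    by (rule test_functionE[OF assms]) blast
  have s: "smooth2 g" using assms by (simp add: test_function_def)
  have le: "(\<integral>x. \<bar>h x\<bar> \<partial>lborel) \<le> 2 * A * C" if "\<And>x. \<bar>h x\<bar> \<le> C" "\<And>x. x \<notin> {-A..A} \<Longrightarrow> h x = 0" for h :: "real \<Rightarrow> real"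
  proof -
    have "(\<integral>x. \<bar>h x\<bar> \<partial>lborel) \<le> (\<integral>x. C * indicator {-A..A} x \<partial>lborel)"
      by (rule integral_mono') (use that b in \<open>auto split: split_indicator\<close>)
    also have "\<dots> = 2 * A * C" using b by simp
    finally show ?thesis .
  qed
  have "cmod (fhat g (s, \<xi>)) \<le> (2 * A * C) * (indicator {0<..<T} s * freq_bound \<xi>)" for s \<xi>
  proof (cases "s \<in> {0<..<T}")
    case True
    have g0: "g s y = 0" if "y \<notin> {-A..A}" for y using b(4)[of s y] that by fastforce
    have g'0: "partial_x g s y = 0" if "y \<notin> {-A..A}" for y
    proof -
      have "((\<lambda>z. g s z) has_real_derivative 0) (at y)"
        by (rule has_field_derivative_transform_within_open[OF DERIV_const, where S = "- {-A..A}"]) (use that g0 in auto)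
      then show ?thesis unfolding partial_x_def by (rule DERIV_imp_deriv)
    qed
    have c: "continuous_on UNIV (partial_x g s)" using smooth2D(3)[OF smooth2D(5)[OF s]] by (meson DERIV_isCont continuous_at_imp_continuous_on)
    have 1: "cmod (fourier (g s) \<xi>) \<le> 2 * A * C"
      using fourier_norm_le[of "g s" \<xi>] le[of "g s"] b(5) g0 by (meson order_trans)
    have "\<bar>\<xi>\<bar> * cmod (fourier (g s) \<xi>) \<le> (\<integral>x. \<bar>partial_x g s x\<bar> \<partial>lborel)"
      by (rule fourier_derivative_bound[OF smooth2D(3)[OF s] c _ b(2)]) (use b(4) in blast)
    also have "\<dots> \<le> 2 * A * C" by (rule le) (use b(6) g'0 in auto)
    finally show ?thesis using freq_boundI[OF 1] True by (simp add: fhat_def)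
  next
    case False
    then have "g s = (\<lambda>_. 0)" using b(4)[of s] by (fastforce simp: fun_eq_iff)
    then show ?thesis using False by (simp add: fhat_def fourier_def)
  qed
  then show ?thesis by (intro exI[of _ T] exI[of _ "2 * A * C"]) (auto simp: split_paired_All)
qed

lemma test_function_fhat_integrable:
  assumes H: "0 < H" "H < 1" and g: "test_function g"
  shows "fhat g \<in> borel_measurable (borel \<Otimes>\<^sub>M borel)"
    and "integrable (noise_measure H) (\<lambda>p. (cmod (fhat g p))\<^sup>2)"
proof -
  show m[measurable]: "fhat g \<in> borel_measurable (borel \<Otimes>\<^sub>M borel)" using test_function_measurable[OF g] by measurable
  obtain T C where b: "\<And>p. cmod (fhat g p) \<le> C * (indicator {0<..<T} (fst p) * freq_bound (snd p))"
    using test_function_fhat_bound[OF g] by blast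
  have i: "integrable (noise_measure H) (\<lambda>p. C\<^sup>2 * (indicator {0<..<T} (fst p) * (freq_bound (snd p))\<^sup>2))"
    by (intro integrable_mult_right integrableI_nonneg) (auto simp: nn_integral_freq_bound[OF H, unfolded infinity_ennreal_def])
  show "integrable (noise_measure H) (\<lambda>p. (cmod (fhat g p))\<^sup>2)"
  proof (rule Bochner_Integration.integrable_bound[OF i])
    have "(cmod (fhat g p))\<^sup>2 \<le> (C * (indicator {0<..<T} (fst p) * freq_bound (snd p)))\<^sup>2" for p
      by (intro power_mono b) simp
    moreover have "(indicator {0<..<T} a :: real)\<^sup>2 = indicator {0<..<T} a" for a by (simp add: indicator_def)
    ultimately have "norm ((cmod (fhat g p))\<^sup>2) \<le> norm (C\<^sup>2 * (indicator {0<..<T} (fst p) * (freq_bound (snd p))\<^sup>2))" for p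
      by (simp only: power_mult_distrib real_norm_def abs_mult abs_power2 abs_indicator)
    then show "AE p in noise_measure H. norm ((cmod (fhat g p))\<^sup>2) \<le> norm (C\<^sup>2 * (indicator {0<..<T} (fst p) * (freq_bound (snd p))\<^sup>2))"
      by (intro AE_I2)
  qed simp
qed

lemma integrable_mult_cnj:
  fixes f g :: "'b \<Rightarrow> complex"
  assumes [measurable]: "f \<in> borel_measurable N" "g \<in> borel_measurable N"
    and "integrable N (\<lambda>p. (cmod (f p))\<^sup>2)" "integrable N (\<lambda>p. (cmod (g p))\<^sup>2)"
  shows "integrable N (\<lambda>p. f p * cnj (g p))"
proof (rule Bochner_Integration.integrable_bound[OF Bochner_Integration.integrable_add[OF assms(3,4)]])
  show "(\<lambda>p. f p * cnj (g p)) \<in> borel_measurable N"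
    using measurable_compose[OF assms(2) borel_measurable_continuous_onI[of cnj]] by (auto intro!: borel_measurable_times continuous_intros)
  have "a * b \<le> a\<^sup>2 + b\<^sup>2" if "0 \<le> a" "0 \<le> b" for a b :: real
    using sum_squares_bound[of a b] mult_nonneg_nonneg[OF that] by linarith
  then show "AE p in N. norm (f p * cnj (g p)) \<le> norm ((cmod (f p))\<^sup>2 + (cmod (g p))\<^sup>2)"
    by (simp add: norm_mult)
qed

text \<open>\<open>noise_inner\<close> is an iterated Bochner integral. It agrees with the joint
  integral by Fubini, whose integrability hypothesis is \<open>integrable_mult_cnj\<close> for two
  square integrable transforms.\<close>

lemma noise_inner_eq:
  assumes H: "0 < H" "H < 1" and t: "test_function \<phi>" "test_function \<psi>"
  shows "noise_inner H \<phi> \<psi> = (\<integral>p. fhat \<phi> p * cnj (fhat \<psi> p) \<partial>noise_measure H)"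
proof -
  note f1 = test_function_fhat_integrable[OF H t(1)] and f2 = test_function_fhat_integrable[OF H t(2)]
  note [measurable] = f1(1) f2(1)
  have i: "integrable (noise_measure H) (\<lambda>p. fhat \<phi> p * cnj (fhat \<psi> p))"
    by (rule integrable_mult_cnj) (use f1 f2 in auto)
  have [measurable]: "(\<lambda>p. fhat \<phi> p * cnj (fhat \<psi> p)) \<in> borel_measurable (borel \<Otimes>\<^sub>M borel)"
    using borel_measurable_integrable[OF i] by simp
  have i': "integrable (lborel \<Otimes>\<^sub>M lborel) (\<lambda>p. noise_weight H p *\<^sub>R (fhat \<phi> p * cnj (fhat \<psi> p)))"
    using i unfolding noise_measure_def by (subst (asm) integrable_density) (auto simp: noise_weight_nonneg[OF H])
  have "(\<integral>p. fhat \<phi> p * cnj (fhat \<psi> p) \<partial>noise_measure H) = (\<integral>p. noise_weight H p *\<^sub>R (fhat \<phi> p * cnj (fhat \<psi> p)) \<partial>(lborel \<Otimes>\<^sub>M lborel))"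
    unfolding noise_measure_def by (rule integral_density) (auto simp: noise_weight_nonneg[OF H])
  also have "\<dots> = (\<integral>s. \<integral>\<xi>. noise_weight H (s, \<xi>) *\<^sub>R (fhat \<phi> (s, \<xi>) * cnj (fhat \<psi> (s, \<xi>))) \<partial>lborel \<partial>lborel)"
    by (rule lborel_pair.integral_fst'[symmetric, OF i'])
  also have "\<dots> = (\<integral>s. complex_of_real (c1H H) * (indicator {0<..} s *\<^sub>R (\<integral>\<xi>. fourier (\<phi> s) \<xi> * cnj (fourier (\<psi> s) \<xi>) * complex_of_real (\<bar>\<xi>\<bar> powr (1 - 2 * H)) \<partial>lborel)) \<partial>lborel)"
  proof (intro Bochner_Integration.integral_cong refl)
    fix s :: real
    have "(\<integral>\<xi>. noise_weight H (s, \<xi>) *\<^sub>R (fhat \<phi> (s, \<xi>) * cnj (fhat \<psi> (s, \<xi>))) \<partial>lborel)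
      = (\<integral>\<xi>. complex_of_real (c1H H * indicator {0<..} s) * (fourier (\<phi> s) \<xi> * cnj (fourier (\<psi> s) \<xi>) * complex_of_real (\<bar>\<xi>\<bar> powr (1 - 2 * H))) \<partial>lborel)"
      by (intro Bochner_Integration.integral_cong refl) (simp add: noise_weight_def fhat_def scaleR_conv_of_real mult_ac)
    then show "(\<integral>\<xi>. noise_weight H (s, \<xi>) *\<^sub>R (fhat \<phi> (s, \<xi>) * cnj (fhat \<psi> (s, \<xi>))) \<partial>lborel) = complex_of_real (c1H H) * (indicator {0<..} s *\<^sub>R (\<integral>\<xi>. fourier (\<phi> s) \<xi> * cnj (fourier (\<psi> s) \<xi>) * complex_of_real (\<bar>\<xi>\<bar> powr (1 - 2 * H)) \<partial>lborel))"
      by (cases "0 < s") (simp_all add: mult.assoc)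
  qed
  also have "\<dots> = noise_inner H \<phi> \<psi>"
    unfolding noise_inner_def set_lebesgue_integral_def by (rule integral_mult_right_zero)
  finally show ?thesis by simp
qed

lemma fhat_diff:
  assumes "integrable lborel (f (fst p))" "integrable lborel (g (fst p))"
  shows "fhat (\<lambda>s y. f s y - g s y) p = fhat f p - fhat g p"
  unfolding fhat_def using fourier_diff[OF assms] by simp

lemma add_self_eq_0_complex: "(z::complex) + z = 0 \<longleftrightarrow> z = 0"
  by (metis mult_2 mult_eq_0_iff zero_neq_numeral)

text \<open>The reflection $y \mapsto 2x - y$ turns the Fourier transform of an even (odd) slice at $\xi$ into $\pm$ its value at $-\xi$ up to a common phase, so the integrand of the inner product is odd in $\xi$.\<close>
lemma noise_inner_even_odd:
  assumes "\<And>s y. \<phi> s (2 * x - y) = \<phi> s y" "\<And>s y. \<psi> s (2 * x - y) = - \<psi> s y"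
  shows "noise_inner H \<phi> \<psi> = 0"
proof -
  have refl: "fourier f \<xi> = cis (- 2 * \<xi> * x) * fourier (\<lambda>y. f (2 * x - y)) (- \<xi>)" for f \<xi>
  proof -
    have "fourier f \<xi> = \<bar>-1\<bar> *\<^sub>R (\<integral>y. cis (- \<xi> * (2 * x + (-1) * y)) * complex_of_real (f (2 * x + (-1) * y)) \<partial>lborel)"
      unfolding fourier_def by (rule lborel_integral_real_affine) simp
    also have "\<dots> = (\<integral>y. cis (- 2 * \<xi> * x) * (cis (- (- \<xi>) * y) * complex_of_real (f (2 * x - y))) \<partial>lborel)"
    proof -
      have "cis (- \<xi> * (2 * x + (-1) * y)) = cis (- 2 * \<xi> * x) * cis (- (- \<xi>) * y)" for y
        unfolding cis_mult by (rule arg_cong[where f = cis]) (simp add: algebra_simps)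
      moreover have "2 * x + (-1) * y = 2 * x - y" for y by simp
      ultimately show ?thesis by (simp only: mult.assoc abs_minus abs_one scaleR_one)
    qed
    also have "\<dots> = cis (- 2 * \<xi> * x) * fourier (\<lambda>y. f (2 * x - y)) (- \<xi>)"
      unfolding fourier_def by (rule integral_mult_right_zero)
    finally show ?thesis .
  qed
  have zero: "(LINT \<xi>|lborel. fourier (\<phi> s) \<xi> * cnj (fourier (\<psi> s) \<xi>) * complex_of_real (\<bar>\<xi>\<bar> powr (1 - 2 * H))) = 0" (is "?I = 0") for s
  proof -
    have p: "fourier (\<phi> s) \<xi> * cnj (fourier (\<psi> s) \<xi>) = - (fourier (\<phi> s) (- \<xi>) * cnj (fourier (\<psi> s) (- \<xi>)))" for \<xi>
    proof -
      have 1: "fourier (\<phi> s) \<xi> = cis (- 2 * \<xi> * x) * fourier (\<phi> s) (- \<xi>)" using refl[of "\<phi> s" \<xi>] assms(1) by simp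
      have "fourier (\<lambda>y. - \<psi> s y) (- \<xi>) = - fourier (\<psi> s) (- \<xi>)" using fourier_cmult[of "-1" "\<psi> s"] by simp
      then have 2: "fourier (\<psi> s) \<xi> = - (cis (- 2 * \<xi> * x) * fourier (\<psi> s) (- \<xi>))" using refl[of "\<psi> s" \<xi>] assms(2) by simp
      have "cis (- 2 * \<xi> * x) * cnj (cis (- 2 * \<xi> * x)) = 1" by (simp add: cis_cnj cis_mult)
      moreover have "c * a * cnj (- (c * b)) = - (c * cnj c * (a * cnj b))" for a b c :: complex by simp
      ultimately show ?thesis unfolding 1 2 by (simp only: mult_1)
    qed
    have "?I = \<bar>-1\<bar> *\<^sub>R (\<integral>\<xi>. fourier (\<phi> s) (0 + (-1) * \<xi>) * cnj (fourier (\<psi> s) (0 + (-1) * \<xi>)) * complex_of_real (\<bar>0 + (-1) * \<xi>\<bar> powr (1 - 2 * H)) \<partial>lborel)"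
      by (rule lborel_integral_real_affine) simp
    also have "\<dots> = (\<integral>\<xi>. - (fourier (\<phi> s) \<xi> * cnj (fourier (\<psi> s) \<xi>) * complex_of_real (\<bar>\<xi>\<bar> powr (1 - 2 * H))) \<partial>lborel)"
    proof -
      have "0 + (-1) * \<xi> = - \<xi>" for \<xi> :: real by simp
      moreover have "fourier (\<phi> s) (- \<xi>) * cnj (fourier (\<psi> s) (- \<xi>)) = - (fourier (\<phi> s) \<xi> * cnj (fourier (\<psi> s) \<xi>))" for \<xi>
        using p[of \<xi>] by (simp only: minus_minus)
      ultimately show ?thesis by (simp only: mult_minus_left abs_minus abs_one scaleR_one abs_minus_cancel)
    qed
    also have "\<dots> = - ?I" by (rule integral_minus)
    finally have "?I + ?I = 0" by (simp only: eq_neg_iff_add_eq_0)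
    then show ?thesis by (simp only: add_self_eq_0_complex)
  qed
  show ?thesis unfolding noise_inner_def set_lebesgue_integral_def zero
    by (simp only: scaleR_zero_right Bochner_Integration.integral_zero mult_zero_right)
qed

lemma noise_inner_disjoint:
  assumes "\<And>s. \<phi> s = (\<lambda>_. 0) \<or> \<psi> s = (\<lambda>_. 0)"
  shows "noise_inner H \<phi> \<psi> = 0"
proof -
  have "fourier (\<phi> s) \<xi> * cnj (fourier (\<psi> s) \<xi>) = 0" for s \<xi>
    using assms[of s] by (auto simp: fourier_def)
  then have "(\<integral>\<xi>. fourier (\<phi> s) \<xi> * cnj (fourier (\<psi> s) \<xi>) * complex_of_real (\<bar>\<xi>\<bar> powr (1 - 2 * H)) \<partial>lborel) = 0" for s
    by (simp only: mult_zero_left Bochner_Integration.integral_zero)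
  then show ?thesis unfolding noise_inner_def set_lebesgue_integral_def
    by (simp only: scaleR_zero_right Bochner_Integration.integral_zero mult_zero_right)
qed

lemma nn_integral_dominated_zero:
  fixes u :: "nat \<Rightarrow> 'b \<Rightarrow> real"
  assumes [measurable]: "\<And>n. u n \<in> borel_measurable N" "w \<in> borel_measurable N"
    and "\<And>n p. u n p \<le> w p" "(\<integral>\<^sup>+p. ennreal (w p) \<partial>N) < \<infinity>" "\<And>p. (\<lambda>n. u n p) \<longlonglongrightarrow> 0"
  shows "(\<lambda>n. \<integral>\<^sup>+p. ennreal (u n p) \<partial>N) \<longlonglongrightarrow> 0"
proof -
  have "(\<lambda>n. \<integral>\<^sup>+p. ennreal (u n p) \<partial>N) \<longlonglongrightarrow> (\<integral>\<^sup>+p. 0 \<partial>N)"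
  proof (rule nn_integral_dominated_convergence[where w = "\<lambda>p. ennreal (w p)"])
    show "AE p in N. (\<lambda>n. ennreal (u n p)) \<longlonglongrightarrow> 0"
      using tendsto_ennrealI[OF assms(5)] by simp
    show "AE p in N. ennreal (u n p) \<le> ennreal (w p)" for n using assms(3) by (auto intro!: ennreal_leI)
  qed (use assms(4) in auto)
  then show ?thesis by simp
qed

section \<open>Approximation of the heat kernel by test functions\<close>

text \<open>A Gaussian density in terms of its rate a = 1 / (2 variance). The heat kernel over the
  time t - s has rate 1 / (2 kappa (t-s)), and \<open>gauss_rate\<close> is a substitute for this
  parameter.\<close>

definition gauss_fun :: "real \<Rightarrow> real \<Rightarrow> real \<Rightarrow> real" where
  "gauss_fun a x y = sqrt (a / pi) * exp (- (a * (y - x)\<^sup>2))"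

lemma gauss_fun_nonneg: "0 < a \<Longrightarrow> 0 \<le> gauss_fun a x y" by (simp add: gauss_fun_def)

lemma gauss_fun_eq_normal:
  assumes "a > 0" shows "gauss_fun a x y = normal_density x (1 / sqrt (2 * a)) y"
  using assms by (simp add: gauss_fun_def normal_density_def power_divide real_sqrt_divide mult.commute)

lemma gauss_fun_moments:
  assumes "a > 0"
  shows "has_bochner_integral lborel (gauss_fun a x) 1"
    and "has_bochner_integral lborel (\<lambda>y. gauss_fun a x y * (y - x)\<^sup>2) (1 / (2 * a))"
proof -
  have p: "0 < 1 / sqrt (2 * a)" using assms by simp
  show "has_bochner_integral lborel (gauss_fun a x) 1"
    using normal_moment_even[OF p, of x 0] by (simp add: gauss_fun_eq_normal[OF assms] cong: has_bochner_integral_cong)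
  show "has_bochner_integral lborel (\<lambda>y. gauss_fun a x y * (y - x)\<^sup>2) (1 / (2 * a))"
    using normal_moment_even[OF p, of x 1] assms by (simp add: gauss_fun_eq_normal[OF assms] power_divide cong: has_bochner_integral_cong)
qed

lemma fourier_gauss_fun:
  "a > 0 \<Longrightarrow> fourier (gauss_fun a x) \<xi> = cis (- \<xi> * x) * complex_of_real (exp (- \<xi>\<^sup>2 / (4 * a)))"
  using fourier_gauss[of a x \<xi>] by (simp add: gauss_fun_def[abs_def])

lemma conv_kernel_eq:
  assumes "0 < \<kappa>"
  shows "conv_kernel \<kappa> t x s = (\<lambda>y. indicator {0<..<t} s * gauss_fun (1 / (2 * \<kappa> * (t - s))) x y)"
proof
  fix y
  have "heat_kernel \<kappa> (t - s) (x - y) = gauss_fun (1 / (2 * \<kappa> * (t - s))) x y" if "s < t"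
  proof -
    have "sqrt (1 / (2 * \<kappa> * (t - s)) / pi) = 1 / sqrt (2 * pi * \<kappa> * (t - s))"
      by (simp add: real_sqrt_divide mult_ac)
    moreover have "(x - y)\<^sup>2 = (y - x)\<^sup>2" by (rule power2_commute)
    ultimately show ?thesis by (simp add: heat_kernel_def gauss_fun_def)
  qed
  then show "conv_kernel \<kappa> t x s y = indicator {0<..<t} s * gauss_fun (1 / (2 * \<kappa> * (t - s))) x y"
    by (auto simp: conv_kernel_def split: split_indicator)
qed

lemma fhat_conv_kernel:
  assumes "0 < \<kappa>"
  shows "fhat (conv_kernel \<kappa> t x) (s, \<xi>) = complex_of_real (indicator {0<..<t} s) * (cis (- \<xi> * x) * complex_of_real (exp (- (\<kappa> * (t - s) * \<xi>\<^sup>2 / 2))))"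
proof (cases "s \<in> {0<..<t}")
  case True
  have "fourier (gauss_fun (1 / (2 * \<kappa> * (t - s))) x) \<xi> = cis (- \<xi> * x) * complex_of_real (exp (- \<xi>\<^sup>2 / (4 * (1 / (2 * \<kappa> * (t - s))))))"
    using True assms by (intro fourier_gauss_fun) simp
  also have "- \<xi>\<^sup>2 / (4 * (1 / (2 * \<kappa> * (t - s)))) = - (\<kappa> * (t - s) * \<xi>\<^sup>2 / 2)" by simp
  finally show ?thesis using True by (simp add: fhat_def conv_kernel_eq[OF assms])
next
  case False
  then show ?thesis by (simp add: fhat_def conv_kernel_eq[OF assms] fourier_def)
qed

lemma conv_kernel_measurable [measurable]:
  "(\<lambda>p. conv_kernel \<kappa> t x (fst p) (snd p)) \<in> borel_measurable (borel \<Otimes>\<^sub>M borel)"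
  unfolding conv_kernel_def heat_kernel_def by measurable

lemma conv_kernel_integrable:
  assumes "0 < \<kappa>" shows "integrable lborel (conv_kernel \<kappa> t x s)"
proof (cases "s \<in> {0<..<t}")
  case True
  then have "0 < 1 / (2 * \<kappa> * (t - s))" using assms by simp
  from gauss_fun_moments(1)[OF this] show ?thesis using True by (simp add: conv_kernel_eq[OF assms] has_bochner_integral_iff eta_contract_eq)
qed (simp add: conv_kernel_eq[OF assms])

text \<open>Besides the second moment of u at time t, where r = t, this covers the cross term of two
  times: the product of the kernel transforms for t' <= t is again of this form, with t' in the role
  of t and the midpoint of t and t' as r.\<close>

lemma nn_integral_kernel_energy:
  assumes H: "0 < H" "H < 1" and k: "0 < \<kappa>" and t: "0 \<le> t" "t \<le> r"
  shows "(\<integral>\<^sup>+p. ennreal (indicator {0<..<t} (fst p) * exp (- (\<kappa> * (r - fst p) * (snd p)\<^sup>2))) \<partial>noise_measure H)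
     = ennreal (c1H H * Gamma (1 - H) * \<kappa> powr (H - 1) * ((r powr H - (r - t) powr H) / H))"
proof -
  let ?K = "c1H H * Gamma (1 - H) * \<kappa> powr (H - 1)"
  have K: "?K \<ge> 0" using c1H_pos[OF H] H by (simp add: Gamma_real_nonneg)
  have "(\<integral>\<^sup>+p. ennreal (indicator {0<..<t} (fst p) * exp (- (\<kappa> * (r - fst p) * (snd p)\<^sup>2))) \<partial>noise_measure H)
    = (\<integral>\<^sup>+s. \<integral>\<^sup>+\<xi>. ennreal (noise_weight H (s, \<xi>)) * ennreal (indicator {0<..<t} (fst (s, \<xi>)) * exp (- (\<kappa> * (r - fst (s, \<xi>)) * (snd (s, \<xi>))\<^sup>2))) \<partial>lborel \<partial>lborel)"
    by (rule nn_integral_noise_measure) simp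
  also have "\<dots> = (\<integral>\<^sup>+s. ennreal ?K * ennreal (indicator {0<..<t} s * (r - s) powr (H - 1)) \<partial>lborel)"
  proof (rule nn_integral_cong)
    fix s :: real
    show "(\<integral>\<^sup>+\<xi>. ennreal (noise_weight H (s, \<xi>)) * ennreal (indicator {0<..<t} (fst (s, \<xi>)) * exp (- (\<kappa> * (r - fst (s, \<xi>)) * (snd (s, \<xi>))\<^sup>2))) \<partial>lborel)
      = ennreal ?K * ennreal (indicator {0<..<t} s * (r - s) powr (H - 1))"
    proof (cases "s \<in> {0<..<t}")
      case True
      then have v: "0 < \<kappa> * (r - s)" using k t by simp
      have "(\<integral>\<^sup>+\<xi>. ennreal (noise_weight H (s, \<xi>)) * ennreal (indicator {0<..<t} (fst (s, \<xi>)) * exp (- (\<kappa> * (r - fst (s, \<xi>)) * (snd (s, \<xi>))\<^sup>2))) \<partial>lborel)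
        = (\<integral>\<^sup>+\<xi>. ennreal (c1H H) * ennreal (\<bar>\<xi>\<bar> powr (2 * (1 - H) - 1) * exp (- (\<kappa> * (r - s) * \<xi>\<^sup>2))) \<partial>lborel)"
        using True c1H_pos[OF H] by (intro nn_integral_cong) (simp add: noise_weight_def ennreal_mult[symmetric] mult_ac)
      also have "\<dots> = ennreal (c1H H) * ennreal (Gamma (1 - H) * (\<kappa> * (r - s)) powr (- (1 - H)))"
        using H v by (subst nn_integral_cmult) (simp_all add: nn_integral_power_gauss[of "1 - H", simplified] del: ennreal_mult)
      also have "\<dots> = ennreal ?K * ennreal (indicator {0<..<t} s * (r - s) powr (H - 1))"
        using True k t c1H_pos[OF H] H K by (simp add: ennreal_mult[symmetric] powr_mult Gamma_real_nonneg mult_ac)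
      finally show ?thesis .
    qed simp
  qed
  also have "\<dots> = ennreal ?K * (\<integral>\<^sup>+s. ennreal (indicator {0<..<t} s * (r - s) powr (H - 1)) \<partial>lborel)"
    by (rule nn_integral_cmult) simp
  also have "(\<integral>\<^sup>+s. ennreal (indicator {0<..<t} s * (r - s) powr (H - 1)) \<partial>lborel) = ennreal ((r powr H - (r - t) powr H) / H)"
    using has_bochner_integral_powr_shift[of H t r] H t
    by (subst nn_integral_eq_integral) (auto simp: has_bochner_integral_iff)
  finally show ?thesis using K t H by (simp add: ennreal_mult[symmetric] powr_mono2)
qed

text \<open>A smooth function of $s$ that vanishes outside $(1/(n+1), t)$ and tends to $1$ inside $(0,t)$.\<close>
definition time_cutoff :: "real \<Rightarrow> nat \<Rightarrow> real \<Rightarrow> real" where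
  "time_cutoff t n s = 1 - exp (- (real (Suc n) * (flat_exp (s - 1 / real (Suc n)) * flat_exp (t - s))))"

lemma time_cutoff_bounds: "0 \<le> time_cutoff t n s" "time_cutoff t n s \<le> 1"
  by (simp_all add: time_cutoff_def)

lemma time_cutoff_support: "time_cutoff t n s \<noteq> 0 \<Longrightarrow> 1 / real (Suc n) < s \<and> s < t"
  by (rule ccontr) (auto simp: time_cutoff_def not_less)

lemma time_cutoff_eq_0:
  assumes "s \<notin> {0<..<t}" shows "time_cutoff t n s = 0"
proof (rule ccontr)
  assume "time_cutoff t n s \<noteq> 0"
  then have "1 / real (Suc n) < s" "s < t" using time_cutoff_support by blast+
  moreover have "0 < 1 / real (Suc n)" by simp
  ultimately have "0 < s \<and> s < t" by linarith
  then show False using assms by simp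
qed

lemma time_cutoff_tendsto:
  assumes "0 < s" "s < t" shows "(\<lambda>n. time_cutoff t n s) \<longlonglongrightarrow> 1"
proof -
  have "(\<lambda>n. s - 1 / real (Suc n)) \<longlonglongrightarrow> s - 0"
    by (intro tendsto_diff tendsto_const) (use LIMSEQ_inverse_real_of_nat in \<open>simp add: inverse_eq_divide\<close>)
  then have "(\<lambda>n. flat_exp (s - 1 / real (Suc n))) \<longlonglongrightarrow> flat_exp s"
    using isCont_tendsto_compose[OF isCont_smooth[OF smooth_on_real_flat_exp]] by simp
  then have "(\<lambda>n. flat_exp (s - 1 / real (Suc n)) * flat_exp (t - s)) \<longlonglongrightarrow> flat_exp s * flat_exp (t - s)"
    by (rule tendsto_mult_right)
  moreover have "0 < flat_exp s * flat_exp (t - s)" using assms by (simp add: flat_exp_pos)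
  moreover have "filterlim (\<lambda>n. real (Suc n)) at_top sequentially"
    by (rule filterlim_compose[OF filterlim_real_sequentially filterlim_Suc])
  ultimately have "filterlim (\<lambda>n. (flat_exp (s - 1 / real (Suc n)) * flat_exp (t - s)) * real (Suc n)) at_top sequentially"
    by (rule filterlim_tendsto_pos_mult_at_top)
  then have "filterlim (\<lambda>n. real (Suc n) * (flat_exp (s - 1 / real (Suc n)) * flat_exp (t - s))) at_top sequentially"
    by (simp only: mult.commute)
  then have "(\<lambda>n. exp (- (real (Suc n) * (flat_exp (s - 1 / real (Suc n)) * flat_exp (t - s))))) \<longlonglongrightarrow> 0"
    by (intro filterlim_compose[OF exp_at_bot] filterlim_compose[OF filterlim_uminus_at_bot_at_top])
  from tendsto_diff[OF tendsto_const[of 1] this] show ?thesis by (simp add: time_cutoff_def)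
qed

text \<open>A smoothing in $s$ of the rate $1/(2\kappa(t-s))$ that stays below it, so that the Fourier transform of the mollified kernel stays below that of the heat kernel.\<close>
definition gauss_rate :: "real \<Rightarrow> real \<Rightarrow> nat \<Rightarrow> real \<Rightarrow> real" where
  "gauss_rate \<kappa> t n s = ((t - s)\<^sup>2 + 1 / real (Suc n)) powr (- 1 / 2) / (2 * \<kappa>)"

lemma gauss_rate_base_pos: "0 < (t - s)\<^sup>2 + 1 / real (Suc n)"
  by (simp add: add_nonneg_pos)

lemma gauss_rate_pos: "0 < \<kappa> \<Longrightarrow> 0 < gauss_rate \<kappa> t n s"
  using gauss_rate_base_pos[of t s n] by (simp add: gauss_rate_def)

lemma gauss_rate_inverse:
  assumes "0 < \<kappa>" shows "1 / (4 * gauss_rate \<kappa> t n s) = \<kappa> * sqrt ((t - s)\<^sup>2 + 1 / real (Suc n)) / 2"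
  using gauss_rate_base_pos[of t s n] assms
  by (simp add: gauss_rate_def powr_minus powr_half_sqrt divide_simps)

text \<open>For fixed n the rate stays bounded up to s = t, where the rate of the heat kernel itself
  blows up. This makes the constant in \<open>test_kernel_fourier_bound\<close> independent of
  s.\<close>

lemma gauss_rate_le:
  assumes "0 < \<kappa>" shows "gauss_rate \<kappa> t n s \<le> sqrt (real (Suc n)) / (2 * \<kappa>)"
proof -
  have "((t - s)\<^sup>2 + 1 / real (Suc n)) powr (- 1 / 2) \<le> (1 / real (Suc n)) powr (- 1 / 2)"
    by (rule powr_mono2') auto
  also have "\<dots> = sqrt (real (Suc n))" by (simp add: powr_minus powr_half_sqrt powr_divide real_sqrt_divide)
  finally show ?thesis using assms by (simp add: gauss_rate_def divide_right_mono)
qed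

definition mollified_kernel :: "real \<Rightarrow> real \<Rightarrow> real \<Rightarrow> nat \<Rightarrow> real \<Rightarrow> real \<Rightarrow> real" where
  "mollified_kernel \<kappa> t x n s y = time_cutoff t n s * gauss_fun (gauss_rate \<kappa> t n s) x y"

text \<open>Truncation in space gets its own parameter m. The Fourier bounds are uniform in m only
  for fixed n, so m tends to infinity first and n afterwards.\<close>

definition test_kernel :: "real \<Rightarrow> real \<Rightarrow> real \<Rightarrow> nat \<Rightarrow> nat \<Rightarrow> real \<Rightarrow> real \<Rightarrow> real" where
  "test_kernel \<kappa> t x n m s y = mollified_kernel \<kappa> t x n s y * cutoff ((y - x) / real (Suc m))"

lemma smooth2_test_kernel:
  assumes "0 < \<kappa>" shows "smooth2 (test_kernel \<kappa> t x n m)"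
proof -
  let ?N = "real (Suc n)" and ?R = "real (Suc m)"
  \<comment> \<open>The expression under the root in \<open>gauss_rate\<close> as a polynomial in s.
    Up to constants the rate is its power -1/2 and the normalising root of the rate its power -1/4,
    both covered by \<open>smooth_on_real_poly_powr\<close>.\<close>
  define q where "q = [: t\<^sup>2 + 1 / ?N, - 2 * t, 1 :]"
  have q: "poly q s = (t - s)\<^sup>2 + 1 / ?N" for s by (simp add: q_def power2_eq_square algebra_simps)
  have qp: "poly q s > 0" for s unfolding q by (rule gauss_rate_base_pos)
  define r where "r = [: x\<^sup>2, - 2 * x, 1 :]"
  have r: "poly r y = (y - x)\<^sup>2" for y by (simp add: r_def power2_eq_square algebra_simps)
  have g: "gauss_rate \<kappa> t n s = poly q s powr (- 1 / 2) * (1 / (2 * \<kappa>))" for s by (simp add: gauss_rate_def q)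
  have sg: "sqrt (gauss_rate \<kappa> t n s / pi) = poly q s powr (- 1 / 4) * sqrt (1 / (2 * \<kappa> * pi))" for s
  proof -
    have "sqrt (poly q s powr (- 1 / 2)) = poly q s powr (- 1 / 4)"
      using qp[of s] by (simp add: powr_half_sqrt[symmetric] powr_powr)
    then show ?thesis unfolding g by (simp add: real_sqrt_mult real_sqrt_divide)
  qed
  have f1: "smooth2 (\<lambda>s y. flat_exp (1 * s + (- 1 / ?N)))"
    by (rule smooth2_time[OF smooth_on_real_affine[OF smooth_on_real_flat_exp]])
  have f2: "smooth2 (\<lambda>s y. flat_exp ((-1) * s + t))"
    by (rule smooth2_time[OF smooth_on_real_affine[OF smooth_on_real_flat_exp]])
  have p1: "smooth2 (\<lambda>s y. poly q s powr b)" for b by (rule smooth2_time[OF smooth_on_real_poly_powr[OF qp]])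
  have p2: "smooth2 (\<lambda>s y. poly r y)" by (rule smooth2_space[OF smooth_on_real_poly])
  note chi = smooth2_add[OF smooth2_const smooth2_mult[OF smooth2_const smooth2_exp[OF smooth2_mult[OF smooth2_const smooth2_mult[OF f1 f2]]]],
      of 1 "-1" "- ?N"]
  note gs = smooth2_mult[OF smooth2_mult[OF p1 smooth2_const] smooth2_exp[OF smooth2_mult[OF smooth2_const smooth2_mult[OF smooth2_mult[OF p1 smooth2_const] p2]]],
      of "- 1 / 4" "sqrt (1 / (2 * \<kappa> * pi))" "- 1" "- 1 / 2" "1 / (2 * \<kappa>)"]
  note smooth2_mult[OF smooth2_mult[OF chi gs] smooth2_cutoff[of "1 / ?R" "- x / ?R"]]
  moreover have "test_kernel \<kappa> t x n m = (\<lambda>s y. ((1 + (-1) * exp ((- ?N) * (flat_exp (1 * s + (- 1 / ?N)) * flat_exp ((-1) * s + t))))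
     * ((poly q s powr (- 1 / 4) * sqrt (1 / (2 * \<kappa> * pi))) * exp ((-1) * ((poly q s powr (- 1 / 2) * (1 / (2 * \<kappa>))) * poly r y)))) * cutoff ((1 / ?R) * y + (- x / ?R)))"
    unfolding fun_eq_iff test_kernel_def mollified_kernel_def time_cutoff_def gauss_fun_def
    unfolding sg unfolding g r by (simp add: diff_divide_distrib del: of_nat_Suc)
  ultimately show ?thesis by (simp only:)
qed

lemma test_kernel_support:
  assumes "test_kernel \<kappa> t x n m s y \<noteq> 0"
  shows "1 / real (Suc n) < s" "s < t" "x - real (Suc m) < y" "y < x + real (Suc m)"
proof -
  have "time_cutoff t n s \<noteq> 0" "cutoff ((y - x) / real (Suc m)) \<noteq> 0"
    using assms by (auto simp: test_kernel_def mollified_kernel_def)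
  then show "1 / real (Suc n) < s" "s < t" using time_cutoff_support by blast+
  have "\<not> 1 \<le> \<bar>(y - x) / real (Suc m)\<bar>" using \<open>cutoff ((y - x) / real (Suc m)) \<noteq> 0\<close> cutoff_eq_0 by blast
  then have "\<bar>y - x\<bar> < real (Suc m)" by (simp add: abs_divide field_simps)
  then show "x - real (Suc m) < y" "y < x + real (Suc m)" by linarith+
qed

lemma test_function_test_kernel:
  assumes "0 < \<kappa>" shows "test_function (test_kernel \<kappa> t x n m)"
  by (rule test_functionI[OF smooth2_test_kernel[OF assms], where a = "1 / real (Suc n)" and b = t and c = "x - real (Suc m)" and d = "x + real (Suc m)"])
     (auto dest: test_kernel_support)

lemma test_kernel_even: "test_kernel \<kappa> t x n m s (2 * x - y) = test_kernel \<kappa> t x n m s y"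
proof -
  have 1: "(2 * x - y - x) / real (Suc m) = - ((y - x) / real (Suc m))" by (simp add: field_simps)
  have 2: "(2 * x - y - x)\<^sup>2 = (y - x)\<^sup>2" by (simp add: power2_eq_square algebra_simps)
  show ?thesis unfolding test_kernel_def mollified_kernel_def gauss_fun_def 1 2 cutoff_minus ..
qed


lemma gauss_rate_measurable [measurable]: "gauss_rate \<kappa> t n \<in> borel_measurable borel"
  unfolding gauss_rate_def by measurable

lemma flat_exp_measurable [measurable]: "flat_exp \<in> borel_measurable borel"
  using isCont_smooth[OF smooth_on_real_flat_exp]
  by (intro borel_measurable_continuous_onI continuous_at_imp_continuous_on) auto

lemma mollified_kernel_measurable [measurable]:
  "(\<lambda>p. mollified_kernel \<kappa> t x n (fst p) (snd p)) \<in> borel_measurable (borel \<Otimes>\<^sub>M borel)"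
  unfolding mollified_kernel_def gauss_fun_def time_cutoff_def by measurable

lemma test_kernel_measurable [measurable]:
  "(\<lambda>p. test_kernel \<kappa> t x n m (fst p) (snd p)) \<in> borel_measurable (borel \<Otimes>\<^sub>M borel)"
  unfolding test_kernel_def cutoff_def by measurable

lemma mollified_kernel_integrable:
  assumes "0 < \<kappa>" shows "integrable lborel (mollified_kernel \<kappa> t x n s)"
proof -
  have "integrable lborel (gauss_fun (gauss_rate \<kappa> t n s) x)"
    using gauss_fun_moments(1)[OF gauss_rate_pos[OF assms]] by (simp add: has_bochner_integral_iff)
  then show ?thesis unfolding mollified_kernel_def[abs_def] by simp
qed

lemma fhat_mollified_kernel:
  assumes "0 < \<kappa>"
  shows "fhat (mollified_kernel \<kappa> t x n) (s, \<xi>) = complex_of_real (time_cutoff t n s) * (cis (- \<xi> * x) * complex_of_real (exp (- (\<kappa> * sqrt ((t - s)\<^sup>2 + 1 / real (Suc n)) * \<xi>\<^sup>2 / 2))))"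
proof -
  have "- \<xi>\<^sup>2 / (4 * gauss_rate \<kappa> t n s) = - (1 / (4 * gauss_rate \<kappa> t n s)) * \<xi>\<^sup>2" by simp
  also have "\<dots> = - (\<kappa> * sqrt ((t - s)\<^sup>2 + 1 / real (Suc n)) * \<xi>\<^sup>2 / 2)" unfolding gauss_rate_inverse[OF assms] by simp
  finally show ?thesis
    by (simp add: fhat_def mollified_kernel_def[abs_def] fourier_cmult fourier_gauss_fun[OF gauss_rate_pos[OF assms]])
qed

text \<open>Both transforms carry the same phase, so the difference is one of real amplitudes a and
  b with 0 <= a <= b. Its square is at most b^2, the energy density of the heat kernel, which is
  integrable by \<open>nn_integral_kernel_energy\<close>.\<close>

lemma mollified_kernel_tendsto:
  assumes H: "0 < H" "H < 1" and k: "0 < \<kappa>" and t: "0 \<le> t"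
  shows "(\<lambda>n. noise_norm2 H (\<lambda>s y. mollified_kernel \<kappa> t x n s y - conv_kernel \<kappa> t x s y)) \<longlonglongrightarrow> 0"
proof -
  let ?d = "\<lambda>n s y. mollified_kernel \<kappa> t x n s y - conv_kernel \<kappa> t x s y"
  let ?E = "\<lambda>n s \<xi>. time_cutoff t n s * exp (- (\<kappa> * sqrt ((t - s)\<^sup>2 + 1 / real (Suc n)) * \<xi>\<^sup>2 / 2)) - indicator {0<..<t} s * exp (- (\<kappa> * (t - s) * \<xi>\<^sup>2 / 2))"
  have m: "(\<lambda>p. ?d n (fst p) (snd p)) \<in> borel_measurable (borel \<Otimes>\<^sub>M borel)" for n by measurable
  have f: "fhat (?d n) (s, \<xi>) = cis (- \<xi> * x) * complex_of_real (?E n s \<xi>)" for n s \<xi>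
    unfolding fhat_diff[OF mollified_kernel_integrable[OF k] conv_kernel_integrable[OF k]] fhat_mollified_kernel[OF k] fhat_conv_kernel[OF k]
    by (simp only: of_real_diff of_real_mult right_diff_distrib mult.left_commute)
  have c: "(cmod (fhat (?d n) p))\<^sup>2 = (?E n (fst p) (snd p))\<^sup>2" for n p
    using f[of n "fst p" "snd p"] by (simp only: prod.collapse norm_cis_mult power2_abs)
  have "(\<lambda>n. \<integral>\<^sup>+p. ennreal ((?E n (fst p) (snd p))\<^sup>2) \<partial>noise_measure H) \<longlonglongrightarrow> 0"
  proof (rule nn_integral_dominated_zero[where w = "\<lambda>p. indicator {0<..<t} (fst p) * exp (- (\<kappa> * (t - fst p) * (snd p)\<^sup>2))"])
    show "(\<integral>\<^sup>+p. ennreal (indicator {0<..<t} (fst p) * exp (- (\<kappa> * (t - fst p) * (snd p)\<^sup>2))) \<partial>noise_measure H) < \<infinity>"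
      unfolding nn_integral_kernel_energy[OF H k t order_refl] by simp
  next
    fix n and p :: "real \<times> real"
    obtain s \<xi> where p: "p = (s, \<xi>)" by (cases p)
    show "(?E n (fst p) (snd p))\<^sup>2 \<le> indicator {0<..<t} (fst p) * exp (- (\<kappa> * (t - fst p) * (snd p)\<^sup>2))"
    proof (cases "s \<in> {0<..<t}")
      case True
      let ?a = "time_cutoff t n s * exp (- (\<kappa> * sqrt ((t - s)\<^sup>2 + 1 / real (Suc n)) * \<xi>\<^sup>2 / 2))" and ?b = "exp (- (\<kappa> * (t - s) * \<xi>\<^sup>2 / 2))"
      have "t - s \<le> sqrt ((t - s)\<^sup>2 + 1 / real (Suc n))" by (rule real_le_rsqrt) simp
      then have "\<kappa> * (t - s) * \<xi>\<^sup>2 \<le> \<kappa> * sqrt ((t - s)\<^sup>2 + 1 / real (Suc n)) * \<xi>\<^sup>2"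
        using k by (intro mult_right_mono mult_left_mono) auto
      then have "?a \<le> 1 * ?b" by (intro mult_mono time_cutoff_bounds) auto
      moreover have "0 \<le> ?a" by (simp add: time_cutoff_bounds)
      ultimately have "\<bar>?a - ?b\<bar> \<le> ?b" by linarith
      then have "(?a - ?b)\<^sup>2 \<le> ?b\<^sup>2" by (metis abs_ge_zero power2_abs power_mono)
      also have "?b\<^sup>2 = exp (- (\<kappa> * (t - s) * \<xi>\<^sup>2))" unfolding power2_eq_square exp_add[symmetric] by (rule arg_cong[where f = exp]) (simp add: field_simps)
      finally show ?thesis using True by (simp add: p)
    next
      case False
      then have "time_cutoff t n s = 0" by (rule time_cutoff_eq_0)
      then show ?thesis using False by (simp add: p)
    qed
    show "(\<lambda>n. (?E n (fst p) (snd p))\<^sup>2) \<longlonglongrightarrow> 0"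
    proof (cases "s \<in> {0<..<t}")
      case True
      have "(\<lambda>n. 1 / real (Suc n)) \<longlonglongrightarrow> 0" using LIMSEQ_inverse_real_of_nat by (simp add: inverse_eq_divide)
      then have "(\<lambda>n. (time_cutoff t n s * exp (- (\<kappa> * sqrt ((t - s)\<^sup>2 + 1 / real (Suc n)) * \<xi>\<^sup>2 / 2)) - 1 * exp (- (\<kappa> * (t - s) * \<xi>\<^sup>2 / 2)))\<^sup>2) \<longlonglongrightarrow> 
          (1 * exp (- (\<kappa> * sqrt ((t - s)\<^sup>2 + 0) * \<xi>\<^sup>2 / 2)) - 1 * exp (- (\<kappa> * (t - s) * \<xi>\<^sup>2 / 2)))\<^sup>2"
        using True by (intro tendsto_intros time_cutoff_tendsto) auto
      then show ?thesis using True by (simp add: p)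
    next
      case False
      then have "time_cutoff t n s = 0" for n by (rule time_cutoff_eq_0)
      then show ?thesis using False by (simp add: p)
    qed
  qed (unfold time_cutoff_def, measurable)
  then show ?thesis unfolding noise_norm2_eq[OF H m] c .
qed

lemma test_kernel_fourier_bound:
  assumes k: "0 < \<kappa>"
  shows "\<exists>C. \<forall>m p. cmod (fhat (test_kernel \<kappa> t x n m) p) \<le> C * (indicator {0<..<t} (fst p) * freq_bound (snd p))"
proof -
  obtain B where B: "0 \<le> B" "\<And>y. \<bar>deriv cutoff y\<bar> \<le> B" using deriv_cutoff_bounded by blast
  let ?A = "sqrt (real (Suc n)) / (2 * \<kappa>)"
  \<comment> \<open>The 1 bounds the L1 norm of the kernel. The other terms bound that of its
    derivative: 2|z| <= 1 + z^2 and the second moment 1/(2a) give a + 1/2 from the Gaussian with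
    rate a, and B comes from the cutoff.\<close>
  let ?C = "1 + ?A + 1 / 2 + B"
  have A0: "0 \<le> ?A" using k by simp
  have "cmod (fhat (test_kernel \<kappa> t x n m) (s, \<xi>)) \<le> ?C * (indicator {0<..<t} s * freq_bound \<xi>)" for m s \<xi>
  proof (cases "s \<in> {0<..<t}")
    case False
    then have "test_kernel \<kappa> t x n m s = (\<lambda>_. 0)" 
      using time_cutoff_eq_0 by (simp add: test_kernel_def mollified_kernel_def fun_eq_iff)
    then show ?thesis using False by (simp add: fhat_def fourier_def)
  next
    case True
    let ?a = "gauss_rate \<kappa> t n s" and ?R = "real (Suc m)"
    let ?f = "test_kernel \<kappa> t x n m s"
    let ?f' = "\<lambda>y. time_cutoff t n s * (gauss_fun ?a x y * (- (?a * (2 * (y - x)))) * cutoff ((y - x) / ?R) + gauss_fun ?a x y * (deriv cutoff ((y - x) / ?R) * (1 / ?R)))"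
    have a: "0 < ?a" by (rule gauss_rate_pos[OF k])
    note mom = gauss_fun_moments[OF a, of x]
    have d: "(?f has_real_derivative ?f' y) (at y)" for y
    proof -
      have "((\<lambda>y. cutoff ((y - x) / ?R)) has_real_derivative deriv cutoff ((y - x) / ?R) * (1 / ?R)) (at y)"
        by (rule DERIV_chain2[OF DERIV_cutoff]) (auto intro!: derivative_eq_intros)
      moreover have "(gauss_fun ?a x has_real_derivative gauss_fun ?a x y * (- (?a * (2 * (y - x))))) (at y)"
        unfolding gauss_fun_def by (auto intro!: derivative_eq_intros)
      ultimately have "((\<lambda>y. time_cutoff t n s * (gauss_fun ?a x y * cutoff ((y - x) / ?R))) has_real_derivative ?f' y) (at y)"
        by (intro DERIV_cmult DERIV_cong[OF DERIV_mult]) (auto simp: algebra_simps)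
      then show ?thesis unfolding test_kernel_def[abs_def] mollified_kernel_def by (simp only: mult.assoc)
    qed
    have c: "continuous_on UNIV ?f'"
    proof -
      have a: "continuous_on UNIV (\<lambda>y. (y - x) / ?R)" by (intro continuous_intros) auto
      have c0: "continuous_on UNIV cutoff" using DERIV_cutoff by (meson DERIV_isCont continuous_at_imp_continuous_on)
      have c1: "continuous_on UNIV (\<lambda>y. deriv cutoff ((y - x) / ?R))"
        by (rule continuous_on_compose2[OF continuous_on_deriv_cutoff a]) simp
      have c2: "continuous_on UNIV (\<lambda>y. cutoff ((y - x) / ?R))" by (rule continuous_on_compose2[OF c0 a]) simp
      have c3: "continuous_on UNIV (\<lambda>y. gauss_fun ?a x y)" unfolding gauss_fun_def by (intro continuous_intros)
      show ?thesis by (intro continuous_on_add continuous_on_mult continuous_on_minus continuous_on_diff continuous_on_const continuous_on_id c1 c2 c3)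
    qed
    have le1: "\<bar>?f y\<bar> \<le> gauss_fun ?a x y" for y
    proof -
      have "\<bar>?f y\<bar> = time_cutoff t n s * gauss_fun ?a x y * cutoff ((y - x) / ?R)"
        by (simp add: test_kernel_def mollified_kernel_def abs_mult time_cutoff_bounds gauss_fun_nonneg[OF a])
      also have "\<dots> \<le> 1 * gauss_fun ?a x y * 1"
        by (intro mult_mono cutoff_le_1 time_cutoff_bounds mult_nonneg_nonneg gauss_fun_nonneg[OF a]) auto
      finally show ?thesis by simp
    qed
    have "(\<integral>y. \<bar>?f y\<bar> \<partial>lborel) \<le> (\<integral>y. gauss_fun ?a x y \<partial>lborel)"
      using mom(1) le1 gauss_fun_nonneg[OF a] by (intro integral_mono') (auto simp: has_bochner_integral_iff)
    also have "\<dots> = 1" using mom(1) by (rule has_bochner_integral_integral_eq)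
    also have "1 \<le> ?C" using A0 B by simp
    finally have 1: "cmod (fourier ?f \<xi>) \<le> ?C" using fourier_norm_le[of ?f \<xi>] by linarith
    have le2: "\<bar>?f' y\<bar> \<le> (?a + B) * gauss_fun ?a x y + ?a * (gauss_fun ?a x y * (y - x)\<^sup>2)" for y
    proof -
      have g: "0 \<le> gauss_fun ?a x y" by (rule gauss_fun_nonneg[OF a])
      have "2 * \<bar>y - x\<bar> \<le> 1 + (y - x)\<^sup>2" using sum_squares_bound[of 1 "\<bar>y - x\<bar>"] by simp
      then have z: "?a * (2 * \<bar>y - x\<bar>) \<le> ?a * (1 + (y - x)\<^sup>2)" using a by (intro mult_left_mono) auto
      have "\<bar>gauss_fun ?a x y * (- (?a * (2 * (y - x)))) * cutoff ((y - x) / ?R)\<bar> = gauss_fun ?a x y * (?a * (2 * \<bar>y - x\<bar>)) * cutoff ((y - x) / ?R)"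
        using g less_imp_le[OF a] by (simp only: abs_mult abs_minus_cancel abs_of_nonneg abs_numeral cutoff_nonneg)
      also have "\<dots> \<le> gauss_fun ?a x y * (?a * (1 + (y - x)\<^sup>2)) * 1"
        using g a z by (intro mult_mono cutoff_le_1 order_refl mult_nonneg_nonneg) auto
      finally have p1: "\<bar>gauss_fun ?a x y * (- (?a * (2 * (y - x)))) * cutoff ((y - x) / ?R)\<bar> \<le> gauss_fun ?a x y * (?a * (1 + (y - x)\<^sup>2))" by simp
      have "\<bar>gauss_fun ?a x y * (deriv cutoff ((y - x) / ?R) * (1 / ?R))\<bar> = gauss_fun ?a x y * (\<bar>deriv cutoff ((y - x) / ?R)\<bar> * (1 / ?R))"
        using g by (simp add: abs_mult)
      also have "\<dots> \<le> gauss_fun ?a x y * (B * 1)"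
        using g B by (intro mult_left_mono mult_mono) auto
      finally have p2: "\<bar>gauss_fun ?a x y * (deriv cutoff ((y - x) / ?R) * (1 / ?R))\<bar> \<le> gauss_fun ?a x y * B" by simp
      have "\<bar>?f' y\<bar> = time_cutoff t n s * \<bar>gauss_fun ?a x y * (- (?a * (2 * (y - x)))) * cutoff ((y - x) / ?R) + gauss_fun ?a x y * (deriv cutoff ((y - x) / ?R) * (1 / ?R))\<bar>"
        unfolding abs_mult[of "time_cutoff t n s"] using time_cutoff_bounds[of t n s] by simp
      also have "\<dots> \<le> 1 * (gauss_fun ?a x y * (?a * (1 + (y - x)\<^sup>2)) + gauss_fun ?a x y * B)"
        by (intro mult_mono time_cutoff_bounds order_trans[OF abs_triangle_ineq] add_mono p1 p2) auto
      finally show ?thesis by (simp add: algebra_simps)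
    qed
    have "\<bar>\<xi>\<bar> * cmod (fourier (\<lambda>y. ?f y) \<xi>) \<le> (\<integral>y. \<bar>?f' y\<bar> \<partial>lborel)"
    proof (rule fourier_derivative_bound[OF d c, where A = "\<bar>x\<bar> + ?R"])
      show "- (\<bar>x\<bar> + ?R) < y \<and> y < \<bar>x\<bar> + ?R" if "?f y \<noteq> 0" for y
        using test_kernel_support(3,4)[OF that] by linarith
    qed simp
    also have "\<dots> \<le> (\<integral>y. (?a + B) * gauss_fun ?a x y + ?a * (gauss_fun ?a x y * (y - x)\<^sup>2) \<partial>lborel)"
      by (rule integral_mono'[OF _ le2])
         (use mom gauss_fun_nonneg[OF a] a B in \<open>auto simp: has_bochner_integral_iff intro!: add_nonneg_nonneg mult_nonneg_nonneg\<close>)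
    also have "\<dots> = (?a + B) * 1 + ?a * (1 / (2 * ?a))"
      by (rule has_bochner_integral_integral_eq, intro has_bochner_integral_add has_bochner_integral_mult_right mom)
    also have "\<dots> \<le> ?C" using a gauss_rate_le[OF k, of t n s] by simp
    finally have 2: "\<bar>\<xi>\<bar> * cmod (fourier ?f \<xi>) \<le> ?C" .
    show ?thesis using freq_boundI[OF 1 2] True by (simp add: fhat_def)
  qed
  then show ?thesis by (intro exI[of _ ?C]) (simp add: split_paired_All)
qed

lemma fhat_test_kernel_tendsto:
  assumes k: "0 < \<kappa>"
  shows "(\<lambda>m. fhat (test_kernel \<kappa> t x n m) p) \<longlonglongrightarrow> fhat (mollified_kernel \<kappa> t x n) p"
  unfolding fhat_def fourier_def
proof (rule integral_dominated_convergence[where w = "\<lambda>y. \<bar>mollified_kernel \<kappa> t x n (fst p) y\<bar>"])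
  note i = mollified_kernel_integrable[OF k, of t x n "fst p"]
  have [measurable]: "cis \<in> borel_measurable borel" by (intro borel_measurable_continuous_onI continuous_intros)
  have [measurable]: "cutoff \<in> borel_measurable borel" unfolding cutoff_def by measurable
  have [measurable]: "mollified_kernel \<kappa> t x n (fst p) \<in> borel_measurable borel" using borel_measurable_integrable[OF i] by simp
  show "integrable lborel (\<lambda>y. \<bar>mollified_kernel \<kappa> t x n (fst p) y\<bar>)" using i by simp
  show "(\<lambda>y. cis (- snd p * y) * complex_of_real (mollified_kernel \<kappa> t x n (fst p) y)) \<in> borel_measurable lborel" by measurable
  show "(\<lambda>y. cis (- snd p * y) * complex_of_real (test_kernel \<kappa> t x n m (fst p) y)) \<in> borel_measurable lborel" for m
    unfolding test_kernel_def by measurable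
  show "AE y in lborel. norm (cis (- snd p * y) * complex_of_real (test_kernel \<kappa> t x n m (fst p) y)) \<le> \<bar>mollified_kernel \<kappa> t x n (fst p) y\<bar>" for m
    using cutoff_le_1 by (intro AE_I2, simp only: norm_cis_mult) (simp add: test_kernel_def abs_mult mult_left_le del: of_nat_Suc)
  have "(\<lambda>m. test_kernel \<kappa> t x n m s y) \<longlonglongrightarrow> mollified_kernel \<kappa> t x n s y" for s y
  proof -
    have "(\<lambda>m. (y - x) * inverse (real (Suc m))) \<longlonglongrightarrow> (y - x) * 0" by (intro tendsto_intros LIMSEQ_inverse_real_of_nat)
    then have "(\<lambda>m. (y - x) / real (Suc m)) \<longlonglongrightarrow> 0" by (simp add: divide_inverse)
    then have "(\<lambda>m. cutoff ((y - x) / real (Suc m))) \<longlonglongrightarrow> cutoff 0"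
      by (rule isCont_tendsto_compose[OF DERIV_isCont[OF DERIV_cutoff]])
    from tendsto_mult[OF tendsto_const this] show ?thesis unfolding test_kernel_def by simp
  qed
  then show "AE y in lborel. (\<lambda>m. cis (- snd p * y) * complex_of_real (test_kernel \<kappa> t x n m (fst p) y)) \<longlonglongrightarrow> cis (- snd p * y) * complex_of_real (mollified_kernel \<kappa> t x n (fst p) y)"
    by (intro AE_I2 tendsto_intros)
qed

lemma test_kernel_tendsto:
  assumes H: "0 < H" "H < 1" and k: "0 < \<kappa>"
  shows "(\<lambda>m. noise_norm2 H (\<lambda>s y. test_kernel \<kappa> t x n m s y - mollified_kernel \<kappa> t x n s y)) \<longlonglongrightarrow> 0"
proof -
  obtain C where C: "\<And>m p. cmod (fhat (test_kernel \<kappa> t x n m) p) \<le> C * (indicator {0<..<t} (fst p) * freq_bound (snd p))"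
    using test_kernel_fourier_bound[OF k] by blast
  \<comment> \<open>The bound is uniform in m and therefore survives the limit; the mollified kernel
    needs no estimate of its own.\<close>
  have C': "cmod (fhat (mollified_kernel \<kappa> t x n) p) \<le> C * (indicator {0<..<t} (fst p) * freq_bound (snd p))" for p
    by (rule LIMSEQ_le_const2[OF tendsto_norm[OF fhat_test_kernel_tendsto[OF k]]]) (use C in blast)
  let ?d = "\<lambda>m s y. test_kernel \<kappa> t x n m s y - mollified_kernel \<kappa> t x n s y"
  have m: "(\<lambda>p. ?d m (fst p) (snd p)) \<in> borel_measurable (borel \<Otimes>\<^sub>M borel)" for m by measurable
  have f: "fhat (?d m) p = fhat (test_kernel \<kappa> t x n m) p - fhat (mollified_kernel \<kappa> t x n) p" for m p
    by (intro fhat_diff mollified_kernel_integrable[OF k] test_function_integrable test_function_test_kernel k)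
  have "(\<lambda>m. \<integral>\<^sup>+p. ennreal ((cmod (fhat (?d m) p))\<^sup>2) \<partial>noise_measure H) \<longlonglongrightarrow> 0"
  proof (rule nn_integral_dominated_zero[where w = "\<lambda>p. (2 * C)\<^sup>2 * (indicator {0<..<t} (fst p) * (freq_bound (snd p))\<^sup>2)"])
    show "(\<lambda>p. (cmod (fhat (?d m) p))\<^sup>2) \<in> borel_measurable (noise_measure H)" for m
      using fhat_measurable[OF m, of m] by measurable
    have "(\<integral>\<^sup>+p. ennreal ((2 * C)\<^sup>2 * (indicator {0<..<t} (fst p) * (freq_bound (snd p))\<^sup>2)) \<partial>noise_measure H)
      = (\<integral>\<^sup>+p. ennreal ((2 * C)\<^sup>2) * ennreal (indicator {0<..<t} (fst p) * (freq_bound (snd p))\<^sup>2) \<partial>noise_measure H)"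
      by (intro nn_integral_cong) (simp only: ennreal_mult' zero_le_power2)
    also have "\<dots> = ennreal ((2 * C)\<^sup>2) * (\<integral>\<^sup>+p. ennreal (indicator {0<..<t} (fst p) * (freq_bound (snd p))\<^sup>2) \<partial>noise_measure H)"
      by (rule nn_integral_cmult) simp
    also have "\<dots> < \<infinity>"
      using nn_integral_freq_bound[OF H, of t] by (simp only: ennreal_mult_less_top infinity_ennreal_def ennreal_less_top simp_thms)
    finally show "(\<integral>\<^sup>+p. ennreal ((2 * C)\<^sup>2 * (indicator {0<..<t} (fst p) * (freq_bound (snd p))\<^sup>2)) \<partial>noise_measure H) < \<infinity>" .
    fix m and p :: "real \<times> real"
    have "cmod (fhat (?d m) p) \<le> cmod (fhat (test_kernel \<kappa> t x n m) p) + cmod (fhat (mollified_kernel \<kappa> t x n) p)"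
      unfolding f by (rule norm_triangle_ineq4)
    also have "\<dots> \<le> (2 * C) * (indicator {0<..<t} (fst p) * freq_bound (snd p))" using C[of m p] C'[of p] by simp
    finally have "(cmod (fhat (?d m) p))\<^sup>2 \<le> ((2 * C) * (indicator {0<..<t} (fst p) * freq_bound (snd p)))\<^sup>2"
      by (intro power_mono) auto
    moreover have "(indicator {0<..<t} a :: real)\<^sup>2 = indicator {0<..<t} a" for a by (simp add: indicator_def)
    ultimately show "(cmod (fhat (?d m) p))\<^sup>2 \<le> (2 * C)\<^sup>2 * (indicator {0<..<t} (fst p) * (freq_bound (snd p))\<^sup>2)"
      by (simp only: power_mult_distrib)
    have "(\<lambda>m. (cmod (fhat (test_kernel \<kappa> t x n m) p - fhat (mollified_kernel \<kappa> t x n) p))\<^sup>2) \<longlonglongrightarrow> (cmod (fhat (mollified_kernel \<kappa> t x n) p - fhat (mollified_kernel \<kappa> t x n) p))\<^sup>2"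
      by (intro tendsto_intros fhat_test_kernel_tendsto[OF k])
    then show "(\<lambda>m. (cmod (fhat (?d m) p))\<^sup>2) \<longlonglongrightarrow> 0" unfolding f by simp
  qed simp
  then show ?thesis unfolding noise_norm2_eq[OF H m] .
qed

lemma noise_norm2_triangle:
  assumes H: "0 < H" "H < 1"
    and [measurable]: "(\<lambda>p. f (fst p) (snd p)) \<in> borel_measurable (borel \<Otimes>\<^sub>M borel)" 
      "(\<lambda>p. g (fst p) (snd p)) \<in> borel_measurable (borel \<Otimes>\<^sub>M borel)" "(\<lambda>p. h (fst p) (snd p)) \<in> borel_measurable (borel \<Otimes>\<^sub>M borel)"
    and i: "\<And>s. integrable lborel (f s)" "\<And>s. integrable lborel (g s)" "\<And>s. integrable lborel (h s)"
  shows "noise_norm2 H (\<lambda>s y. f s y - h s y) \<le> 2 * noise_norm2 H (\<lambda>s y. f s y - g s y) + 2 * noise_norm2 H (\<lambda>s y. g s y - h s y)"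
proof -
  have m: "(\<lambda>p. f (fst p) (snd p) - h (fst p) (snd p)) \<in> borel_measurable (borel \<Otimes>\<^sub>M borel)"
    "(\<lambda>p. f (fst p) (snd p) - g (fst p) (snd p)) \<in> borel_measurable (borel \<Otimes>\<^sub>M borel)"
    "(\<lambda>p. g (fst p) (snd p) - h (fst p) (snd p)) \<in> borel_measurable (borel \<Otimes>\<^sub>M borel)" by measurable
  note fm [measurable] = m[THEN fhat_measurable]
  have "(\<integral>\<^sup>+p. ennreal ((cmod (fhat (\<lambda>s y. f s y - h s y) p))\<^sup>2) \<partial>noise_measure H) 
    \<le> (\<integral>\<^sup>+p. 2 * ennreal ((cmod (fhat (\<lambda>s y. f s y - g s y) p))\<^sup>2) + 2 * ennreal ((cmod (fhat (\<lambda>s y. g s y - h s y) p))\<^sup>2) \<partial>noise_measure H)"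
  proof (rule nn_integral_mono)
    fix p
    have "(cmod (a - c))\<^sup>2 \<le> 2 * (cmod (a - b))\<^sup>2 + 2 * (cmod (b - c))\<^sup>2" for a b c :: complex
    proof -
      have "cmod (a - c) \<le> cmod (a - b) + cmod (b - c)" using norm_triangle_ineq[of "a - b" "b - c"] by simp
      then have "(cmod (a - c))\<^sup>2 \<le> (cmod (a - b) + cmod (b - c))\<^sup>2" by (intro power_mono) auto
      also have "\<dots> \<le> 2 * (cmod (a - b))\<^sup>2 + 2 * (cmod (b - c))\<^sup>2"
        using sum_squares_bound[of "cmod (a - b)" "cmod (b - c)"] by (simp add: power2_sum)
      finally show ?thesis .
    qed
    then have "(cmod (fhat (\<lambda>s y. f s y - h s y) p))\<^sup>2 \<le> 2 * (cmod (fhat (\<lambda>s y. f s y - g s y) p))\<^sup>2 + 2 * (cmod (fhat (\<lambda>s y. g s y - h s y) p))\<^sup>2"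
      unfolding fhat_diff[OF i(1) i(2)] fhat_diff[OF i(1) i(3)] fhat_diff[OF i(2) i(3)] .
    from ennreal_leI[OF this] 
    show "ennreal ((cmod (fhat (\<lambda>s y. f s y - h s y) p))\<^sup>2) \<le> 2 * ennreal ((cmod (fhat (\<lambda>s y. f s y - g s y) p))\<^sup>2) + 2 * ennreal ((cmod (fhat (\<lambda>s y. g s y - h s y) p))\<^sup>2)"
      by (simp add: ennreal_mult)
  qed
  also have "\<dots> = 2 * (\<integral>\<^sup>+p. ennreal ((cmod (fhat (\<lambda>s y. f s y - g s y) p))\<^sup>2) \<partial>noise_measure H) + 2 * (\<integral>\<^sup>+p. ennreal ((cmod (fhat (\<lambda>s y. g s y - h s y) p))\<^sup>2) \<partial>noise_measure H)"
    by (subst nn_integral_add) (simp_all add: nn_integral_cmult)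
  finally show ?thesis unfolding noise_norm2_eq[OF H m(1)] noise_norm2_eq[OF H m(2)] noise_norm2_eq[OF H m(3)] .
qed

text \<open>\<open>is_stoch_conv\<close> constrains u only along sequences of test functions that
  approximate the kernel, so it has content only once such a sequence exists. The symmetry and the
  support of this sequence make the limit orthogonal to odd and to future test functions.\<close>

lemma conv_kernel_approximation:
  assumes H: "0 < H" "H < 1" and k: "0 < \<kappa>" and t: "0 \<le> t"
  shows "\<exists>\<phi>. (\<forall>n::nat. test_function (\<phi> n) \<and> (\<forall>s y. \<phi> n s (2 * x - y) = \<phi> n s y) \<and> (\<forall>s y. \<phi> n s y \<noteq> 0 \<longrightarrow> s < t))
     \<and> (\<lambda>n. noise_norm2 H (\<lambda>s y. \<phi> n s y - conv_kernel \<kappa> t x s y)) \<longlonglongrightarrow> 0"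
proof -
  \<comment> \<open>Diagonal sequence: to each n belongs an m whose truncation error is below
    1/(n+1).\<close>
  have "\<exists>m. noise_norm2 H (\<lambda>s y. test_kernel \<kappa> t x n m s y - mollified_kernel \<kappa> t x n s y) < ennreal (1 / real (Suc n))" for n
    using order_tendstoD(2)[OF test_kernel_tendsto[OF H k, of t x n], of "ennreal (1 / real (Suc n))"]
    by (auto dest!: eventually_happens)
  then obtain m where m: "\<And>n. noise_norm2 H (\<lambda>s y. test_kernel \<kappa> t x n (m n) s y - mollified_kernel \<kappa> t x n s y) < ennreal (1 / real (Suc n))"
    by metis
  let ?\<phi> = "\<lambda>n. test_kernel \<kappa> t x n (m n)"
  have b: "noise_norm2 H (\<lambda>s y. ?\<phi> n s y - conv_kernel \<kappa> t x s y)
     \<le> 2 * ennreal (1 / real (Suc n)) + 2 * noise_norm2 H (\<lambda>s y. mollified_kernel \<kappa> t x n s y - conv_kernel \<kappa> t x s y)" for n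
  proof -
    have "noise_norm2 H (\<lambda>s y. ?\<phi> n s y - conv_kernel \<kappa> t x s y)
     \<le> 2 * noise_norm2 H (\<lambda>s y. ?\<phi> n s y - mollified_kernel \<kappa> t x n s y) + 2 * noise_norm2 H (\<lambda>s y. mollified_kernel \<kappa> t x n s y - conv_kernel \<kappa> t x s y)"
      by (rule noise_norm2_triangle[OF H]) 
         (simp_all add: test_function_integrable test_function_test_kernel[OF k] mollified_kernel_integrable[OF k] conv_kernel_integrable[OF k])
    also have "\<dots> \<le> 2 * ennreal (1 / real (Suc n)) + 2 * noise_norm2 H (\<lambda>s y. mollified_kernel \<kappa> t x n s y - conv_kernel \<kappa> t x s y)"
      by (intro add_mono mult_left_mono less_imp_le[OF m]) auto
    finally show ?thesis .
  qed
  have inv: "(\<lambda>n. 1 / real (Suc n)) \<longlonglongrightarrow> 0" using LIMSEQ_inverse_real_of_nat by (simp add: inverse_eq_divide)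
  have "(\<lambda>n. 2 * ennreal (1 / real (Suc n)) + 2 * noise_norm2 H (\<lambda>s y. mollified_kernel \<kappa> t x n s y - conv_kernel \<kappa> t x s y)) \<longlonglongrightarrow> 2 * ennreal 0 + 2 * 0"
    by (intro tendsto_add ennreal_tendsto_cmult tendsto_ennrealI inv mollified_kernel_tendsto[OF H k t]) auto
  then have l: "(\<lambda>n. 2 * ennreal (1 / real (Suc n)) + 2 * noise_norm2 H (\<lambda>s y. mollified_kernel \<kappa> t x n s y - conv_kernel \<kappa> t x s y)) \<longlonglongrightarrow> 0" by simp
  have "(\<lambda>n. noise_norm2 H (\<lambda>s y. ?\<phi> n s y - conv_kernel \<kappa> t x s y)) \<longlonglongrightarrow> 0"
    by (rule tendsto_sandwich[OF _ _ tendsto_const l]) (use b in auto)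
  then show ?thesis
    by (intro exI[of _ ?\<phi>]) (auto simp: test_function_test_kernel[OF k] test_kernel_even dest: test_kernel_support)
qed

section \<open>The stochastic convolution and its increments\<close>

locale stoch_conv = prob_space M for M :: "'a measure" +
  fixes H \<kappa> :: real
    and W :: "(real \<Rightarrow> real \<Rightarrow> real) \<Rightarrow> 'a \<Rightarrow> real"
    and u :: "real \<Rightarrow> real \<Rightarrow> 'a \<Rightarrow> real"
  assumes H: "0 < H" "H < 1" and k: "0 < \<kappa>"
    and noise: "is_noise M H W" and conv: "is_stoch_conv M H \<kappa> W u"
begin

definition noise_span :: "('a \<Rightarrow> real) set" where
  "noise_span = {\<lambda>\<omega>. \<Sum>i\<in>J. c i * W i \<omega> | J c. finite J \<and> J \<subseteq> {\<phi>. test_function \<phi>}}"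

abbreviation "GS \<equiv> L2_closure M noise_span"

lemma gaussian_space_noise_span: "gaussian_space M noise_span"
  unfolding noise_span_def using noise by (intro gaussian_space_span) (auto simp: is_noise_def)

lemma noise_in_span: "test_function \<phi> \<Longrightarrow> W \<phi> \<in> noise_span"
  unfolding noise_span_def by (intro CollectI exI[of _ "{\<phi>}"] exI[of _ "\<lambda>_. 1"]) auto

lemma noise_sq_int: "test_function \<phi> \<Longrightarrow> sq_int M (W \<phi>)"
  by (rule gaussian_spaceD(2)[OF gaussian_space_noise_span noise_in_span])

lemma noise_cov:
  assumes "test_function \<phi>" "test_function \<psi>"
  shows "complex_of_real (expectation (\<lambda>\<omega>. W \<phi> \<omega> * W \<psi> \<omega>)) = noise_inner H \<phi> \<psi>"
  using noise assms unfolding is_noise_def by blast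

text \<open>The isometry for differences. \<open>is_noise\<close> gives covariances but no linearity
  of W in the test function, so the square is expanded into four inner products that recombine to |a
  - b|^2.\<close>

lemma noise_msq_diff:
  assumes t: "test_function \<phi>" "test_function \<psi>"
  shows "integrable (noise_measure H) (\<lambda>p. (cmod (fhat \<phi> p - fhat \<psi> p))\<^sup>2)"
    and "msq M (\<lambda>\<omega>. W \<phi> \<omega> - W \<psi> \<omega>) = (\<integral>p. (cmod (fhat \<phi> p - fhat \<psi> p))\<^sup>2 \<partial>noise_measure H)"
proof -
  let ?N = "noise_measure H"
  note f1 = test_function_fhat_integrable[OF H t(1)] and f2 = test_function_fhat_integrable[OF H t(2)]
  have m: "fhat \<phi> \<in> borel_measurable ?N" "fhat \<psi> \<in> borel_measurable ?N" using f1(1) f2(1) by auto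
  note i = integrable_mult_cnj[OF m(1) m(1) f1(2) f1(2)] integrable_mult_cnj[OF m(1) m(2) f1(2) f2(2)]
    integrable_mult_cnj[OF m(2) m(1) f2(2) f1(2)] integrable_mult_cnj[OF m(2) m(2) f2(2) f2(2)]
  let ?g = "\<lambda>p. (fhat \<phi> p * cnj (fhat \<phi> p) - fhat \<phi> p * cnj (fhat \<psi> p)) - (fhat \<psi> p * cnj (fhat \<phi> p) - fhat \<psi> p * cnj (fhat \<psi> p))"
  have g: "?g p = complex_of_real ((cmod (fhat \<phi> p - fhat \<psi> p))\<^sup>2)" for p
    unfolding complex_norm_square complex_cnj_diff by (simp add: algebra_simps)
  have ig: "integrable ?N ?g" by (intro Bochner_Integration.integrable_diff i)
  show i': "integrable ?N (\<lambda>p. (cmod (fhat \<phi> p - fhat \<psi> p))\<^sup>2)"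
    using ig unfolding g complex_of_real_integrable_eq .
  have "complex_of_real (msq M (\<lambda>\<omega>. W \<phi> \<omega> - W \<psi> \<omega>)) = complex_of_real (msq M (W \<phi>) + msq M (W \<psi>) - 2 * expectation (\<lambda>\<omega>. W \<phi> \<omega> * W \<psi> \<omega>))"
    using msq_lin[OF noise_sq_int[OF t(1)] noise_sq_int[OF t(2)], of 1 "-1"] by simp
  also have "\<dots> = (noise_inner H \<phi> \<phi> - noise_inner H \<phi> \<psi>) - (noise_inner H \<psi> \<phi> - noise_inner H \<psi> \<psi>)"
    unfolding noise_cov[OF t(1) t(1), symmetric] noise_cov[OF t(2) t(2), symmetric] noise_cov[OF t, symmetric] noise_cov[OF t(2) t(1), symmetric]
    by (simp add: power2_eq_square mult.commute)
  also have "\<dots> = (\<integral>p. ?g p \<partial>?N)"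
    unfolding noise_inner_eq[OF H t(1) t(1)] noise_inner_eq[OF H t(2) t(2)] noise_inner_eq[OF H t] noise_inner_eq[OF H t(2) t(1)]
    by (simp only: Bochner_Integration.integral_diff Bochner_Integration.integrable_diff i)
  also have "\<dots> = complex_of_real (\<integral>p. (cmod (fhat \<phi> p - fhat \<psi> p))\<^sup>2 \<partial>?N)"
    unfolding g by (rule integral_complex_of_real)
  finally show "msq M (\<lambda>\<omega>. W \<phi> \<omega> - W \<psi> \<omega>) = (\<integral>p. (cmod (fhat \<phi> p - fhat \<psi> p))\<^sup>2 \<partial>?N)"
    unfolding of_real_eq_iff .
qed

lemma noise_norm2_minus_kernel:
  assumes "test_function \<phi>"
  shows "noise_norm2 H (\<lambda>s y. \<phi> s y - conv_kernel \<kappa> t x s y) = (\<integral>\<^sup>+p. ennreal ((cmod (fhat \<phi> p - fhat (conv_kernel \<kappa> t x) p))\<^sup>2) \<partial>noise_measure H)"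
proof -
  have [measurable]: "(\<lambda>p. \<phi> (fst p) (snd p)) \<in> borel_measurable (borel \<Otimes>\<^sub>M borel)" by (rule test_function_measurable[OF assms])
  have "(\<lambda>p. \<phi> (fst p) (snd p) - conv_kernel \<kappa> t x (fst p) (snd p)) \<in> borel_measurable (borel \<Otimes>\<^sub>M borel)" by measurable
  then show ?thesis
    using fhat_diff[OF test_function_integrable[OF assms] conv_kernel_integrable[OF k]]
    by (subst noise_norm2_eq[OF H]) simp_all
qed

lemma u_sq_int: "0 \<le> t \<Longrightarrow> sq_int M (u t x)"
  using conv unfolding is_stoch_conv_def sq_int_def by blast

lemma u_approximation:
  assumes "0 \<le> t"
  obtains \<phi> :: "nat \<Rightarrow> real \<Rightarrow> real \<Rightarrow> real"
  where "\<And>n. test_function (\<phi> n)" "\<And>n s y. \<phi> n s (2 * x - y) = \<phi> n s y" "\<And>n s y. \<phi> n s y \<noteq> 0 \<Longrightarrow> s < t"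
    "(\<lambda>n. \<integral>\<^sup>+p. ennreal ((cmod (fhat (\<phi> n) p - fhat (conv_kernel \<kappa> t x) p))\<^sup>2) \<partial>noise_measure H) \<longlonglongrightarrow> 0"
    "(\<lambda>n. msq M (\<lambda>\<omega>. W (\<phi> n) \<omega> - u t x \<omega>)) \<longlonglongrightarrow> 0"
proof -
  obtain \<phi> :: "nat \<Rightarrow> real \<Rightarrow> real \<Rightarrow> real" where p: "\<And>n. test_function (\<phi> n)" "\<And>n s y. \<phi> n s (2 * x - y) = \<phi> n s y" "\<And>n s y. \<phi> n s y \<noteq> 0 \<Longrightarrow> s < t"
    and l: "(\<lambda>n. noise_norm2 H (\<lambda>s y. \<phi> n s y - conv_kernel \<kappa> t x s y)) \<longlonglongrightarrow> 0"
    using conv_kernel_approximation[OF H k assms, of x] by blast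
  have "(\<lambda>n. msq M (\<lambda>\<omega>. W (\<phi> n) \<omega> - u t x \<omega>)) \<longlonglongrightarrow> 0"
    using conv p(1) l assms unfolding is_stoch_conv_def by blast
  with p l show ?thesis
    by (intro that[of \<phi>]) (auto simp: noise_norm2_minus_kernel)
qed

lemma u_in_GS:
  assumes "0 \<le> t" shows "u t x \<in> GS"
proof -
  obtain \<phi> where p: "\<And>n. test_function (\<phi> n)" and l: "(\<lambda>n. msq M (\<lambda>\<omega>. W (\<phi> n) \<omega> - u t x \<omega>)) \<longlonglongrightarrow> 0"
    by (rule u_approximation[OF assms, of x]) blast
  show ?thesis by (rule L2_closureI[OF u_sq_int[OF assms] noise_in_span[OF p] l])
qed

lemma u_orthogonal_odd:
  assumes "0 \<le> t" "test_function \<psi>" "\<And>s y. \<psi> s (2 * x - y) = - \<psi> s y"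
  shows "expectation (\<lambda>\<omega>. u t x \<omega> * W \<psi> \<omega>) = 0"
proof -
  obtain \<phi> where p: "\<And>n. test_function (\<phi> n)" "\<And>n s y. \<phi> n s (2 * x - y) = \<phi> n s y" and l: "(\<lambda>n. msq M (\<lambda>\<omega>. W (\<phi> n) \<omega> - u t x \<omega>)) \<longlonglongrightarrow> 0"
    by (rule u_approximation[OF assms(1), of x]) blast
  have "noise_inner H \<psi> (\<phi> n) = 0" for n
    using noise_inner_even_odd[of "\<phi> n" x \<psi> H, OF p(2) assms(3)] noise_cov[OF p(1) assms(2), of n] noise_cov[OF assms(2) p(1), of n]
    by (simp add: mult.commute)
  then have z: "expectation (\<lambda>\<omega>. W \<psi> \<omega> * W (\<phi> n) \<omega>) = 0" for n
    using noise_cov[OF assms(2) p(1), of n] by simp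
  have "(\<lambda>n. expectation (\<lambda>\<omega>. W \<psi> \<omega> * W (\<phi> n) \<omega>)) \<longlonglongrightarrow> expectation (\<lambda>\<omega>. W \<psi> \<omega> * u t x \<omega>)"
    by (rule inner_tendsto[OF noise_sq_int[OF p(1)] u_sq_int[OF assms(1)] l noise_sq_int[OF assms(2)]])
  then show ?thesis unfolding z by (simp add: LIMSEQ_const_iff mult.commute)
qed

lemma u_orthogonal_future:
  assumes "0 \<le> t" "test_function \<psi>" "\<And>s y. \<psi> s y \<noteq> 0 \<Longrightarrow> t \<le> s"
  shows "expectation (\<lambda>\<omega>. u t x \<omega> * W \<psi> \<omega>) = 0"
proof -
  obtain \<phi> where p: "\<And>n. test_function (\<phi> n)" "\<And>n s y. \<phi> n s y \<noteq> 0 \<Longrightarrow> s < t" and l: "(\<lambda>n. msq M (\<lambda>\<omega>. W (\<phi> n) \<omega> - u t x \<omega>)) \<longlonglongrightarrow> 0"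
    by (rule u_approximation[OF assms(1), of x]) blast
  have "\<psi> s = (\<lambda>_. 0) \<or> \<phi> n s = (\<lambda>_. 0)" for n s
    using assms(3)[of s] p(2)[of n s] by (metis leD)
  then have "noise_inner H \<psi> (\<phi> n) = 0" for n by (rule noise_inner_disjoint)
  then have z: "expectation (\<lambda>\<omega>. W \<psi> \<omega> * W (\<phi> n) \<omega>) = 0" for n
    using noise_cov[OF assms(2) p(1), of n] by simp
  have "(\<lambda>n. expectation (\<lambda>\<omega>. W \<psi> \<omega> * W (\<phi> n) \<omega>)) \<longlonglongrightarrow> expectation (\<lambda>\<omega>. W \<psi> \<omega> * u t x \<omega>)"
    by (rule inner_tendsto[OF noise_sq_int[OF p(1)] u_sq_int[OF assms(1)] l noise_sq_int[OF assms(2)]])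
  then show ?thesis unfolding z by (simp add: LIMSEQ_const_iff mult.commute)
qed

section \<open>Variances of the increments of u in time and in space\<close>

lemma fhat_kernel_measurable [measurable]: "fhat (conv_kernel \<kappa> t x) \<in> borel_measurable (borel \<Otimes>\<^sub>M borel)"
  by measurable

lemma norm_fhat_kernel:
  "(cmod (fhat (conv_kernel \<kappa> t x) p))\<^sup>2 = indicator {0<..<t} (fst p) * exp (- (\<kappa> * (t - fst p) * (snd p)\<^sup>2))"
proof -
  have e: "(exp (- (a / 2)))\<^sup>2 = exp (- a)" for a :: real by (simp add: power2_eq_square exp_add[symmetric])
  have "cmod (fhat (conv_kernel \<kappa> t x) (s, \<xi>)) = indicator {0<..<t} s * exp (- (\<kappa> * (t - s) * \<xi>\<^sup>2 / 2))" for s \<xi>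
    unfolding fhat_conv_kernel[OF k] by (simp add: norm_mult del: of_real_mult)
  then have "(cmod (fhat (conv_kernel \<kappa> t x) (s, \<xi>)))\<^sup>2 = indicator {0<..<t} s * exp (- (\<kappa> * (t - s) * \<xi>\<^sup>2))" for s \<xi>
    by (simp add: power_mult_distrib e) (simp add: indicator_def)
  from this[of "fst p" "snd p"] show ?thesis by simp
qed

lemma integrable_kernel_energy:
  assumes "0 \<le> t" "t \<le> r"
  shows "has_bochner_integral (noise_measure H) (\<lambda>p. indicator {0<..<t} (fst p) * exp (- (\<kappa> * (r - fst p) * (snd p)\<^sup>2)))
    (c1H H * Gamma (1 - H) * \<kappa> powr (H - 1) * ((r powr H - (r - t) powr H) / H))"
proof (rule has_bochner_integral_nn_integral[OF _ _ _ nn_integral_kernel_energy[OF H k assms]])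
  show "0 \<le> c1H H * Gamma (1 - H) * \<kappa> powr (H - 1) * ((r powr H - (r - t) powr H) / H)"
    using c1H_pos[OF H] H assms by (intro mult_nonneg_nonneg divide_nonneg_nonneg) (auto simp: Gamma_real_nonneg powr_mono2)
qed auto

text \<open>The isometry for test functions passes to the limit along approximating sequences for
  the two points. The same numbers converge to the left side by convergence in L2(M) and to the
  right side by convergence in L2 of the noise measure.\<close>

lemma u_increment:
  assumes t: "0 \<le> t" "0 \<le> t'"
  shows "ennreal (msq M (\<lambda>\<omega>. u t x \<omega> - u t' x' \<omega>)) = (\<integral>\<^sup>+p. ennreal ((cmod (fhat (conv_kernel \<kappa> t x) p - fhat (conv_kernel \<kappa> t' x') p))\<^sup>2) \<partial>noise_measure H)"
proof -
  let ?N = "noise_measure H"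
  obtain \<phi> where p: "\<And>n. test_function (\<phi> n)" and nl: "(\<lambda>n. \<integral>\<^sup>+p. ennreal ((cmod (fhat (\<phi> n) p - fhat (conv_kernel \<kappa> t x) p))\<^sup>2) \<partial>?N) \<longlonglongrightarrow> 0"
    and l: "(\<lambda>n. msq M (\<lambda>\<omega>. W (\<phi> n) \<omega> - u t x \<omega>)) \<longlonglongrightarrow> 0"
    by (rule u_approximation[OF t(1), of x]) blast
  obtain \<phi>' where p': "\<And>n. test_function (\<phi>' n)" and nl': "(\<lambda>n. \<integral>\<^sup>+p. ennreal ((cmod (fhat (\<phi>' n) p - fhat (conv_kernel \<kappa> t' x') p))\<^sup>2) \<partial>?N) \<longlonglongrightarrow> 0"
    and l': "(\<lambda>n. msq M (\<lambda>\<omega>. W (\<phi>' n) \<omega> - u t' x' \<omega>)) \<longlonglongrightarrow> 0"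
    by (rule u_approximation[OF t(2), of x']) blast
  let ?f = "\<lambda>n p. fhat (\<phi> n) p - fhat (\<phi>' n) p"
  let ?k = "\<lambda>p. fhat (conv_kernel \<kappa> t x) p - fhat (conv_kernel \<kappa> t' x') p"
  have [measurable]: "fhat (\<phi> n) \<in> borel_measurable (borel \<Otimes>\<^sub>M borel)" "fhat (\<phi>' n) \<in> borel_measurable (borel \<Otimes>\<^sub>M borel)" for n
    by (rule test_function_fhat_integrable(1)[OF H p] test_function_fhat_integrable(1)[OF H p'])+
  have sqf: "sq_int ?N (\<lambda>p. cmod (?f n p))" for n
    unfolding sq_int_def using noise_msq_diff(1)[OF p p', of n n] by simp
  have sqk: "sq_int ?N (\<lambda>p. cmod (fhat (conv_kernel \<kappa> t x) p))" if "0 \<le> t" for t x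
    unfolding sq_int_def norm_fhat_kernel using integrable_kernel_energy[OF that order_refl] by (simp add: has_bochner_integral_iff)
  have bound: "(cmod (a + b))\<^sup>2 \<le> 2 * (cmod a)\<^sup>2 + 2 * (cmod b)\<^sup>2" for a b :: complex
  proof -
    have "(cmod (a + b))\<^sup>2 \<le> (cmod a + cmod b)\<^sup>2" by (intro power_mono norm_triangle_ineq) auto
    also have "\<dots> \<le> 2 * (cmod a)\<^sup>2 + 2 * (cmod b)\<^sup>2"
      using sum_squares_bound[of "cmod a" "cmod b"] by (simp add: power2_sum)
    finally show ?thesis .
  qed
  have ik: "integrable ?N (\<lambda>p. (cmod (?k p))\<^sup>2)"
  proof (rule Bochner_Integration.integrable_bound)
    show "integrable ?N (\<lambda>p. 2 * (cmod (fhat (conv_kernel \<kappa> t x) p))\<^sup>2 + 2 * (cmod (fhat (conv_kernel \<kappa> t' x') p))\<^sup>2)"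
      using sqk[OF t(1), of x] sqk[OF t(2), of x'] unfolding sq_int_def by auto
    show "AE p in ?N. norm ((cmod (?k p))\<^sup>2) \<le> norm (2 * (cmod (fhat (conv_kernel \<kappa> t x) p))\<^sup>2 + 2 * (cmod (fhat (conv_kernel \<kappa> t' x') p))\<^sup>2)"
      using bound[of "fhat (conv_kernel \<kappa> t x) _" "- fhat (conv_kernel \<kappa> t' x') _"] by (intro AE_I2) simp
  qed simp
  then have sk: "sq_int ?N (\<lambda>p. cmod (?k p))" unfolding sq_int_def by simp
  have "(\<lambda>n. \<integral>\<^sup>+p. ennreal ((cmod (?f n p - ?k p))\<^sup>2) \<partial>?N) \<longlonglongrightarrow> 0"
  proof (rule tendsto_sandwich[OF _ _ tendsto_const])
    show "\<forall>\<^sub>F n in sequentially. (\<integral>\<^sup>+p. ennreal ((cmod (?f n p - ?k p))\<^sup>2) \<partial>?N) \<le>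
       2 * (\<integral>\<^sup>+p. ennreal ((cmod (fhat (\<phi> n) p - fhat (conv_kernel \<kappa> t x) p))\<^sup>2) \<partial>?N) + 2 * (\<integral>\<^sup>+p. ennreal ((cmod (fhat (\<phi>' n) p - fhat (conv_kernel \<kappa> t' x') p))\<^sup>2) \<partial>?N)"
    proof (rule always_eventually, rule allI)
      fix n
      have "(\<integral>\<^sup>+p. ennreal ((cmod (?f n p - ?k p))\<^sup>2) \<partial>?N) \<le> (\<integral>\<^sup>+p. 2 * ennreal ((cmod (fhat (\<phi> n) p - fhat (conv_kernel \<kappa> t x) p))\<^sup>2) + 2 * ennreal ((cmod (fhat (\<phi>' n) p - fhat (conv_kernel \<kappa> t' x') p))\<^sup>2) \<partial>?N)"
      proof (rule nn_integral_mono)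
        fix p
        have e: "?f n p - ?k p = (fhat (\<phi> n) p - fhat (conv_kernel \<kappa> t x) p) + - (fhat (\<phi>' n) p - fhat (conv_kernel \<kappa> t' x') p)" by simp
        have "(cmod (?f n p - ?k p))\<^sup>2 \<le> 2 * (cmod (fhat (\<phi> n) p - fhat (conv_kernel \<kappa> t x) p))\<^sup>2 + 2 * (cmod (fhat (\<phi>' n) p - fhat (conv_kernel \<kappa> t' x') p))\<^sup>2"
          unfolding e using bound[of "fhat (\<phi> n) p - fhat (conv_kernel \<kappa> t x) p" "- (fhat (\<phi>' n) p - fhat (conv_kernel \<kappa> t' x') p)"] by (simp only: norm_minus_cancel)
        from ennreal_leI[OF this] show "ennreal ((cmod (?f n p - ?k p))\<^sup>2) \<le> 2 * ennreal ((cmod (fhat (\<phi> n) p - fhat (conv_kernel \<kappa> t x) p))\<^sup>2) + 2 * ennreal ((cmod (fhat (\<phi>' n) p - fhat (conv_kernel \<kappa> t' x') p))\<^sup>2)"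
          by (simp add: ennreal_mult)
      qed
      also have "\<dots> = 2 * (\<integral>\<^sup>+p. ennreal ((cmod (fhat (\<phi> n) p - fhat (conv_kernel \<kappa> t x) p))\<^sup>2) \<partial>?N) + 2 * (\<integral>\<^sup>+p. ennreal ((cmod (fhat (\<phi>' n) p - fhat (conv_kernel \<kappa> t' x') p))\<^sup>2) \<partial>?N)"
        by (subst nn_integral_add) (simp_all add: nn_integral_cmult)
      finally show "(\<integral>\<^sup>+p. ennreal ((cmod (?f n p - ?k p))\<^sup>2) \<partial>?N) \<le>
       2 * (\<integral>\<^sup>+p. ennreal ((cmod (fhat (\<phi> n) p - fhat (conv_kernel \<kappa> t x) p))\<^sup>2) \<partial>?N) + 2 * (\<integral>\<^sup>+p. ennreal ((cmod (fhat (\<phi>' n) p - fhat (conv_kernel \<kappa> t' x') p))\<^sup>2) \<partial>?N)" .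
    qed
    have "(\<lambda>n. 2 * (\<integral>\<^sup>+p. ennreal ((cmod (fhat (\<phi> n) p - fhat (conv_kernel \<kappa> t x) p))\<^sup>2) \<partial>?N) + 2 * (\<integral>\<^sup>+p. ennreal ((cmod (fhat (\<phi>' n) p - fhat (conv_kernel \<kappa> t' x') p))\<^sup>2) \<partial>?N)) \<longlonglongrightarrow> 2 * 0 + 2 * 0"
      by (intro tendsto_add ennreal_tendsto_cmult nl nl') auto
    then show "(\<lambda>n. 2 * (\<integral>\<^sup>+p. ennreal ((cmod (fhat (\<phi> n) p - fhat (conv_kernel \<kappa> t x) p))\<^sup>2) \<partial>?N) + 2 * (\<integral>\<^sup>+p. ennreal ((cmod (fhat (\<phi>' n) p - fhat (conv_kernel \<kappa> t' x') p))\<^sup>2) \<partial>?N)) \<longlonglongrightarrow> 0" by simp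
  qed simp
  note d0 = this
  \<comment> \<open>Only moduli are compared, through the reverse triangle inequality, so the
    real-valued \<open>msq_tendsto\<close> can be used on the noise measure as well.\<close>
  have "(\<lambda>n. msq ?N (\<lambda>p. cmod (?f n p) - cmod (?k p))) \<longlonglongrightarrow> 0"
  proof -
    have le: "ennreal (msq ?N (\<lambda>p. cmod (?f n p) - cmod (?k p))) \<le> (\<integral>\<^sup>+p. ennreal ((cmod (?f n p - ?k p))\<^sup>2) \<partial>?N)" for n
    proof -
      have "integrable ?N (\<lambda>p. (cmod (?f n p) - cmod (?k p))\<^sup>2)" using sq_int_diff[OF sqf sk] by (simp add: sq_int_def)
      then have "ennreal (msq ?N (\<lambda>p. cmod (?f n p) - cmod (?k p))) = (\<integral>\<^sup>+p. ennreal ((cmod (?f n p) - cmod (?k p))\<^sup>2) \<partial>?N)"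
        by (intro nn_integral_eq_integral[symmetric]) auto
      also have "\<dots> \<le> (\<integral>\<^sup>+p. ennreal ((cmod (?f n p - ?k p))\<^sup>2) \<partial>?N)"
      proof (intro nn_integral_mono ennreal_leI)
        fix p
        have "\<bar>cmod (?f n p) - cmod (?k p)\<bar> \<le> cmod (?f n p - ?k p)" by (rule norm_triangle_ineq3)
        then show "(cmod (?f n p) - cmod (?k p))\<^sup>2 \<le> (cmod (?f n p - ?k p))\<^sup>2" by (metis abs_ge_zero power2_abs power_mono)
      qed
      finally show ?thesis .
    qed
    have "(\<lambda>n. ennreal (msq ?N (\<lambda>p. cmod (?f n p) - cmod (?k p)))) \<longlonglongrightarrow> 0"
      by (rule tendsto_sandwich[OF _ _ tendsto_const d0]) (use le in auto)
    then show ?thesis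
      using tendsto_ennreal_iff[of "\<lambda>n. msq ?N (\<lambda>p. cmod (?f n p) - cmod (?k p))" sequentially 0] by simp
  qed
  from msq_tendsto[OF sqf sk this]
  have 1: "(\<lambda>n. msq M (\<lambda>\<omega>. W (\<phi> n) \<omega> - W (\<phi>' n) \<omega>)) \<longlonglongrightarrow> (\<integral>p. (cmod (?k p))\<^sup>2 \<partial>?N)"
    unfolding noise_msq_diff(2)[OF p p'] .
  have s: "sq_int M (\<lambda>\<omega>. W (\<phi> n) \<omega> - W (\<phi>' n) \<omega>)" for n by (intro sq_int_diff noise_sq_int p p')
  have s': "sq_int M (\<lambda>\<omega>. u t x \<omega> - u t' x' \<omega>)" by (intro sq_int_diff u_sq_int t)
  have a: "sq_int M (\<lambda>\<omega>. W (\<phi> n) \<omega> - u t x \<omega>)" "sq_int M (\<lambda>\<omega>. (-1) * (W (\<phi>' n) \<omega> - u t' x' \<omega>))" for n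
    using sq_int_lin[OF sq_int_diff[OF noise_sq_int[OF p', of n] u_sq_int[OF t(2), of x']] sq_int_diff[OF noise_sq_int[OF p', of n] u_sq_int[OF t(2), of x']], of "-1" 0]
    by (auto intro!: sq_int_diff noise_sq_int u_sq_int p t)
  have l2: "(\<lambda>n. 2 * msq M (\<lambda>\<omega>. W (\<phi> n) \<omega> - u t x \<omega>) + 2 * msq M (\<lambda>\<omega>. W (\<phi>' n) \<omega> - u t' x' \<omega>)) \<longlonglongrightarrow> 2 * 0 + 2 * 0"
    by (intro tendsto_intros l l')
  have "(\<lambda>n. msq M (\<lambda>\<omega>. (W (\<phi> n) \<omega> - W (\<phi>' n) \<omega>) - (u t x \<omega> - u t' x' \<omega>))) \<longlonglongrightarrow> 0"
  proof (rule tendsto_zero_bound[OF l2])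
    fix n
    have e: "(W (\<phi> n) \<omega> - W (\<phi>' n) \<omega>) - (u t x \<omega> - u t' x' \<omega>) = (W (\<phi> n) \<omega> - u t x \<omega>) + (-1) * (W (\<phi>' n) \<omega> - u t' x' \<omega>)" for \<omega> by simp
    show "msq M (\<lambda>\<omega>. (W (\<phi> n) \<omega> - W (\<phi>' n) \<omega>) - (u t x \<omega> - u t' x' \<omega>)) \<le> 2 * msq M (\<lambda>\<omega>. W (\<phi> n) \<omega> - u t x \<omega>) + 2 * msq M (\<lambda>\<omega>. W (\<phi>' n) \<omega> - u t' x' \<omega>)"
      unfolding e using msq_add_le[OF a, of n n] by (simp only: power_mult_distrib power2_minus one_power2 mult_1)
  qed simp_all
  from msq_tendsto[OF s s' this]
  have 2: "(\<lambda>n. msq M (\<lambda>\<omega>. W (\<phi> n) \<omega> - W (\<phi>' n) \<omega>)) \<longlonglongrightarrow> msq M (\<lambda>\<omega>. u t x \<omega> - u t' x' \<omega>)" .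
  have "msq M (\<lambda>\<omega>. u t x \<omega> - u t' x' \<omega>) = (\<integral>p. (cmod (?k p))\<^sup>2 \<partial>?N)" by (rule LIMSEQ_unique[OF 2 1])
  then show ?thesis using nn_integral_eq_integral[OF ik] by simp
qed

lemma u_time_increment:
  assumes t: "0 \<le> t'" "t' \<le> t"
  shows "msq M (\<lambda>\<omega>. u t x \<omega> - u t' x \<omega>) = (C1 H \<kappa>)\<^sup>2 * ((t - t') powr H - ((t + t') powr H - ((2 * t) powr H + (2 * t') powr H) / 2))"
proof -
  let ?N = "noise_measure H"
  let ?K = "c1H H * Gamma (1 - H) * \<kappa> powr (H - 1)"
  let ?e = "\<lambda>T r p. indicator {0<..<T} (fst p) * exp (- (\<kappa> * (r - fst p) * (snd p)\<^sup>2)) :: real"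
  let ?r = "(t + t') / 2"
  have eq: "(cmod (fhat (conv_kernel \<kappa> t x) p - fhat (conv_kernel \<kappa> t' x) p))\<^sup>2 = ?e t t p + ?e t' t' p - 2 * ?e t' ?r p" for p
  proof -
    obtain s \<xi> where p: "p = (s, \<xi>)" by (cases p)
    let ?a = "exp (- (\<kappa> * (t - s) * \<xi>\<^sup>2 / 2))" and ?b = "exp (- (\<kappa> * (t' - s) * \<xi>\<^sup>2 / 2))"
    have ee: "(exp (- (a / 2)))\<^sup>2 = exp (- a)" for a :: real by (simp add: power2_eq_square exp_add[symmetric])
    have ab: "?a * ?b = exp (- (\<kappa> * (?r - s) * \<xi>\<^sup>2))" unfolding exp_add[symmetric] by (rule arg_cong[where f = exp]) (simp add: field_simps)
    have "fhat (conv_kernel \<kappa> t x) p - fhat (conv_kernel \<kappa> t' x) p = cis (- \<xi> * x) * complex_of_real (indicator {0<..<t} s * ?a - indicator {0<..<t'} s * ?b)"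
      unfolding p fhat_conv_kernel[OF k] by (simp only: of_real_diff of_real_mult right_diff_distrib mult.left_commute)
    then have "(cmod (fhat (conv_kernel \<kappa> t x) p - fhat (conv_kernel \<kappa> t' x) p))\<^sup>2 = (indicator {0<..<t} s * ?a - indicator {0<..<t'} s * ?b)\<^sup>2"
      by (simp only: norm_cis_mult power2_abs)
    also have "\<dots> = indicator {0<..<t} s * ?a\<^sup>2 + indicator {0<..<t'} s * ?b\<^sup>2 - 2 * (indicator {0<..<t'} s * (?a * ?b))"
      using t(2) by (auto simp: indicator_def power2_diff)
    finally show ?thesis unfolding ee ab by (simp only: p fst_conv snd_conv)
  qed
  have "has_bochner_integral ?N (\<lambda>p. ?e t t p + ?e t' t' p - 2 * ?e t' ?r p)
     (?K * ((t powr H - (t - t) powr H) / H) + ?K * ((t' powr H - (t' - t') powr H) / H) - 2 * (?K * ((?r powr H - (?r - t') powr H) / H)))"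
    using t by (intro has_bochner_integral_diff has_bochner_integral_add has_bochner_integral_mult_right integrable_kernel_energy) auto
  note hb = this[unfolded eq[symmetric]]
  have "ennreal (msq M (\<lambda>\<omega>. u t x \<omega> - u t' x \<omega>)) = ennreal (\<integral>p. (cmod (fhat (conv_kernel \<kappa> t x) p - fhat (conv_kernel \<kappa> t' x) p))\<^sup>2 \<partial>?N)"
    unfolding u_increment[OF order_trans[OF t] t(1)]
    by (rule nn_integral_eq_integral) (use hb in \<open>auto simp: has_bochner_integral_iff\<close>)
  then have "msq M (\<lambda>\<omega>. u t x \<omega> - u t' x \<omega>) = (\<integral>p. (cmod (fhat (conv_kernel \<kappa> t x) p - fhat (conv_kernel \<kappa> t' x) p))\<^sup>2 \<partial>?N)"
    by (subst (asm) ennreal_inj) auto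
  also have "\<dots> = ?K * ((t powr H - (t - t) powr H) / H) + ?K * ((t' powr H - (t' - t') powr H) / H) - 2 * (?K * ((?r powr H - (?r - t') powr H) / H))"
    using hb by (rule has_bochner_integral_integral_eq)
  also have "\<dots> = (?K / H) * (t powr H + t' powr H - 2 * (?r powr H - (?r - t') powr H))"
    using H by (simp add: field_simps)
  also have "?r - t' = (t - t') / 2" by (simp add: field_simps)
  \<comment> \<open>Pulling out 2^(1-H) brings the midpoint terms to (t-t')^H and (t+t')^H; the
    remaining t^H and t'^H become ((2t)^H + (2t')^H) / 2, since 2^(1-H) 2^H = 2.\<close>
  also have "t powr H + t' powr H - 2 * (?r powr H - ((t - t') / 2) powr H) = 2 powr (1 - H) * ((t - t') powr H - ((t + t') powr H - ((2 * t) powr H + (2 * t') powr H) / 2))"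
  proof -
    have e: "2 powr (1 - H) * 2 powr H = (2::real)" by (simp add: powr_add[symmetric])
    have e2: "(2::real) / 2 powr H = 2 powr (1 - H)" by (simp add: powr_diff)
    have p: "(2 * a) powr H = 2 powr H * a powr H" "(a / 2) powr H = a powr H / 2 powr H" if "0 \<le> a" for a :: real
      using that by (simp_all add: powr_mult powr_divide)
    have "2 powr (1 - H) * ((t - t') powr H - ((t + t') powr H - ((2 * t) powr H + (2 * t') powr H) / 2))
      = 2 powr (1 - H) * (t - t') powr H - 2 powr (1 - H) * (t + t') powr H + (2 powr (1 - H) * 2 powr H) * (t powr H + t' powr H) / 2"
      using t p by (simp add: algebra_simps)
    also have "\<dots> = t powr H + t' powr H - 2 * ((t + t') powr H / 2 powr H - (t - t') powr H / 2 powr H)"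
      unfolding e e2[symmetric] by (simp add: algebra_simps)
    finally show ?thesis using t p(2)[of "t + t'"] p(2)[of "t - t'"] by simp
  qed
  also have "(?K / H) * (2 powr (1 - H) * ((t - t') powr H - ((t + t') powr H - ((2 * t) powr H + (2 * t') powr H) / 2)))
     = (2 powr (1 - H) * ?K / H) * ((t - t') powr H - ((t + t') powr H - ((2 * t) powr H + (2 * t') powr H) / 2))" by simp
  \<comment> \<open>The sine in \<open>c1H\<close> cancels against the reflection formula for
    Gamma(1-H), and Gamma(2H+1) = 2H Gamma(2H) cancels the division by H.\<close>
  also have "2 powr (1 - H) * ?K / H = (C1 H \<kappa>)\<^sup>2"
  proof -
    have G: "Gamma H * Gamma (1 - H) = pi / sin (pi * H)" by (rule Gamma_reflection_real[OF H])
    have s: "sin (pi * H) > 0" using H by (intro sin_gt_zero) auto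
    have G0: "Gamma H > 0" "Gamma (2 * H) > 0" using H by (auto intro!: Gamma_real_pos)
    have "Gamma (2 * H + 1) = 2 * H * Gamma (2 * H)" using H by (intro Gamma_plus1) (auto simp: nonpos_Ints_def)
    moreover have "Gamma (1 - H) = pi / (sin (H * pi) * Gamma H)"
    proof -
      have "Gamma (1 - H) = (Gamma H * Gamma (1 - H)) / Gamma H" using G0 by simp
      then show ?thesis unfolding G by (simp add: mult.commute)
    qed
    ultimately have "c1H H * Gamma (1 - H) / H = Gamma (2 * H) / Gamma H"
      using s G0 H by (simp add: c1H_def mult.commute[of pi])
    moreover have "2 powr (1 - H) * ?K / H = 2 powr (1 - H) * (c1H H * Gamma (1 - H) / H) * \<kappa> powr (H - 1)" by simp
    ultimately have e: "2 powr (1 - H) * ?K / H = 2 powr (1 - H) * (Gamma (2 * H) / Gamma H) * \<kappa> powr (H - 1)" by (simp only:)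
    have kk: "\<kappa> powr (H - 1) = 1 / \<kappa> powr (1 - H)" by (simp add: powr_minus_divide[symmetric])
    have "2 powr (1 - H) * ?K / H = 2 powr (1 - H) * Gamma (2 * H) / (\<kappa> powr (1 - H) * Gamma H)" unfolding e unfolding kk by simp
    then show ?thesis unfolding C1_def using G0 by simp
  qed
  finally show ?thesis .
qed

text \<open>Integrating exp(-kappa (t-s) xi^2) over s in (0,t) gives (1 - exp(-kappa t xi^2)) /
  (kappa xi^2), and the new xi^2 turns the weight |xi|^(1-2H) into |xi|^(-1-2H). The identity stays
  in \<open>ennreal\<close> so that it can be added to the one for \<open>wave\<close>.\<close>

lemma u_space_increment:
  assumes t: "0 < t"
  shows "ennreal (msq M (\<lambda>\<omega>. u t x \<omega> - u t x' \<omega>)) =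
    (\<integral>\<^sup>+\<xi>. ennreal (2 * c1H H / \<kappa> * ((1 - cos ((x - x') * \<xi>)) * \<bar>\<xi>\<bar> powr (- 1 - 2 * H)) * (1 - exp (- (\<kappa> * t * \<xi>\<^sup>2)))) \<partial>lborel)"
proof -
  let ?N = "noise_measure H"
  have eq: "(cmod (fhat (conv_kernel \<kappa> t x) p - fhat (conv_kernel \<kappa> t x') p))\<^sup>2 = indicator {0<..<t} (fst p) * (2 * (1 - cos ((x - x') * snd p)) * exp (- (\<kappa> * (t - fst p) * (snd p)\<^sup>2)))" for p
  proof -
    obtain s \<xi> where p: "p = (s, \<xi>)" by (cases p)
    let ?a = "exp (- (\<kappa> * (t - s) * \<xi>\<^sup>2 / 2))"
    have ee: "(exp (- (a / 2)))\<^sup>2 = exp (- a)" for a :: real by (simp add: power2_eq_square exp_add[symmetric])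
    have "fhat (conv_kernel \<kappa> t x) p - fhat (conv_kernel \<kappa> t x') p = complex_of_real (indicator {0<..<t} s * ?a) * (cis (- \<xi> * x) - cis (- \<xi> * x'))"
      unfolding p fhat_conv_kernel[OF k] by (simp add: algebra_simps)
    then have "(cmod (fhat (conv_kernel \<kappa> t x) p - fhat (conv_kernel \<kappa> t x') p))\<^sup>2 = (indicator {0<..<t} s * ?a)\<^sup>2 * (cmod (cis (- \<xi> * x) - cis (- \<xi> * x')))\<^sup>2"
      by (simp only: norm_mult norm_of_real power_mult_distrib power2_abs)
    also have "(cmod (cis (- \<xi> * x) - cis (- \<xi> * x')))\<^sup>2 = 2 * (1 - cos ((x - x') * \<xi>))"
    proof -
      have "(cmod (cis (- \<xi> * x) - cis (- \<xi> * x')))\<^sup>2 = (cos (\<xi> * x) - cos (\<xi> * x'))\<^sup>2 + (sin (\<xi> * x) - sin (\<xi> * x'))\<^sup>2"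
        by (simp add: cmod_power2 power2_commute)
      also have "\<dots> = ((sin (\<xi> * x))\<^sup>2 + (cos (\<xi> * x))\<^sup>2) + ((sin (\<xi> * x'))\<^sup>2 + (cos (\<xi> * x'))\<^sup>2) - 2 * cos (\<xi> * x - \<xi> * x')"
        unfolding cos_diff by (simp add: power2_diff algebra_simps)
      finally show ?thesis unfolding sin_cos_squared_add by (simp add: algebra_simps)
    qed
    also have "(indicator {0<..<t} s * ?a)\<^sup>2 = indicator {0<..<t} s * exp (- (\<kappa> * (t - s) * \<xi>\<^sup>2))"
      unfolding power_mult_distrib ee by (simp add: indicator_def)
    finally show ?thesis by (simp add: p mult_ac)
  qed
  have "ennreal (msq M (\<lambda>\<omega>. u t x \<omega> - u t x' \<omega>)) = (\<integral>\<^sup>+s. \<integral>\<^sup>+\<xi>. ennreal (noise_weight H (s, \<xi>)) * ennreal (indicator {0<..<t} (fst (s, \<xi>)) * (2 * (1 - cos ((x - x') * snd (s, \<xi>))) * exp (- (\<kappa> * (t - fst (s, \<xi>)) * (snd (s, \<xi>))\<^sup>2)))) \<partial>lborel \<partial>lborel)"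
    unfolding u_increment[OF less_imp_le[OF t] less_imp_le[OF t]] eq by (rule nn_integral_noise_measure) simp
  also have "\<dots> = (\<integral>\<^sup>+\<xi>. \<integral>\<^sup>+s. ennreal (noise_weight H (s, \<xi>)) * ennreal (indicator {0<..<t} s * (2 * (1 - cos ((x - x') * \<xi>)) * exp (- (\<kappa> * (t - s) * \<xi>\<^sup>2)))) \<partial>lborel \<partial>lborel)"
    unfolding fst_conv snd_conv by (rule lborel_pair.Fubini'[symmetric]) simp
  also have "\<dots> = (\<integral>\<^sup>+\<xi>. ennreal (2 * c1H H / \<kappa> * ((1 - cos ((x - x') * \<xi>)) * \<bar>\<xi>\<bar> powr (- 1 - 2 * H)) * (1 - exp (- (\<kappa> * t * \<xi>\<^sup>2)))) \<partial>lborel)"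
  proof (rule nn_integral_cong)
    fix \<xi> :: real
    show "(\<integral>\<^sup>+s. ennreal (noise_weight H (s, \<xi>)) * ennreal (indicator {0<..<t} s * (2 * (1 - cos ((x - x') * \<xi>)) * exp (- (\<kappa> * (t - s) * \<xi>\<^sup>2)))) \<partial>lborel)
      = ennreal (2 * c1H H / \<kappa> * ((1 - cos ((x - x') * \<xi>)) * \<bar>\<xi>\<bar> powr (- 1 - 2 * H)) * (1 - exp (- (\<kappa> * t * \<xi>\<^sup>2))))"
    proof (cases "\<xi> = 0")
      case False
      let ?A = "2 * c1H H * (1 - cos ((x - x') * \<xi>)) * \<bar>\<xi>\<bar> powr (1 - 2 * H)"
      have A: "0 \<le> ?A" using c1H_pos[OF H] by (simp add: cos_le_one)
      have z: "\<kappa> * \<xi>\<^sup>2 > 0" using k False by simp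
      have "(\<integral>\<^sup>+s. ennreal (noise_weight H (s, \<xi>)) * ennreal (indicator {0<..<t} s * (2 * (1 - cos ((x - x') * \<xi>)) * exp (- (\<kappa> * (t - s) * \<xi>\<^sup>2)))) \<partial>lborel)
        = (\<integral>\<^sup>+s. ennreal ?A * (ennreal (exp (- (\<kappa> * (t - s) * \<xi>\<^sup>2))) * indicator {0..t} s) \<partial>lborel)"
      proof (rule nn_integral_cong_AE)
        show "AE s in lborel. ennreal (noise_weight H (s, \<xi>)) * ennreal (indicator {0<..<t} s * (2 * (1 - cos ((x - x') * \<xi>)) * exp (- (\<kappa> * (t - s) * \<xi>\<^sup>2))))
          = ennreal ?A * (ennreal (exp (- (\<kappa> * (t - s) * \<xi>\<^sup>2))) * indicator {0..t} s)"
          using AE_lborel_singleton[of 0] AE_lborel_singleton[of t]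
        proof eventually_elim
          case (elim s)
          show ?case
          proof (cases "s \<in> {0<..<t}")
            case True
            have "noise_weight H (s, \<xi>) * (2 * (1 - cos ((x - x') * \<xi>)) * exp (- (\<kappa> * (t - s) * \<xi>\<^sup>2))) = ?A * exp (- (\<kappa> * (t - s) * \<xi>\<^sup>2))"
              using True by (simp add: noise_weight_def mult_ac)
            then show ?thesis using True A noise_weight_nonneg[OF H, of "(s, \<xi>)"] by (simp add: ennreal_mult'[symmetric])
          next
            case False
            then have "s \<notin> {0..t}" using elim by auto
            then show ?thesis using False by simp
          qed
        qed
      qed
      also have "\<dots> = ennreal ?A * (\<integral>\<^sup>+s. ennreal (exp (- (\<kappa> * (t - s) * \<xi>\<^sup>2))) * indicator {0..t} s \<partial>lborel)"
        by (rule nn_integral_cmult) simp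
      also have "(\<integral>\<^sup>+s. ennreal (exp (- (\<kappa> * (t - s) * \<xi>\<^sup>2))) * indicator {0..t} s \<partial>lborel) = ennreal (exp (- (\<kappa> * (t - t) * \<xi>\<^sup>2)) / (\<kappa> * \<xi>\<^sup>2) - exp (- (\<kappa> * (t - 0) * \<xi>\<^sup>2)) / (\<kappa> * \<xi>\<^sup>2))"
        by (rule nn_integral_FTC_Icc) (use z t in \<open>auto intro!: derivative_eq_intros\<close>)
      also have "exp (- (\<kappa> * (t - t) * \<xi>\<^sup>2)) / (\<kappa> * \<xi>\<^sup>2) - exp (- (\<kappa> * (t - 0) * \<xi>\<^sup>2)) / (\<kappa> * \<xi>\<^sup>2) = (1 - exp (- (\<kappa> * t * \<xi>\<^sup>2))) / (\<kappa> * \<xi>\<^sup>2)"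
        by (simp add: diff_divide_distrib)
      also have "ennreal ?A * ennreal ((1 - exp (- (\<kappa> * t * \<xi>\<^sup>2))) / (\<kappa> * \<xi>\<^sup>2)) = ennreal (?A * ((1 - exp (- (\<kappa> * t * \<xi>\<^sup>2))) / (\<kappa> * \<xi>\<^sup>2)))"
        using A by (rule ennreal_mult'[symmetric])
      also have "\<bar>\<xi>\<bar> powr (1 - 2 * H) = \<bar>\<xi>\<bar> powr (- 1 - 2 * H) * \<xi>\<^sup>2"
      proof -
        have "\<xi>\<^sup>2 = \<bar>\<xi>\<bar> powr 2" using False by simp
        then have "\<bar>\<xi>\<bar> powr (- 1 - 2 * H) * \<xi>\<^sup>2 = \<bar>\<xi>\<bar> powr ((- 1 - 2 * H) + 2)" by (simp only: powr_add)
        then show ?thesis by simp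
      qed
      also have "2 * c1H H * (1 - cos ((x - x') * \<xi>)) * (\<bar>\<xi>\<bar> powr (- 1 - 2 * H) * \<xi>\<^sup>2) * ((1 - exp (- (\<kappa> * t * \<xi>\<^sup>2))) / (\<kappa> * \<xi>\<^sup>2))
        = 2 * c1H H / \<kappa> * ((1 - cos ((x - x') * \<xi>)) * \<bar>\<xi>\<bar> powr (- 1 - 2 * H)) * (1 - exp (- (\<kappa> * t * \<xi>\<^sup>2)))"
        using False k by (simp add: divide_simps)
      finally show ?thesis .
    qed simp
  qed
  finally show ?thesis .
qed

end

section \<open>White sequences inside the noise that are independent of the convolution\<close>

lemma AE_lborel_interval:
  assumes "AE s in lborel. Q s" "a < (b::real)"
  shows "\<exists>s\<in>{a<..<b}. Q s"
proof (rule ccontr)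
  assume "\<not> (\<exists>s\<in>{a<..<b}. Q s)"
  then have "AE s in lborel. s \<notin> {a<..<b}" using assms(1) by (auto elim!: eventually_mono)
  then have "emeasure lborel {a<..<b} = 0" by (subst (asm) AE_iff_measurable[of "{a<..<b}"]) auto
  then show False using assms(2) by simp
qed

text \<open>Odd probes are orthogonal to the even kernel of $u_t(x)$ for every $t$.\<close>
definition odd_bump :: "real \<Rightarrow> real" where
  "odd_bump z = flat_exp (z - 1) * flat_exp (2 - z) - flat_exp (- z - 1) * flat_exp (2 + z)"

lemma odd_bump_minus: "odd_bump (- z) = - odd_bump z" by (simp add: odd_bump_def)

lemma odd_bump_support: "odd_bump z \<noteq> 0 \<Longrightarrow> -2 \<le> z \<and> z \<le> 2"
  by (rule ccontr) (auto simp: odd_bump_def not_le)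

lemma odd_bump_measurable [measurable]: "odd_bump \<in> borel_measurable borel"
  unfolding odd_bump_def by measurable

lemma flat_exp_le_1: "flat_exp x \<le> 1" by (simp add: flat_exp_def)

lemma integrable_odd_bump: "integrable lborel odd_bump"
proof (rule Bochner_Integration.integrable_bound)
  show "integrable lborel (\<lambda>z. 2 * indicator {-2..2::real} z :: real)" by simp
  have "\<bar>flat_exp (z - 1) * flat_exp (2 - z)\<bar> \<le> 1" "\<bar>flat_exp (- z - 1) * flat_exp (2 + z)\<bar> \<le> 1" for z
    by (simp_all add: abs_mult mult_le_one flat_exp_le_1)
  then have "\<bar>odd_bump z\<bar> \<le> 2" for z unfolding odd_bump_def
    by (rule order_trans[OF abs_triangle_ineq4 order_trans[OF add_mono]]) simp
  moreover have "odd_bump z = 0" if "z \<notin> {-2..2}" for z using odd_bump_support[of z] that by auto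
  ultimately show "AE z in lborel. norm (odd_bump z) \<le> norm (2 * indicator {-2..2::real} z :: real)"
    by (intro AE_I2) (auto split: split_indicator)
qed simp

text \<open>Up to a phase the transform is that of the bump at the origin, whose imaginary part is
  minus the integral of sin(xi y) against the bump. For 0 < xi < 1 and |y| <= 2 one has |xi y| < pi,
  so sine and bump have equal signs and the integrand is nonnegative, strictly positive on
  (1,2).\<close>

lemma fourier_odd_bump_nonzero:
  assumes "0 < \<xi>" "\<xi> < 1" shows "fourier (\<lambda>y. odd_bump (y - x)) \<xi> \<noteq> 0"
proof
  assume z: "fourier (\<lambda>y. odd_bump (y - x)) \<xi> = 0"
  have "fourier (\<lambda>y. odd_bump (y - x)) \<xi> = \<bar>1\<bar> *\<^sub>R (\<integral>z. cis (- \<xi> * (x + 1 * z)) * complex_of_real (odd_bump (x + 1 * z - x)) \<partial>lborel)"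
    unfolding fourier_def by (rule lborel_integral_real_affine) simp
  also have "\<dots> = (\<integral>z. cis (- \<xi> * x) * (cis (- \<xi> * z) * complex_of_real (odd_bump z)) \<partial>lborel)"
  proof -
    have "cis (- \<xi> * (x + 1 * z)) = cis (- \<xi> * x) * cis (- \<xi> * z)" for z
      unfolding cis_mult by (rule arg_cong[where f = cis]) (simp add: algebra_simps)
    moreover have "x + 1 * z - x = z" for z by simp
    ultimately show ?thesis by (simp only: mult.assoc abs_one scaleR_one)
  qed
  also have "\<dots> = cis (- \<xi> * x) * fourier odd_bump \<xi>"
    unfolding fourier_def by (rule integral_mult_right_zero)
  finally have "fourier odd_bump \<xi> = 0" using z by simp
  moreover have "Im (fourier odd_bump \<xi>) = (\<integral>y. Im (cis (- \<xi> * y) * complex_of_real (odd_bump y)) \<partial>lborel)"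
    unfolding fourier_def by (rule integral_Im[symmetric, OF integrable_fourier[OF integrable_odd_bump]])
  ultimately have 0: "(\<integral>y. sin (\<xi> * y) * odd_bump y \<partial>lborel) = 0" by simp
  have i: "integrable lborel (\<lambda>y. sin (\<xi> * y) * odd_bump y)"
    by (rule Bochner_Integration.integrable_bound[OF integrable_odd_bump]) (auto intro!: AE_I2 mult_left_le_one_le simp: abs_mult)
  have pos: "0 < sin (\<xi> * y)" if "0 < y" "y \<le> 2" for y
  proof (rule sin_gt_zero)
    show "0 < \<xi> * y" using assms that by simp
    have "\<xi> * y \<le> 1 * 2" using assms that by (intro mult_mono) auto
    then show "\<xi> * y < pi" using pi_gt3 by linarith
  qed
  have b: "0 \<le> odd_bump y" if "0 \<le> y" for y using that by (simp add: odd_bump_def)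
  have nn1: "0 \<le> sin (\<xi> * y) * odd_bump y" if "0 \<le> y" for y
  proof (cases "y = 0 \<or> y > 2")
    case True
    then show ?thesis using odd_bump_support[of y] by (cases "odd_bump y = 0") auto
  next
    case False
    then show ?thesis using pos[of y] b[of y] that by simp
  qed
  have nn: "0 \<le> sin (\<xi> * y) * odd_bump y" for y
    using nn1[of y] nn1[of "- y"] by (cases "0 \<le> y") (auto simp: odd_bump_minus)
  from 0 have "AE y in lborel. sin (\<xi> * y) * odd_bump y = 0"
    using integral_nonneg_eq_0_iff_AE[OF i] nn by simp
  from AE_lborel_interval[OF this, of 1 2] obtain y where y: "1 < y" "y < 2" "sin (\<xi> * y) * odd_bump y = 0" by auto
  have "0 < odd_bump y" using y by (simp add: odd_bump_def flat_exp_pos)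
  then show False using y pos[of y] by simp
qed

text \<open>Disjoint time supports make the probes orthogonal; with start $r = t$ they all lie in the future of $t$.\<close>
definition probe :: "real \<Rightarrow> real \<Rightarrow> nat \<Rightarrow> real \<Rightarrow> real \<Rightarrow> real" where
  "probe r x n s y = flat_exp (s - (r + real n + 1)) * flat_exp (r + real n + 2 - s) * odd_bump (y - x)"

lemma probe_support: "probe r x n s y \<noteq> 0 \<Longrightarrow> r + real n + 1 < s \<and> s < r + real n + 2 \<and> x - 2 \<le> y \<and> y \<le> x + 2"
  using odd_bump_support[of "y - x"] unfolding probe_def
  by (cases "r + real n + 1 < s"; cases "s < r + real n + 2") auto

lemma probe_odd: "probe r x n s (2 * x - y) = - probe r x n s y"
  using odd_bump_minus[of "y - x"] by (simp add: probe_def)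

lemma test_function_probe:
  assumes "0 \<le> r" shows "test_function (probe r x n)"
proof (rule test_functionI[where a = "r + real n + 1" and b = "r + real n + 2" and c = "x - 2" and d = "x + 2"])
  note t = smooth2_time[OF smooth_on_real_affine[OF smooth_on_real_flat_exp]]
  note s = smooth2_space[OF smooth_on_real_affine[OF smooth_on_real_flat_exp]]
  note smooth2_mult[OF smooth2_mult[OF t[of 1 "- (r + real n + 1)"] t[of "-1" "r + real n + 2"]]
      smooth2_add[OF smooth2_mult[OF s[of 1 "- x - 1"] s[of "-1" "2 + x"]]
        smooth2_mult[OF smooth2_const[of "-1"] smooth2_mult[OF s[of "-1" "x - 1"] s[of 1 "2 - x"]]]]]
  moreover have "probe r x n = (\<lambda>s y. flat_exp (1 * s + - (r + real n + 1)) * flat_exp (- 1 * s + (r + real n + 2)) *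
     (flat_exp (1 * y + (- x - 1)) * flat_exp (- 1 * y + (2 + x)) + - 1 * (flat_exp (- 1 * y + (x - 1)) * flat_exp (1 * y + (2 - x)))))"
    by (simp add: probe_def odd_bump_def fun_eq_iff algebra_simps)
  ultimately show "smooth2 (probe r x n)" by (simp only:)
qed (use assms probe_support[of r x n] in \<open>fastforce simp: less_imp_le\<close>)+

context stoch_conv begin

text \<open>Zero variance would make the transform vanish almost everywhere where the weight is
  positive. Times inside the support of the probe and frequencies in (0,1) form such a set of
  positive measure, against \<open>fourier_odd_bump_nonzero\<close>.\<close>

lemma probe_variance_pos:
  assumes r: "0 \<le> r" shows "0 < msq M (W (probe r x n))"
proof -
  let ?g = "probe r x n" and ?N = "noise_measure H"
  note t = test_function_probe[OF r, of x n]
  note f = test_function_fhat_integrable[OF H t]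
  note [measurable] = f(1)
  have "complex_of_real (msq M (W ?g)) = (\<integral>p. fhat ?g p * cnj (fhat ?g p) \<partial>?N)"
    using noise_cov[OF t t] noise_inner_eq[OF H t t] by (simp add: power2_eq_square)
  also have "\<dots> = (\<integral>p. complex_of_real ((cmod (fhat ?g p))\<^sup>2) \<partial>?N)"
    by (simp only: complex_norm_square)
  also have "\<dots> = complex_of_real (\<integral>p. (cmod (fhat ?g p))\<^sup>2 \<partial>?N)" by (rule integral_complex_of_real)
  finally have e: "msq M (W ?g) = (\<integral>p. (cmod (fhat ?g p))\<^sup>2 \<partial>?N)" unfolding of_real_eq_iff .
  have "msq M (W ?g) \<noteq> 0"
  proof
    assume "msq M (W ?g) = 0"
    then have "AE p in ?N. (cmod (fhat ?g p))\<^sup>2 = 0"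
      unfolding e using integral_nonneg_eq_0_iff_AE[OF f(2)] by simp
    then have "AE p in lborel \<Otimes>\<^sub>M lborel. 0 < ennreal (noise_weight H p) \<longrightarrow> (cmod (fhat ?g p))\<^sup>2 = 0"
      unfolding noise_measure_def by (subst (asm) AE_density) simp_all
    then have "AE s in lborel. AE \<xi> in lborel. 0 < ennreal (noise_weight H (s, \<xi>)) \<longrightarrow> (cmod (fhat ?g (s, \<xi>)))\<^sup>2 = 0"
      by (rule lborel_pair.AE_pair)
    from AE_lborel_interval[OF this, of "r + real n + 1" "r + real n + 2"]
    obtain s where s: "r + real n + 1 < s" "s < r + real n + 2"
      and ae: "AE \<xi> in lborel. 0 < ennreal (noise_weight H (s, \<xi>)) \<longrightarrow> (cmod (fhat ?g (s, \<xi>)))\<^sup>2 = 0" by auto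
    from AE_lborel_interval[OF ae, of 0 1] obtain \<xi> where x: "0 < \<xi>" "\<xi> < 1"
      and z: "0 < ennreal (noise_weight H (s, \<xi>)) \<longrightarrow> (cmod (fhat ?g (s, \<xi>)))\<^sup>2 = 0" by auto
    have "0 < noise_weight H (s, \<xi>)" using s r x c1H_pos[OF H] by (simp add: noise_weight_def)
    then have "fourier (probe r x n s) \<xi> = 0" using z by (simp add: fhat_def)
    then have "fourier (\<lambda>y. odd_bump (y - x)) \<xi> = 0"
      using s fourier_cmult[of "flat_exp (s - (r + real n + 1)) * flat_exp (r + real n + 2 - s)" "\<lambda>y. odd_bump (y - x)" \<xi>]
        flat_exp_pos[of "s - (r + real n + 1)"] flat_exp_pos[of "r + real n + 2 - s"]
      by (simp add: probe_def[abs_def])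
    then show False using fourier_odd_bump_nonzero[OF x] by blast
  qed
  moreover have "0 \<le> msq M (W ?g)" by simp
  ultimately show ?thesis by linarith
qed

definition white_seq :: "real \<Rightarrow> real \<Rightarrow> nat \<Rightarrow> 'a \<Rightarrow> real" where
  "white_seq r x n \<omega> = (1 / sqrt (msq M (W (probe r x n)))) * W (probe r x n) \<omega>"

lemma white_seq_in_span: "0 \<le> r \<Longrightarrow> white_seq r x n \<in> noise_span"
  unfolding white_seq_def[abs_def]
  by (rule gaussian_spaceD(7)[OF gaussian_space_noise_span noise_in_span[OF test_function_probe]])

lemma white_seq_orthonormal:
  assumes r: "0 \<le> r"
  shows "expectation (\<lambda>\<omega>. white_seq r x m \<omega> * white_seq r x n \<omega>) = (if m = n then 1 else 0)"
proof -
  let ?v = "\<lambda>n. msq M (W (probe r x n))"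
  have "expectation (\<lambda>\<omega>. white_seq r x m \<omega> * white_seq r x n \<omega>) = expectation (\<lambda>\<omega>. (1 / sqrt (?v m) * (1 / sqrt (?v n))) * (W (probe r x m) \<omega> * W (probe r x n) \<omega>))"
    unfolding white_seq_def by (simp only: mult_ac)
  also have "\<dots> = (1 / sqrt (?v m) * (1 / sqrt (?v n))) * expectation (\<lambda>\<omega>. W (probe r x m) \<omega> * W (probe r x n) \<omega>)"
    by (rule integral_mult_right_zero)
  also have "\<dots> = (if m = n then 1 else 0)"
  proof (cases "m = n")
    case True
    have "(1 / sqrt (?v n) * (1 / sqrt (?v n))) * ?v n = 1" using probe_variance_pos[OF r, of x n] by simp
    then show ?thesis using True by (simp only: power2_eq_square if_True simp_thms)
  next
    case False
    have "probe r x m s = (\<lambda>_. 0) \<or> probe r x n s = (\<lambda>_. 0)" for s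
    proof (rule ccontr)
      assume "\<not> (probe r x m s = (\<lambda>_. 0) \<or> probe r x n s = (\<lambda>_. 0))"
      then obtain y y' where "probe r x m s y \<noteq> 0" "probe r x n s y' \<noteq> 0" by (auto simp: fun_eq_iff)
      then have "r + real m + 1 < s \<and> s < r + real m + 2" "r + real n + 1 < s \<and> s < r + real n + 2"
        using probe_support by blast+
      then have "real m < real n + 1" "real n < real m + 1" by linarith+
      then show False using False by linarith
    qed
    then have "noise_inner H (probe r x m) (probe r x n) = 0" by (rule noise_inner_disjoint)
    then have "expectation (\<lambda>\<omega>. W (probe r x m) \<omega> * W (probe r x n) \<omega>) = 0"
      using noise_cov[OF test_function_probe[OF r, of x m] test_function_probe[OF r, of x n]] by simp
    then show ?thesis using False by simp
  qed
  finally show ?thesis .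
qed

lemma u_white_seq_odd:
  assumes "0 \<le> t" shows "expectation (\<lambda>\<omega>. u t x \<omega> * white_seq 0 x n \<omega>) = 0"
proof -
  have "expectation (\<lambda>\<omega>. u t x \<omega> * white_seq 0 x n \<omega>) = expectation (\<lambda>\<omega>. (1 / sqrt (msq M (W (probe 0 x n)))) * (u t x \<omega> * W (probe 0 x n) \<omega>))"
    unfolding white_seq_def by (simp only: mult_ac)
  also have "\<dots> = (1 / sqrt (msq M (W (probe 0 x n)))) * expectation (\<lambda>\<omega>. u t x \<omega> * W (probe 0 x n) \<omega>)"
    by (rule integral_mult_right_zero)
  also have "expectation (\<lambda>\<omega>. u t x \<omega> * W (probe 0 x n) \<omega>) = 0"
    by (rule u_orthogonal_odd[OF assms test_function_probe probe_odd]) simp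
  finally show ?thesis by simp
qed

lemma u_white_seq_future:
  assumes "0 \<le> t" shows "expectation (\<lambda>\<omega>. u t x \<omega> * white_seq t x' n \<omega>) = 0"
proof -
  have "expectation (\<lambda>\<omega>. u t x \<omega> * white_seq t x' n \<omega>) = expectation (\<lambda>\<omega>. (1 / sqrt (msq M (W (probe t x' n)))) * (u t x \<omega> * W (probe t x' n) \<omega>))"
    unfolding white_seq_def by (simp only: mult_ac)
  also have "\<dots> = (1 / sqrt (msq M (W (probe t x' n)))) * expectation (\<lambda>\<omega>. u t x \<omega> * W (probe t x' n) \<omega>)"
    by (rule integral_mult_right_zero)
  also have "expectation (\<lambda>\<omega>. u t x \<omega> * W (probe t x' n) \<omega>) = 0"
    by (rule u_orthogonal_future[OF assms test_function_probe[OF assms]]) (use probe_support in fastforce)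
  finally show ?thesis by simp
qed

end

section \<open>Variables generated by an orthonormal Gaussian sequence\<close>

text \<open>All that the construction of S takes from the noise. The two decompositions instantiate
  it with different probe sequences inside the same span.\<close>

locale orthonormal_gaussian = prob_space M for M :: "'a measure" +
  fixes L :: "('a \<Rightarrow> real) set" and \<xi> :: "nat \<Rightarrow> 'a \<Rightarrow> real"
  assumes L: "gaussian_space M L" and xi_in: "\<And>n. \<xi> n \<in> L"
    and orthonormal: "\<And>m n. expectation (\<lambda>\<omega>. \<xi> m \<omega> * \<xi> n \<omega>) = (if m = n then 1 else 0)"
begin

lemma xi_sq_int: "sq_int M (\<xi> n)" by (rule gaussian_spaceD(2)[OF L xi_in])

lemma xi_measurable [measurable]: "\<xi> n \<in> borel_measurable M" using xi_sq_int by (simp add: sq_int_def)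

lemma in_closure: "Y \<in> L \<Longrightarrow> Y \<in> L2_closure M L"
  by (rule L2_closureI[OF gaussian_spaceD(2)[OF L], of _ "\<lambda>_. Y"]) simp_all

lemma sum_in: "finite J \<Longrightarrow> (\<lambda>\<omega>. \<Sum>k\<in>J. c k * \<xi> k \<omega>) \<in> L"
  by (rule gaussian_space_sum[OF L xi_in])

lemma inner_sum:
  assumes "finite J" "finite K"
  shows "expectation (\<lambda>\<omega>. (\<Sum>k\<in>J. c k * \<xi> k \<omega>) * (\<Sum>k\<in>K. d k * \<xi> k \<omega>)) = (\<Sum>k\<in>J \<inter> K. c k * d k)"
proof -
  have i: "integrable M (\<lambda>\<omega>. c j * d k * (\<xi> j \<omega> * \<xi> k \<omega>))" for j k
    by (intro integrable_mult_right sq_int_mult xi_sq_int)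
  have "expectation (\<lambda>\<omega>. (\<Sum>k\<in>J. c k * \<xi> k \<omega>) * (\<Sum>k\<in>K. d k * \<xi> k \<omega>)) = expectation (\<lambda>\<omega>. \<Sum>j\<in>J. \<Sum>k\<in>K. c j * d k * (\<xi> j \<omega> * \<xi> k \<omega>))"
    by (simp only: sum_product mult_ac)
  also have "\<dots> = (\<Sum>j\<in>J. \<Sum>k\<in>K. c j * d k * expectation (\<lambda>\<omega>. \<xi> j \<omega> * \<xi> k \<omega>))"
    using i by (simp add: Bochner_Integration.integral_sum)
  also have "\<dots> = (\<Sum>j\<in>J. \<Sum>k\<in>K. if j = k then c j * d j else 0)"
    by (intro sum.cong refl) (simp add: orthonormal)
  also have "\<dots> = (\<Sum>j\<in>J. if j \<in> K then c j * d j else 0)"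
    by (intro sum.cong refl) (simp add: sum.delta'[OF assms(2)])
  also have "\<dots> = (\<Sum>k\<in>J \<inter> K. c k * d k)" using assms by (simp add: sum.inter_restrict)
  finally show ?thesis .
qed

lemma msq_sum: "finite J \<Longrightarrow> msq M (\<lambda>\<omega>. \<Sum>k\<in>J. c k * \<xi> k \<omega>) = (\<Sum>k\<in>J. (c k)\<^sup>2)"
  using inner_sum[of J J c c] by (simp add: power2_eq_square)

lemma orthogonal_sum:
  assumes "sq_int M X" "\<And>k. expectation (\<lambda>\<omega>. X \<omega> * \<xi> k \<omega>) = 0" "finite J"
  shows "expectation (\<lambda>\<omega>. X \<omega> * (\<Sum>k\<in>J. c k * \<xi> k \<omega>)) = 0"
proof -
  have i: "integrable M (\<lambda>\<omega>. c k * (X \<omega> * \<xi> k \<omega>))" for k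
    by (intro integrable_mult_right sq_int_mult xi_sq_int assms)
  have "expectation (\<lambda>\<omega>. X \<omega> * (\<Sum>k\<in>J. c k * \<xi> k \<omega>)) = expectation (\<lambda>\<omega>. \<Sum>k\<in>J. c k * (X \<omega> * \<xi> k \<omega>))"
    by (simp only: sum_distrib_left mult_ac)
  also have "\<dots> = 0" using i assms(2) by (simp add: Bochner_Integration.integral_sum)
  finally show ?thesis .
qed

text \<open>Closed subspace of everything built linearly from the sequence; orthogonality to the sequence passes to it.\<close>
definition generated :: "('a \<Rightarrow> real) set" where
  "generated = {Y \<in> L2_closure M L. \<forall>X. sq_int M X \<longrightarrow> (\<forall>k. expectation (\<lambda>\<omega>. X \<omega> * \<xi> k \<omega>) = 0) \<longrightarrow> expectation (\<lambda>\<omega>. X \<omega> * Y \<omega>) = 0}"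

lemma generated_sq_int: "Y \<in> generated \<Longrightarrow> sq_int M Y"
  unfolding generated_def by (auto simp: L2_closure_def)

lemma sum_generated: "finite J \<Longrightarrow> (\<lambda>\<omega>. \<Sum>k\<in>J. c k * \<xi> k \<omega>) \<in> generated"
  unfolding generated_def using in_closure[OF sum_in] orthogonal_sum by blast

lemma generated_lin:
  assumes "X \<in> generated" "Y \<in> generated" shows "(\<lambda>\<omega>. a * X \<omega> + b * Y \<omega>) \<in> generated"
  unfolding generated_def
proof (intro CollectI conjI allI impI)
  show "(\<lambda>\<omega>. a * X \<omega> + b * Y \<omega>) \<in> L2_closure M L"
    using assms by (intro gaussian_spaceD(3)[OF gaussian_space_L2_closure[OF L]]) (auto simp: generated_def)
  fix V assume V: "sq_int M V" "\<forall>k. expectation (\<lambda>\<omega>. V \<omega> * \<xi> k \<omega>) = 0"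
  have "expectation (\<lambda>\<omega>. V \<omega> * (a * X \<omega> + b * Y \<omega>)) = expectation (\<lambda>\<omega>. a * (V \<omega> * X \<omega>) + b * (V \<omega> * Y \<omega>))"
    by (simp only: distrib_left mult_ac)
  also have "\<dots> = a * expectation (\<lambda>\<omega>. V \<omega> * X \<omega>) + b * expectation (\<lambda>\<omega>. V \<omega> * Y \<omega>)"
    using sq_int_mult[OF V(1) generated_sq_int[OF assms(1)]] sq_int_mult[OF V(1) generated_sq_int[OF assms(2)]] by simp
  also have "\<dots> = 0" using assms V unfolding generated_def by simp
  finally show "expectation (\<lambda>\<omega>. V \<omega> * (a * X \<omega> + b * Y \<omega>)) = 0" .
qed

lemma generated_AE_limit:
  assumes Z: "\<And>n::nat. Z n \<in> generated" and Y: "Y \<in> borel_measurable M"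
    and ae: "AE \<omega> in M. (\<lambda>n. Z n \<omega>) \<longlonglongrightarrow> Y \<omega>"
    and d: "\<And>n m. msq M (\<lambda>\<omega>. Z n \<omega> - Z m \<omega>) \<le> d n + d m" "d \<longlonglongrightarrow> (0::real)" "\<And>n. d n \<ge> 0"
  shows "Y \<in> generated" "(\<lambda>n. msq M (Z n)) \<longlonglongrightarrow> msq M Y"
proof -
  have s: "sq_int M (Z n)" for n by (rule generated_sq_int[OF Z])
  note l = L2_AE_limit[OF s Y ae d]
  show "(\<lambda>n. msq M (Z n)) \<longlonglongrightarrow> msq M Y" by (rule msq_tendsto[OF s l])
  have c: "Z n \<in> L2_closure M L" for n using Z by (simp add: generated_def)
  have "expectation (\<lambda>\<omega>. X \<omega> * Y \<omega>) = 0" if "sq_int M X" "\<forall>k. expectation (\<lambda>\<omega>. X \<omega> * \<xi> k \<omega>) = 0" for X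
  proof -
    have "expectation (\<lambda>\<omega>. X \<omega> * Z n \<omega>) = 0" for n using Z[of n] that by (simp add: generated_def)
    then show ?thesis using inner_tendsto[OF s l that(1)] by (simp add: LIMSEQ_const_iff)
  qed
  then show "Y \<in> generated" unfolding generated_def using L2_closure_limit[OF L c l] by blast
qed

text \<open>Y is a sum defined path by path, so that its regularity can be read off. Square
  summability shows that it is also the mean square limit, which brings it into the Gaussian space
  and gives its variance.\<close>

lemma series_generated:
  assumes Y: "Y \<in> borel_measurable M" and ae: "AE \<omega> in M. (\<lambda>k. c k * \<xi> k \<omega>) sums Y \<omega>"
    and sm: "summable (\<lambda>k. (c k)\<^sup>2)"
  shows "Y \<in> generated" "msq M Y = (\<Sum>k. (c k)\<^sup>2)"
proof -
  let ?Z = "\<lambda>n \<omega>. \<Sum>k<n. c k * \<xi> k \<omega>"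
  \<comment> \<open>Tail of the squared coefficients: it bounds the squared distance between the
    n-th and every later partial sum.\<close>
  let ?d = "\<lambda>n. (\<Sum>k. (c k)\<^sup>2) - (\<Sum>k<n. (c k)\<^sup>2)"
  have d0: "0 \<le> ?d n" for n using sum_le_suminf[OF sm, of "{..<n}"] by simp
  have le: "msq M (\<lambda>\<omega>. ?Z n \<omega> - ?Z m \<omega>) \<le> ?d m" if "m \<le> n" for m n
  proof -
    have "?Z n \<omega> - ?Z m \<omega> = (\<Sum>k\<in>{m..<n}. c k * \<xi> k \<omega>)" for \<omega>
      using sum_diff[of "{..<n}" "{..<m}" "\<lambda>k. c k * \<xi> k \<omega>"] that by (simp add: lessThan_minus_lessThan)
    then have "msq M (\<lambda>\<omega>. ?Z n \<omega> - ?Z m \<omega>) = (\<Sum>k\<in>{m..<n}. (c k)\<^sup>2)" by (simp add: msq_sum)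
    also have "\<dots> = (\<Sum>k<n. (c k)\<^sup>2) - (\<Sum>k<m. (c k)\<^sup>2)"
      using sum_diff[of "{..<n}" "{..<m}" "\<lambda>k. (c k)\<^sup>2"] that by (simp add: lessThan_minus_lessThan)
    also have "\<dots> \<le> ?d m" using d0[of n] by simp
    finally show ?thesis .
  qed
  have le2: "msq M (\<lambda>\<omega>. ?Z n \<omega> - ?Z m \<omega>) \<le> ?d n + ?d m" for m n
    using le[of m n] le[of n m] d0[of n] d0[of m] by (cases "m \<le> n") (auto simp: power2_commute)
  have dl: "?d \<longlonglongrightarrow> 0" using tendsto_diff[OF tendsto_const summable_LIMSEQ[OF sm], of "\<Sum>k. (c k)\<^sup>2"] by simp
  have ae': "AE \<omega> in M. (\<lambda>n. ?Z n \<omega>) \<longlonglongrightarrow> Y \<omega>" using ae by (simp add: sums_def)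
  note l = generated_AE_limit[OF sum_generated[OF finite_lessThan] Y ae' le2 dl d0]
  show "Y \<in> generated" by (rule l(1))
  show "msq M Y = (\<Sum>k. (c k)\<^sup>2)"
    using l(2) summable_LIMSEQ[OF sm] unfolding msq_sum[OF finite_lessThan] by (rule LIMSEQ_unique)
qed

end

section \<open>A process with the smooth part of the covariance in time\<close>

text \<open>The Taylor coefficients (-1)^k binom(-a,k) of (1-w)^(-a); the rising factorial shows
  that they are nonnegative.\<close>

definition binom_coeff :: "real \<Rightarrow> nat \<Rightarrow> real" where
  "binom_coeff a k = pochhammer a k / fact k"

lemma binom_coeff_nonneg: "0 < a \<Longrightarrow> 0 \<le> binom_coeff a k"
  by (simp add: binom_coeff_def pochhammer_nonneg)

lemma binom_coeff_sums:
  assumes "\<bar>w\<bar> < 1" shows "(\<lambda>k. binom_coeff a k * w ^ k) sums (1 - w) powr (- a)"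
proof -
  have "(\<lambda>k. (- a gchoose k) * (- w) ^ k) sums (1 + - w) powr (- a)"
    by (rule gen_binomial_real) (use assms in simp)
  moreover have "(- a gchoose k) * (- w) ^ k = binom_coeff a k * w ^ k" for k
    by (simp add: gbinomial_pochhammer binom_coeff_def power_minus[of w])
  ultimately show ?thesis by simp
qed

text \<open>Each factor of the covariance receives the square root of a coefficient, so absolute
  convergence of the random series needs these sums. The bound sqrt b <= 1 + b reduces them to a
  geometric and a binomial series.\<close>

lemma sqrt_binom_coeff_summable:
  assumes "0 < a" "0 \<le> \<rho>" "\<rho> < 1"
  shows "summable (\<lambda>k. sqrt (binom_coeff a k) * \<rho> ^ k)"
proof (rule summable_comparison_test')
  show "summable (\<lambda>k. \<rho> ^ k + binom_coeff a k * \<rho> ^ k)"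
    using assms by (intro summable_add summable_geometric sums_summable[OF binom_coeff_sums]) auto
  fix k
  have "sqrt b \<le> 1 + b" if "0 \<le> b" for b :: real
    using that by (intro real_le_lsqrt) (auto simp: power2_eq_square algebra_simps)
  then have "sqrt (binom_coeff a k) * \<rho> ^ k \<le> (1 + binom_coeff a k) * \<rho> ^ k"
    using assms binom_coeff_nonneg by (intro mult_right_mono) auto
  then show "norm (sqrt (binom_coeff a k) * \<rho> ^ k) \<le> \<rho> ^ k + binom_coeff a k * \<rho> ^ k"
    using assms binom_coeff_nonneg[of a k] by (simp add: algebra_simps)
qed

text \<open>The Cayley transform turns $(r + r')^{-a}$ into a multiple of $(1 - z z')^{-a}$,
  whose binomial series has nonnegative coefficients.\<close>
definition cayley :: "real \<Rightarrow> real" where "cayley r = (r - 1) / (r + 1)"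

text \<open>With z, z' the Cayley images of r, r', 1 - z z' = 2 (r+r') / ((r+1)(r'+1)). Hence
  (r+r')^(-a) is (1 - z z')^(-a) times 2^a ((r+1)(r'+1))^(-a), and the last factor here is the share
  of r in that prefactor.\<close>

definition mode :: "real \<Rightarrow> nat \<Rightarrow> real \<Rightarrow> real" where
  "mode a k r = sqrt (binom_coeff a k) * cayley r ^ k * (2 powr (a / 2) * (r + 1) powr (- a))"

lemma cayley_measurable [measurable]: "cayley \<in> borel_measurable borel" unfolding cayley_def by measurable
lemma cayley_bound: "0 < r \<Longrightarrow> \<bar>cayley r\<bar> < 1"
  by (auto simp: cayley_def abs_less_iff field_simps)

lemma cayley_mono: "0 < s \<Longrightarrow> s \<le> r \<Longrightarrow> cayley s \<le> cayley r"
  by (simp add: cayley_def field_simps)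

text \<open>By monotonicity |\<open>cayley\<close>| attains its maximum over [s,t] at an
  endpoint.\<close>

lemma cayley_interval:
  assumes "0 < s" "s \<le> t"
  obtains \<rho> where "0 \<le> \<rho>" "\<rho> < 1" "\<And>r. r \<in> {s..t} \<Longrightarrow> \<bar>cayley r\<bar> \<le> \<rho>"
proof (rule that[of "max \<bar>cayley s\<bar> \<bar>cayley t\<bar>"])
  show "max \<bar>cayley s\<bar> \<bar>cayley t\<bar> < 1" using cayley_bound[of s] cayley_bound[of t] assms by simp
  fix r assume "r \<in> {s..t}"
  then have "cayley s \<le> cayley r" "cayley r \<le> cayley t" using cayley_mono[of s r] cayley_mono[of r t] assms by auto
  then show "\<bar>cayley r\<bar> \<le> max \<bar>cayley s\<bar> \<bar>cayley t\<bar>" by linarith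
qed simp

lemma mode_sums:
  assumes "0 < a" "0 < r" "0 < r'"
  shows "(\<lambda>k. mode a k r * mode a k r') sums (r + r') powr (- a)"
proof -
  have w: "\<bar>cayley r * cayley r'\<bar> < 1"
    using cayley_bound[OF assms(2)] cayley_bound[OF assms(3)] mult_strict_mono[of "\<bar>cayley r\<bar>" 1 "\<bar>cayley r'\<bar>" 1] by (simp add: abs_mult)
  have e: "1 - cayley r * cayley r' = 2 * (r + r') / ((r + 1) * (r' + 1))"
  proof -
    have nz: "r + 1 \<noteq> 0" "r' + 1 \<noteq> 0" using assms by auto
    have "1 - cayley r * cayley r' = ((r + 1) * (r' + 1)) / ((r + 1) * (r' + 1)) - ((r - 1) * (r' - 1)) / ((r + 1) * (r' + 1))"
      using nz by (simp add: cayley_def)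
    also have "\<dots> = ((r + 1) * (r' + 1) - (r - 1) * (r' - 1)) / ((r + 1) * (r' + 1))"
      by (rule diff_divide_distrib[symmetric])
    also have "(r + 1) * (r' + 1) - (r - 1) * (r' - 1) = 2 * (r + r')" by (simp add: algebra_simps)
    finally show ?thesis .
  qed
  let ?c = "(2 powr (a / 2) * (r + 1) powr (- a)) * (2 powr (a / 2) * (r' + 1) powr (- a))"
  have "(\<lambda>k. (binom_coeff a k * (cayley r * cayley r') ^ k) * ?c) sums ((1 - cayley r * cayley r') powr (- a) * ?c)"
    by (rule sums_mult2[OF binom_coeff_sums[OF w]])
  moreover have "(binom_coeff a k * (cayley r * cayley r') ^ k) * ?c = mode a k r * mode a k r'" for k
  proof -
    have "binom_coeff a k = sqrt (binom_coeff a k) * sqrt (binom_coeff a k)" using binom_coeff_nonneg[OF assms(1)] by simp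
    then show ?thesis unfolding mode_def power_mult_distrib by (rule ssubst[where P = "\<lambda>X. X * _ * _ = _"]) (simp only: ac_simps)
  qed
  moreover have "(1 - cayley r * cayley r') powr (- a) * ?c = (r + r') powr (- a)"
  proof -
    have 1: "2 powr (a / 2) * 2 powr (a / 2) * 2 powr (- a) = (1::real)" by (simp add: powr_add[symmetric])
    have 2: "x powr (- a) * (1 / x powr (- a)) = 1" if "x > 0" for x :: real using that by simp
    have "(1 - cayley r * cayley r') powr (- a) = 2 powr (- a) * (r + r') powr (- a) * (1 / (r + 1) powr (- a)) * (1 / (r' + 1) powr (- a))"
    proof -
      have 3: "(2 * (r + r')) powr (- a) = 2 powr (- a) * (r + r') powr (- a)" by (rule powr_mult)
      have 4: "((r + 1) * (r' + 1)) powr (- a) = (r + 1) powr (- a) * (r' + 1) powr (- a)" by (rule powr_mult)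
      have "(2 * (r + r') / ((r + 1) * (r' + 1))) powr (- a) = (2 * (r + r')) powr (- a) / ((r + 1) * (r' + 1)) powr (- a)"
        by (rule powr_divide)
      then show ?thesis unfolding e 3 4 by simp
    qed
    then have "(1 - cayley r * cayley r') powr (- a) * ?c = (2 powr (a / 2) * 2 powr (a / 2) * 2 powr (- a)) * (r + r') powr (- a)
       * ((r + 1) powr (- a) * (1 / (r + 1) powr (- a))) * ((r' + 1) powr (- a) * (1 / (r' + 1) powr (- a)))" by (simp only: mult_ac)
    also have "\<dots> = (r + r') powr (- a)" unfolding 1 using assms by (simp add: 2)
    finally show ?thesis .
  qed
  ultimately show ?thesis by simp
qed

lemma mode_bound:
  assumes a: "0 < a" and r: "0 < r" "\<bar>cayley r\<bar> \<le> \<rho>"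
  shows "\<bar>mode a k r\<bar> \<le> 2 powr (a / 2) * (sqrt (binom_coeff a k) * \<rho> ^ k)"
proof -
  have "(r + 1) powr (- a) \<le> 1 powr (- a)" using a r by (intro powr_mono2') auto
  then have "(sqrt (binom_coeff a k) * \<bar>cayley r\<bar> ^ k) * (2 powr (a / 2) * (r + 1) powr (- a)) \<le> (sqrt (binom_coeff a k) * \<rho> ^ k) * (2 powr (a / 2) * 1)"
    using a r binom_coeff_nonneg[OF a] by (intro mult_mono power_mono mult_nonneg_nonneg) auto
  then show ?thesis unfolding mode_def using binom_coeff_nonneg[OF a, of k] by (simp add: abs_mult power_abs mult_ac)
qed

lemma continuous_on_mode: "S \<subseteq> {0<..} \<Longrightarrow> continuous_on S (mode a k)"
  unfolding mode_def[abs_def] cayley_def by (intro continuous_intros) (auto dest: subsetD)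

lemma sums_set_integral:
  fixes f :: "nat \<Rightarrow> real \<Rightarrow> real"
  assumes st: "s \<le> t" and c: "\<And>k. continuous_on {s..t} (f k)"
    and M: "\<And>k r. r \<in> {s..t} \<Longrightarrow> \<bar>f k r\<bar> \<le> M k" "summable M"
  shows "(\<lambda>k. LINT r:{s..t}|lborel. f k r) sums (LINT r:{s..t}|lborel. (\<Sum>k. f k r))"
proof -
  have M0: "0 \<le> M k" for k using M(1)[of s k] st by auto
  let ?g = "\<lambda>k r. indicator {s..t} r *\<^sub>R f k r"
  have i: "integrable lborel (?g k)" for k
    using borel_integrable_atLeastAtMost'[OF c] by (simp add: set_integrable_def)
  have b: "norm (?g k r) \<le> M k" for k r using M(1)[of r k] M0 by (auto split: split_indicator)
  have "(\<lambda>k. \<integral>r. ?g k r \<partial>lborel) sums (\<integral>r. (\<Sum>k. ?g k r) \<partial>lborel)"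
  proof (rule sums_integral[OF i])
    show "AE r in lborel. summable (\<lambda>k. norm (?g k r))"
      by (intro AE_I2 summable_comparison_test'[OF M(2)]) (use b in simp)
    have "norm (\<integral>r. norm (?g k r) \<partial>lborel) \<le> M k * (t - s)" for k
    proof -
      have "integrable lborel (\<lambda>r. M k * indicator {s..t} r)" using st by simp
      then have "(\<integral>r. norm (?g k r) \<partial>lborel) \<le> (\<integral>r. M k * indicator {s..t} r \<partial>lborel)"
        by (rule integral_mono') (use M(1) M0 in \<open>auto split: split_indicator\<close>)
      then show ?thesis using st by simp
    qed
    then show "summable (\<lambda>k. \<integral>r. norm (?g k r) \<partial>lborel)"
      by (intro summable_comparison_test'[OF summable_mult2[OF M(2)]]) 
  qed
  moreover have "(\<Sum>k. ?g k r) = indicator {s..t} r *\<^sub>R (\<Sum>k. f k r)" for r by (auto split: split_indicator)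
  ultimately show ?thesis unfolding set_lebesgue_integral_def by simp
qed

lemma set_integral_FTC:
  fixes F :: "real \<Rightarrow> real"
  assumes "s \<le> t" "\<And>r. r \<in> {s..t} \<Longrightarrow> (F has_real_derivative f r) (at r)" "continuous_on {s..t} f"
  shows "(LINT r:{s..t}|lborel. f r) = F t - F s"
proof -
  have "has_bochner_integral lborel (\<lambda>x. indicator {s..t} x *\<^sub>R f x) (F t - F s)"
    using assms by (intro has_bochner_integral_FTC_Icc) (auto simp: has_real_derivative_iff_has_vector_derivative[symmetric] intro: DERIV_subset)
  then show ?thesis unfolding set_lebesgue_integral_def by (rule has_bochner_integral_integral_eq)
qed

text \<open>The sum is the double integral of (r+r')^(H-2) over the square with side [s,t]:
  summation and integration are exchanged once in each variable, and both integrals are elementary.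
  Staying away from 0 keeps |\<open>cayley\<close>| below some rho < 1, which provides the summable
  majorant.\<close>

lemma mode_integral_square_sums:
  assumes H: "0 < H" "H < 1" and st: "0 < s" "s \<le> t"
  shows "(\<lambda>k. (LINT r:{s..t}|lborel. mode (2 - H) k r)\<^sup>2) sums ((2 * (t + s) powr H - (2 * t) powr H - (2 * s) powr H) / (H * (1 - H)))"
proof -
  let ?a = "2 - H"
  have a: "0 < ?a" using H by simp
  obtain \<rho> where \<rho>: "0 \<le> \<rho>" "\<rho> < 1" "\<And>r. r \<in> {s..t} \<Longrightarrow> \<bar>cayley r\<bar> \<le> \<rho>" by (rule cayley_interval[OF st]) blast
  let ?m = "\<lambda>k. 2 powr (?a / 2) * (sqrt (binom_coeff ?a k) * \<rho> ^ k)"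
  have mb: "\<bar>mode ?a k r\<bar> \<le> ?m k" if "r \<in> {s..t}" for k r using that st \<rho> by (intro mode_bound[OF a]) auto
  have m0: "0 \<le> ?m k" for k using \<rho> binom_coeff_nonneg[OF a] by simp
  \<comment> \<open>In the product of two majorants the square roots combine, leaving the binomial
    series at rho^2.\<close>
  have sm: "summable (\<lambda>k. ?m k * ?m k)"
  proof -
    have "?m k * ?m k = (2 powr (?a / 2) * 2 powr (?a / 2)) * (binom_coeff ?a k * (\<rho>\<^sup>2) ^ k)" for k
    proof -
      have "sqrt (binom_coeff ?a k) * sqrt (binom_coeff ?a k) = binom_coeff ?a k" using binom_coeff_nonneg[OF a] by simp
      then have "binom_coeff ?a k * X = sqrt (binom_coeff ?a k) * (sqrt (binom_coeff ?a k) * X)" for X by (simp add: mult.assoc[symmetric])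
      then show ?thesis unfolding power2_eq_square power_mult_distrib by (simp only: mult_ac)
    qed
    moreover have "\<bar>\<rho>\<^sup>2\<bar> < 1" using \<rho> by (simp add: power_less_one_iff abs_square_less_1)
    ultimately show ?thesis using sums_summable[OF binom_coeff_sums, of "\<rho>\<^sup>2" ?a] by (simp only: summable_mult)
  qed
  note cm = continuous_on_mode[of "{s..t}" ?a]
  have sub: "{s..t} \<subseteq> {0<..}" using st by auto
  define c where "c = (\<lambda>k. LINT r:{s..t}|lborel. mode ?a k r)"
  \<comment> \<open>The inner integral of (r+r')^(H-2) over r' in [s,t].\<close>
  define G where "G = (\<lambda>r. ((r + t) powr (H - 1) - (r + s) powr (H - 1)) / (H - 1))"
  have 1: "(\<lambda>k. mode ?a k r * c k) sums G r" if r: "r \<in> {s..t}" for r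
  proof -
    have "(\<lambda>k. LINT r':{s..t}|lborel. mode ?a k r * mode ?a k r') sums (LINT r':{s..t}|lborel. (\<Sum>k. mode ?a k r * mode ?a k r'))"
    proof (rule sums_set_integral[OF st(2) _ _ sm])
      show "\<bar>mode ?a k r * mode ?a k r'\<bar> \<le> ?m k * ?m k" if "r' \<in> {s..t}" for k r'
        unfolding abs_mult[of "mode ?a k r"] using mb[OF r] mb[OF that] m0 by (intro mult_mono) auto
    qed (intro continuous_intros cm sub)
    moreover have "(LINT r':{s..t}|lborel. mode ?a k r * mode ?a k r') = mode ?a k r * c k" for k unfolding c_def by simp
    moreover have "(LINT r':{s..t}|lborel. (\<Sum>k. mode ?a k r * mode ?a k r')) = (LINT r':{s..t}|lborel. (r + r') powr (H - 2))"
    proof (rule set_lebesgue_integral_cong)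
      show "\<forall>r'. r' \<in> {s..t} \<longrightarrow> (\<Sum>k. mode ?a k r * mode ?a k r') = (r + r') powr (H - 2)"
        using sums_unique[OF mode_sums[OF a]] r st by simp
    qed simp
    moreover have "(LINT r':{s..t}|lborel. (r + r') powr (H - 2)) = (r + t) powr (H - 1) / (H - 1) - (r + s) powr (H - 1) / (H - 1)"
    proof (rule set_integral_FTC[OF st(2)])
      fix r' assume "r' \<in> {s..t}"
      then have "0 < r + r'" using r st by simp
      then have "((\<lambda>r'. (r + r') powr (H - 1)) has_real_derivative (H - 1) * (r + r') powr (H - 1 - 1) * 1) (at r')"
        by (intro DERIV_chain2[OF has_real_derivative_powr]) (auto intro!: derivative_eq_intros)
      from DERIV_cdivide[OF this, of "H - 1"]
      show "((\<lambda>r'. (r + r') powr (H - 1) / (H - 1)) has_real_derivative (r + r') powr (H - 2)) (at r')"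
        using H by simp
    qed (use r st in \<open>auto intro!: continuous_intros\<close>)
    ultimately show ?thesis by (simp only: G_def diff_divide_distrib)
  qed
  have cb: "\<bar>c k\<bar> \<le> ?m k * (t - s)" for k
  proof -
    have i: "set_integrable lborel {s..t} (mode ?a k)" by (rule borel_integrable_atLeastAtMost'[OF cm[OF sub]])
    have "\<bar>c k\<bar> \<le> (\<integral>r. \<bar>indicator {s..t} r *\<^sub>R mode ?a k r\<bar> \<partial>lborel)"
      unfolding c_def set_lebesgue_integral_def by (rule integral_abs_bound)
    also have "\<dots> \<le> (\<integral>r. ?m k * indicator {s..t} r \<partial>lborel)"
    proof (rule integral_mono')
      show "integrable lborel (\<lambda>r. ?m k * indicator {s..t} r)" using st by simp
    qed (use mb m0 in \<open>auto split: split_indicator\<close>)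
    also have "\<dots> = ?m k * (t - s)" using st by simp
    finally show ?thesis .
  qed
  have "(\<lambda>k. LINT r:{s..t}|lborel. mode ?a k r * c k) sums (LINT r:{s..t}|lborel. (\<Sum>k. mode ?a k r * c k))"
  proof (rule sums_set_integral[OF st(2) _ _ summable_mult2[OF sm, of "t - s"]])
    show "\<bar>mode ?a k r * c k\<bar> \<le> ?m k * ?m k * (t - s)" if "r \<in> {s..t}" for k r
      unfolding abs_mult[of "mode ?a k r"] mult.assoc[of _ _ "t - s"] using mb[OF that] cb[of k] m0 by (intro mult_mono) auto
  qed (intro continuous_intros cm sub)
  moreover have "(LINT r:{s..t}|lborel. mode ?a k r * c k) = (c k)\<^sup>2" for k by (simp add: c_def[symmetric] power2_eq_square) (simp add: c_def)
  moreover have "(LINT r:{s..t}|lborel. (\<Sum>k. mode ?a k r * c k)) = (LINT r:{s..t}|lborel. G r)"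
    using sums_unique[OF 1] by (intro set_lebesgue_integral_cong) auto
  moreover have "(LINT r:{s..t}|lborel. G r) = ((t + t) powr H - (t + s) powr H) / (H * (H - 1)) - ((s + t) powr H - (s + s) powr H) / (H * (H - 1))"
  proof (rule set_integral_FTC[OF st(2)])
    fix r assume "r \<in> {s..t}"
    then have p: "0 < r + t" "0 < r + s" using st by auto
    have "((\<lambda>r. ((r + t) powr H - (r + s) powr H) / (H * (H - 1))) has_real_derivative (H * (r + t) powr (H - 1) - H * (r + s) powr (H - 1)) / (H * (H - 1))) (at r)"
      using p H by (auto intro!: derivative_eq_intros)
    also have "(H * (r + t) powr (H - 1) - H * (r + s) powr (H - 1)) / (H * (H - 1)) = G r"
      using H unfolding G_def right_diff_distrib[symmetric] by simp
    finally show "((\<lambda>r. ((r + t) powr H - (r + s) powr H) / (H * (H - 1))) has_real_derivative G r) (at r)" .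
  qed (use st H in \<open>auto simp: G_def intro!: continuous_intros\<close>)
  moreover have "((t + t) powr H - (t + s) powr H) / (H * (H - 1)) - ((s + t) powr H - (s + s) powr H) / (H * (H - 1)) = (2 * (t + s) powr H - (2 * t) powr H - (2 * s) powr H) / (H * (1 - H))"
  proof -
    have "H * (H - 1) = - (H * (1 - H))" by (simp add: algebra_simps)
    moreover have "t + t = 2 * t" "s + s = 2 * s" "s + t = t + s" by simp_all
    ultimately show ?thesis by (simp only: divide_minus_right) (simp add: diff_divide_distrib add_divide_distrib)
  qed
  ultimately show ?thesis unfolding c_def by simp
qed

text \<open>Since \<open>cayley\<close> has derivative 2 (r+1)^(-2), differentiating one term yields
  two terms, with exponents b - 1 and b - 2. Admitting sums therefore makes the class closed under
  differentiation on the open half-line.\<close>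

inductive_set cayley_series :: "(real \<Rightarrow> real) set" where
  base: "(\<And>w. \<bar>w\<bar> < 1 \<Longrightarrow> summable (\<lambda>k. p k * w ^ k)) \<Longrightarrow> (\<lambda>r. (r + 1) powr b * (\<Sum>k. p k * cayley r ^ k)) \<in> cayley_series"
| sum: "f \<in> cayley_series \<Longrightarrow> g \<in> cayley_series \<Longrightarrow> (\<lambda>r. f r + g r) \<in> cayley_series"

lemma cayley_series_deriv:
  assumes "f \<in> cayley_series"
  shows "\<exists>g\<in>cayley_series. \<forall>r\<in>{0<..}. (f has_real_derivative g r) (at r)"
  using assms
proof induction
  case (base p b)
  have d: "summable (\<lambda>k. diffs p k * w ^ k)" if "\<bar>w\<bar> < 1" for w :: real
    by (rule termdiff_converges[of w 1]) (use that base in auto)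
  have "((\<lambda>r. (r + 1) powr b * (\<Sum>k. p k * cayley r ^ k)) has_real_derivative
      (r + 1) powr (b - 1) * (\<Sum>k. (b * p k) * cayley r ^ k) + (r + 1) powr (b - 2) * (\<Sum>k. (2 * diffs p k) * cayley r ^ k)) (at r)"
    if r: "0 < r" for r
  proof -
    note w = cayley_bound[OF r]
    have c: "(cayley has_real_derivative 2 * (r + 1) powr (- 2)) (at r)"
    proof -
      have "(cayley has_real_derivative (1 * (r + 1) - (r - 1) * 1) / ((r + 1) * (r + 1))) (at r)"
        unfolding cayley_def[abs_def] using r by (auto intro!: derivative_eq_intros)
      moreover have "(1 * (r + 1) - (r - 1) * 1) / ((r + 1) * (r + 1)) = 2 * (r + 1) powr (- 2)"
        using r by (simp add: powr_minus power2_eq_square divide_inverse)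
      ultimately show ?thesis by simp
    qed
    have s: "((\<lambda>w. \<Sum>k. p k * w ^ k) has_real_derivative (\<Sum>k. diffs p k * cayley r ^ k)) (at (cayley r))"
      by (rule termdiffs_strong'[of 1]) (use base w in auto)
    have "((\<lambda>r. (r + 1) powr b * (\<Sum>k. p k * cayley r ^ k)) has_real_derivative
       (b * (r + 1) powr (b - 1)) * (\<Sum>k. p k * cayley r ^ k) + ((\<Sum>k. diffs p k * cayley r ^ k) * (2 * (r + 1) powr (- 2))) * (r + 1) powr b) (at r)"
      by (rule DERIV_mult[OF _ DERIV_chain2[OF s c]]) (use r in \<open>auto intro!: derivative_eq_intros\<close>)
    moreover have "(\<Sum>k. (b * p k) * cayley r ^ k) = b * (\<Sum>k. p k * cayley r ^ k)"
      using suminf_mult[OF base[OF w], of b] by (simp add: mult.assoc)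
    moreover have "(\<Sum>k. (2 * diffs p k) * cayley r ^ k) = 2 * (\<Sum>k. diffs p k * cayley r ^ k)"
      using suminf_mult[OF d[OF w], of 2] by (simp add: mult.assoc)
    moreover have "((\<Sum>k. diffs p k * cayley r ^ k) * (2 * (r + 1) powr (- 2))) * (r + 1) powr b = (r + 1) powr (b - 2) * (2 * (\<Sum>k. diffs p k * cayley r ^ k))"
    proof -
      have "(r + 1) powr (b - 2) = (r + 1) powr (- 2) * (r + 1) powr b" by (simp add: powr_add[symmetric])
      then show ?thesis by (simp only: mult_ac)
    qed
    ultimately show ?thesis by (simp only: mult.assoc mult.left_commute[of b])
  qed
  moreover have "(\<lambda>r. (r + 1) powr (b - 1) * (\<Sum>k. (b * p k) * cayley r ^ k) + (r + 1) powr (b - 2) * (\<Sum>k. (2 * diffs p k) * cayley r ^ k)) \<in> cayley_series"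
    by (intro cayley_series.intros) (use summable_mult[OF base] summable_mult[OF d] in \<open>auto simp: mult.assoc\<close>)
  ultimately show ?case by (intro bexI) auto
next
  case (sum f g)
  then obtain f' g' where "f' \<in> cayley_series" "g' \<in> cayley_series" "\<And>r. r \<in> {0<..} \<Longrightarrow> (f has_real_derivative f' r) (at r)"
    "\<And>r. r \<in> {0<..} \<Longrightarrow> (g has_real_derivative g' r) (at r)" by blast
  then show ?case using cayley_series.sum[of f' g'] by (intro bexI[of _ "\<lambda>r. f' r + g' r"]) (auto intro!: DERIV_add)
qed

section \<open>Sample paths and increments of the time process\<close>

context orthonormal_gaussian begin

lemma expectation_abs_xi_le: "expectation (\<lambda>\<omega>. \<bar>\<xi> k \<omega>\<bar>) \<le> 1"
  using expectation_abs_le[OF xi_sq_int, of k] orthonormal[of k k] by (simp add: power2_eq_square)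

lemma nn_integral_abs_xi_le: "(\<integral>\<^sup>+\<omega>. ennreal \<bar>\<xi> k \<omega>\<bar> \<partial>M) \<le> 1"
proof -
  have "(\<integral>\<^sup>+\<omega>. ennreal \<bar>\<xi> k \<omega>\<bar> \<partial>M) = ennreal (expectation (\<lambda>\<omega>. \<bar>\<xi> k \<omega>\<bar>))"
    using sq_int_integrable[OF xi_sq_int, of k] by (intro nn_integral_eq_integral) auto
  then show ?thesis using expectation_abs_xi_le[of k] by (simp add: ennreal_le_1)
qed

definition radius :: "nat \<Rightarrow> real" where "radius n = real (Suc n) / real (Suc (Suc n))"

text \<open>Countably many radii increasing to 1 express absolute convergence for all arguments of
  modulus below 1 and keep the event measurable.\<close>

definition tame :: "real \<Rightarrow> 'a \<Rightarrow> bool" where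
  "tame a \<omega> \<longleftrightarrow> (\<forall>n. (\<Sum>k. ennreal (\<bar>\<xi> k \<omega>\<bar> * (sqrt (binom_coeff a k) * radius n ^ k))) \<noteq> \<infinity>)"

lemma tame_measurable [measurable]: "Measurable.pred M (tame a)"
  unfolding tame_def[abs_def] by measurable

text \<open>By Tonelli: each |xi k| has mean at most 1, so the expectation of the series is bounded
  by the deterministic series of \<open>sqrt_binom_coeff_summable\<close>.\<close>

lemma AE_tame:
  assumes a: "0 < a" shows "AE \<omega> in M. tame a \<omega>"
proof -
  have "AE \<omega> in M. (\<Sum>k. ennreal (\<bar>\<xi> k \<omega>\<bar> * (sqrt (binom_coeff a k) * radius n ^ k))) \<noteq> \<infinity>" for n
  proof (rule nn_integral_noteq_infinite)
    let ?c = "\<lambda>k. sqrt (binom_coeff a k) * radius n ^ k"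
    have r: "0 \<le> radius n" "radius n < 1" by (auto simp: radius_def)
    have c0: "0 \<le> ?c k" for k using r binom_coeff_nonneg[OF a] by simp
    have "(\<integral>\<^sup>+\<omega>. (\<Sum>k. ennreal (\<bar>\<xi> k \<omega>\<bar> * ?c k)) \<partial>M) = (\<Sum>k. \<integral>\<^sup>+\<omega>. ennreal (\<bar>\<xi> k \<omega>\<bar> * ?c k) \<partial>M)"
      by (rule nn_integral_suminf) simp
    also have "\<dots> \<le> (\<Sum>k. ennreal (?c k))"
    proof (rule suminf_le)
      fix k
      have "(\<integral>\<^sup>+\<omega>. ennreal (\<bar>\<xi> k \<omega>\<bar> * ?c k) \<partial>M) = (\<integral>\<^sup>+\<omega>. ennreal \<bar>\<xi> k \<omega>\<bar> * ennreal (?c k) \<partial>M)"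
        using c0 by (intro nn_integral_cong) (simp add: ennreal_mult)
      also have "\<dots> = (\<integral>\<^sup>+\<omega>. ennreal \<bar>\<xi> k \<omega>\<bar> \<partial>M) * ennreal (?c k)" by (rule nn_integral_multc) simp
      also have "\<dots> \<le> 1 * ennreal (?c k)" by (intro mult_right_mono nn_integral_abs_xi_le) simp
      finally show "(\<integral>\<^sup>+\<omega>. ennreal (\<bar>\<xi> k \<omega>\<bar> * ?c k) \<partial>M) \<le> ennreal (?c k)" by simp
    qed auto
    also have "\<dots> = ennreal (\<Sum>k. ?c k)"
      by (rule suminf_ennreal2[OF c0 sqrt_binom_coeff_summable[OF a r]])
    finally show "(\<integral>\<^sup>+\<omega>. (\<Sum>k. ennreal (\<bar>\<xi> k \<omega>\<bar> * ?c k)) \<partial>M) \<noteq> \<infinity>" by (auto simp: top_unique)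
  qed simp
  then show ?thesis unfolding tame_def AE_all_countable by blast
qed

lemma tame_summable:
  assumes a: "0 < a" and t: "tame a \<omega>" and \<rho>: "0 \<le> \<rho>" "\<rho> < 1"
  shows "summable (\<lambda>k. \<bar>\<xi> k \<omega>\<bar> * (sqrt (binom_coeff a k) * \<rho> ^ k))"
proof -
  \<comment> \<open>This n makes 1 - rho exceed 1/(n+2), which is 1 -
    \<open>radius n\<close>.\<close>
  obtain n :: nat where n: "1 / (1 - \<rho>) < real n" using reals_Archimedean2 by blast
  then have "\<rho> \<le> radius n" using \<rho> unfolding radius_def by (simp add: field_simps)
  have "summable (\<lambda>k. \<bar>\<xi> k \<omega>\<bar> * (sqrt (binom_coeff a k) * radius n ^ k))"
    using t binom_coeff_nonneg[OF a] unfolding tame_def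
    by (intro summable_suminf_not_top) (auto simp: radius_def)
  then show ?thesis
  proof (rule summable_comparison_test')
    fix k
    show "norm (\<bar>\<xi> k \<omega>\<bar> * (sqrt (binom_coeff a k) * \<rho> ^ k)) \<le> \<bar>\<xi> k \<omega>\<bar> * (sqrt (binom_coeff a k) * radius n ^ k)"
      using \<rho> \<open>\<rho> \<le> radius n\<close> binom_coeff_nonneg[OF a, of k] by (auto simp: abs_mult intro!: mult_left_mono power_mono)
  qed
qed

text \<open>A Gaussian process with covariance $(r + r')^{-a}$, that is $\sum_k \xi_k\, \mathrm{mode}_{a,k}(r)$; its paths are power series in the Cayley variable on a set of full measure, and the sum is replaced by $0$ off that set.\<close>
definition slope :: "real \<Rightarrow> real \<Rightarrow> 'a \<Rightarrow> real" where
  "slope a r \<omega> = (if tame a \<omega> then (r + 1) powr (- a) * (\<Sum>k. (2 powr (a / 2) * (\<xi> k \<omega> * sqrt (binom_coeff a k))) * cayley r ^ k) else 0)"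

lemma slope_measurable [measurable (raw)]:
  assumes [measurable]: "f \<in> borel_measurable N" "g \<in> measurable N M"
  shows "(\<lambda>p. slope a (f p) (g p)) \<in> borel_measurable N"
proof -
  have [measurable]: "(\<lambda>p. \<xi> k (g p)) \<in> borel_measurable N" for k by (rule measurable_compose[OF assms(2) xi_measurable])
  have [measurable]: "Measurable.pred N (\<lambda>p. tame a (g p))" by (rule measurable_compose[OF assms(2) tame_measurable])
  show ?thesis unfolding slope_def by measurable
qed

lemma slope_series_summable:
  assumes "0 < a" "tame a \<omega>" "\<bar>w\<bar> < 1"
  shows "summable (\<lambda>k. (2 powr (a / 2) * (\<xi> k \<omega> * sqrt (binom_coeff a k))) * w ^ k)"
proof (rule summable_rabs_cancel)
  have "summable (\<lambda>k. 2 powr (a / 2) * (\<bar>\<xi> k \<omega>\<bar> * (sqrt (binom_coeff a k) * \<bar>w\<bar> ^ k)))"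
    by (intro summable_mult tame_summable assms) simp
  then show "summable (\<lambda>k. \<bar>2 powr (a / 2) * (\<xi> k \<omega> * sqrt (binom_coeff a k)) * w ^ k\<bar>)"
    using binom_coeff_nonneg[OF assms(1)] by (simp add: abs_mult power_abs mult_ac)
qed

lemma slope_in_cayley_series:
  assumes "0 < a" "tame a \<omega>" shows "(\<lambda>r. slope a r \<omega>) \<in> cayley_series"
  using cayley_series.base[OF slope_series_summable[OF assms], of "- a"] assms(2) by (simp add: slope_def)

lemma slope_sums:
  assumes "0 < a" "tame a \<omega>" "0 < r"
  shows "(\<lambda>k. mode a k r * \<xi> k \<omega>) sums slope a r \<omega>"
proof -
  let ?p = "\<lambda>k. (2 powr (a / 2) * (\<xi> k \<omega> * sqrt (binom_coeff a k))) * cayley r ^ k"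
  have "(\<lambda>k. (r + 1) powr (- a) * ?p k) sums ((r + 1) powr (- a) * (\<Sum>k. ?p k))"
    by (intro sums_mult summable_sums slope_series_summable cayley_bound assms)
  moreover have "(r + 1) powr (- a) * ?p k = mode a k r * \<xi> k \<omega>" for k unfolding mode_def by (simp only: mult_ac)
  ultimately show ?thesis using assms(2) by (simp only: slope_def if_True)
qed

lemma continuous_on_slope:
  assumes "0 < a" "S \<subseteq> {0<..}" shows "continuous_on S (\<lambda>r. slope a r \<omega>)"
proof (cases "tame a \<omega>")
  case True
  from cayley_series_deriv[OF slope_in_cayley_series[OF assms(1) True]] assms(2) show ?thesis
    by (meson DERIV_isCont continuous_at_imp_continuous_on subsetD)
next
  case False
  then show ?thesis by (simp add: slope_def)
qed

lemma msq_slope: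
  assumes "0 < a" "0 < r" shows "sq_int M (slope a r)" "msq M (slope a r) = (2 * r) powr (- a)"
proof -
  have s: "(\<lambda>k. (mode a k r)\<^sup>2) sums (2 * r) powr (- a)"
    using mode_sums[OF assms(1,2,2)] by (simp add: power2_eq_square)
  have ae: "AE \<omega> in M. (\<lambda>k. mode a k r * \<xi> k \<omega>) sums slope a r \<omega>"
    using AE_tame[OF assms(1)] by eventually_elim (rule slope_sums[OF assms(1) _ assms(2)])
  have m: "slope a r \<in> borel_measurable M" by measurable
  note g = series_generated[OF m ae sums_summable[OF s]]
  show "sq_int M (slope a r)" by (rule generated_sq_int[OF g(1)])
  show "msq M (slope a r) = (2 * r) powr (- a)" using g(2) sums_unique[OF s] by simp
qed

text \<open>Integrability down to $r = 0$ gives continuity of the primitive at $0$.\<close>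
definition regular :: "real \<Rightarrow> 'a \<Rightarrow> bool" where
  "regular a \<omega> \<longleftrightarrow> tame a \<omega> \<and> (\<integral>\<^sup>+r. ennreal \<bar>slope a r \<omega>\<bar> * indicator {0..1} r \<partial>lborel) \<noteq> \<infinity>"

lemma regular_measurable [measurable]: "Measurable.pred M (regular a)"
proof -
  have [measurable]: "(\<lambda>\<omega>. \<integral>\<^sup>+r. ennreal \<bar>slope a r \<omega>\<bar> * indicator {0..1} r \<partial>lborel) \<in> borel_measurable M"
    by (rule lborel.borel_measurable_nn_integral) (simp add: case_prod_beta)
  show ?thesis unfolding regular_def[abs_def] by measurable
qed

text \<open>The variance (2r)^(H-2) of the slope is not integrable at 0, but its standard deviation,
  at most r^(H/2-1), is, and it bounds the mean of the absolute value. Tonelli then gives a finite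
  integral for almost every path.\<close>

lemma AE_regular:
  assumes H: "0 < H" "H < 1" shows "AE \<omega> in M. regular (2 - H) \<omega>"
proof -
  let ?a = "2 - H"
  have a: "0 < ?a" using H by simp
  interpret P: pair_sigma_finite lborel M by (simp add: pair_sigma_finite_def sigma_finite_measure_axioms lborel.sigma_finite_measure_axioms)
  have "(\<integral>\<^sup>+\<omega>. \<integral>\<^sup>+r. ennreal \<bar>slope ?a r \<omega>\<bar> * indicator {0..1} r \<partial>lborel \<partial>M) = (\<integral>\<^sup>+r. \<integral>\<^sup>+\<omega>. ennreal \<bar>slope ?a r \<omega>\<bar> * indicator {0..1} r \<partial>M \<partial>lborel)"
    by (rule P.Fubini') (simp add: case_prod_beta)
  also have "\<dots> \<le> (\<integral>\<^sup>+r. ennreal (r powr (H / 2 - 1)) * indicator {0..1} r \<partial>lborel)"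
  proof (rule nn_integral_mono_AE, use AE_lborel_singleton[of 0] in eventually_elim)
    fix r :: real assume "r \<noteq> 0"
    show "(\<integral>\<^sup>+\<omega>. ennreal \<bar>slope ?a r \<omega>\<bar> * indicator {0..1} r \<partial>M) \<le> ennreal (r powr (H / 2 - 1)) * indicator {0..1} r"
    proof (cases "r \<in> {0..1}")
      case True
      then have r: "0 < r" using \<open>r \<noteq> 0\<close> by simp
      have "(\<integral>\<^sup>+\<omega>. ennreal \<bar>slope ?a r \<omega>\<bar> \<partial>M) = ennreal (expectation (\<lambda>\<omega>. \<bar>slope ?a r \<omega>\<bar>))"
        using sq_int_integrable[OF msq_slope(1)[OF a r]] by (intro nn_integral_eq_integral) auto
      also have "\<dots> \<le> ennreal (r powr (H / 2 - 1))"
      proof (rule ennreal_leI)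
        have "expectation (\<lambda>\<omega>. \<bar>slope ?a r \<omega>\<bar>) \<le> sqrt ((2 * r) powr (- ?a))"
          using expectation_abs_le[OF msq_slope(1)[OF a r]] msq_slope(2)[OF a r] by simp
        also have "\<dots> = (2 * r) powr (H / 2 - 1)"
        proof -
          have "(- ?a) * (1 / 2) = H / 2 - 1" by simp
          then have "((2 * r) powr (- ?a)) powr (1 / 2) = (2 * r) powr (H / 2 - 1)" unfolding powr_powr by (simp only:)
          then show ?thesis by (simp add: powr_half_sqrt)
        qed
        also have "\<dots> \<le> r powr (H / 2 - 1)" using r H by (intro powr_mono2') auto
        finally show "expectation (\<lambda>\<omega>. \<bar>slope ?a r \<omega>\<bar>) \<le> r powr (H / 2 - 1)" .
      qed
      finally show ?thesis using True by simp
    qed simp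
  qed
  also have "(\<integral>\<^sup>+r. ennreal (r powr (H / 2 - 1)) * indicator {0..1} r \<partial>lborel) = ennreal (1 powr (H / 2 - 1 + 1) / (H / 2 - 1 + 1))"
    by (rule nn_integral_has_integral_lebesgue'[OF _ has_integral_powr_from_0]) (use H in auto)
  finally have le: "(\<integral>\<^sup>+\<omega>. \<integral>\<^sup>+r. ennreal \<bar>slope ?a r \<omega>\<bar> * indicator {0..1} r \<partial>lborel \<partial>M) \<le> ennreal (1 powr (H / 2 - 1 + 1) / (H / 2 - 1 + 1))" .
  have "(\<lambda>\<omega>. \<integral>\<^sup>+r. ennreal \<bar>slope ?a r \<omega>\<bar> * indicator {0..1} r \<partial>lborel) \<in> borel_measurable M"
    by (rule lborel.borel_measurable_nn_integral) (simp add: case_prod_beta)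
  then have "AE \<omega> in M. (\<integral>\<^sup>+r. ennreal \<bar>slope ?a r \<omega>\<bar> * indicator {0..1} r \<partial>lborel) \<noteq> \<infinity>"
    by (rule nn_integral_noteq_infinite) (use le in \<open>auto simp: top_unique\<close>)
  with AE_tame[OF a] show ?thesis by eventually_elim (simp add: regular_def)
qed

lemma regular_integrable:
  assumes "0 < a" "regular a \<omega>" "\<omega> \<in> space M"
  shows "set_integrable lborel {0..t} (\<lambda>r. slope a r \<omega>)"
proof -
  have [measurable]: "(\<lambda>r. slope a r \<omega>) \<in> borel_measurable borel" using assms(3) by measurable
  have 1: "set_integrable lborel {0..1} (\<lambda>r. slope a r \<omega>)"
    unfolding set_integrable_def
  proof (rule integrableI_bounded)
    have "(\<integral>\<^sup>+r. ennreal (norm (indicator {0..1} r *\<^sub>R slope a r \<omega>)) \<partial>lborel) = (\<integral>\<^sup>+r. ennreal \<bar>slope a r \<omega>\<bar> * indicator {0..1} r \<partial>lborel)"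
      by (intro nn_integral_cong) (auto split: split_indicator)
    then show "(\<integral>\<^sup>+r. ennreal (norm (indicator {0..1} r *\<^sub>R slope a r \<omega>)) \<partial>lborel) < \<infinity>"
      using assms(2) by (simp add: regular_def less_top)
  qed simp
  have 2: "set_integrable lborel {1..t} (\<lambda>r. slope a r \<omega>)"
    by (rule borel_integrable_atLeastAtMost'[OF continuous_on_slope[OF assms(1)]]) auto
  show ?thesis by (rule set_integrable_subset[OF set_integrable_Un[OF 1 2]]) auto
qed

definition primitive :: "real \<Rightarrow> real \<Rightarrow> 'a \<Rightarrow> real" where
  "primitive a t \<omega> = (if regular a \<omega> then LINT r:{0..t}|lborel. slope a r \<omega> else 0)"

lemma primitive_measurable [measurable]: "primitive a t \<in> borel_measurable M"
proof -
  have [measurable]: "(\<lambda>\<omega>. LINT r:{0..t}|lborel. slope a r \<omega>) \<in> borel_measurable M"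
    unfolding set_lebesgue_integral_def by (rule lborel.borel_measurable_lebesgue_integral) (simp add: case_prod_beta)
  show ?thesis unfolding primitive_def[abs_def] by measurable
qed

lemma primitive_0 [simp]: "primitive a 0 \<omega> = 0"
proof -
  have "(LINT r:{0..0::real}|lborel. slope a r \<omega>) = 0" unfolding set_lebesgue_integral_def
  proof (rule integral_eq_zero_AE)
    show "AE r in lborel. indicat_real {0..0::real} r *\<^sub>R slope a r \<omega> = 0"
      using AE_lborel_singleton[of "0::real"] by eventually_elim (simp add: indicator_def)
  qed
  then show ?thesis by (simp add: primitive_def)
qed

lemma primitive_eq_integral:
  assumes "0 < a" "regular a \<omega>" "\<omega> \<in> space M"
  shows "(\<lambda>r. slope a r \<omega>) integrable_on {0..t}" "primitive a t \<omega> = integral {0..t} (\<lambda>r. slope a r \<omega>)"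
  using set_borel_integral_eq_integral[OF regular_integrable[OF assms, of t]] assms(2) by (auto simp: primitive_def)

lemma primitive_diff:
  assumes "0 < a" "regular a \<omega>" "\<omega> \<in> space M" "0 < s" "s \<le> t"
  shows "primitive a t \<omega> - primitive a s \<omega> = integral {s..t} (\<lambda>r. slope a r \<omega>)"
    "primitive a t \<omega> - primitive a s \<omega> = (LINT r:{s..t}|lborel. slope a r \<omega>)"
proof -
  show 1: "primitive a t \<omega> - primitive a s \<omega> = integral {s..t} (\<lambda>r. slope a r \<omega>)"
    unfolding primitive_eq_integral(2)[OF assms(1-3)]
    using Henstock_Kurzweil_Integration.integral_combine[OF _ assms(5) primitive_eq_integral(1)[OF assms(1-3)]] assms(4) by simp
  have "set_integrable lborel {s..t} (\<lambda>r. slope a r \<omega>)"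
    by (rule set_integrable_subset[OF regular_integrable[OF assms(1-3), of t]]) (use assms in auto)
  from set_borel_integral_eq_integral(2)[OF this] 1
  show "primitive a t \<omega> - primitive a s \<omega> = (LINT r:{s..t}|lborel. slope a r \<omega>)" by simp
qed

lemma continuous_on_primitive:
  assumes "0 < a" "\<omega> \<in> space M" shows "continuous_on {0..} (\<lambda>t. primitive a t \<omega>)"
proof (cases "regular a \<omega>")
  case True
  show ?thesis unfolding continuous_on_eq_continuous_within
  proof
    fix t :: real assume t: "t \<in> {0..}"
    have "continuous_on {0..t + 1} (\<lambda>t. primitive a t \<omega>)"
      unfolding primitive_eq_integral(2)[OF assms(1) True assms(2)]
      by (rule indefinite_integral_continuous_1[OF primitive_eq_integral(1)[OF assms(1) True assms(2)]])
    then have "continuous (at t within {0..t + 1}) (\<lambda>t. primitive a t \<omega>)" using t by (auto simp: continuous_on_eq_continuous_within)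
    moreover have "at t within {0..t + 1} = at t within {0..}"
      by (rule at_within_nhd[of _ "{..<t + 1}"]) auto
    ultimately show "continuous (at t within {0..}) (\<lambda>t. primitive a t \<omega>)" by simp
  qed
qed (simp add: primitive_def)

lemma DERIV_primitive:
  assumes "0 < a" "\<omega> \<in> space M" "regular a \<omega>" "0 < t"
  shows "((\<lambda>t. primitive a t \<omega>) has_real_derivative slope a t \<omega>) (at t)"
proof -
  have c: "continuous_on {t / 2..t + 1} (\<lambda>r. slope a r \<omega>)" by (rule continuous_on_slope[OF assms(1)]) (use assms(4) in auto)
  \<comment> \<open>Starting at t/2 keeps the interval inside the open half-line, where the slope is
    continuous.\<close>
  have "((\<lambda>x. primitive a (t / 2) \<omega> + integral {t / 2..x} (\<lambda>r. slope a r \<omega>)) has_real_derivative 0 + slope a t \<omega>) (at t within {t / 2..t + 1})"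
    by (intro DERIV_add DERIV_const integral_has_real_derivative[OF c]) (use assms(4) in auto)
  moreover have "at t within {t / 2..t + 1} = at t"
    by (rule at_within_interior) (use assms(4) in simp)
  ultimately have "((\<lambda>x. primitive a (t / 2) \<omega> + integral {t / 2..x} (\<lambda>r. slope a r \<omega>)) has_real_derivative slope a t \<omega>) (at t)" by simp
  then show ?thesis
  proof (rule has_field_derivative_transform_within_open[where S = "{t / 2<..}"])
    fix x assume "x \<in> {t / 2<..}"
    then show "primitive a (t / 2) \<omega> + integral {t / 2..x} (\<lambda>r. slope a r \<omega>) = primitive a x \<omega>"
      using primitive_diff(1)[OF assms(1,3,2), of "t / 2" x] assms(4) by simp
  qed (use assms(4) in auto)
qed

lemma smooth_primitive:
  assumes "0 < a" "\<omega> \<in> space M" shows "smooth_on_real {0<..} (\<lambda>t. primitive a t \<omega>)"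
proof (cases "regular a \<omega>")
  case True
  show ?thesis
  proof (rule smooth_on_real_coinduct[where C = "insert (\<lambda>t. primitive a t \<omega>) cayley_series"])
    fix g assume "g \<in> insert (\<lambda>t. primitive a t \<omega>) cayley_series"
    then show "\<exists>g'\<in>insert (\<lambda>t. primitive a t \<omega>) cayley_series. \<forall>x\<in>{0<..}. (g has_real_derivative g' x) (at x)"
    proof
      assume "g = (\<lambda>t. primitive a t \<omega>)"
      then show ?thesis using DERIV_primitive[OF assms True] slope_in_cayley_series[OF assms(1)] True
        by (intro bexI[of _ "\<lambda>r. slope a r \<omega>"]) (auto simp: regular_def)
    next
      assume "g \<in> cayley_series"
      then show ?thesis using cayley_series_deriv by blast
    qed
  qed auto
qed (simp add: primitive_def smooth_on_real_const)

text \<open>For s > 0 the mode series is dominated uniformly on [s,t] along each regular path and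
  can be integrated term by term. The increment becomes a series in the xi whose squared
  coefficients are summed by \<open>mode_integral_square_sums\<close>; time 0 is reached by a limit
  in \<open>primitive_generated\<close>.\<close>

lemma primitive_increment:
  assumes H: "0 < H" "H < 1" and st: "0 < s" "s \<le> t"
  shows "(\<lambda>\<omega>. primitive (2 - H) t \<omega> - primitive (2 - H) s \<omega>) \<in> generated"
    and "msq M (\<lambda>\<omega>. primitive (2 - H) t \<omega> - primitive (2 - H) s \<omega>) = (2 * (t + s) powr H - (2 * t) powr H - (2 * s) powr H) / (H * (1 - H))"
proof -
  let ?a = "2 - H"
  have a: "0 < ?a" using H by simp
  define c where "c = (\<lambda>k. LINT r:{s..t}|lborel. mode ?a k r)"
  have m: "(\<lambda>\<omega>. primitive ?a t \<omega> - primitive ?a s \<omega>) \<in> borel_measurable M" by measurable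
  have ae: "AE \<omega> in M. (\<lambda>k. c k * \<xi> k \<omega>) sums (primitive ?a t \<omega> - primitive ?a s \<omega>)"
    using AE_regular[OF H] AE_space
  proof eventually_elim
    fix \<omega> assume \<omega>: "regular ?a \<omega>" "\<omega> \<in> space M"
    then have tm: "tame ?a \<omega>" by (simp add: regular_def)
    obtain \<rho> where \<rho>: "0 \<le> \<rho>" "\<rho> < 1" "\<And>r. r \<in> {s..t} \<Longrightarrow> \<bar>cayley r\<bar> \<le> \<rho>" by (rule cayley_interval[OF st]) blast
    have "(\<lambda>k. LINT r:{s..t}|lborel. mode ?a k r * \<xi> k \<omega>) sums (LINT r:{s..t}|lborel. (\<Sum>k. mode ?a k r * \<xi> k \<omega>))"
    proof (rule sums_set_integral[OF st(2)])
      show "continuous_on {s..t} (\<lambda>r. mode ?a k r * \<xi> k \<omega>)" for k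
        by (intro continuous_on_mult_right continuous_on_mode) (use st in auto)
      show "summable (\<lambda>k. 2 powr (?a / 2) * (\<bar>\<xi> k \<omega>\<bar> * (sqrt (binom_coeff ?a k) * \<rho> ^ k)))"
        by (intro summable_mult tame_summable a tm \<rho>)
      show "\<bar>mode ?a k r * \<xi> k \<omega>\<bar> \<le> 2 powr (?a / 2) * (\<bar>\<xi> k \<omega>\<bar> * (sqrt (binom_coeff ?a k) * \<rho> ^ k))" if r: "r \<in> {s..t}" for k r
      proof -
        have "\<bar>mode ?a k r\<bar> \<le> 2 powr (?a / 2) * (sqrt (binom_coeff ?a k) * \<rho> ^ k)" using r st \<rho> by (intro mode_bound[OF a]) auto
        from mult_right_mono[OF this abs_ge_zero[of "\<xi> k \<omega>"]] show ?thesis by (simp only: abs_mult mult_ac)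
      qed
    qed
    moreover have "(LINT r:{s..t}|lborel. mode ?a k r * \<xi> k \<omega>) = c k * \<xi> k \<omega>" for k unfolding c_def by simp
    moreover have "(LINT r:{s..t}|lborel. (\<Sum>k. mode ?a k r * \<xi> k \<omega>)) = (LINT r:{s..t}|lborel. slope ?a r \<omega>)"
      using sums_unique[OF slope_sums[OF a tm]] st by (intro set_lebesgue_integral_cong) auto
    ultimately show "(\<lambda>k. c k * \<xi> k \<omega>) sums (primitive ?a t \<omega> - primitive ?a s \<omega>)"
      unfolding primitive_diff(2)[OF a \<omega> st] by (simp only:)
  qed
  have sm: "(\<lambda>k. (c k)\<^sup>2) sums ((2 * (t + s) powr H - (2 * t) powr H - (2 * s) powr H) / (H * (1 - H)))"
    unfolding c_def by (rule mode_integral_square_sums[OF H st])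
  note g = series_generated[OF m ae sums_summable[OF sm]]
  show "(\<lambda>\<omega>. primitive ?a t \<omega> - primitive ?a s \<omega>) \<in> generated" by (rule g(1))
  show "msq M (\<lambda>\<omega>. primitive ?a t \<omega> - primitive ?a s \<omega>) = (2 * (t + s) powr H - (2 * t) powr H - (2 * s) powr H) / (H * (1 - H))"
    using g(2) sums_unique[OF sm] by simp
qed

text \<open>Along times decreasing to 0, path continuity at 0 supplies the pointwise limit and the
  increment formula the Cauchy estimate.\<close>

lemma primitive_generated:
  assumes H: "0 < H" "H < 1" and t: "0 \<le> t"
  shows "primitive (2 - H) t \<in> generated"
    and "msq M (primitive (2 - H) t) = (2 * t powr H - (2 * t) powr H) / (H * (1 - H))"
proof -
  let ?a = "2 - H" and ?h = "H * (1 - H)"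
  have a: "0 < ?a" and h: "0 < ?h" using H by auto
  have "primitive ?a t \<in> generated \<and> msq M (primitive ?a t) = (2 * t powr H - (2 * t) powr H) / ?h"
  proof (cases "t = 0")
    case True
    then have e: "primitive ?a t = (\<lambda>_. 0)" by (simp add: fun_eq_iff)
    show ?thesis unfolding e using sum_generated[of "{}" "\<lambda>_. 0"] True H by simp
  next
    case False
    then have t: "0 < t" using assms(3) by simp
    define s where "s = (\<lambda>n. t * inverse (real (Suc n)))"
    have s: "0 < s n" "s n \<le> t" for n using t by (auto simp: s_def field_simps)
    have sl: "s \<longlonglongrightarrow> 0" unfolding s_def using tendsto_mult[OF tendsto_const LIMSEQ_inverse_real_of_nat, of t] by simp
    let ?Z = "\<lambda>n \<omega>. primitive ?a t \<omega> - primitive ?a (s n) \<omega>"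
    let ?d = "\<lambda>n. (2 * s n) powr H / ?h"
    have dl0: "(\<lambda>n. (2 * s n) powr H) \<longlonglongrightarrow> 0"
      by (rule tendsto_zero_powrI[of _ _ _ H]) (use tendsto_mult[OF tendsto_const sl, of 2] s H in \<open>auto intro!: always_eventually less_imp_le\<close>)
    then have dl: "?d \<longlonglongrightarrow> 0" using tendsto_divide_zero by blast
    \<comment> \<open>From x + y <= 2 max x y; it brings the variance of an increment near 0 into
      the additive form d n + d m.\<close>
    have bound: "2 * (x + y) powr H - (2 * x) powr H - (2 * y) powr H \<le> (2 * x) powr H + (2 * y) powr H" if "0 < x" "0 < y" for x y :: real
    proof -
      have "(x + y) powr H \<le> (2 * max x y) powr H" using that H by (intro powr_mono2) auto
      also have "\<dots> \<le> (2 * x) powr H + (2 * y) powr H" by (cases "x \<le> y") (auto simp: max_def)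
      finally show ?thesis by simp
    qed
    have d: "msq M (\<lambda>\<omega>. ?Z n \<omega> - ?Z m \<omega>) \<le> ?d n + ?d m" for n m
    proof -
      have w: "msq M (\<lambda>\<omega>. ?Z n \<omega> - ?Z m \<omega>) \<le> ?d n + ?d m" if nm: "s n \<le> s m" for n m
      proof -
        have "msq M (\<lambda>\<omega>. ?Z n \<omega> - ?Z m \<omega>) = msq M (\<lambda>\<omega>. primitive ?a (s m) \<omega> - primitive ?a (s n) \<omega>)" by simp
        also have "\<dots> = (2 * (s m + s n) powr H - (2 * s m) powr H - (2 * s n) powr H) / ?h"
          by (rule primitive_increment(2)[OF H s(1) nm])
        also have "\<dots> \<le> ((2 * s m) powr H + (2 * s n) powr H) / ?h" using h bound[OF s(1) s(1)] by (intro divide_right_mono) auto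
        finally show ?thesis by (simp add: add_divide_distrib)
      qed
      show ?thesis
      proof (cases "s n \<le> s m")
        case False
        have "msq M (\<lambda>\<omega>. ?Z n \<omega> - ?Z m \<omega>) = msq M (\<lambda>\<omega>. ?Z m \<omega> - ?Z n \<omega>)" by (simp only: power2_commute)
        then show ?thesis using w[of m n] False by simp
      qed (rule w)
    qed
    have ae: "AE \<omega> in M. (\<lambda>n. ?Z n \<omega>) \<longlonglongrightarrow> primitive ?a t \<omega>"
    proof (rule AE_I2)
      fix \<omega> assume "\<omega> \<in> space M"
      then have "(\<lambda>n. primitive ?a (s n) \<omega>) \<longlonglongrightarrow> primitive ?a 0 \<omega>"
        using continuous_on_tendsto_compose[OF continuous_on_primitive[OF a] sl] s by (auto intro!: always_eventually less_imp_le)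
      then show "(\<lambda>n. ?Z n \<omega>) \<longlonglongrightarrow> primitive ?a t \<omega>" using tendsto_diff[OF tendsto_const, of _ _ sequentially "primitive ?a t \<omega>"] by fastforce
    qed
    note l = generated_AE_limit[OF primitive_increment(1)[OF H s] _ ae d dl]
    have "(\<lambda>n. (2 * (t + s n) powr H - (2 * t) powr H - (2 * s n) powr H) / ?h) \<longlonglongrightarrow> (2 * (t + 0) powr H - (2 * t) powr H - 0) / ?h"
      using h t by (intro tendsto_intros sl dl0) auto
    then have "(\<lambda>n. msq M (?Z n)) \<longlonglongrightarrow> (2 * t powr H - (2 * t) powr H) / ?h"
      unfolding primitive_increment(2)[OF H s] by simp
    with l show ?thesis using LIMSEQ_unique h by (auto simp: divide_nonneg_nonneg)
  qed
  then show "primitive ?a t \<in> generated" "msq M (primitive ?a t) = (2 * t powr H - (2 * t) powr H) / ?h" by auto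
qed

lemma primitive_increment':
  assumes H: "0 < H" "H < 1" and st: "0 \<le> s" "s \<le> t"
  shows "msq M (\<lambda>\<omega>. primitive (2 - H) t \<omega> - primitive (2 - H) s \<omega>) = (2 * (t + s) powr H - (2 * t) powr H - (2 * s) powr H) / (H * (1 - H))"
  using primitive_increment(2)[OF H _ st(2)] primitive_generated(2)[OF H, of t] st H by (cases "s = 0") auto

end

section \<open>A process with the smooth part of the covariance in space\<close>

text \<open>Closed form of the N-th moment of |xi|^(1-2H) exp(-tau xi^2), as
  \<open>gauss_moment_integral\<close> confirms; odd moments vanish by symmetry.\<close>

definition gauss_moment :: "real \<Rightarrow> real \<Rightarrow> nat \<Rightarrow> real" where
  "gauss_moment H \<tau> N = (if even N then Gamma (real (N div 2) + 1 - H) * \<tau> powr (- (real (N div 2) + 1 - H)) else 0)"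

text \<open>The identity binom(l,i) i! / Gamma(i+alpha+1) = binom(l+alpha, l-i) l! /
  Gamma(l+alpha+1) turns the sum, up to a constant factor, into a Vandermonde convolution with value
  binom(j+l+alpha, l).\<close>

lemma Gamma_Vandermonde:
  assumes "\<alpha> > -1"
  shows "(\<Sum>i\<le>min j l. real (j choose i) * real (l choose i) * (fact i / Gamma (real i + \<alpha> + 1)))
    = Gamma (real (j + l) + \<alpha> + 1) / (Gamma (real j + \<alpha> + 1) * Gamma (real l + \<alpha> + 1))"
proof -
  have pos: "0 < Gamma (real n + \<alpha> + 1)" for n using assms by (intro Gamma_real_pos) simp
  have np: "real n + \<alpha> + 1 \<notin> \<int>\<^sub>\<le>\<^sub>0" for n
  proof
    assume "real n + \<alpha> + 1 \<in> \<int>\<^sub>\<le>\<^sub>0"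
    then have "real n + \<alpha> + 1 \<le> 0" by (auto elim!: nonpos_Ints_cases)
    then show False using assms by simp
  qed
  have g: "(real n + \<alpha> gchoose i) = Gamma (real n + \<alpha> + 1) / (fact i * Gamma (real n + \<alpha> - real i + 1))" for n i
    by (rule gbinomial_Gamma[OF np])
  have "(\<Sum>i\<le>min j l. real (j choose i) * real (l choose i) * (fact i / Gamma (real i + \<alpha> + 1)))
    = (\<Sum>i\<in>{0..l}. real (j choose i) * real (l choose i) * (fact i / Gamma (real i + \<alpha> + 1)))"
    by (rule sum.mono_neutral_left) (auto simp: binomial_eq_0)
  also have "\<dots> = (\<Sum>i\<in>{0..l}. (fact l / Gamma (real l + \<alpha> + 1)) * ((real j gchoose i) * (real l + \<alpha> gchoose (l - i))))"
  proof (rule sum.cong[OF refl])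
    fix i assume "i \<in> {0..l}"
    then have i: "i \<le> l" by simp
    have "real l + \<alpha> - real (l - i) + 1 = real i + \<alpha> + 1" using i by (simp add: of_nat_diff)
    then have "(real l + \<alpha> gchoose (l - i)) = Gamma (real l + \<alpha> + 1) / (fact (l - i) * Gamma (real i + \<alpha> + 1))"
      by (simp only: g)
    moreover have "real (l choose i) = fact l / (fact i * fact (l - i))" by (rule binomial_fact[OF i])
    ultimately have e: "real (l choose i) * (fact i / Gamma (real i + \<alpha> + 1)) = fact l / Gamma (real l + \<alpha> + 1) * (real l + \<alpha> gchoose (l - i))"
      using pos[of l] by simp
    have "real (j choose i) * real (l choose i) * (fact i / Gamma (real i + \<alpha> + 1)) = real (j choose i) * (real (l choose i) * (fact i / Gamma (real i + \<alpha> + 1)))"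
      by (rule mult.assoc)
    then show "real (j choose i) * real (l choose i) * (fact i / Gamma (real i + \<alpha> + 1))
      = (fact l / Gamma (real l + \<alpha> + 1)) * ((real j gchoose i) * (real l + \<alpha> gchoose (l - i)))"
      unfolding e binomial_gbinomial[of j i, symmetric] by (simp only: mult.left_commute)
  qed
  also have "\<dots> = (fact l / Gamma (real l + \<alpha> + 1)) * (real j + (real l + \<alpha>) gchoose l)"
    unfolding sum_distrib_left[symmetric] gbinomial_Vandermonde ..
  also have "(real j + (real l + \<alpha>) gchoose l) = Gamma (real (j + l) + \<alpha> + 1) / (fact l * Gamma (real j + \<alpha> + 1))"
    using g[of "j + l" l] by (simp add: add.assoc)
  finally show ?thesis by simp
qed

text \<open>Lower triangular factor of the moment matrix of the weight $|\xi|^{1-2H} e^{-\tau\xi^2}$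
  (even and odd moments decouple; the entries are Laguerre coefficients).\<close>
definition moment_factor :: "real \<Rightarrow> real \<Rightarrow> nat \<Rightarrow> nat \<Rightarrow> real" where
  "moment_factor H \<tau> n k = (if even (n + k) then
     real (n div 2 choose (k div 2)) * Gamma (real (n div 2) + (real (n mod 2) - H) + 1) *
     sqrt (fact (k div 2) / Gamma (real (k div 2) + (real (n mod 2) - H) + 1)) * \<tau> powr (- (real n + 1 - H) / 2) else 0)"

text \<open>A Cholesky factorisation of the moment matrix. Triangularity lets the n-th moment
  variable be a finite combination of the first n + 1 members of the sequence.\<close>

lemma moment_factor_sum:
  assumes H: "0 < H" "H < 1" and t: "0 < \<tau>"
  shows "(\<Sum>k\<in>{..m} \<inter> {..n}. moment_factor H \<tau> m k * moment_factor H \<tau> n k) = gauss_moment H \<tau> (m + n)"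
proof (cases "even (m + n)")
  case False
  then have "moment_factor H \<tau> m k * moment_factor H \<tau> n k = 0" for k by (auto simp: moment_factor_def)
  then have "(\<Sum>k\<in>{..m} \<inter> {..n}. moment_factor H \<tau> m k * moment_factor H \<tau> n k) = 0" by (intro sum.neutral ballI)
  then show ?thesis using False by (simp only: gauss_moment_def if_False)
next
  case True
  define b where "b = n mod 2"
  have b: "m mod 2 = b" "n mod 2 = b" using True by (auto simp: b_def) presburger
  define j l where "j = m div 2" and "l = n div 2"
  have mn: "m = 2 * j + b" "n = 2 * l + b" using b mult_div_mod_eq[of 2 m] mult_div_mod_eq[of 2 n] by (simp_all add: j_def l_def)
  have b1: "b \<le> 1" by (simp add: b_def)
  \<comment> \<open>The common parity b of m and n moves into the Gamma parameter: an extra factor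
    xi^(2b) in the weight shifts -H to b - H.\<close>
  define \<alpha> where "\<alpha> = real b - H"
  have \<alpha>: "\<alpha> > -1" using H by (simp add: \<alpha>_def)
  have pos: "0 < Gamma (real n + \<alpha> + 1)" for n using \<alpha> by (intro Gamma_real_pos) simp
  let ?f = "\<lambda>k. moment_factor H \<tau> m k * moment_factor H \<tau> n k"
  \<comment> \<open>Entries of the other parity vanish, so k runs over the numbers 2 i + b.\<close>
  have "(\<Sum>k\<in>{..m} \<inter> {..n}. ?f k) = (\<Sum>k\<in>(\<lambda>i. 2 * i + b) ` {..min j l}. ?f k)"
  proof (rule sum.mono_neutral_right)
    show "(\<lambda>i. 2 * i + b) ` {..min j l} \<subseteq> {..m} \<inter> {..n}" using mn by auto
    show "\<forall>k\<in>{..m} \<inter> {..n} - (\<lambda>i. 2 * i + b) ` {..min j l}. ?f k = 0"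
    proof
      fix k assume k: "k \<in> {..m} \<inter> {..n} - (\<lambda>i. 2 * i + b) ` {..min j l}"
      have "odd (n + k)"
      proof
        assume "even (n + k)"
        then have "k mod 2 = b" using b(2) by presburger
        then have "k = 2 * (k div 2) + b" by presburger
        moreover have "k div 2 \<le> min j l" using k by (auto simp: j_def l_def intro: div_le_mono)
        ultimately show False using k by blast
      qed
      then show "?f k = 0" by (simp add: moment_factor_def)
    qed
  qed simp
  also have "\<dots> = (\<Sum>i\<le>min j l. ?f (2 * i + b))" by (subst sum.reindex) (auto simp: inj_on_def)
  also have "\<dots> = (\<Sum>i\<le>min j l. (Gamma (real j + \<alpha> + 1) * Gamma (real l + \<alpha> + 1) * \<tau> powr (- (real (j + l) + \<alpha> + 1))) *
     (real (j choose i) * real (l choose i) * (fact i / Gamma (real i + \<alpha> + 1))))"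
  proof (rule sum.cong[OF refl])
    fix i
    have d: "(2 * i + b) div 2 = i" using b1 by presburger
    have e: "even (m + (2 * i + b))" "even (n + (2 * i + b))" unfolding mn by simp_all
    let ?s = "fact i / Gamma (real i + \<alpha> + 1)"
    have s: "sqrt ?s * sqrt ?s = ?s" using pos[of i] by (simp add: less_imp_le)
    have p: "\<tau> powr (- (real m + 1 - H) / 2) * \<tau> powr (- (real n + 1 - H) / 2) = \<tau> powr (- (real (j + l) + \<alpha> + 1))"
    proof -
      have "- (real m + 1 - H) / 2 + - (real n + 1 - H) / 2 = - (real (j + l) + \<alpha> + 1)"
        unfolding \<alpha>_def by (subst mn(1), subst mn(2)) (simp add: field_simps)
      then show ?thesis by (simp only: powr_add[symmetric])
    qed
    have "?f (2 * i + b) = (real (j choose i) * Gamma (real j + \<alpha> + 1) * sqrt ?s * \<tau> powr (- (real m + 1 - H) / 2)) * (real (l choose i) * Gamma (real l + \<alpha> + 1) * sqrt ?s * \<tau> powr (- (real n + 1 - H) / 2))"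
      using e by (simp add: moment_factor_def d b j_def[symmetric] l_def[symmetric] \<alpha>_def[symmetric])
    also have "\<dots> = (Gamma (real j + \<alpha> + 1) * Gamma (real l + \<alpha> + 1) * (\<tau> powr (- (real m + 1 - H) / 2) * \<tau> powr (- (real n + 1 - H) / 2))) * (real (j choose i) * real (l choose i) * (sqrt ?s * sqrt ?s))"
      by (simp only: mult_ac)
    finally show "?f (2 * i + b) = (Gamma (real j + \<alpha> + 1) * Gamma (real l + \<alpha> + 1) * \<tau> powr (- (real (j + l) + \<alpha> + 1))) *
     (real (j choose i) * real (l choose i) * (fact i / Gamma (real i + \<alpha> + 1)))" unfolding p s .
  qed
  also have "\<dots> = (Gamma (real j + \<alpha> + 1) * Gamma (real l + \<alpha> + 1) * \<tau> powr (- (real (j + l) + \<alpha> + 1))) * (Gamma (real (j + l) + \<alpha> + 1) / (Gamma (real j + \<alpha> + 1) * Gamma (real l + \<alpha> + 1)))"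
    unfolding sum_distrib_left[symmetric] Gamma_Vandermonde[OF \<alpha>] ..
  also have "\<dots> = Gamma (real (j + l) + \<alpha> + 1) * \<tau> powr (- (real (j + l) + \<alpha> + 1))"
    using pos[of j] pos[of l] by simp
  also have "real (j + l) + \<alpha> + 1 = real ((m + n) div 2) + 1 - H"
  proof -
    have "(m + n) div 2 = j + l + b" unfolding mn by simp
    then show ?thesis by (simp add: \<alpha>_def)
  qed
  finally show ?thesis using True by (simp add: gauss_moment_def)
qed

lemma gauss_moment_integral:
  assumes H: "0 < H" "H < 1" and t: "0 < \<tau>"
  shows "has_bochner_integral lborel (\<lambda>\<xi>. \<xi> ^ N * (\<bar>\<xi>\<bar> powr (1 - 2 * H) * exp (- (\<tau> * \<xi>\<^sup>2)))) (gauss_moment H \<tau> N)"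
proof -
  let ?w = "\<lambda>\<xi>. \<bar>\<xi>\<bar> powr (1 - 2 * H) * exp (- (\<tau> * \<xi>\<^sup>2))"
  have ev: "has_bochner_integral lborel (\<lambda>\<xi>. \<xi> ^ (2 * q) * ?w \<xi>) (Gamma (real q + 1 - H) * \<tau> powr (- (real q + 1 - H)))" for q
  proof -
    have eq: "\<xi> ^ (2 * q) * ?w \<xi> = \<bar>\<xi>\<bar> powr (2 * (real q + 1 - H) - 1) * exp (- (\<tau> * \<xi>\<^sup>2))" for \<xi>
    proof (cases "\<xi> = 0")
      case False
      have "\<xi> ^ (2 * q) = \<bar>\<xi>\<bar> ^ (2 * q)" by (simp add: power_mult power2_abs)
      also have "\<dots> = \<bar>\<xi>\<bar> powr (real (2 * q))" using False by (subst powr_realpow) auto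
      finally have "\<xi> ^ (2 * q) * \<bar>\<xi>\<bar> powr (1 - 2 * H) = \<bar>\<xi>\<bar> powr (real (2 * q) + (1 - 2 * H))" by (simp add: powr_add)
      also have "real (2 * q) + (1 - 2 * H) = 2 * (real q + 1 - H) - 1" by simp
      finally show ?thesis by (simp add: mult.assoc[symmetric])
    qed simp
    show ?thesis unfolding eq by (rule has_bochner_integral_power_gauss) (use H t in auto)
  qed
  show ?thesis
  proof (cases "even N")
    case True
    then show ?thesis using ev[of "N div 2"] by (simp add: gauss_moment_def)
  next
    case False
    \<comment> \<open>Symmetry gives the value 0 only together with absolute convergence; |xi^N| <=
      1 + xi^(2N) bounds an odd moment by two even ones.\<close>
    have i: "integrable lborel (\<lambda>\<xi>. \<xi> ^ N * ?w \<xi>)"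
    proof (rule Bochner_Integration.integrable_bound)
      show "integrable lborel (\<lambda>\<xi>. \<xi> ^ (2 * 0) * ?w \<xi> + \<xi> ^ (2 * N) * ?w \<xi>)"
        using ev[of 0] ev[of N] by (intro Bochner_Integration.integrable_add) (auto simp: has_bochner_integral_iff)
      have "\<bar>\<xi> ^ N\<bar> \<le> 1 + \<xi> ^ (2 * N)" for \<xi> :: real
        using sum_squares_bound[of 1 "\<bar>\<xi> ^ N\<bar>"] abs_ge_zero[of "\<xi> ^ N"] unfolding power2_abs power_mult[symmetric] mult.commute[of N 2]
        by simp
      then have "\<bar>\<xi> ^ N\<bar> * ?w \<xi> \<le> (1 + \<xi> ^ (2 * N)) * ?w \<xi>" for \<xi> by (intro mult_right_mono) auto
      then have le: "norm (\<xi> ^ N * ?w \<xi>) \<le> \<xi> ^ (2 * 0) * ?w \<xi> + \<xi> ^ (2 * N) * ?w \<xi>" for \<xi>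
        by (simp add: abs_mult distrib_right)
      show "AE \<xi> in lborel. norm (\<xi> ^ N * ?w \<xi>) \<le> norm (\<xi> ^ (2 * 0) * ?w \<xi> + \<xi> ^ (2 * N) * ?w \<xi>)"
        by (rule AE_I2, rule order_trans[OF le], unfold real_norm_def, rule abs_ge_self)
    qed simp
    have "(\<integral>\<xi>. \<xi> ^ N * ?w \<xi> \<partial>lborel) = \<bar>-1\<bar> *\<^sub>R (\<integral>\<xi>. (0 + (-1) * \<xi>) ^ N * ?w (0 + (-1) * \<xi>) \<partial>lborel)"
      by (rule lborel_integral_real_affine) simp
    also have "\<dots> = - (\<integral>\<xi>. \<xi> ^ N * ?w \<xi> \<partial>lborel)" using False by (simp add: power_minus_odd)
    finally have "(\<integral>\<xi>. \<xi> ^ N * ?w \<xi> \<partial>lborel) = 0" by simp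
    then show ?thesis using i False by (simp add: has_bochner_integral_iff gauss_moment_def)
  qed
qed

section \<open>The entire random power series in space\<close>

lemma smooth_power_series:
  fixes p :: "nat \<Rightarrow> real"
  assumes "\<And>x. summable (\<lambda>n. p n * x ^ n)"
  shows "smooth_on_real UNIV (\<lambda>x. \<Sum>n. p n * x ^ n)"
proof (rule smooth_on_real_coinduct[where C = "{\<lambda>x. \<Sum>n. p n * x ^ n | p. \<forall>x. summable (\<lambda>n. p n * x ^ n)}"])
  fix g :: "real \<Rightarrow> real" assume "g \<in> {\<lambda>x. \<Sum>n. p n * x ^ n | p. \<forall>x. summable (\<lambda>n. p n * x ^ n)}"
  then obtain p where g: "g = (\<lambda>x. \<Sum>n. p n * x ^ n)" and s: "\<And>x. summable (\<lambda>n. p n * x ^ n)" by blast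
  have "(g has_real_derivative (\<Sum>n. diffs p n * x ^ n)) (at x)" for x
    unfolding g by (rule termdiffs_strong_converges_everywhere[OF s])
  moreover have "summable (\<lambda>n. diffs p n * x ^ n)" for x
    by (rule termdiff_converges_all[OF s])
  ultimately show "\<exists>g'\<in>{\<lambda>x. \<Sum>n. p n * x ^ n | p. \<forall>x. summable (\<lambda>n. p n * x ^ n)}. \<forall>x\<in>UNIV. (g has_real_derivative g' x) (at x)"
    by (intro bexI[of _ "\<lambda>x. \<Sum>n. diffs p n * x ^ n"]) auto
qed (use assms in auto)

text \<open>Coefficient of theta^(n+1) in sin theta + 1 - cos theta. Adding the odd sine to the even
  1 - cos lets one real noise do the work of two: against an even weight their cross term
  cancels.\<close>

definition wave_coeff :: "nat \<Rightarrow> real" where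
  "wave_coeff n = sin_coeff (Suc n) - cos_coeff (Suc n)"

lemma wave_coeff_bound: "\<bar>wave_coeff n\<bar> \<le> 1 / fact n"
proof -
  have "\<bar>wave_coeff n\<bar> = 1 / fact (Suc n)"
    by (auto simp: wave_coeff_def sin_coeff_def cos_coeff_def power_abs abs_mult)
  also have "\<dots> \<le> 1 / fact n" by (intro divide_left_mono fact_mono) auto
  finally show ?thesis .
qed

lemma wave_coeff_sums: "(\<lambda>n. wave_coeff n * \<theta> ^ Suc n) sums (sin \<theta> + 1 - cos \<theta>)"
proof -
  have "(\<lambda>n. sin_coeff n * \<theta> ^ n - cos_coeff n * \<theta> ^ n) sums (sin \<theta> - cos \<theta>)"
    using sums_diff[OF sin_converges[of \<theta>] cos_converges[of \<theta>]] by simp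
  then have "(\<lambda>n. sin_coeff (Suc n) * \<theta> ^ Suc n - cos_coeff (Suc n) * \<theta> ^ Suc n) sums (sin \<theta> - cos \<theta> - (sin_coeff 0 * \<theta> ^ 0 - cos_coeff 0 * \<theta> ^ 0))"
    by (subst sums_Suc_iff) simp
  moreover have "sin \<theta> - cos \<theta> - (sin_coeff 0 * \<theta> ^ 0 - cos_coeff 0 * \<theta> ^ 0) = sin \<theta> + 1 - cos \<theta>" by simp
  ultimately show ?thesis unfolding wave_coeff_def left_diff_distrib by (simp only:)
qed

lemma Gamma_le_fact:
  assumes H: "0 < H" "H < 1" shows "Gamma (real n + 1 - H) \<le> Gamma (1 - H) * fact n"
proof (induction n)
  case (Suc n)
  have G: "0 < Gamma (real n + 1 - H)" using H by (intro Gamma_real_pos) auto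
  have "Gamma (real (Suc n) + 1 - H) = Gamma ((real n + 1 - H) + 1)" by (simp add: algebra_simps)
  also have "\<dots> = (real n + 1 - H) * Gamma (real n + 1 - H)"
    by (rule Gamma_plus1) (use H in \<open>auto elim!: nonpos_Ints_cases\<close>)
  also have "\<dots> \<le> real (Suc n) * (Gamma (1 - H) * fact n)"
    using Suc.IH G H by (intro mult_mono) auto
  finally show ?case by (simp add: mult_ac)
qed simp

context orthonormal_gaussian begin

definition moment_var :: "real \<Rightarrow> real \<Rightarrow> nat \<Rightarrow> 'a \<Rightarrow> real" where
  "moment_var H \<tau> n \<omega> = (\<Sum>k\<le>n. moment_factor H \<tau> n k * \<xi> k \<omega>)"

lemma moment_var_measurable [measurable]: "moment_var H \<tau> n \<in> borel_measurable M"
  unfolding moment_var_def[abs_def] by measurable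

lemma moment_var_generated: "moment_var H \<tau> n \<in> generated"
  unfolding moment_var_def[abs_def] by (rule sum_generated) simp

lemma moment_var_inner:
  assumes "0 < H" "H < 1" "0 < \<tau>"
  shows "expectation (\<lambda>\<omega>. moment_var H \<tau> m \<omega> * moment_var H \<tau> n \<omega>) = gauss_moment H \<tau> (m + n)"
  unfolding moment_var_def inner_sum[OF finite_atMost finite_atMost] by (rule moment_factor_sum[OF assms])

lemma moment_var_sum_generated: "finite J \<Longrightarrow> (\<lambda>\<omega>. \<Sum>n\<in>J. c n * moment_var H \<tau> n \<omega>) \<in> generated"
proof (induction rule: finite_induct)
  case empty
  then show ?case using sum_generated[of "{}" "\<lambda>_. 0"] by simp
next
  case (insert n J)
  then show ?case using generated_lin[OF moment_var_generated insert.IH, of "c n" H \<tau> n 1] by simp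
qed

text \<open>Polynomials correspond isometrically to combinations of the \<open>moment_var\<close>:
  xi^n in L2 of the Gaussian weight is mapped to the n-th moment variable.\<close>

lemma moment_var_sum_msq:
  assumes H: "0 < H" "H < 1" "0 < \<tau>" and J: "finite J"
  shows "has_bochner_integral lborel (\<lambda>\<xi>. (\<Sum>n\<in>J. c n * \<xi> ^ n)\<^sup>2 * (\<bar>\<xi>\<bar> powr (1 - 2 * H) * exp (- (\<tau> * \<xi>\<^sup>2))))
    (msq M (\<lambda>\<omega>. \<Sum>n\<in>J. c n * moment_var H \<tau> n \<omega>))"
proof -
  let ?w = "\<lambda>\<xi>. \<bar>\<xi>\<bar> powr (1 - 2 * H) * exp (- (\<tau> * \<xi>\<^sup>2))"
  have i: "integrable M (\<lambda>\<omega>. c m * c n * (moment_var H \<tau> m \<omega> * moment_var H \<tau> n \<omega>))" for m n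
    by (intro integrable_mult_right sq_int_mult generated_sq_int moment_var_generated)
  have "msq M (\<lambda>\<omega>. \<Sum>n\<in>J. c n * moment_var H \<tau> n \<omega>) = expectation (\<lambda>\<omega>. \<Sum>m\<in>J. \<Sum>n\<in>J. c m * c n * (moment_var H \<tau> m \<omega> * moment_var H \<tau> n \<omega>))"
    unfolding power2_eq_square sum_product by (intro arg_cong[where f = expectation] ext sum.cong refl) (simp only: mult_ac)
  also have "\<dots> = (\<Sum>m\<in>J. \<Sum>n\<in>J. c m * c n * gauss_moment H \<tau> (m + n))"
    using i by (simp add: Bochner_Integration.integral_sum moment_var_inner[OF H])
  finally have e: "msq M (\<lambda>\<omega>. \<Sum>n\<in>J. c n * moment_var H \<tau> n \<omega>) = (\<Sum>m\<in>J. \<Sum>n\<in>J. c m * c n * gauss_moment H \<tau> (m + n))" .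
  have "(\<Sum>n\<in>J. c n * \<xi> ^ n)\<^sup>2 * ?w \<xi> = (\<Sum>m\<in>J. \<Sum>n\<in>J. c m * c n * (\<xi> ^ (m + n) * ?w \<xi>))" for \<xi>
    unfolding power2_eq_square[of "sum _ _"] sum_product sum_distrib_right[of _ _ "?w \<xi>"] by (intro sum.cong refl) (simp only: power_add mult_ac)
  then show ?thesis unfolding e
    by (simp only:) (intro has_bochner_integral_sum has_bochner_integral_mult_right gauss_moment_integral H)
qed

text \<open>Natural radii R suffice for convergence on the whole line and keep the event measurable;
  1/n! is the bound of \<open>wave_coeff_bound\<close>.\<close>

definition entire :: "real \<Rightarrow> real \<Rightarrow> 'a \<Rightarrow> bool" where
  "entire H \<tau> \<omega> \<longleftrightarrow> (\<forall>R::nat. (\<Sum>n. ennreal (\<bar>moment_var H \<tau> n \<omega>\<bar> * (real R ^ n / fact n))) \<noteq> \<infinity>)"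

lemma entire_measurable [measurable]: "Measurable.pred M (entire H \<tau>)"
  unfolding entire_def[abs_def] by measurable

text \<open>The variance Gamma(n+1-H) tau^(-(n+1-H)) grows at most like n! up to a geometric factor,
  so the moment variables are of order sqrt(n!) while their coefficients are at most 1/n!.\<close>

lemma expectation_abs_moment_var:
  assumes H: "0 < H" "H < 1" "0 < \<tau>"
  shows "expectation (\<lambda>\<omega>. \<bar>moment_var H \<tau> n \<omega>\<bar>) \<le> sqrt (Gamma (1 - H) * \<tau> powr (H - 1)) * sqrt (fact n * (1 / \<tau>) ^ n)"
proof -
  have "expectation (\<lambda>\<omega>. \<bar>moment_var H \<tau> n \<omega>\<bar>) \<le> sqrt (gauss_moment H \<tau> (n + n))"
    using expectation_abs_le[OF generated_sq_int[OF moment_var_generated], of H \<tau> n] moment_var_inner[OF H, of n n] by (simp add: power2_eq_square)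
  also have "gauss_moment H \<tau> (n + n) = Gamma (real n + 1 - H) * \<tau> powr (- (real n + 1 - H))"
    by (simp add: gauss_moment_def)
  also have "sqrt \<dots> \<le> sqrt ((Gamma (1 - H) * fact n) * \<tau> powr (- (real n + 1 - H)))"
    by (intro real_sqrt_le_mono mult_right_mono Gamma_le_fact H) simp
  also have "\<tau> powr (- (real n + 1 - H)) = \<tau> powr (H - 1) * (1 / \<tau>) ^ n"
  proof -
    have "- (real n + 1 - H) = (H - 1) + - real n" by simp
    then have "\<tau> powr (- (real n + 1 - H)) = \<tau> powr (H - 1) * \<tau> powr (- real n)" by (simp only: powr_add)
    then show ?thesis using H by (simp add: powr_minus powr_realpow power_inverse divide_inverse)
  qed
  also have "sqrt (Gamma (1 - H) * fact n * (\<tau> powr (H - 1) * (1 / \<tau>) ^ n)) = sqrt (Gamma (1 - H) * \<tau> powr (H - 1)) * sqrt (fact n * (1 / \<tau>) ^ n)"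
    unfolding real_sqrt_mult[symmetric] by (simp only: mult_ac)
  finally show ?thesis .
qed

lemma summable_power_sqrt_fact:
  fixes q :: real assumes "0 \<le> q" shows "summable (\<lambda>n. q ^ n / sqrt (fact n))"
proof (rule summable_comparison_test')
  have "summable (\<lambda>n. (4 * q\<^sup>2) ^ n / fact n)"
    using sums_summable[OF exp_converges[of "4 * q\<^sup>2"]] unfolding real_scaleR_def divide_inverse mult.commute[of "inverse _"] .
  moreover have "summable (\<lambda>n. (1 / 4 :: real) ^ n)" by (rule summable_geometric) simp
  ultimately show "summable (\<lambda>n. (4 * q\<^sup>2) ^ n / fact n + (1 / 4) ^ n)" by (rule summable_add)
  fix n
  have sq: "(x ^ n)\<^sup>2 = (x\<^sup>2) ^ n" for x :: real by (simp only: power_mult[symmetric] mult.commute)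
  \<comment> \<open>Splitting off 2^n and 2^(-n) lets the bound x y <= x^2 + y^2 trade the root of
    n! for an exponential and a geometric series.\<close>
  let ?a = "(2 * q) ^ n / sqrt (fact n)" and ?b = "(1 / 2 :: real) ^ n"
  have "(2 * q) ^ n * (1 / 2) ^ n = q ^ n" unfolding power_mult_distrib[symmetric] by simp
  then have "q ^ n / sqrt (fact n) = ?a * ?b" by simp
  also have "\<dots> \<le> ?a\<^sup>2 + ?b\<^sup>2"
  proof -
    have "0 \<le> ?a * ?b" using assms by simp
    then show ?thesis using sum_squares_bound[of ?a ?b] by linarith
  qed
  also have "?a\<^sup>2 = (4 * q\<^sup>2) ^ n / fact n" unfolding power_divide sq power_mult_distrib[of 2 q 2] by simp
  also have "?b\<^sup>2 = (1 / 4) ^ n" unfolding sq by (simp add: power2_eq_square)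
  finally show "norm (q ^ n / sqrt (fact n)) \<le> (4 * q\<^sup>2) ^ n / fact n + (1 / 4) ^ n" using assms by simp
qed

lemma AE_entire:
  assumes H: "0 < H" "H < 1" "0 < \<tau>" shows "AE \<omega> in M. entire H \<tau> \<omega>"
proof -
  have "AE \<omega> in M. (\<Sum>n. ennreal (\<bar>moment_var H \<tau> n \<omega>\<bar> * (real R ^ n / fact n))) \<noteq> \<infinity>" for R
  proof (rule nn_integral_noteq_infinite)
    let ?c = "\<lambda>n. real R ^ n / fact n :: real" and ?K = "sqrt (Gamma (1 - H) * \<tau> powr (H - 1))"
    let ?q = "real R * sqrt (1 / \<tau>)"
    have le: "(\<integral>\<^sup>+\<omega>. ennreal (\<bar>moment_var H \<tau> n \<omega>\<bar> * ?c n) \<partial>M) \<le> ennreal (?K * (?q ^ n / sqrt (fact n)))" for n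
    proof -
      have i: "integrable M (\<lambda>\<omega>. \<bar>moment_var H \<tau> n \<omega>\<bar> * ?c n)"
        using sq_int_integrable[OF generated_sq_int[OF moment_var_generated], of H \<tau> n] by simp
      have "(\<integral>\<^sup>+\<omega>. ennreal (\<bar>moment_var H \<tau> n \<omega>\<bar> * ?c n) \<partial>M) = ennreal (expectation (\<lambda>\<omega>. \<bar>moment_var H \<tau> n \<omega>\<bar> * ?c n))"
        by (rule nn_integral_eq_integral[OF i]) simp
      also have "expectation (\<lambda>\<omega>. \<bar>moment_var H \<tau> n \<omega>\<bar> * ?c n) = expectation (\<lambda>\<omega>. \<bar>moment_var H \<tau> n \<omega>\<bar>) * ?c n"
        by (rule integral_mult_left_zero)
      also have "\<dots> \<le> (?K * sqrt (fact n * (1 / \<tau>) ^ n)) * ?c n"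
        by (intro mult_right_mono expectation_abs_moment_var H) simp
      also have "\<dots> = ?K * (?q ^ n / sqrt (fact n))"
      proof -
        have "fact n = sqrt (fact n) * sqrt (fact n :: real)" by simp
        moreover have "0 < sqrt (fact n :: real)" by simp
        ultimately have "sqrt (fact n) * (real R ^ n / fact n) = real R ^ n / sqrt (fact n)"
          by (metis less_irrefl mult.commute nonzero_mult_divide_mult_cancel_right times_divide_eq_left)
        moreover have "?K * sqrt (fact n * (1 / \<tau>) ^ n) * ?c n = ?K * (sqrt (1 / \<tau>) ^ n * (sqrt (fact n) * ?c n))"
          unfolding real_sqrt_mult real_sqrt_power by (simp only: mult_ac)
        ultimately show ?thesis by (simp only: power_mult_distrib times_divide_eq_right mult_ac)
      qed
      finally show ?thesis by (simp add: ennreal_leI)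
    qed
    have s: "summable (\<lambda>n. ?K * (?q ^ n / sqrt (fact n)))" using H by (intro summable_mult summable_power_sqrt_fact) simp
    have K0: "0 \<le> ?K * (?q ^ n / sqrt (fact n))" for n using H by (simp add: Gamma_real_nonneg)
    have "(\<integral>\<^sup>+\<omega>. (\<Sum>n. ennreal (\<bar>moment_var H \<tau> n \<omega>\<bar> * ?c n)) \<partial>M) = (\<Sum>n. \<integral>\<^sup>+\<omega>. ennreal (\<bar>moment_var H \<tau> n \<omega>\<bar> * ?c n) \<partial>M)"
      by (rule nn_integral_suminf) simp
    also have "\<dots> \<le> (\<Sum>n. ennreal (?K * (?q ^ n / sqrt (fact n))))" by (rule suminf_le[OF le]) auto
    also have "\<dots> = ennreal (\<Sum>n. ?K * (?q ^ n / sqrt (fact n)))" by (rule suminf_ennreal2[OF K0 s])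
    finally show "(\<integral>\<^sup>+\<omega>. (\<Sum>n. ennreal (\<bar>moment_var H \<tau> n \<omega>\<bar> * ?c n)) \<partial>M) \<noteq> \<infinity>" by (auto simp: top_unique)
  qed simp
  then show ?thesis unfolding entire_def AE_all_countable by blast
qed

text \<open>The index shift comes from the division by xi: the power x^(m+1) meets the m-th moment.
  The constant coefficient 0 makes every path vanish at the origin.\<close>

definition wave_series :: "real \<Rightarrow> real \<Rightarrow> 'a \<Rightarrow> nat \<Rightarrow> real" where
  "wave_series H \<tau> \<omega> n = (case n of 0 \<Rightarrow> 0 | Suc m \<Rightarrow> (if entire H \<tau> \<omega> then wave_coeff m * moment_var H \<tau> m \<omega> else 0))"

text \<open>Formally this is $\int (\sin x\xi + 1 - \cos x\xi)\, \xi^{-1} \, \mu(d\xi)$ for a white noise $\mu$ with control $|\xi|^{1-2H} e^{-\tau\xi^2} d\xi$, written as a power series in $x$ whose coefficients are the moments $\int \xi^n \mu(d\xi)$.\<close>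
definition wave :: "real \<Rightarrow> real \<Rightarrow> real \<Rightarrow> 'a \<Rightarrow> real" where
  "wave H \<tau> x \<omega> = (\<Sum>n. wave_series H \<tau> \<omega> n * x ^ n)"

lemma wave_series_summable: "summable (\<lambda>n. wave_series H \<tau> \<omega> n * x ^ n)"
proof (cases "entire H \<tau> \<omega>")
  case True
  obtain R :: nat where R: "\<bar>x\<bar> \<le> real R" using real_arch_simple by blast
  have s: "summable (\<lambda>n. \<bar>moment_var H \<tau> n \<omega>\<bar> * (real R ^ n / fact n))"
    by (rule summable_suminf_not_top) (use True in \<open>auto simp: entire_def\<close>)
  have "summable (\<lambda>n. wave_series H \<tau> \<omega> (Suc n) * x ^ Suc n)"
  proof (rule summable_comparison_test'[OF summable_mult[OF s, of "\<bar>x\<bar>"]])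
    fix n
    have "norm (wave_series H \<tau> \<omega> (Suc n) * x ^ Suc n) = \<bar>x\<bar> * (\<bar>moment_var H \<tau> n \<omega>\<bar> * (\<bar>x\<bar> ^ n * \<bar>wave_coeff n\<bar>))"
      using True by (simp add: wave_series_def abs_mult power_abs)
    also have "\<dots> \<le> \<bar>x\<bar> * (\<bar>moment_var H \<tau> n \<omega>\<bar> * (real R ^ n * (1 / fact n)))"
      using R wave_coeff_bound by (intro mult_left_mono mult_mono power_mono) auto
    finally show "norm (wave_series H \<tau> \<omega> (Suc n) * x ^ Suc n) \<le> \<bar>x\<bar> * (\<bar>moment_var H \<tau> n \<omega>\<bar> * (real R ^ n / fact n))" by simp
  qed
  then show ?thesis by (subst (asm) summable_Suc_iff)
next
  case False
  then have "wave_series H \<tau> \<omega> n = 0" for n by (simp add: wave_series_def split: nat.split)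
  then show ?thesis by simp
qed

lemma wave_0 [simp]: "wave H \<tau> 0 \<omega> = 0"
  unfolding wave_def powser_zero by (simp add: wave_series_def)

lemma smooth_wave: "smooth_on_real UNIV (\<lambda>x. wave H \<tau> x \<omega>)"
  unfolding wave_def by (rule smooth_power_series[OF wave_series_summable])

lemma wave_measurable [measurable]: "wave H \<tau> x \<in> borel_measurable M"
proof -
  have [measurable]: "(\<lambda>\<omega>. wave_series H \<tau> \<omega> n) \<in> borel_measurable M" for n
    unfolding wave_series_def by (cases n) simp_all
  show ?thesis unfolding wave_def[abs_def] by measurable
qed

lemma wave_sums:
  assumes "entire H \<tau> \<omega>" shows "(\<lambda>n. (wave_coeff n * x ^ Suc n) * moment_var H \<tau> n \<omega>) sums wave H \<tau> x \<omega>"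
proof -
  have "(\<lambda>n. wave_series H \<tau> \<omega> n * x ^ n) sums wave H \<tau> x \<omega>"
    unfolding wave_def by (rule summable_sums[OF wave_series_summable])
  then have "(\<lambda>n. wave_series H \<tau> \<omega> (Suc n) * x ^ Suc n) sums (wave H \<tau> x \<omega> - wave_series H \<tau> \<omega> 0 * x ^ 0)"
    by (subst sums_Suc_iff) simp
  then show ?thesis using assms by (simp add: wave_series_def mult_ac)
qed

text \<open>The partial sums of the increment correspond to polynomials that converge to G in L2 of
  the Gaussian weight, where G(xi) xi is an increment of sine minus an increment of cosine.
  Symmetrising in xi removes the mixed terms and leaves 2 (1 - cos((x-y) xi)).\<close>

lemma wave_increment:
  assumes H: "0 < H" "H < 1" "0 < \<tau>"
  shows "(\<lambda>\<omega>. wave H \<tau> x \<omega> - wave H \<tau> y \<omega>) \<in> generated"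
    and "ennreal (msq M (\<lambda>\<omega>. wave H \<tau> x \<omega> - wave H \<tau> y \<omega>)) =
      (\<integral>\<^sup>+\<xi>. ennreal (2 * ((1 - cos ((x - y) * \<xi>)) * \<bar>\<xi>\<bar> powr (- 1 - 2 * H)) * exp (- (\<tau> * \<xi>\<^sup>2))) \<partial>lborel)"
proof -
  let ?w = "\<lambda>\<xi>. \<bar>\<xi>\<bar> powr (1 - 2 * H) * exp (- (\<tau> * \<xi>\<^sup>2))"
  let ?c = "\<lambda>n. wave_coeff n * (x ^ Suc n - y ^ Suc n)"
  let ?g = "\<lambda>N \<xi>. \<Sum>n<N. ?c n * \<xi> ^ n"
  define B where "B = max \<bar>x\<bar> \<bar>y\<bar>"
  have B: "0 \<le> B" by (simp add: B_def)
  have cb: "\<bar>?c n * \<xi> ^ n\<bar> \<le> 2 * B * ((B * \<bar>\<xi>\<bar>) ^ n / fact n)" for n \<xi>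
  proof -
    have "\<bar>x\<bar> ^ Suc n \<le> B ^ Suc n" "\<bar>y\<bar> ^ Suc n \<le> B ^ Suc n" by (intro power_mono; simp add: B_def)+
    then have "\<bar>x ^ Suc n - y ^ Suc n\<bar> \<le> 2 * B ^ Suc n"
      using abs_triangle_ineq4[of "x ^ Suc n" "y ^ Suc n"] unfolding power_abs by linarith
    then have "\<bar>wave_coeff n\<bar> * \<bar>x ^ Suc n - y ^ Suc n\<bar> * \<bar>\<xi>\<bar> ^ n \<le> (1 / fact n) * (2 * B ^ Suc n) * \<bar>\<xi>\<bar> ^ n"
      by (intro mult_right_mono mult_mono wave_coeff_bound) auto
    then show ?thesis by (simp add: abs_mult power_abs power_mult_distrib mult_ac)
  qed
  have es: "(\<lambda>n. 2 * B * ((B * \<bar>\<xi>\<bar>) ^ n / fact n)) sums (2 * B * exp (B * \<bar>\<xi>\<bar>))" for \<xi>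
    using exp_converges[of "B * \<bar>\<xi>\<bar>"] by (intro sums_mult) (simp add: divide_inverse mult.commute)
  have gs: "summable (\<lambda>n. ?c n * \<xi> ^ n)" for \<xi>
    by (rule summable_comparison_test'[OF sums_summable[OF es]]) (use cb in simp)
  let ?G = "\<lambda>\<xi>. \<Sum>n. ?c n * \<xi> ^ n"
  have gl: "(\<lambda>N. ?g N \<xi>) \<longlonglongrightarrow> ?G \<xi>" for \<xi> using summable_LIMSEQ[OF gs] .
  have gb: "\<bar>?g N \<xi>\<bar> \<le> 2 * B * exp (B * \<bar>\<xi>\<bar>)" for N \<xi>
  proof -
    have "\<bar>?g N \<xi>\<bar> \<le> (\<Sum>n<N. 2 * B * ((B * \<bar>\<xi>\<bar>) ^ n / fact n))"
      by (rule order_trans[OF sum_abs sum_mono[OF cb]])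
    also have "\<dots> \<le> (\<Sum>n. 2 * B * ((B * \<bar>\<xi>\<bar>) ^ n / fact n))"
      by (rule sum_le_suminf[OF sums_summable[OF es]]) (use B in auto)
    also have "\<dots> = 2 * B * exp (B * \<bar>\<xi>\<bar>)" using sums_unique[OF es] by simp
    finally show ?thesis .
  qed
  have Gb: "\<bar>?G \<xi>\<bar> \<le> 2 * B * exp (B * \<bar>\<xi>\<bar>)" for \<xi>
    by (rule LIMSEQ_le_const2[OF tendsto_rabs[OF gl]]) (use gb in blast)
  \<comment> \<open>Majorant of all squared integrands below. The polynomials, their limit and the
    differences are at most 4 B exp(B |xi|), and completing the square spends half of the Gaussian
    exponent on absorbing this growth.\<close>
  let ?D = "\<lambda>\<xi>. 16 * B\<^sup>2 * exp (2 * B\<^sup>2 / \<tau>) * (\<bar>\<xi>\<bar> powr (2 * (1 - H) - 1) * exp (- (\<tau> / 2 * \<xi>\<^sup>2)))"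
  have Di: "integrable lborel ?D"
    using has_bochner_integral_power_gauss[of "1 - H" "\<tau> / 2"] H by (intro integrable_mult_right) (auto simp: has_bochner_integral_iff)
  have Db: "(4 * B * exp (B * \<bar>\<xi>\<bar>))\<^sup>2 * ?w \<xi> \<le> ?D \<xi>" for \<xi>
  proof -
    have "0 \<le> (2 * B / \<tau> - \<bar>\<xi>\<bar>)\<^sup>2 * (\<tau> / 2)" using H by simp
    also have "(2 * B / \<tau> - \<bar>\<xi>\<bar>)\<^sup>2 * (\<tau> / 2) = 2 * B\<^sup>2 / \<tau> - 2 * B * \<bar>\<xi>\<bar> + \<tau> / 2 * \<xi>\<^sup>2"
      using H by (simp add: power2_diff field_simps) (simp add: power2_eq_square)
    finally have "exp (2 * B * \<bar>\<xi>\<bar> - \<tau> * \<xi>\<^sup>2) \<le> exp (2 * B\<^sup>2 / \<tau> - \<tau> / 2 * \<xi>\<^sup>2)" by (simp add: field_simps)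
    then have "16 * B\<^sup>2 * \<bar>\<xi>\<bar> powr (1 - 2 * H) * exp (2 * B * \<bar>\<xi>\<bar> - \<tau> * \<xi>\<^sup>2) \<le> 16 * B\<^sup>2 * \<bar>\<xi>\<bar> powr (1 - 2 * H) * exp (2 * B\<^sup>2 / \<tau> - \<tau> / 2 * \<xi>\<^sup>2)"
      by (intro mult_left_mono) auto
    moreover have "(4 * B * exp (B * \<bar>\<xi>\<bar>))\<^sup>2 * ?w \<xi> = 16 * B\<^sup>2 * \<bar>\<xi>\<bar> powr (1 - 2 * H) * exp (2 * B * \<bar>\<xi>\<bar> - \<tau> * \<xi>\<^sup>2)"
    proof -
      have "(exp (B * \<bar>\<xi>\<bar>))\<^sup>2 * exp (- (\<tau> * \<xi>\<^sup>2)) = exp (2 * B * \<bar>\<xi>\<bar> - \<tau> * \<xi>\<^sup>2)"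
        unfolding power2_eq_square exp_add[symmetric] by (rule arg_cong[where f = exp]) simp
      then show ?thesis by (simp add: power_mult_distrib mult_ac)
    qed
    moreover have "?D \<xi> = 16 * B\<^sup>2 * \<bar>\<xi>\<bar> powr (1 - 2 * H) * exp (2 * B\<^sup>2 / \<tau> - \<tau> / 2 * \<xi>\<^sup>2)"
    proof -
      have "exp (2 * B\<^sup>2 / \<tau>) * exp (- (\<tau> / 2 * \<xi>\<^sup>2)) = exp (2 * B\<^sup>2 / \<tau> - \<tau> / 2 * \<xi>\<^sup>2)"
        unfolding exp_add[symmetric] by (rule arg_cong[where f = exp]) simp
      moreover have "2 * (1 - H) - 1 = 1 - 2 * H" by simp
      ultimately show ?thesis by (simp only: mult.assoc mult.left_commute)
    qed
    ultimately show ?thesis by (simp only:)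
  qed
  have [measurable]: "?G \<in> borel_measurable borel" by measurable
  have bnd: "h\<^sup>2 * ?w \<xi> \<le> ?D \<xi>" if "\<bar>h\<bar> \<le> 4 * B * exp (B * \<bar>\<xi>\<bar>)" for h \<xi>
  proof -
    have "h\<^sup>2 \<le> (4 * B * exp (B * \<bar>\<xi>\<bar>))\<^sup>2" using that by (metis abs_ge_zero power2_abs power_mono)
    then have "h\<^sup>2 * ?w \<xi> \<le> (4 * B * exp (B * \<bar>\<xi>\<bar>))\<^sup>2 * ?w \<xi>" by (intro mult_right_mono) auto
    then show ?thesis using Db[of \<xi>] by linarith
  qed
  have be: "0 \<le> 2 * B * exp (B * \<bar>\<xi>\<bar>)" for \<xi> using B by simp
  have l1: "(\<lambda>N. \<integral>\<xi>. (?g N \<xi> - ?G \<xi>)\<^sup>2 * ?w \<xi> \<partial>lborel) \<longlonglongrightarrow> (\<integral>\<xi>. 0 \<partial>(lborel :: real measure))"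
  proof (rule integral_dominated_convergence[where w = ?D])
    show "integrable lborel ?D" by (rule Di)
    show "AE \<xi> in lborel. norm ((?g N \<xi> - ?G \<xi>)\<^sup>2 * ?w \<xi>) \<le> ?D \<xi>" for N
    proof (rule AE_I2)
      fix \<xi>
      have "\<bar>?g N \<xi> - ?G \<xi>\<bar> \<le> 4 * B * exp (B * \<bar>\<xi>\<bar>)" using gb[of \<xi> N] Gb[of \<xi>] by linarith
      from bnd[OF this] show "norm ((?g N \<xi> - ?G \<xi>)\<^sup>2 * ?w \<xi>) \<le> ?D \<xi>" by (simp add: abs_mult)
    qed
    show "AE \<xi> in lborel. (\<lambda>N. (?g N \<xi> - ?G \<xi>)\<^sup>2 * ?w \<xi>) \<longlonglongrightarrow> 0"
    proof (rule AE_I2)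
      fix \<xi>
      have "(\<lambda>N. (?g N \<xi> - ?G \<xi>)\<^sup>2 * ?w \<xi>) \<longlonglongrightarrow> (?G \<xi> - ?G \<xi>)\<^sup>2 * ?w \<xi>" by (intro tendsto_intros gl)
      then show "(\<lambda>N. (?g N \<xi> - ?G \<xi>)\<^sup>2 * ?w \<xi>) \<longlonglongrightarrow> 0" by simp
    qed
  qed measurable
  have l2: "(\<lambda>N. \<integral>\<xi>. (?g N \<xi>)\<^sup>2 * ?w \<xi> \<partial>lborel) \<longlonglongrightarrow> (\<integral>\<xi>. (?G \<xi>)\<^sup>2 * ?w \<xi> \<partial>lborel)"
  proof (rule integral_dominated_convergence[where w = ?D])
    show "integrable lborel ?D" by (rule Di)
    show "AE \<xi> in lborel. norm ((?g N \<xi>)\<^sup>2 * ?w \<xi>) \<le> ?D \<xi>" for N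
    proof (rule AE_I2)
      fix \<xi>
      have "\<bar>?g N \<xi>\<bar> \<le> 4 * B * exp (B * \<bar>\<xi>\<bar>)" using gb[of \<xi> N] be[of \<xi>] by linarith
      from bnd[OF this] show "norm ((?g N \<xi>)\<^sup>2 * ?w \<xi>) \<le> ?D \<xi>" by (simp add: abs_mult)
    qed
    show "AE \<xi> in lborel. (\<lambda>N. (?g N \<xi>)\<^sup>2 * ?w \<xi>) \<longlonglongrightarrow> (?G \<xi>)\<^sup>2 * ?w \<xi>"
      by (intro AE_I2 tendsto_intros gl)
  qed measurable
  let ?Z = "\<lambda>N \<omega>. \<Sum>n<N. ?c n * moment_var H \<tau> n \<omega>"
  let ?d = "\<lambda>N. 2 * (\<integral>\<xi>. (?g N \<xi> - ?G \<xi>)\<^sup>2 * ?w \<xi> \<partial>lborel)"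
  have Zg: "?Z N \<in> generated" for N by (rule moment_var_sum_generated) simp
  have ae: "AE \<omega> in M. (\<lambda>N. ?Z N \<omega>) \<longlonglongrightarrow> wave H \<tau> x \<omega> - wave H \<tau> y \<omega>"
    using AE_entire[OF H]
  proof eventually_elim
    fix \<omega> assume "entire H \<tau> \<omega>"
    from sums_diff[OF wave_sums[OF this, of x] wave_sums[OF this, of y]]
    have "(\<lambda>n. ?c n * moment_var H \<tau> n \<omega>) sums (wave H \<tau> x \<omega> - wave H \<tau> y \<omega>)"
      by (simp only: left_diff_distrib right_diff_distrib)
    then show "(\<lambda>N. ?Z N \<omega>) \<longlonglongrightarrow> wave H \<tau> x \<omega> - wave H \<tau> y \<omega>" by (simp only: sums_def)
  qed
  have igd: "integrable lborel (\<lambda>\<xi>. (?g N \<xi> - ?G \<xi>)\<^sup>2 * ?w \<xi>)" for N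
  proof (rule Bochner_Integration.integrable_bound[OF Di])
    show "AE \<xi> in lborel. norm ((?g N \<xi> - ?G \<xi>)\<^sup>2 * ?w \<xi>) \<le> norm (?D \<xi>)"
    proof (rule AE_I2)
      fix \<xi>
      have "\<bar>?g N \<xi> - ?G \<xi>\<bar> \<le> 4 * B * exp (B * \<bar>\<xi>\<bar>)" using gb[of \<xi> N] Gb[of \<xi>] by linarith
      from bnd[OF this] show "norm ((?g N \<xi> - ?G \<xi>)\<^sup>2 * ?w \<xi>) \<le> norm (?D \<xi>)" by (simp add: abs_mult)
    qed
  qed measurable
  have msqZ: "has_bochner_integral lborel (\<lambda>\<xi>. (?g N \<xi>)\<^sup>2 * ?w \<xi>) (msq M (?Z N))" for N
    by (rule moment_var_sum_msq[OF H]) simp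
  have d: "msq M (\<lambda>\<omega>. ?Z N \<omega> - ?Z N' \<omega>) \<le> ?d N + ?d N'" for N N'
  proof -
    \<comment> \<open>A difference of two partial sums is one sum over the longer range with
      coefficients padded by 0, so \<open>moment_var_sum_msq\<close> applies to it.\<close>
    let ?e = "\<lambda>n. (if n < N then ?c n else 0) - (if n < N' then ?c n else 0)"
    have s: "(\<Sum>n<max N N'. ?e n * f n) = (\<Sum>n<N. ?c n * f n) - (\<Sum>n<N'. ?c n * f n)" for f :: "nat \<Rightarrow> real"
    proof -
      have "(\<Sum>n<max N N'. (if n < K then ?c n else 0) * f n) = (\<Sum>n<K. ?c n * f n)" if "K \<le> max N N'" for K
        using that by (intro sum.mono_neutral_cong_right) auto
      from this[of N] this[of N'] show ?thesis by (simp only: left_diff_distrib sum_subtractf max.cobounded1 max.cobounded2)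
    qed
    have "has_bochner_integral lborel (\<lambda>\<xi>. (\<Sum>n<max N N'. ?e n * \<xi> ^ n)\<^sup>2 * ?w \<xi>) (msq M (\<lambda>\<omega>. \<Sum>n<max N N'. ?e n * moment_var H \<tau> n \<omega>))"
      by (rule moment_var_sum_msq[OF H]) simp
    then have hb: "has_bochner_integral lborel (\<lambda>\<xi>. (?g N \<xi> - ?g N' \<xi>)\<^sup>2 * ?w \<xi>) (msq M (\<lambda>\<omega>. ?Z N \<omega> - ?Z N' \<omega>))"
      unfolding s .
    then have "msq M (\<lambda>\<omega>. ?Z N \<omega> - ?Z N' \<omega>) = (\<integral>\<xi>. (?g N \<xi> - ?g N' \<xi>)\<^sup>2 * ?w \<xi> \<partial>lborel)"
      by (rule has_bochner_integral_integral_eq[symmetric])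
    also have "\<dots> \<le> (\<integral>\<xi>. 2 * ((?g N \<xi> - ?G \<xi>)\<^sup>2 * ?w \<xi>) + 2 * ((?g N' \<xi> - ?G \<xi>)\<^sup>2 * ?w \<xi>) \<partial>lborel)"
    proof (rule integral_mono)
      show "integrable lborel (\<lambda>\<xi>. (?g N \<xi> - ?g N' \<xi>)\<^sup>2 * ?w \<xi>)" using hb by (simp only: has_bochner_integral_iff)
      show "integrable lborel (\<lambda>\<xi>. 2 * ((?g N \<xi> - ?G \<xi>)\<^sup>2 * ?w \<xi>) + 2 * ((?g N' \<xi> - ?G \<xi>)\<^sup>2 * ?w \<xi>))"
        by (intro Bochner_Integration.integrable_add integrable_mult_right igd)
      fix \<xi>
      have "(a - b)\<^sup>2 \<le> 2 * (a - c)\<^sup>2 + 2 * (b - c)\<^sup>2" for a b c :: real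
        using sum_squares_bound[of "a - c" "- (b - c)"] zero_le_power2[of "(a - c) + (b - c)"] by (simp add: power2_eq_square algebra_simps)
      from mult_right_mono[OF this, of "?w \<xi>" "?g N \<xi>" "?g N' \<xi>" "?G \<xi>"]
      show "(?g N \<xi> - ?g N' \<xi>)\<^sup>2 * ?w \<xi> \<le> 2 * ((?g N \<xi> - ?G \<xi>)\<^sup>2 * ?w \<xi>) + 2 * ((?g N' \<xi> - ?G \<xi>)\<^sup>2 * ?w \<xi>)"
        by (simp add: distrib_right mult.assoc)
    qed
    also have "\<dots> = ?d N + ?d N'"
      using igd by (subst Bochner_Integration.integral_add) (auto intro!: integrable_mult_right)
    finally show ?thesis .
  qed
  have dl: "?d \<longlonglongrightarrow> 0" using tendsto_mult[OF tendsto_const[of 2] l1] by simp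
  have d0: "0 \<le> ?d N" for N by (intro mult_nonneg_nonneg Bochner_Integration.integral_nonneg) auto
  have Ym: "(\<lambda>\<omega>. wave H \<tau> x \<omega> - wave H \<tau> y \<omega>) \<in> borel_measurable M" by measurable
  note l = generated_AE_limit[OF Zg Ym ae d dl d0]
  show "(\<lambda>\<omega>. wave H \<tau> x \<omega> - wave H \<tau> y \<omega>) \<in> generated" by (rule l(1))
  have "(\<lambda>N. msq M (?Z N)) \<longlonglongrightarrow> (\<integral>\<xi>. (?G \<xi>)\<^sup>2 * ?w \<xi> \<partial>lborel)"
    using l2 unfolding has_bochner_integral_integral_eq[OF msqZ] .
  then have e: "msq M (\<lambda>\<omega>. wave H \<tau> x \<omega> - wave H \<tau> y \<omega>) = (\<integral>\<xi>. (?G \<xi>)\<^sup>2 * ?w \<xi> \<partial>lborel)"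
    by (rule LIMSEQ_unique[OF l(2)])
  have iG: "integrable lborel (\<lambda>\<xi>. (?G \<xi>)\<^sup>2 * ?w \<xi>)"
  proof (rule Bochner_Integration.integrable_bound[OF Di])
    show "AE \<xi> in lborel. norm ((?G \<xi>)\<^sup>2 * ?w \<xi>) \<le> norm (?D \<xi>)"
    proof (rule AE_I2)
      fix \<xi>
      have "\<bar>?G \<xi>\<bar> \<le> 4 * B * exp (B * \<bar>\<xi>\<bar>)" using Gb[of \<xi>] be[of \<xi>] by linarith
      from bnd[OF this] show "norm ((?G \<xi>)\<^sup>2 * ?w \<xi>) \<le> norm (?D \<xi>)" by (simp add: abs_mult)
    qed
  qed measurable
  have G: "?G \<xi> * \<xi> = (sin (x * \<xi>) - sin (y * \<xi>)) - (cos (x * \<xi>) - cos (y * \<xi>))" for \<xi>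
  proof -
    have "(\<lambda>n. wave_coeff n * (x * \<xi>) ^ Suc n - wave_coeff n * (y * \<xi>) ^ Suc n) sums ((sin (x * \<xi>) + 1 - cos (x * \<xi>)) - (sin (y * \<xi>) + 1 - cos (y * \<xi>)))"
      by (intro sums_diff wave_coeff_sums)
    moreover have "wave_coeff n * (x * \<xi>) ^ Suc n - wave_coeff n * (y * \<xi>) ^ Suc n = (?c n * \<xi> ^ n) * \<xi>" for n
      by (simp add: power_mult_distrib algebra_simps)
    ultimately have "(\<lambda>n. (?c n * \<xi> ^ n) * \<xi>) sums ((sin (x * \<xi>) + 1 - cos (x * \<xi>)) - (sin (y * \<xi>) + 1 - cos (y * \<xi>)))" by (simp only:)
    moreover have "(\<lambda>n. (?c n * \<xi> ^ n) * \<xi>) sums (?G \<xi> * \<xi>)" by (rule sums_mult2[OF summable_sums[OF gs]])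
    ultimately have "?G \<xi> * \<xi> = (sin (x * \<xi>) + 1 - cos (x * \<xi>)) - (sin (y * \<xi>) + 1 - cos (y * \<xi>))" by (rule sums_unique2[symmetric])
    then show ?thesis by simp
  qed
  let ?F = "\<lambda>\<xi>. 2 * ((1 - cos ((x - y) * \<xi>)) * \<bar>\<xi>\<bar> powr (- 1 - 2 * H)) * exp (- (\<tau> * \<xi>\<^sup>2))"
  \<comment> \<open>The weight contributes the xi^2 that clears the division by xi in G, at xi and
    at -xi alike.\<close>
  have sym: "(?G \<xi>)\<^sup>2 * ?w \<xi> + (?G (- \<xi>))\<^sup>2 * ?w (- \<xi>) = 2 * ?F \<xi>" if "\<xi> \<noteq> 0" for \<xi>
  proof -
    let ?s = "sin (x * \<xi>) - sin (y * \<xi>)" and ?k = "cos (x * \<xi>) - cos (y * \<xi>)"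
    have w: "?w \<xi> = \<xi>\<^sup>2 * (\<bar>\<xi>\<bar> powr (- 1 - 2 * H) * exp (- (\<tau> * \<xi>\<^sup>2)))"
    proof -
      have "\<xi>\<^sup>2 = \<bar>\<xi>\<bar> powr 2" using that by simp
      then have "\<xi>\<^sup>2 * \<bar>\<xi>\<bar> powr (- 1 - 2 * H) = \<bar>\<xi>\<bar> powr (2 + (- 1 - 2 * H))" by (simp only: powr_add)
      then show ?thesis by simp
    qed
    have "?G (- \<xi>) * (- \<xi>) = - ?s - ?k" unfolding G by simp
    then have "(?G (- \<xi>) * (- \<xi>))\<^sup>2 = (- ?s - ?k)\<^sup>2" by (simp only:)
    then have 1: "(?G (- \<xi>))\<^sup>2 * \<xi>\<^sup>2 = (- ?s - ?k)\<^sup>2" unfolding power_mult_distrib power2_minus .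
    have "(?G \<xi> * \<xi>)\<^sup>2 = (?s - ?k)\<^sup>2" unfolding G ..
    then have 2: "(?G \<xi>)\<^sup>2 * \<xi>\<^sup>2 = (?s - ?k)\<^sup>2" unfolding power_mult_distrib .
    have 3: "(?s - ?k)\<^sup>2 + (- ?s - ?k)\<^sup>2 = 2 * (?s\<^sup>2 + ?k\<^sup>2)"
    proof -
      have "(a - b)\<^sup>2 + (- a - b)\<^sup>2 = 2 * (a\<^sup>2 + b\<^sup>2)" for a b :: real by (simp add: power2_eq_square algebra_simps)
      then show ?thesis .
    qed
    have 4: "?s\<^sup>2 + ?k\<^sup>2 = 2 * (1 - cos ((x - y) * \<xi>))"
    proof -
      have "(a - b)\<^sup>2 + (c - d)\<^sup>2 = (a\<^sup>2 + c\<^sup>2) + (b\<^sup>2 + d\<^sup>2) - 2 * (c * d + a * b)" for a b c d :: real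
        by (simp add: power2_diff algebra_simps)
      from this[of "sin (x * \<xi>)" "sin (y * \<xi>)" "cos (x * \<xi>)" "cos (y * \<xi>)"]
      show ?thesis unfolding sin_cos_squared_add left_diff_distrib[of x y \<xi>] cos_diff by simp
    qed
    have "(?G \<xi>)\<^sup>2 * ?w \<xi> + (?G (- \<xi>))\<^sup>2 * ?w (- \<xi>) = ((?G \<xi>)\<^sup>2 * \<xi>\<^sup>2 + (?G (- \<xi>))\<^sup>2 * \<xi>\<^sup>2) * (\<bar>\<xi>\<bar> powr (- 1 - 2 * H) * exp (- (\<tau> * \<xi>\<^sup>2)))"
      unfolding abs_minus_cancel power2_minus w by (simp only: distrib_right mult.assoc)
    also have "\<dots> = 2 * ?F \<xi>" unfolding 1 2 3 4 by (simp only: mult_ac)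
    finally show ?thesis .
  qed
  define f where "f = (\<lambda>\<xi>. (?G \<xi>)\<^sup>2 * ?w \<xi>)"
  have [measurable]: "f \<in> borel_measurable borel" unfolding f_def by measurable
  have f0: "0 \<le> f \<xi>" for \<xi> unfolding f_def by (intro mult_nonneg_nonneg) simp_all
  have sym: "f \<xi> + f (- \<xi>) = 2 * ?F \<xi>" if "\<xi> \<noteq> 0" for \<xi> unfolding f_def by (rule sym[OF that])
  have "(\<integral>\<^sup>+\<xi>. ennreal (f \<xi>) \<partial>lborel) = ennreal \<bar>-1\<bar> * (\<integral>\<^sup>+\<xi>. ennreal (f (0 + (-1) * \<xi>)) \<partial>lborel)"
    by (rule nn_integral_real_affine) simp_all
  then have rfl: "(\<integral>\<^sup>+\<xi>. ennreal (f \<xi>) \<partial>lborel) = (\<integral>\<^sup>+\<xi>. ennreal (f (- \<xi>)) \<partial>lborel)" by simp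
  \<comment> \<open>Doubling the integral allows the values at xi and -xi to be added under one
    integral.\<close>
  have "2 * ennreal (msq M (\<lambda>\<omega>. wave H \<tau> x \<omega> - wave H \<tau> y \<omega>)) = 2 * (\<integral>\<^sup>+\<xi>. ennreal (f \<xi>) \<partial>lborel)"
    unfolding e f_def by (subst nn_integral_eq_integral[OF iG]) (simp_all only: AE_I2 mult_nonneg_nonneg zero_le_power2 powr_ge_zero exp_ge_zero)
  also have "\<dots> = (\<integral>\<^sup>+\<xi>. ennreal (f \<xi>) \<partial>lborel) + (\<integral>\<^sup>+\<xi>. ennreal (f (- \<xi>)) \<partial>lborel)"
    unfolding rfl[symmetric] by (rule mult_2)
  also have "\<dots> = (\<integral>\<^sup>+\<xi>. ennreal (f \<xi>) + ennreal (f (- \<xi>)) \<partial>lborel)"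
    by (rule nn_integral_add[symmetric]) measurable
  also have "\<dots> = (\<integral>\<^sup>+\<xi>. 2 * ennreal (?F \<xi>) \<partial>lborel)"
  proof (rule nn_integral_cong_AE, use AE_lborel_singleton[of 0] in eventually_elim)
    fix \<xi> :: real assume "\<xi> \<noteq> 0"
    have "ennreal (f \<xi>) + ennreal (f (- \<xi>)) = ennreal (f \<xi> + f (- \<xi>))"
      by (rule ennreal_plus[symmetric, OF f0 f0])
    also have "\<dots> = 2 * ennreal (?F \<xi>)" unfolding sym[OF \<open>\<xi> \<noteq> 0\<close>] by (subst ennreal_mult) (auto simp: cos_le_one)
    finally show "ennreal (f \<xi>) + ennreal (f (- \<xi>)) = 2 * ennreal (?F \<xi>)" .
  qed
  also have "\<dots> = 2 * (\<integral>\<^sup>+\<xi>. ennreal (?F \<xi>) \<partial>lborel)" by (rule nn_integral_cmult) measurable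
  finally show "ennreal (msq M (\<lambda>\<omega>. wave H \<tau> x \<omega> - wave H \<tau> y \<omega>)) = (\<integral>\<^sup>+\<xi>. ennreal (?F \<xi>) \<partial>lborel)"
    by (simp add: ennreal_mult_cancel_left)
qed

end

section \<open>The decompositions\<close>

lemma smooth_on_real_lin:
  assumes "open S" "smooth_on_real S f" shows "smooth_on_real S (\<lambda>x. a + b * f x)"
proof (rule smooth_on_real_coinduct[where C = "{\<lambda>x. a + b * f x | a b f. smooth_on_real S f}"])
  fix g assume "g \<in> {\<lambda>x. a + b * f x | a b f. smooth_on_real S f}"
  then obtain a b f where g: "g = (\<lambda>x. a + b * f x)" and f: "smooth_on_real S f" by blast
  have "(g has_real_derivative 0 + b * deriv f x) (at x)" if "x \<in> S" for x
    unfolding g using smooth_on_real_deriv(2)[OF f that] by (auto intro!: derivative_eq_intros)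
  then show "\<exists>g'\<in>{\<lambda>x. a + b * f x | a b f. smooth_on_real S f}. \<forall>x\<in>S. (g has_real_derivative g' x) (at x)"
    using smooth_on_real_deriv(1)[OF f] by (intro bexI[of _ "\<lambda>x. 0 + b * deriv f x"]) blast+
qed (use assms in blast)+

text \<open>With X the normalised sum, v - c X equals v 0 - S exactly: the irregular process drops
  out of the residual except for one random constant. Orthogonality to the sequence passes to S
  through \<open>generated\<close>, so the two increment variances add up.\<close>

lemma (in orthonormal_gaussian) fBm_minus_smooth:
  fixes v S :: "real \<Rightarrow> 'a \<Rightarrow> real"
  assumes I: "0 \<in> I" and T: "open T" and c: "0 < c"
    and v: "\<And>i. i \<in> I \<Longrightarrow> v i \<in> L2_closure M L"
    and ort: "\<And>i k. i \<in> I \<Longrightarrow> expectation (\<lambda>\<omega>. v i \<omega> * \<xi> k \<omega>) = 0"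
    and S: "\<And>i. i \<in> I \<Longrightarrow> S i \<in> generated" and S0: "\<And>\<omega>. S 0 \<omega> = 0"
    and inc: "\<And>i j. i \<in> I \<Longrightarrow> j \<in> I \<Longrightarrow> j \<le> i \<Longrightarrow>
      msq M (\<lambda>\<omega>. v i \<omega> - v j \<omega>) + msq M (\<lambda>\<omega>. S i \<omega> - S j \<omega>) = c\<^sup>2 * (i - j) powr (2 * \<alpha>)"
    and cont: "\<And>\<omega>. \<omega> \<in> space M \<Longrightarrow> continuous_on I (\<lambda>i. S i \<omega>)"
    and smooth: "\<And>\<omega>. \<omega> \<in> space M \<Longrightarrow> smooth_on_real T (\<lambda>i. S i \<omega>)"
  shows "\<exists>X. is_fBm M \<alpha> I X \<and> gaussian_family M I (\<lambda>t \<omega>. v t \<omega> - c * X t \<omega>) \<and>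
    centered_family M I (\<lambda>t \<omega>. v t \<omega> - c * X t \<omega>) \<and> has_smooth_version M I T (\<lambda>t \<omega>. v t \<omega> - c * X t \<omega>)"
proof -
  let ?L = "L2_closure M L"
  note G = gaussian_space_L2_closure[OF L]
  \<comment> \<open>Subtracting v 0 makes X vanish at 0 on every path, not only almost
    surely.\<close>
  define X where "X = (\<lambda>i \<omega>. (1 / c) * ((v i \<omega> - v 0 \<omega>) + S i \<omega>))"
  have SL: "S i \<in> ?L" if "i \<in> I" for i using S[OF that] by (simp add: generated_def)
  have XL: "X i \<in> ?L" if "i \<in> I" for i
    unfolding X_def by (intro gaussian_spaceD(5-7)[OF G] v SL I that)
  have r: "v i \<omega> - c * X i \<omega> = v 0 \<omega> - S i \<omega>" for i \<omega> using c by (simp add: X_def)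
  have rL: "(\<lambda>\<omega>. v 0 \<omega> - S i \<omega>) \<in> ?L" if "i \<in> I" for i
    by (intro gaussian_spaceD(6)[OF G] v SL I that)
  have vs: "sq_int M (v i)" if "i \<in> I" for i by (rule gaussian_spaceD(2)[OF G v[OF that]])
  have msq_X: "expectation (\<lambda>\<omega>. (X i \<omega> - X j \<omega>)\<^sup>2) = (i - j) powr (2 * \<alpha>)" if ij: "i \<in> I" "j \<in> I" "j \<le> i" for i j
  proof -
    have dv: "sq_int M (\<lambda>\<omega>. v i \<omega> - v j \<omega>)" by (rule sq_int_diff[OF vs vs]) fact+
    have dS: "(\<lambda>\<omega>. S i \<omega> - S j \<omega>) \<in> generated"
      using generated_lin[OF S[OF ij(1)] S[OF ij(2)], of 1 "-1"] by simp
    have "expectation (\<lambda>\<omega>. (v i \<omega> - v j \<omega>) * \<xi> k \<omega>) = 0" for k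
    proof -
      have "expectation (\<lambda>\<omega>. (v i \<omega> - v j \<omega>) * \<xi> k \<omega>) = expectation (\<lambda>\<omega>. v i \<omega> * \<xi> k \<omega>) - expectation (\<lambda>\<omega>. v j \<omega> * \<xi> k \<omega>)"
        unfolding left_diff_distrib by (intro Bochner_Integration.integral_diff sq_int_mult vs xi_sq_int ij)
      then show ?thesis using ort ij by simp
    qed
    then have o: "expectation (\<lambda>\<omega>. (v i \<omega> - v j \<omega>) * (S i \<omega> - S j \<omega>)) = 0"
      using dS dv unfolding generated_def by blast
    have "X i \<omega> - X j \<omega> = (1 / c) * (v i \<omega> - v j \<omega>) + (1 / c) * (S i \<omega> - S j \<omega>)" for \<omega>
      unfolding X_def by (simp add: algebra_simps)
    then have "expectation (\<lambda>\<omega>. (X i \<omega> - X j \<omega>)\<^sup>2) = (1 / c)\<^sup>2 * msq M (\<lambda>\<omega>. v i \<omega> - v j \<omega>) + (1 / c)\<^sup>2 * msq M (\<lambda>\<omega>. S i \<omega> - S j \<omega>)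
        + 2 * (1 / c) * (1 / c) * expectation (\<lambda>\<omega>. (v i \<omega> - v j \<omega>) * (S i \<omega> - S j \<omega>))"
      using msq_lin[OF dv generated_sq_int[OF dS], of "1 / c" "1 / c"] by (simp only:)
    also have "\<dots> = (1 / c)\<^sup>2 * (msq M (\<lambda>\<omega>. v i \<omega> - v j \<omega>) + msq M (\<lambda>\<omega>. S i \<omega> - S j \<omega>))"
      unfolding o distrib_left by simp
    also have "\<dots> = (i - j) powr (2 * \<alpha>)" unfolding inc[OF ij] using c by (simp add: power_divide)
    finally show ?thesis .
  qed
  have "is_fBm M \<alpha> I X" unfolding is_fBm_def
  proof (intro conjI ballI)
    show "gaussian_family M I X" "centered_family M I X" by (rule gaussian_space_family[OF G XL]; assumption)+
    show "X 0 \<omega> = 0" for \<omega> by (simp add: X_def S0)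
    fix s t assume "s \<in> I" "t \<in> I"
    then show "expectation (\<lambda>\<omega>. (X t \<omega> - X s \<omega>)\<^sup>2) = \<bar>t - s\<bar> powr (2 * \<alpha>)"
      using msq_X[of t s] msq_X[of s t] power2_commute[of "X t _" "X s _"] by (cases "s \<le> t") simp_all
  qed
  moreover have "gaussian_family M I (\<lambda>t \<omega>. v t \<omega> - c * X t \<omega>)" "centered_family M I (\<lambda>t \<omega>. v t \<omega> - c * X t \<omega>)"
    unfolding r by (rule gaussian_space_family[OF G rL]; assumption)+
  moreover have "has_smooth_version M I T (\<lambda>t \<omega>. v t \<omega> - c * X t \<omega>)"
    unfolding has_smooth_version_def r
  proof (intro exI[of _ "\<lambda>t \<omega>. v 0 \<omega> - S t \<omega>"] conjI ballI)
    show "(\<lambda>\<omega>. v 0 \<omega> - S t \<omega>) \<in> borel_measurable M" if "t \<in> I" for t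
      by (rule sq_intD(1)[OF gaussian_spaceD(2)[OF G rL[OF that]]])
    show "AE \<omega> in M. v 0 \<omega> - S t \<omega> = v 0 \<omega> - S t \<omega>" for t by simp
    fix \<omega> assume w: "\<omega> \<in> space M"
    show "continuous_on I (\<lambda>t. v 0 \<omega> - S t \<omega>)" by (intro continuous_on_diff continuous_on_const cont[OF w])
    show "smooth_on_real T (\<lambda>t. v 0 \<omega> - S t \<omega>)"
      using smooth_on_real_lin[OF T smooth[OF w], of "v 0 \<omega>" "-1"] by simp
  qed
  ultimately show ?thesis by blast
qed

context stoch_conv begin

lemma orthonormal_white_seq: "0 \<le> r \<Longrightarrow> orthonormal_gaussian M noise_span (white_seq r x)"
  by unfold_locales (auto intro: gaussian_space_noise_span white_seq_in_span simp: white_seq_orthonormal)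

lemma time_decomposition:
  "\<exists>X. is_fBm M (H / 2) {0..} X \<and> gaussian_family M {0..} (\<lambda>t \<omega>. u t x \<omega> - C1 H \<kappa> * X t \<omega>) \<and>
    centered_family M {0..} (\<lambda>t \<omega>. u t x \<omega> - C1 H \<kappa> * X t \<omega>) \<and>
    has_smooth_version M {0..} {0<..} (\<lambda>t \<omega>. u t x \<omega> - C1 H \<kappa> * X t \<omega>)"
proof -
  \<comment> \<open>The centre x is what counts here: oddness about x gives orthogonality to u at x
    for all times, so the start of the probes may be 0.\<close>
  interpret N: orthonormal_gaussian M noise_span "white_seq 0 x" by (rule orthonormal_white_seq) simp
  \<comment> \<open>The increment variance of the primitive is 2 r(s,t) / (H (1-H)) with r as in the
    overview; the square of this factor scales it to C^2 r(s,t).\<close>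
  let ?b = "C1 H \<kappa> * sqrt (H * (1 - H) / 2)"
  let ?S = "\<lambda>t \<omega>. ?b * N.primitive (2 - H) t \<omega>"
  show ?thesis
  proof (rule N.fBm_minus_smooth[where S = ?S])
    show "0 < C1 H \<kappa>" unfolding C1_def using H k by (simp add: Gamma_real_pos)
    show "u t x \<in> GS" if "t \<in> {0..}" for t using that by (intro u_in_GS) simp
    show "expectation (\<lambda>\<omega>. u t x \<omega> * white_seq 0 x n \<omega>) = 0" if "t \<in> {0..}" for t n
      using that by (intro u_white_seq_odd) simp
    show "?S t \<in> N.generated" if "t \<in> {0..}" for t
      using N.generated_lin[OF N.primitive_generated(1) N.primitive_generated(1), of H t H t ?b 0] that H by simp
    show "?S 0 \<omega> = 0" for \<omega> by simp
    show "msq M (\<lambda>\<omega>. u t x \<omega> - u s x \<omega>) + msq M (\<lambda>\<omega>. ?S t \<omega> - ?S s \<omega>) = (C1 H \<kappa>)\<^sup>2 * (t - s) powr (2 * (H / 2))"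
      if "t \<in> {0..}" "s \<in> {0..}" "s \<le> t" for t s
    proof -
      have s: "0 \<le> s" using that by simp
      have "msq M (\<lambda>\<omega>. ?S t \<omega> - ?S s \<omega>) = ?b\<^sup>2 * msq M (\<lambda>\<omega>. N.primitive (2 - H) t \<omega> - N.primitive (2 - H) s \<omega>)"
        unfolding right_diff_distrib[symmetric] power_mult_distrib[of ?b] by (rule integral_mult_right_zero)
      also have "\<dots> = ((C1 H \<kappa>)\<^sup>2 * (H * (1 - H) / 2)) * ((2 * (t + s) powr H - (2 * t) powr H - (2 * s) powr H) / (H * (1 - H)))"
        unfolding N.primitive_increment'[OF H s that(3)] power_mult_distrib using H by simp
      also have "\<dots> = (C1 H \<kappa>)\<^sup>2 * ((t + s) powr H - ((2 * t) powr H + (2 * s) powr H) / 2)"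
        using H by (simp add: field_simps)
      finally show ?thesis unfolding u_time_increment[OF s that(3)] by (simp add: algebra_simps)
    qed
    show "continuous_on {0..} (\<lambda>t. ?S t \<omega>)" if "\<omega> \<in> space M" for \<omega>
      by (intro continuous_on_mult_left N.continuous_on_primitive that) (use H in simp)
    show "smooth_on_real {0<..} (\<lambda>t. ?S t \<omega>)" if "\<omega> \<in> space M" for \<omega>
      using smooth_on_real_lin[OF _ N.smooth_primitive[OF _ that], of "2 - H" 0 ?b] H by simp
  qed simp_all
qed

lemma space_decomposition:
  assumes t: "0 < t"
  shows "\<exists>B. is_fBm M H UNIV B \<and> gaussian_family M UNIV (\<lambda>x \<omega>. u t x \<omega> - \<kappa> powr (-1/2) * B x \<omega>) \<and>
    centered_family M UNIV (\<lambda>x \<omega>. u t x \<omega> - \<kappa> powr (-1/2) * B x \<omega>) \<and>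
    has_smooth_version M UNIV UNIV (\<lambda>x \<omega>. u t x \<omega> - \<kappa> powr (-1/2) * B x \<omega>)"
proof -
  \<comment> \<open>The probes lie after t. Their centre 0 is arbitrary, because disjointness in
    time gives orthogonality to u at every x.\<close>
  interpret N: orthonormal_gaussian M noise_span "white_seq t 0" by (rule orthonormal_white_seq) (use t in simp)
  \<comment> \<open>Chosen so that the spectral densities of u and of the correction add up: (1 - e)
    + e = 1 under the common factor 2 \<open>c1H\<close> / kappa.\<close>
  let ?K = "c1H H / \<kappa>" and ?\<tau> = "\<kappa> * t"
  let ?S = "\<lambda>x \<omega>. sqrt ?K * N.wave H ?\<tau> x \<omega>"
  have \<tau>: "0 < ?\<tau>" using k t by simp
  have K: "0 < ?K" using c1H_pos[OF H] k by simp
  show ?thesis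
  proof (rule N.fBm_minus_smooth[where S = ?S])
    show "0 < \<kappa> powr (-1/2)" using k by simp
    show "u t x \<in> GS" for x using t by (intro u_in_GS) simp
    show "expectation (\<lambda>\<omega>. u t x \<omega> * white_seq t 0 n \<omega>) = 0" for x n
      using t by (intro u_white_seq_future) simp
    show "?S x \<in> N.generated" for x
      using N.generated_lin[OF N.wave_increment(1)[OF H \<tau>] N.wave_increment(1)[OF H \<tau>], of "sqrt ?K" x 0 0 0 0] by simp
    show "?S 0 \<omega> = 0" for \<omega> by simp
    show "msq M (\<lambda>\<omega>. u t x \<omega> - u t y \<omega>) + msq M (\<lambda>\<omega>. ?S x \<omega> - ?S y \<omega>) = (\<kappa> powr (-1/2))\<^sup>2 * (x - y) powr (2 * H)"
      if "y \<le> x" for x y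
    proof -
      let ?q = "\<lambda>\<xi>. (1 - cos ((x - y) * \<xi>)) * \<bar>\<xi>\<bar> powr (- 1 - 2 * H)" and ?e = "\<lambda>\<xi>. exp (- (?\<tau> * \<xi>\<^sup>2))"
      have q: "0 \<le> ?q \<xi>" for \<xi> by (simp add: cos_le_one)
      have e: "?e \<xi> \<le> 1" for \<xi> using \<tau> by simp
      let ?g = "Gamma (2 * H + 1) * sin (H * pi)"
      have g: "0 < ?g" using H by (intro mult_pos_pos Gamma_real_pos sin_gt_zero) auto
      have "msq M (\<lambda>\<omega>. ?S x \<omega> - ?S y \<omega>) = (sqrt ?K)\<^sup>2 * msq M (\<lambda>\<omega>. N.wave H ?\<tau> x \<omega> - N.wave H ?\<tau> y \<omega>)"
        unfolding right_diff_distrib[symmetric] power_mult_distrib[of "sqrt ?K"] by (rule integral_mult_right_zero)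
      then have "msq M (\<lambda>\<omega>. ?S x \<omega> - ?S y \<omega>) = ?K * msq M (\<lambda>\<omega>. N.wave H ?\<tau> x \<omega> - N.wave H ?\<tau> y \<omega>)"
        unfolding real_sqrt_pow2[OF less_imp_le[OF K]] .
      then have "ennreal (msq M (\<lambda>\<omega>. ?S x \<omega> - ?S y \<omega>)) = ennreal ?K * (\<integral>\<^sup>+\<xi>. ennreal (2 * ?q \<xi> * ?e \<xi>) \<partial>lborel)"
        unfolding N.wave_increment(2)[OF H \<tau>, symmetric] using K by (simp only: ennreal_mult' less_imp_le)
      also have "\<dots> = (\<integral>\<^sup>+\<xi>. ennreal ?K * ennreal (2 * ?q \<xi> * ?e \<xi>) \<partial>lborel)"
        by (rule nn_integral_cmult[symmetric]) measurable
      finally have S: "ennreal (msq M (\<lambda>\<omega>. ?S x \<omega> - ?S y \<omega>)) = (\<integral>\<^sup>+\<xi>. ennreal ?K * ennreal (2 * ?q \<xi> * ?e \<xi>) \<partial>lborel)" .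
      \<comment> \<open>The sum is formed in \<open>ennreal\<close>, where integrability is not an
        issue; the finite value appears at the end.\<close>
      have "ennreal (msq M (\<lambda>\<omega>. u t x \<omega> - u t y \<omega>) + msq M (\<lambda>\<omega>. ?S x \<omega> - ?S y \<omega>))
        = (\<integral>\<^sup>+\<xi>. ennreal (2 * c1H H / \<kappa> * ?q \<xi> * (1 - ?e \<xi>)) \<partial>lborel) + (\<integral>\<^sup>+\<xi>. ennreal ?K * ennreal (2 * ?q \<xi> * ?e \<xi>) \<partial>lborel)"
        unfolding u_space_increment[OF t, symmetric] S[symmetric] by (intro ennreal_plus Bochner_Integration.integral_nonneg zero_le_power2)
      also have "\<dots> = (\<integral>\<^sup>+\<xi>. ennreal (2 * c1H H / \<kappa> * ?q \<xi> * (1 - ?e \<xi>)) + ennreal ?K * ennreal (2 * ?q \<xi> * ?e \<xi>) \<partial>lborel)"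
        by (rule nn_integral_add[symmetric]) measurable
      also have "\<dots> = (\<integral>\<^sup>+\<xi>. ennreal (2 * ?K) * ennreal (?q \<xi>) \<partial>lborel)"
      proof (rule nn_integral_cong)
        fix \<xi> :: real
        have "ennreal (2 * c1H H / \<kappa> * ?q \<xi> * (1 - ?e \<xi>)) + ennreal ?K * ennreal (2 * ?q \<xi> * ?e \<xi>)
          = ennreal (2 * c1H H / \<kappa> * ?q \<xi> * (1 - ?e \<xi>)) + ennreal (?K * (2 * ?q \<xi> * ?e \<xi>))"
          using K by (simp only: ennreal_mult' less_imp_le)
        also have "\<dots> = ennreal (2 * c1H H / \<kappa> * ?q \<xi> * (1 - ?e \<xi>) + ?K * (2 * ?q \<xi> * ?e \<xi>))"
        proof (rule ennreal_plus[symmetric])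
          have "0 \<le> (2 * ?K) * (?q \<xi> * (1 - ?e \<xi>))" using K q e by (intro mult_nonneg_nonneg) simp_all
          then show "0 \<le> 2 * c1H H / \<kappa> * ?q \<xi> * (1 - ?e \<xi>)" by (simp only: mult.assoc times_divide_eq_right)
          show "0 \<le> ?K * (2 * ?q \<xi> * ?e \<xi>)" using less_imp_le[OF K] q[of \<xi>] by (intro mult_nonneg_nonneg) simp_all
        qed
        also have "2 * c1H H / \<kappa> * ?q \<xi> * (1 - ?e \<xi>) + ?K * (2 * ?q \<xi> * ?e \<xi>) = (2 * ?K) * ?q \<xi>"
        proof -
          have "2 * a / b * c * (1 - d) + a / b * (2 * c * d) = (2 * (a / b)) * c" for a b c d :: real
            by (simp add: algebra_simps add_divide_distrib diff_divide_distrib)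
          then show ?thesis .
        qed
        also have "ennreal \<dots> = ennreal (2 * ?K) * ennreal (?q \<xi>)" using K by (intro ennreal_mult') simp
        finally show "ennreal (2 * c1H H / \<kappa> * ?q \<xi> * (1 - ?e \<xi>)) + ennreal ?K * ennreal (2 * ?q \<xi> * ?e \<xi>) = ennreal (2 * ?K) * ennreal (?q \<xi>)" .
      qed
      also have "\<dots> = ennreal (2 * ?K) * (\<integral>\<^sup>+\<xi>. ennreal (?q \<xi>) \<partial>lborel)" by (rule nn_integral_cmult) measurable
      also have "\<dots> = ennreal (2 * ?K) * ennreal (\<bar>x - y\<bar> powr (2 * H) * pi / ?g)"
        unfolding nn_integral_one_minus_cos_scale[OF H] ..
      also have "\<dots> = ennreal ((2 * ?K) * (\<bar>x - y\<bar> powr (2 * H) * pi / ?g))"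
        using K by (intro ennreal_mult'[symmetric]) simp
      \<comment> \<open>\<open>c1H\<close> is half the reciprocal of the cosine integral for unit
        distance, which leaves just 1/kappa.\<close>
      also have "(2 * ?K) * (\<bar>x - y\<bar> powr (2 * H) * pi / ?g) = (x - y) powr (2 * H) / \<kappa>"
      proof -
        have c: "c1H H = 1 / (2 * pi) * ?g" by (simp add: c1H_def)
        have "2 * (1 / (2 * p) * g / k) * (a * p / g) = a / k" if "p \<noteq> 0" "g \<noteq> 0" for a p g k :: real
          using that by simp
        from this[of pi ?g] show ?thesis unfolding c using that g by (simp only: abs_of_nonneg diff_ge_0_iff_ge pi_neq_zero less_irrefl simp_thms not_False_eq_True)
      qed
      finally have "msq M (\<lambda>\<omega>. u t x \<omega> - u t y \<omega>) + msq M (\<lambda>\<omega>. ?S x \<omega> - ?S y \<omega>) = (x - y) powr (2 * H) / \<kappa>"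
        by (subst (asm) ennreal_inj) (use k in \<open>auto intro!: add_nonneg_nonneg\<close>)
      also have "\<dots> = (\<kappa> powr (-1/2))\<^sup>2 * (x - y) powr (2 * H)"
      proof -
        have "(\<kappa> powr (-1/2))\<^sup>2 = \<kappa> powr (-1/2) * \<kappa> powr (-1/2)" by (rule power2_eq_square)
        also have "\<dots> = \<kappa> powr (-1)" unfolding powr_add[symmetric] by simp
        also have "\<dots> = 1 / \<kappa>" using k by (simp add: powr_neg_one)
        finally show ?thesis by simp
      qed
      finally show ?thesis .
    qed
    show s: "smooth_on_real UNIV (\<lambda>x. ?S x \<omega>)" for \<omega>
      using smooth_on_real_lin[OF open_UNIV N.smooth_wave, of 0 "sqrt ?K"] by simp
    show "continuous_on UNIV (\<lambda>x. ?S x \<omega>)" for \<omega>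
      using smooth_on_real_deriv(2)[OF s] by (blast intro: continuous_at_imp_continuous_on DERIV_isCont)
  qed simp_all
qed

end

theorem theorem3p1:
  fixes M :: "'a measure" and H \<kappa> :: real
    and W :: "(real \<Rightarrow> real \<Rightarrow> real) \<Rightarrow> 'a \<Rightarrow> real"
    and u :: "real \<Rightarrow> real \<Rightarrow> 'a \<Rightarrow> real"
  assumes "prob_space M"
    and "0 < H" and "H < 1" and "0 < \<kappa>"
    and "is_noise M H W"
    and "is_stoch_conv M H \<kappa> W u"
  shows "(\<forall>x. \<exists>X. is_fBm M (H / 2) {0..} X \<and>
            gaussian_family M {0..} (\<lambda>t \<omega>. u t x \<omega> - C1 H \<kappa> * X t \<omega>) \<and>
            centered_family M {0..} (\<lambda>t \<omega>. u t x \<omega> - C1 H \<kappa> * X t \<omega>) \<and>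
            has_smooth_version M {0..} {0<..} (\<lambda>t \<omega>. u t x \<omega> - C1 H \<kappa> * X t \<omega>))
       \<and> (\<forall>t>0. \<exists>B. is_fBm M H UNIV B \<and>
            gaussian_family M UNIV (\<lambda>x \<omega>. u t x \<omega> - \<kappa> powr (-1/2) * B x \<omega>) \<and>
            has_smooth_version M UNIV UNIV (\<lambda>x \<omega>. u t x \<omega> - \<kappa> powr (-1/2) * B x \<omega>))"
proof -
  interpret prob_space M by fact
  interpret stoch_conv M H \<kappa> W u by unfold_locales fact+
  show ?thesis using time_decomposition space_decomposition by blast
qed

end
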